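(* Let $M$ be a $d\times d$ dilation matrix, $d_M:=|\det(M)|$, and let $\Gamma_M=\{\gamma_1,\dots,\gamma_{d_M}\}:=[M[0,1)^d]\cap\mathbb{Z}^d$ with $\gamma_1:=0$. Let $a\in l_0(\mathbb{Z}^d)$ be an $M$-interpolatory filter with $\widehat a(0)=1$. Suppose $\operatorname{sr}(a,M)=2m$ for some $m\in\mathbb{N}$. Then one can construct filters $b_1,\dots,b_s\in l_0(\mathbb{Z}^d)$ such that (1) $\{a;b_1,\dots,b_s\}_{\epsilon_1,\dots,\epsilon_s}$ is a quasi-tight $M$-framelet filter bank for some $\epsilon_1,\dots,\epsilon_s\in\{-1,1\}$, that is, $$\overline{\widehat a(\xi)}\,\widehat a(\xi+2\pi\omega)+\sum_{l=1}^s\epsilon_l\overline{\widehat{b_l}(\xi)}\,\widehat{b_l}(\xi+2\pi\omega)=\boldsymbol\delta(\omega),\quad\xi\in\mathbb{R}^d,\ \omega\in\Omega_M;$$ (2) $\min_{1\le l\le s}\operatorname{vm}(b_l)\ge m$, and $b_l(Mk)=0$ for all $k\in\mathbb{Z}^d\setminus\{0\}$ and $l=1,\dots,s$. The construction is as follows. (S1) For $j=2,\dots,d_M$, define $h_j$ by $\widehat{h_j}(\xi):=d_M^{-1}-d_M|\widehat{a^{[\gamma_j,M]}}(\xi)|^2$, $\xi\in\mathbb{R}^d$. For every $j=2,\dots,d_M$ there exist $s_j\in\mathbb{N}$, $u_{j,t}\in l_0(\mathbb{Z}^d)$ and $\epsilon_{j,t}\in\{-1,1\}$, $t=1,\dots,s_j$,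 such that $$\widehat{h_j}(\xi)=\sum_{t=1}^{s_j}\epsilon_{j,t}|\widehat{u_{j,t}}(\xi)|^2,\quad\forall\xi\in\mathbb{R}^d,\qquad\text{and}\qquad \widehat{u_{j,t}}(\xi)=\mathcal{O}(\|\xi\|^m),\ \xi\to0,\ t=1,\dots,s_j.$$ (S2) For any $u_{j,t},\epsilon_{j,t}$ as in (S1), define filters by $$\widehat{b_1}(\xi):=1-\widehat a(\xi),\qquad \widehat{b_j}(\xi):=d_M^{-1/2}-d_M^{1/2}e^{-i\gamma_j\cdot\xi}\widehat{a^{[\gamma_j,M]}}(M^{\mathsf T}\xi),\quad j=2,\dots,d_M,$$ $$\widehat{b_{j,t}}(\xi):=e^{-i\gamma_j\cdot\xi}\widehat{u_{j,t}}(M^{\mathsf T}\xi),\quad t=1,\dots,s_j,\ j=2,\dots,d_M,$$ and let $\epsilon_1=-1$, $\epsilon_j=1$ for $j=2,\dots,d_M$. Let $b_1,\dots,b_s$ be the list consisting of $b_1,\dots,b_{d_M}$ and all $b_{j,t}$ ($t=1,\dots,s_j$, $j=2,\dots,d_M$), and let $\epsilon_1,\dots,\epsilon_s$ be the correspondingly ordered list consisting of $\epsilon_1,\dots,\epsilon_{d_M}$ and all $\epsilon_{j,t}$. Then $b_1,\dots,b_s$ and $\epsilon_1,\dots,\epsilon_s$ satisfy (1) and (2). Moreover, let $\phi$ be the standard $M$-refinable function of $a$. If $\operatorname{sm}_\infty(a,M)>0$, then, defining $\psi_l$ by $\widehat{\psi_l}(\xi):=\widehat{b_l}(M^{-\mathsf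 T}\xi)\widehat\phi(M^{-\mathsf T}\xi)$ for $l=1,\dots,s$, $\{\phi;\psi_1,\dots,\psi_s\}_{\epsilon_1,\dots,\epsilon_s}$ is a quasi-tight $M$-framelet in $L_2(\mathbb{R}^d)$ such that $\phi$ is fundamental, $$\psi_l(k)=0,\quad\forall k\in\mathbb{Z}^d\setminus\{0\},\quad l=1,\dots,s,$$ and $\min_{1\le l\le s}\operatorname{vm}(\psi_l)\ge m$.
   Context: A $d\times d$ dilation matrix is a matrix $M\in\mathbb{Z}^{d\times d}$ all of whose eigenvalues are greater than one in modulus; $d_M:=|\det M|$; $M^{-\mathsf T}:=(M^{\mathsf T})^{-1}$. $l_0(\mathbb{Z}^d)$ is the space of finitely supported sequences $u:\mathbb{Z}^d\to\mathbb{C}$ (filters), with Fourier series $\widehat u(\xi):=\sum_{k\in\mathbb{Z}^d}u(k)e^{-ik\cdot\xi}$. For $f\in L_1(\mathbb{R}^d)$, $\widehat f(\xi):=\int_{\mathbb{R}^d}f(x)e^{-ix\cdot\xi}dx$, extended to $L_2$ and tempered distributions. $\boldsymbol\delta(0)=1$ and $\boldsymbol\delta(x)=0$ for $x\neq0$. For functions smooth near $\xi_0$, $f(\xi)=g(\xi)+\mathcal{O}(\|\xi-\xi_0\|^m)$ as $\xi\to\xi_0$ means $\partial^\mu f(\xi_0)=\partial^\mu g(\xi_0)$ for all $\mu\in\mathbb{N}_0^d$ with $|\mu|<m$. $\Omega_M:=[M^{-\mathsf T}\mathbb{Z}^d]\cap[0,1)^d$. For $\gamma\in\mathbb{Z}^d$,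 the coset filter is $u^{[\gamma,M]}(k):=u(\gamma+Mk)$, $k\in\mathbb{Z}^d$. A filter $a$ is $M$-interpolatory if $a(Mk)=d_M^{-1}\boldsymbol\delta(k)$ for all $k\in\mathbb{Z}^d$. $\operatorname{sr}(a,M)$ (order of sum rules) is the largest $m\in\mathbb{N}_0$ such that $\widehat a(\xi+2\pi\omega)=\mathcal{O}(\|\xi\|^m)$ as $\xi\to0$ for all $\omega\in\Omega_M\setminus\{0\}$. For a filter $u$ (resp. a compactly supported distribution $\psi$), $\operatorname{vm}(u)$ (resp. $\operatorname{vm}(\psi)$) is the supremum of $m\in\mathbb{N}_0$ with $\widehat u(\xi)=\mathcal{O}(\|\xi\|^m)$ (resp. $\widehat\psi(\xi)=\mathcal{O}(\|\xi\|^m)$) as $\xi\to0$. The standard $M$-refinable function (distribution) $\phi$ of a filter $a$ with $\widehat a(0)=1$ is defined by $\widehat\phi(\xi):=\prod_{j=1}^\infty\widehat a((M^{\mathsf T})^{-j}\xi)$. A function $\phi$ is fundamental if it is continuous and $\phi(k)=\boldsymbol\delta(k)$ for all $k\in\mathbb{Z}^d$. Smoothness exponent: with $n_0:=\operatorname{sr}(a,M)$, define $a_n$ by $\widehat{a_n}(\xi):=\widehat a(\xi)\widehat a(M^{\mathsf T}\xi)\cdots\widehat a((M^{\mathsf T})^{n-1}\xi)$ and $\nabla^\mu\boldsymbol\delta$ by $\widehat{\nabla^\mu\boldsymbol\delta}(\xi)=(1-e^{-i\xi_1})^{\mu_1}\cdots(1-e^{-i\xi_d})^{\mu_d}$. Put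 $\rho_{n_0}(a,M)_\infty:=|\det M|\sup\{\lim_{n\to\infty}\|(\nabla^\mu\boldsymbol\delta)*a_n\|_{\ell_\infty(\mathbb{Z}^d)}^{1/n}:\mu\in\mathbb{N}_0^d,|\mu|=n_0\}$ (with $*$ convolution of sequences) and $\operatorname{sm}_\infty(a,M):=-\log_{\rho(M)}(\rho_{n_0}(a,M)_\infty)$, where $\rho(M)$ is the spectral radius of $M$. Framelets: for functions $\psi_l$ put $\psi_{l;j,k}:=d_M^{j/2}\psi_l(M^j\cdot-k)$. $\{\phi;\psi_1,\dots,\psi_s\}\subset L_2(\mathbb{R}^d)$ is an $M$-framelet in $L_2(\mathbb{R}^d)$ if there are constants $C_1,C_2>0$ with $C_1\|f\|_2^2\le\sum_{k\in\mathbb{Z}^d}|\langle f,\phi(\cdot-k)\rangle|^2+\sum_{l=1}^s\sum_{j=0}^\infty\sum_{k\in\mathbb{Z}^d}|\langle f,\psi_{l;j,k}\rangle|^2\le C_2\|f\|_2^2$ for all $f\in L_2(\mathbb{R}^d)$. $(\{\phi;\psi_1,\dots,\psi_s\},\{\tilde\phi;\tilde\psi_1,\dots,\tilde\psi_s\})$ is a dual $M$-framelet in $L_2(\mathbb{R}^d)$ if both are $M$-framelets in $L_2(\mathbb{R}^d)$ and $f=\sum_{k}\langle f,\phi(\cdot-k)\rangle\tilde\phi(\cdot-k)+\sum_{l=1}^s\sum_{j=0}^\infty\sum_{k}\langle f,\psi_{l;j,k}\rangle\tilde\psi_{l;j,k}$ for all $f\in L_2(\mathbb{R}^d)$, with unconditional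 convergence in $L_2(\mathbb{R}^d)$. A quasi-tight $M$-framelet $\{\phi;\psi_1,\dots,\psi_s\}_{\epsilon_1,\dots,\epsilon_s}$ is a dual $M$-framelet with $\tilde\phi=\phi$ and $\psi_l=\epsilon_l\tilde\psi_l$, $\epsilon_l\in\{-1,1\}$, for $l=1,\dots,s$. *)

theory Defs
  imports "HOL-Analysis.Analysis"
begin

definition rvec :: "int ^ 'n \<Rightarrow> real ^ 'n" where
  "rvec k = (\<chi> i. real_of_int (k $ i))"

definition rmat :: "int ^ 'n ^ 'n \<Rightarrow> real ^ 'n ^ 'n" where
  "rmat M = (\<chi> i j. real_of_int (M $ i $ j))"

definition eigenvals :: "int ^ 'n ^ 'n \<Rightarrow> complex set" where
  "eigenvals M = {z. \<exists>v :: complex ^ 'n. v \<noteq> 0 \<and> (\<chi> i j. complex_of_int (M $ i $ j)) *v v = z *s v}"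

definition spec_radius :: "int ^ 'n ^ 'n \<Rightarrow> real" where
  "spec_radius M = Max (cmod ` eigenvals M)"

definition dilation_matrix :: "int ^ 'n ^ 'n \<Rightarrow> bool" where
  "dilation_matrix M \<longleftrightarrow> (\<forall>z \<in> eigenvals M. cmod z > 1)"

definition dM :: "int ^ 'n ^ 'n \<Rightarrow> nat" where
  "dM M = nat \<bar>det M\<bar>"

text \<open>Powers of matrices are written as iterates of the action on vectors, because the power
  operation of the type of vectors acts componentwise.\<close>

definition act :: "int ^ 'n ^ 'n \<Rightarrow> real ^ 'n \<Rightarrow> real ^ 'n" where
  "act M x = rmat M *v x"

definition actT :: "int ^ 'n ^ 'n \<Rightarrow> real ^ 'n \<Rightarrow> real ^ 'n" where
  "actT M \<xi> = transpose (rmat M) *v \<xi>"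

definition act_invT :: "int ^ 'n ^ 'n \<Rightarrow> real ^ 'n \<Rightarrow> real ^ 'n" where
  "act_invT M \<xi> = matrix_inv (transpose (rmat M)) *v \<xi>"

definition unit_cube :: "(real ^ 'n) set" where
  "unit_cube = {x. \<forall>i. 0 \<le> x $ i \<and> x $ i < 1}"

definition Omega :: "int ^ 'n ^ 'n \<Rightarrow> (real ^ 'n) set" where
  "Omega M = range (\<lambda>k. act_invT M (rvec k)) \<inter> unit_cube"

definition Gamma_set :: "int ^ 'n ^ 'n \<Rightarrow> (int ^ 'n) set" where
  "Gamma_set M = {k. rvec k \<in> act M ` unit_cube}"

definition delta :: "'a::zero \<Rightarrow> complex" where
  "delta x = (if x = 0 then 1 else 0)"

definition partial_deriv :: "'n \<Rightarrow> (real ^ 'n \<Rightarrow> complex) \<Rightarrow> real ^ 'n \<Rightarrow> complex" where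
  "partial_deriv i f x = vector_derivative (\<lambda>t. f (x + t *\<^sub>R axis i 1)) (at 0)"

text \<open>The derivative with multi-index \<open>\<mu>\<close>: differentiate \<open>\<mu> i\<close> times in each direction \<open>i\<close>. The
  index type carries no order, so some order of differentiation is picked; it is immaterial for the
  smooth functions to which this is applied.\<close>

definition multi_deriv :: "('n \<Rightarrow> nat) \<Rightarrow> (real ^ 'n \<Rightarrow> complex) \<Rightarrow> real ^ 'n \<Rightarrow> complex" where
  "multi_deriv \<mu> f = foldr partial_deriv (SOME w. \<forall>i. count_list w i = \<mu> i) f"

text \<open>\<open>f(\<xi>) = g(\<xi>) + O(\<parallel>\<xi> - \<xi>\<^sub>0\<parallel>\<^sup>m)\<close> as \<open>\<xi> \<longlongrightarrow> \<xi>\<^sub>0\<close>, for functions smooth near \<open>\<xi>\<^sub>0\<close>.\<close>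

definition eq_mod_O :: "(real ^ 'n \<Rightarrow> complex) \<Rightarrow> (real ^ 'n \<Rightarrow> complex) \<Rightarrow> real ^ 'n \<Rightarrow> nat \<Rightarrow> bool" where
  "eq_mod_O f g \<xi>0 m \<longleftrightarrow>
     (\<forall>\<mu>. (\<Sum>i\<in>UNIV. \<mu> i) < m \<longrightarrow> multi_deriv \<mu> f \<xi>0 = multi_deriv \<mu> g \<xi>0)"

abbreviation vanishes_O :: "(real ^ 'n \<Rightarrow> complex) \<Rightarrow> nat \<Rightarrow> bool" where
  "vanishes_O f m \<equiv> eq_mod_O f (\<lambda>_. 0) 0 m"

type_synonym 'n filt = "int ^ 'n \<Rightarrow> complex"

definition l0 :: "('n::finite) filt set" where
  "l0 = {u. finite {k. u k \<noteq> 0}}"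

definition fseries :: "('n::finite) filt \<Rightarrow> real ^ 'n \<Rightarrow> complex" where
  "fseries u \<xi> = (\<Sum>k | u k \<noteq> 0. u k * exp (- (\<i> * complex_of_real (rvec k \<bullet> \<xi>))))"

text \<open>The unique filter with a prescribed Fourier series (a trigonometric polynomial).\<close>

definition filter_of :: "(real ^ 'n \<Rightarrow> complex) \<Rightarrow> 'n filt" where
  "filter_of F = (THE u. u \<in> l0 \<and> (\<forall>\<xi>. fseries u \<xi> = F \<xi>))"

definition coset_filter :: "('n::finite) filt \<Rightarrow> int ^ 'n \<Rightarrow> int ^ 'n ^ 'n \<Rightarrow> 'n filt" where
  "coset_filter u \<gamma> M k = u (\<gamma> + M *v k)"

definition interpolatory :: "int ^ 'n ^ 'n \<Rightarrow> 'n filt \<Rightarrow> bool" where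
  "interpolatory M a \<longleftrightarrow> (\<forall>k. a (M *v k) = delta k / of_nat (dM M))"

text \<open>The admissible orders are closed downwards, so a finite value of this supremum is the largest
  admissible order.\<close>

definition sr :: "('n::finite) filt \<Rightarrow> int ^ 'n ^ 'n \<Rightarrow> enat" where
  "sr a M = Sup {enat m | m. \<forall>\<omega> \<in> Omega M - {0}.
      vanishes_O (\<lambda>\<xi>. fseries a (\<xi> + (2 * pi) *\<^sub>R \<omega>)) m}"

definition vm_filter :: "('n::finite) filt \<Rightarrow> enat" where
  "vm_filter u = Sup {enat m | m. vanishes_O (fseries u) m}"

definition conv :: "('n::finite) filt \<Rightarrow> 'n filt \<Rightarrow> 'n filt" where
  "conv u v k = (\<Sum>j | u j \<noteq> 0. u j * v (k - j))"

definition linf_norm :: "('n::finite) filt \<Rightarrow> real" where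
  "linf_norm u = (SUP k. cmod (u k))"

definition iter_filter :: "('n::finite) filt \<Rightarrow> int ^ 'n ^ 'n \<Rightarrow> nat \<Rightarrow> 'n filt" where
  "iter_filter a M n = filter_of (\<lambda>\<xi>. \<Prod>j<n. fseries a ((actT M ^^ j) \<xi>))"

definition nabla_delta :: "('n::finite \<Rightarrow> nat) \<Rightarrow> 'n filt" where
  "nabla_delta \<mu> = filter_of (\<lambda>\<xi>. \<Prod>i\<in>UNIV. (1 - exp (- (\<i> * complex_of_real (\<xi> $ i)))) ^ \<mu> i)"

definition rho_inf :: "nat \<Rightarrow> 'n filt \<Rightarrow> int ^ 'n ^ 'n \<Rightarrow> real" where
  "rho_inf n0 a M = real (dM M) *
     (SUP \<mu> \<in> {\<mu>. (\<Sum>i\<in>UNIV. \<mu> i) = n0}.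
        lim (\<lambda>n. root n (linf_norm (conv (nabla_delta \<mu>) (iter_filter a M n)))))"

text \<open>The case distinction implements \<open>- log 0 = \<infinity>\<close>, since the logarithm of the library vanishes
  at \<open>0\<close>.\<close>

definition sm_inf :: "('n::finite) filt \<Rightarrow> int ^ 'n ^ 'n \<Rightarrow> ereal" where
  "sm_inf a M = (let r = rho_inf (the_enat (sr a M)) a M in
     if r = 0 then \<infinity> else ereal (- log (spec_radius M) r))"

definition fourier :: "(real ^ 'n \<Rightarrow> complex) \<Rightarrow> real ^ 'n \<Rightarrow> complex" where
  "fourier f \<xi> = (LINT x|lebesgue. f x * exp (- (\<i> * complex_of_real (x \<bullet> \<xi>))))"

text \<open>\<open>f\<close> is an integrable function with Fourier transform \<open>F\<close>, i.e. the (tempered) distribution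
  defined by its Fourier transform \<open>F\<close> is the function \<open>f\<close>.\<close>

definition has_fourier :: "(real ^ 'n \<Rightarrow> complex) \<Rightarrow> (real ^ 'n \<Rightarrow> complex) \<Rightarrow> bool" where
  "has_fourier f F \<longleftrightarrow> integrable lebesgue f \<and> (\<forall>\<xi>. fourier f \<xi> = F \<xi>)"

definition refinable_hat :: "int ^ 'n ^ 'n \<Rightarrow> 'n filt \<Rightarrow> real ^ 'n \<Rightarrow> complex" where
  "refinable_hat M a \<xi> = prodinf (\<lambda>j. fseries a ((act_invT M ^^ Suc j) \<xi>))"

definition fundamental :: "(real ^ 'n \<Rightarrow> complex) \<Rightarrow> bool" where
  "fundamental \<phi> \<longleftrightarrow> continuous_on UNIV \<phi> \<and> (\<forall>k. \<phi> (rvec k) = delta k)"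

definition vm_fun :: "(real ^ 'n \<Rightarrow> complex) \<Rightarrow> enat" where
  "vm_fun \<psi> = Sup {enat m | m. vanishes_O (fourier \<psi>) m}"

definition L2 :: "(real ^ 'n \<Rightarrow> complex) set" where
  "L2 = {f \<in> borel_measurable lebesgue. integrable lebesgue (\<lambda>x. (cmod (f x))\<^sup>2)}"

definition L2_inner :: "(real ^ 'n \<Rightarrow> complex) \<Rightarrow> (real ^ 'n \<Rightarrow> complex) \<Rightarrow> complex" where
  "L2_inner f g = (LINT x|lebesgue. f x * cnj (g x))"

definition L2_norm :: "(real ^ 'n \<Rightarrow> complex) \<Rightarrow> real" where
  "L2_norm f = sqrt (LINT x|lebesgue. (cmod (f x))\<^sup>2)"

definition shift :: "(real ^ 'n \<Rightarrow> complex) \<Rightarrow> int ^ 'n \<Rightarrow> real ^ 'n \<Rightarrow> complex" where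
  "shift \<phi> k x = \<phi> (x - rvec k)"

definition dilate_shift ::
    "int ^ 'n ^ 'n \<Rightarrow> (real ^ 'n \<Rightarrow> complex) \<Rightarrow> nat \<Rightarrow> int ^ 'n \<Rightarrow> real ^ 'n \<Rightarrow> complex" where
  "dilate_shift M \<psi> j k x =
     complex_of_real (real (dM M) powr (real j / 2)) * \<psi> ((act M ^^ j) x - rvec k)"

definition framelet :: "int ^ 'n ^ 'n \<Rightarrow> (real ^ 'n \<Rightarrow> complex) \<Rightarrow> (real ^ 'n \<Rightarrow> complex) list \<Rightarrow> bool" where
  "framelet M \<phi> \<psi>s \<longleftrightarrow> \<phi> \<in> L2 \<and> set \<psi>s \<subseteq> L2 \<and>
     (\<exists>C1 C2 :: real. C1 > 0 \<and> C2 > 0 \<and> (\<forall>f \<in> L2.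
        let S = (\<Sum>\<^sub>\<infinity>k. ennreal ((cmod (L2_inner f (shift \<phi> k)))\<^sup>2)) +
                (\<Sum>l<length \<psi>s. \<Sum>\<^sub>\<infinity>j. \<Sum>\<^sub>\<infinity>k.
                   ennreal ((cmod (L2_inner f (dilate_shift M (\<psi>s ! l) j k)))\<^sup>2))
        in ennreal (C1 * (L2_norm f)\<^sup>2) \<le> S \<and> S \<le> ennreal (C2 * (L2_norm f)\<^sup>2)))"

text \<open>The elements of the system generated by \<open>\<phi>\<close> and \<open>\<psi>s\<close>: \<open>Inl k\<close> indexes the shift of \<open>\<phi>\<close> by
  \<open>k\<close>, and \<open>Inr (l, j, k)\<close> indexes \<open>\<psi>\<^bsub>l;j,k\<^esub>\<close>.\<close>

primrec framelet_elem ::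
    "int ^ 'n ^ 'n \<Rightarrow> (real ^ 'n \<Rightarrow> complex) \<Rightarrow> (real ^ 'n \<Rightarrow> complex) list \<Rightarrow>
     (int ^ 'n) + (nat \<times> nat \<times> (int ^ 'n)) \<Rightarrow> real ^ 'n \<Rightarrow> complex" where
  "framelet_elem M \<phi> \<psi>s (Inl k) = shift \<phi> k"
| "framelet_elem M \<phi> \<psi>s (Inr p) = (case p of (l, j, k) \<Rightarrow> dilate_shift M (\<psi>s ! l) j k)"

definition framelet_index :: "nat \<Rightarrow> ((int ^ 'n) + (nat \<times> nat \<times> (int ^ 'n))) set" where
  "framelet_index s = UNIV <+> {..<s} \<times> UNIV"

text \<open>Unconditional convergence in \<open>L2\<close> is convergence of the net of partial sums over finite sets
  of indices.\<close>

definition dual_framelet ::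
    "int ^ 'n ^ 'n \<Rightarrow> (real ^ 'n \<Rightarrow> complex) \<Rightarrow> (real ^ 'n \<Rightarrow> complex) list \<Rightarrow>
     (real ^ 'n \<Rightarrow> complex) \<Rightarrow> (real ^ 'n \<Rightarrow> complex) list \<Rightarrow> bool" where
  "dual_framelet M \<phi> \<psi>s \<phi>' \<psi>s' \<longleftrightarrow>
     length \<psi>s' = length \<psi>s \<and> framelet M \<phi> \<psi>s \<and> framelet M \<phi>' \<psi>s' \<and>
     (\<forall>f \<in> L2.
        ((\<lambda>I. L2_norm (\<lambda>x. f x -
              (\<Sum>i\<in>I. L2_inner f (framelet_elem M \<phi> \<psi>s i) * framelet_elem M \<phi>' \<psi>s' i x)))
          \<longlongrightarrow> 0) (finite_subsets_at_top (framelet_index (length \<psi>s))))"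

definition quasi_tight_framelet ::
    "int ^ 'n ^ 'n \<Rightarrow> (real ^ 'n \<Rightarrow> complex) \<Rightarrow> (real ^ 'n \<Rightarrow> complex) list \<Rightarrow> int list \<Rightarrow> bool" where
  "quasi_tight_framelet M \<phi> \<psi>s \<epsilon>s \<longleftrightarrow>
     length \<epsilon>s = length \<psi>s \<and> set \<epsilon>s \<subseteq> {-1, 1} \<and>
     (\<exists>\<psi>s'. dual_framelet M \<phi> \<psi>s \<phi> \<psi>s' \<and>
        (\<forall>l<length \<psi>s. \<psi>s ! l = (\<lambda>x. of_int (\<epsilon>s ! l) * (\<psi>s' ! l) x)))"

definition quasi_tight_filter_bank ::
    "int ^ 'n ^ 'n \<Rightarrow> 'n filt \<Rightarrow> 'n filt list \<Rightarrow> int list \<Rightarrow> bool" where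
  "quasi_tight_filter_bank M a bs \<epsilon>s \<longleftrightarrow>
     a \<in> l0 \<and> set bs \<subseteq> l0 \<and> length \<epsilon>s = length bs \<and> set \<epsilon>s \<subseteq> {-1, 1} \<and>
     (\<forall>\<xi>. \<forall>\<omega> \<in> Omega M.
        cnj (fseries a \<xi>) * fseries a (\<xi> + (2 * pi) *\<^sub>R \<omega>) +
        (\<Sum>l<length bs. of_int (\<epsilon>s ! l) *
           cnj (fseries (bs ! l) \<xi>) * fseries (bs ! l) (\<xi> + (2 * pi) *\<^sub>R \<omega>)) = delta \<omega>)"

definition h_filter :: "int ^ 'n ^ 'n \<Rightarrow> 'n filt \<Rightarrow> int ^ 'n \<Rightarrow> 'n filt" where
  "h_filter M a \<gamma> = filter_of (\<lambda>\<xi>.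
     complex_of_real (1 / real (dM M) - real (dM M) * (cmod (fseries (coset_filter a \<gamma> M) \<xi>))\<^sup>2))"

definition signed_squares :: "('n::finite) filt \<Rightarrow> nat \<Rightarrow> nat \<Rightarrow> (nat \<Rightarrow> 'n filt) \<Rightarrow> (nat \<Rightarrow> int) \<Rightarrow> bool" where
  "signed_squares h m s u \<epsilon> \<longleftrightarrow>
     s \<ge> 1 \<and> (\<forall>t\<in>{1..s}. u t \<in> l0 \<and> \<epsilon> t \<in> {-1, 1}) \<and>
     (\<forall>\<xi>. fseries h \<xi> = (\<Sum>t=1..s. of_int (\<epsilon> t) * complex_of_real ((cmod (fseries (u t) \<xi>))\<^sup>2))) \<and>
     (\<forall>t\<in>{1..s}. vanishes_O (fseries (u t)) m)"

definition b_first :: "('n::finite) filt \<Rightarrow> 'n filt" where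
  "b_first a = filter_of (\<lambda>\<xi>. 1 - fseries a \<xi>)"

definition b_coset :: "int ^ 'n ^ 'n \<Rightarrow> 'n filt \<Rightarrow> int ^ 'n \<Rightarrow> 'n filt" where
  "b_coset M a \<gamma> = filter_of (\<lambda>\<xi>.
     complex_of_real (real (dM M) powr (- 1 / 2)) -
     complex_of_real (real (dM M) powr (1 / 2)) * exp (- (\<i> * complex_of_real (rvec \<gamma> \<bullet> \<xi>))) *
       fseries (coset_filter a \<gamma> M) (actT M \<xi>))"

definition b_extra :: "int ^ 'n ^ 'n \<Rightarrow> int ^ 'n \<Rightarrow> 'n filt \<Rightarrow> 'n filt" where
  "b_extra M \<gamma> u = filter_of (\<lambda>\<xi>.
     exp (- (\<i> * complex_of_real (rvec \<gamma> \<bullet> \<xi>))) * fseries u (actT M \<xi>))"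

definition all_filters ::
    "int ^ 'n ^ 'n \<Rightarrow> 'n filt \<Rightarrow> (nat \<Rightarrow> int ^ 'n) \<Rightarrow> (nat \<Rightarrow> nat) \<Rightarrow> (nat \<Rightarrow> nat \<Rightarrow> 'n filt) \<Rightarrow> 'n filt list" where
  "all_filters M a \<gamma> s u =
     b_first a # map (\<lambda>j. b_coset M a (\<gamma> j)) [2..<dM M + 1] @
     concat (map (\<lambda>j. map (\<lambda>t. b_extra M (\<gamma> j) (u j t)) [1..<s j + 1]) [2..<dM M + 1])"

definition all_signs ::
    "int ^ 'n ^ 'n \<Rightarrow> (nat \<Rightarrow> nat) \<Rightarrow> (nat \<Rightarrow> nat \<Rightarrow> int) \<Rightarrow> int list" where
  "all_signs M s \<epsilon> =
     (-1) # map (\<lambda>j. 1) [2..<dM M + 1] @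
     concat (map (\<lambda>j. map (\<lambda>t. \<epsilon> j t) [1..<s j + 1]) [2..<dM M + 1])"

end

theory Submission
  imports Defs "HOL-Computational_Algebra.Fundamental_Theorem_Algebra"
begin

text \<open>Interpolation and the sum rules determine the moments of \<open>a\<close> on each coset of \<open>M \<int>\<^sup>d\<close> up to degree
  \<open>2 m - 1\<close>. Hence \<open>h\<^sub>j\<close> vanishes to order \<open>2 m\<close> and lies in the ideal generated by the products of \<open>2 m\<close>
  factors \<open>1 - e^{- i \<xi>\<^sub>k}\<close>. Splitting each product into halves writes \<open>h\<^sub>j = Re h\<^sub>j\<close> as a sum of terms
  \<open>Re (U V) = \<bar>(cnj U + V) / 2\<bar>\<^sup>2 - \<bar>(cnj U - V) / 2\<bar>\<^sup>2\<close> with \<open>U, V\<close> of order \<open>m\<close>, and the identity of the filter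
  bank is a computation with the coset decomposition of \<open>a\<close>.

  If \<open>sm\<^sub>\<infinity>(a, M) > 0\<close>, the differences of order \<open>2 m\<close> of \<open>d\<^sup>n a\<^sub>n\<close> decay geometrically, so the cascade
  algorithm, started from a Lipschitz kernel that reproduces polynomials, converges uniformly to a Hoelder
  continuous \<open>\<phi>\<close>. The framelet is then treated in the time domain: the frequency identity, averaged over
  \<open>\<Omega>\<^sub>M\<close>, telescopes the framelet expansion into the quasi-projections \<open>\<Sum>\<^sub>k \<langle>f, \<phi>\<^sub>J\<^sub>k\<rangle> \<phi>\<^sub>J\<^sub>k\<close>, which converge
  for continuous \<open>f\<close> with bounded support, and Schur's test gives the Bessel bound that extends this to \<open>L\<^sub>2\<close>.\<close>

section \<open>Lattice vectors and trigonometric polynomials\<close>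

text \<open>The signs come from algebra: |a|^2 - |1 - a|^2 = 2 Re a - 1 removes the square of a, and
  its linear part is cancelled by the cross terms of the filters \<open>b_coset\<close>; on each
  coset only a multiple of |A_j|^2 is left, which h_j compensates. The even order 2 m is what
  permits halving. Orders of vanishing are treated as annihilation of polynomials by coefficient
  sequences. This is stable under affine substitution, so passing to cosets, upsampling, reflecting
  and refining become substitutions in the test polynomial. The exponent is defined by
  \<open>lim\<close> and a real \<open>SUP\<close>, which say nothing unless the limits exist and
  the set is bounded. Both have to be proved before the hypothesis yields any decay, and the decay
  has to be carried from pure differences to all filters with 2 m vanishing moments. M need not be
  isotropic: the contraction of its inverse powers and the growth of its powers have unrelated
  rates, whence the two-parameter modulus of continuity of \<phi>. The lower frame bound comes from
  the reconstruction and needs no estimate of its own.\<close>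

lemma rvec_add: "rvec (k + l) = rvec k + rvec l"
  by (simp add: rvec_def vec_eq_iff)

lemma rvec_zero [simp]: "rvec 0 = 0"
  by (simp add: rvec_def vec_eq_iff)

lemma rvec_minus: "rvec (- k) = - rvec k"
  by (simp add: rvec_def vec_eq_iff)

lemma rvec_diff: "rvec (k - l) = rvec k - rvec l"
  by (simp add: rvec_def vec_eq_iff)

lemma rvec_nth: "rvec k $ i = real_of_int (k $ i)"
  by (simp add: rvec_def)

lemma rvec_inject [simp]: "rvec k = rvec l \<longleftrightarrow> k = l"
  by (simp add: rvec_def vec_eq_iff)

lemma rvec_mult: "rvec (M *v k) = rmat M *v rvec k"
  by (simp add: rvec_def rmat_def matrix_vector_mult_def vec_eq_iff)

lemma rvec_axis: "rvec (axis i 1) = axis i 1"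
  by (simp add: rvec_def axis_def vec_eq_iff)

lemma finite_int_vec_bounded:
  fixes S :: "(int ^ 'n) set"
  assumes "bounded (rvec ` S)"
  shows "finite S"
proof -
  obtain C where C: "\<And>k. k \<in> S \<Longrightarrow> norm (rvec k) \<le> C"
    using assms by (auto simp: bounded_iff)
  have "k $ i \<in> {-\<lceil>C\<rceil>..\<lceil>C\<rceil>}" if "k \<in> S" for k i
  proof -
    have "\<bar>rvec k $ i\<bar> \<le> C"
      using C[OF that] component_le_norm_cart[of "rvec k" i] by linarith
    then have "\<bar>real_of_int (k $ i)\<bar> \<le> C" unfolding rvec_nth .
    then have "k $ i \<le> \<lceil>C\<rceil>" "- (k $ i) \<le> \<lceil>C\<rceil>" by linarith+
    then show ?thesis by simp
  qed
  then have "vec_nth ` S \<subseteq> Pi\<^sub>E UNIV (\<lambda>_. {-\<lceil>C\<rceil>..\<lceil>C\<rceil>})"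
    by (intro image_subsetI PiE_I) auto
  moreover have "finite (Pi\<^sub>E (UNIV :: 'n set) (\<lambda>_. {-\<lceil>C\<rceil>..\<lceil>C\<rceil>}))"
    by (intro finite_PiE) auto
  ultimately have "finite (vec_nth ` S)" by (rule finite_subset)
  then show ?thesis
    by (rule finite_imageD) (auto simp: inj_on_def vec_nth_inject)
qed

text \<open>The exponential in \<open>fseries\<close>, isolated because it is multiplicative in both
  arguments and because the transposed matrix acting on the frequency becomes \<open>M\<close>
  acting on the index (\<open>chr_actT\<close>).\<close>

definition chr :: "int ^ 'n \<Rightarrow> real ^ 'n \<Rightarrow> complex" where
  "chr k \<xi> = exp (- (\<i> * of_real (rvec k \<bullet> \<xi>)))"

abbreviation "ochr k \<omega> \<equiv> chr k ((2 * pi) *\<^sub>R \<omega>)"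

lemma chr_add: "chr (k + l) \<xi> = chr k \<xi> * chr l \<xi>"
  by (simp add: chr_def rvec_add inner_add_left algebra_simps flip: exp_add)

lemma chr_0 [simp]: "chr 0 \<xi> = 1"
  by (simp add: chr_def)

lemma chr_at_0 [simp]: "chr k 0 = 1"
  by (simp add: chr_def)

lemma norm_chr [simp]: "cmod (chr k \<xi>) = 1"
  by (simp add: chr_def)

lemma chr_nz [simp]: "chr k \<xi> \<noteq> 0"
  by (simp add: chr_def)

lemma chr_minus: "chr (- k) \<xi> = cnj (chr k \<xi>)"
  by (simp add: chr_def rvec_minus exp_cnj)

lemma chr_mult_cnj [simp]: "chr k \<xi> * cnj (chr k \<xi>) = 1" "cnj (chr k \<xi>) * chr k \<xi> = 1"
  by (simp_all flip: chr_minus chr_add)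

lemma chr_plus: "chr k (x + y) = chr k x * chr k y"
  by (simp add: chr_def inner_add_right algebra_simps flip: exp_add)

lemma inner_transpose_mult:
  fixes A :: "real ^ 'n ^ 'n"
  shows "x \<bullet> (transpose A *v y) = (A *v x) \<bullet> y"
  by (metis dot_lmul_matrix transpose_matrix_vector transpose_transpose)

lemma chr_actT: "chr k (actT M \<xi>) = chr (M *v k) \<xi>"
  unfolding chr_def actT_def inner_transpose_mult rvec_mult ..

lemma chr_axis: "chr (axis i 1) \<xi> = exp (- (\<i> * of_real (\<xi> $ i)))"
  by (simp add: chr_def rvec_axis inner_axis' )

lemma chr_axis_int: "chr (axis i n) \<xi> = exp (- (\<i> * of_real (of_int n * \<xi> $ i)))"
proof -
  have "rvec (axis i n) = axis i (real_of_int n)"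
    by (simp add: rvec_def axis_def vec_eq_iff)
  then show ?thesis by (simp add: chr_def inner_axis')
qed

lemma exp_2pi_int: "exp (- (\<i> * of_real (2 * pi * real_of_int n))) = 1"
proof -
  have "- (\<i> * of_real (2 * pi * real_of_int n)) = (2 * of_int (- n) * pi) * \<i>"
    by simp
  then show ?thesis by (metis exp_integer_2pi Ints_of_int mult.assoc)
qed

lemma chr_2pi_rvec: "chr k ((2 * pi) *\<^sub>R rvec n) = 1"
proof -
  have "rvec k \<bullet> rvec n = real_of_int (\<Sum>i\<in>UNIV. k $ i * n $ i)"
    by (simp add: rvec_def inner_vec_def)
  then have "rvec k \<bullet> ((2 * pi) *\<^sub>R rvec n) = 2 * pi * real_of_int (\<Sum>i\<in>UNIV. k $ i * n $ i)"
    by simp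
  then show ?thesis unfolding chr_def by (simp only: exp_2pi_int)
qed

lemma chr_separates:
  assumes "k \<noteq> l"
  shows "\<exists>\<xi>. chr k \<xi> \<noteq> chr l \<xi>"
proof -
  obtain i where i: "k $ i \<noteq> l $ i" using assms by (auto simp: vec_eq_iff)
  define n where "n = k $ i - l $ i"
  \<comment> \<open>On an axis along which \<open>k\<close> and \<open>l\<close> differ by
    \<open>n\<close>, this point gives the quotient of the two characters the value -1.\<close>
  define \<xi> where "\<xi> = (pi / real_of_int n) *\<^sub>R (axis i 1 :: real^'a)"
  have n: "n \<noteq> 0" using i by (simp add: n_def)
  have "chr (k - l) \<xi> = exp (- (\<i> * of_real pi))"
    using n by (simp add: chr_def \<xi>_def inner_axis rvec_nth n_def)
  also have "\<dots> = -1" by (simp add: exp_minus)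
  finally have "chr (k - l) \<xi> \<noteq> 1" by simp
  moreover have "chr k \<xi> = chr (k - l) \<xi> * chr l \<xi>" by (simp flip: chr_add)
  ultimately show ?thesis by (auto intro!: exI[of _ \<xi>])
qed

section \<open>Finitely supported filters and trigonometric polynomials\<close>

lemma l0_finite: "u \<in> l0 \<Longrightarrow> finite {k. u k \<noteq> 0}"
  by (simp add: l0_def)

lemma l0I: "finite S \<Longrightarrow> (\<And>k. k \<notin> S \<Longrightarrow> u k = 0) \<Longrightarrow> u \<in> l0"
  unfolding l0_def by (auto intro: finite_subset)

lemma fseries_superset:
  assumes "finite S" "\<And>k. k \<notin> S \<Longrightarrow> u k = 0"
  shows "fseries u \<xi> = (\<Sum>k\<in>S. u k * chr k \<xi>)"
  unfolding fseries_def chr_def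
  by (rule sum.mono_neutral_left) (use assms in auto)

lemma fseries_chr: "fseries u \<xi> = (\<Sum>k | u k \<noteq> 0. u k * chr k \<xi>)"
  by (simp add: fseries_def chr_def)

lemma l0_add [intro]: "u \<in> l0 \<Longrightarrow> v \<in> l0 \<Longrightarrow> (\<lambda>k. u k + v k) \<in> l0"
  by (rule l0I[of "{k. u k \<noteq> 0} \<union> {k. v k \<noteq> 0}"]) (auto simp: l0_def)

lemma l0_scale [intro]: "u \<in> l0 \<Longrightarrow> (\<lambda>k. c k * u k) \<in> l0"
  by (rule l0I[of "{k. u k \<noteq> 0}"]) (auto simp: l0_def)

lemma l0_scale2 [intro]: "u \<in> l0 \<Longrightarrow> (\<lambda>k. u k * c k) \<in> l0"
  by (rule l0I[of "{k. u k \<noteq> 0}"]) (auto simp: l0_def)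

lemma l0_single [intro]: "(\<lambda>k. if k = j then c else 0) \<in> l0"
  by (rule l0I[of "{j}"]) auto

lemma l0_diff [intro]: "u \<in> l0 \<Longrightarrow> v \<in> l0 \<Longrightarrow> (\<lambda>k. u k - v k) \<in> l0"
  by (rule l0I[of "{k. u k \<noteq> 0} \<union> {k. v k \<noteq> 0}"]) (auto simp: l0_def)

lemma l0_sum [intro]: "(\<And>i. i \<in> I \<Longrightarrow> u i \<in> l0) \<Longrightarrow> (\<lambda>k. \<Sum>i\<in>I. u i k) \<in> l0"
proof (induction I rule: infinite_finite_induct)
  case (insert x F)
  then show ?case by simp (intro l0_add, auto)
qed (auto intro: l0I[of "{}"])

lemma l0_delta [intro, simp]: "delta \<in> l0"
  by (rule l0I[of "{0}"]) (auto simp: delta_def)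

lemma fseries_add:
  assumes "u \<in> l0" "v \<in> l0"
  shows "fseries (\<lambda>k. u k + v k) \<xi> = fseries u \<xi> + fseries v \<xi>"
proof -
  let ?S = "{k. u k \<noteq> 0} \<union> {k. v k \<noteq> 0}"
  have S: "finite ?S" using assms by (auto simp: l0_def)
  show ?thesis
    by (subst (1 2 3) fseries_superset[OF S]) (auto simp: sum.distrib algebra_simps)
qed

lemma fseries_scale: "fseries (\<lambda>k. c * u k) \<xi> = c * fseries u \<xi>"
  by (cases "c = 0") (simp_all add: fseries_def sum_distrib_left mult.assoc)

lemma fseries_diff:
  assumes "u \<in> l0" "v \<in> l0"
  shows "fseries (\<lambda>k. u k - v k) \<xi> = fseries u \<xi> - fseries v \<xi>"
  using fseries_add[OF assms(1) l0_scale[OF assms(2), of "\<lambda>_. -1"], of \<xi>] fseries_scale[of "-1" v \<xi>]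
  by simp

lemma fseries_zero [simp]: "fseries (\<lambda>_. 0) \<xi> = 0"
  by (simp add: fseries_def)

lemma fseries_single: "fseries (\<lambda>k. if k = j then c else 0) \<xi> = c * chr j \<xi>"
  by (subst fseries_superset[of "{j}"]) auto

lemma fseries_delta [simp]: "fseries delta \<xi> = 1"
  by (subst fseries_superset[of "{0}"]) (auto simp: delta_def)

text \<open>Dedekind's argument for the independence of characters: translating by a point
  \<open>\<eta>\<close> that separates \<open>l\<close> from \<open>k0\<close> and subtracting
  \<open>chr k0 \<eta>\<close> times the relation cancels the term of \<open>k0\<close>, while the
  term of \<open>l\<close> keeps a nonzero factor.\<close>

lemma trig_poly_unique_aux:
  fixes c :: "int ^ 'n \<Rightarrow> complex"
  assumes "finite S" "\<And>\<xi>. (\<Sum>k\<in>S. c k * chr k \<xi>) = 0" "k \<in> S"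
  shows "c k = 0"
  using assms
proof (induction S arbitrary: c k rule: finite_induct)
  case (insert k0 S)
  have "c l = 0" if l: "l \<in> S" for l
  proof -
    obtain \<eta> where \<eta>: "chr l \<eta> \<noteq> chr k0 \<eta>"
      using chr_separates[of l k0] l insert.hyps by auto
    have "(\<Sum>k\<in>S. (c k * (chr k \<eta> - chr k0 \<eta>)) * chr k \<xi>) = 0" for \<xi>
    proof -
      have "(\<Sum>k\<in>S. (c k * (chr k \<eta> - chr k0 \<eta>)) * chr k \<xi>) =
        (\<Sum>k\<in>insert k0 S. (c k * (chr k \<eta> - chr k0 \<eta>)) * chr k \<xi>)"
        using insert.hyps by simp
      also have "\<dots> = (\<Sum>k\<in>insert k0 S. c k * chr k (\<xi> + \<eta>)) -
          chr k0 \<eta> * (\<Sum>k\<in>insert k0 S. c k * chr k \<xi>)"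
        by (simp only: sum_distrib_left chr_plus sum_subtractf[symmetric])
          (intro sum.cong, auto simp: algebra_simps)
      also have "\<dots> = 0" unfolding insert.prems(1) by simp
      finally show ?thesis .
    qed
    from insert.IH[OF this l] \<eta> show ?thesis by simp
  qed
  note z = this
  have "c k0 = 0"
    using insert.prems(1)[of 0] insert.hyps z by simp
  with z insert.prems(2) show ?case by auto
qed simp

lemma fseries_inject:
  assumes "u \<in> l0" "v \<in> l0" "\<And>\<xi>. fseries u \<xi> = fseries v \<xi>"
  shows "u = v"
proof
  fix k
  let ?w = "\<lambda>k. u k - v k"
  have w: "?w \<in> l0" using assms by auto
  have "(\<Sum>k\<in>{k. ?w k \<noteq> 0}. ?w k * chr k \<xi>) = 0" for \<xi>
    using fseries_diff[OF assms(1,2), of \<xi>] assms(3)[of \<xi>] by (simp add: fseries_chr)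
  from trig_poly_unique_aux[OF l0_finite[OF w] this, of k] show "u k = v k" by auto
qed

text \<open>Turns the definite description in \<open>filter_of\<close> into a computation:
  uniqueness is settled once by \<open>fseries_inject\<close>, so a filter of the construction is
  identified by exhibiting its coefficients.\<close>

lemma filter_of_eqI:
  assumes "u \<in> l0" "\<And>\<xi>. fseries u \<xi> = F \<xi>"
  shows "filter_of F = u"
  unfolding filter_of_def
  by (rule the_equality) (use assms in \<open>auto intro: fseries_inject\<close>)

lemma filter_of_fseries [simp]: "u \<in> l0 \<Longrightarrow> filter_of (fseries u) = u"
  by (rule filter_of_eqI) auto

text \<open>Membership is the existence half of \<open>filter_of\<close>. The closure rules below
  spare the computation of coefficients of products, conjugates and dilations.\<close>

definition trig_polys :: "(real ^ 'n \<Rightarrow> complex) set" where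
  "trig_polys = fseries ` l0"

lemma trig_polys_fseries [intro]: "u \<in> l0 \<Longrightarrow> fseries u \<in> trig_polys"
  by (simp add: trig_polys_def)

lemma filter_of_props:
  assumes "F \<in> trig_polys"
  shows "filter_of F \<in> l0" "fseries (filter_of F) = F"
  using assms by (auto simp: trig_polys_def)

lemma trig_polys_zero [intro, simp]: "(\<lambda>_. 0) \<in> trig_polys"
  unfolding trig_polys_def
  by (rule image_eqI[of _ _ "\<lambda>_. 0"]) (auto intro: l0I[of "{}"])

lemma trig_polys_chr [intro]: "(\<lambda>\<xi>. c * chr k \<xi>) \<in> trig_polys"
  unfolding trig_polys_def
  by (rule image_eqI[of _ _ "\<lambda>j. if j = k then c else 0"]) (auto simp: fseries_single)

lemma trig_polys_const [intro, simp]: "(\<lambda>\<xi>. c) \<in> trig_polys"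
  using trig_polys_chr[of c 0] by simp

lemma trig_polys_chr1 [intro]: "chr k \<in> trig_polys"
  using trig_polys_chr[of 1 k] by (simp add: fun_eq_iff)

lemma trig_polys_add [intro]:
  "F \<in> trig_polys \<Longrightarrow> G \<in> trig_polys \<Longrightarrow> (\<lambda>\<xi>. F \<xi> + G \<xi>) \<in> trig_polys"
  unfolding trig_polys_def by (auto intro!: image_eqI[OF _ l0_add] simp: fseries_add[symmetric] fun_eq_iff)

lemma trig_polys_sum [intro]:
  "(\<And>i. i \<in> I \<Longrightarrow> F i \<in> trig_polys) \<Longrightarrow> (\<lambda>\<xi>. \<Sum>i\<in>I. F i \<xi>) \<in> trig_polys"
  by (induction I rule: infinite_finite_induct) (auto intro!: trig_polys_add)

lemma trig_polys_mult [intro]: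
  assumes "F \<in> trig_polys" "G \<in> trig_polys"
  shows "(\<lambda>\<xi>. F \<xi> * G \<xi>) \<in> trig_polys"
proof -
  obtain u v where uv: "u \<in> l0" "v \<in> l0" "F = fseries u" "G = fseries v"
    using assms by (auto simp: trig_polys_def)
  have "(\<lambda>\<xi>. \<Sum>k | u k \<noteq> 0. \<Sum>l | v l \<noteq> 0. (u k * v l) * chr (k + l) \<xi>) \<in> trig_polys"
    by (intro trig_polys_sum trig_polys_chr)
  also have "(\<lambda>\<xi>. \<Sum>k | u k \<noteq> 0. \<Sum>l | v l \<noteq> 0. (u k * v l) * chr (k + l) \<xi>) = (\<lambda>\<xi>. F \<xi> * G \<xi>)"
    by (simp add: uv fseries_chr sum_product chr_add mult_ac)
  finally show ?thesis .
qed

lemma trig_polys_uminus [intro]: "F \<in> trig_polys \<Longrightarrow> (\<lambda>\<xi>. - F \<xi>) \<in> trig_polys"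
  using trig_polys_mult[of "\<lambda>_. -1" F] by simp

lemma trig_polys_diff [intro]:
  "F \<in> trig_polys \<Longrightarrow> G \<in> trig_polys \<Longrightarrow> (\<lambda>\<xi>. F \<xi> - G \<xi>) \<in> trig_polys"
  using trig_polys_add[OF _ trig_polys_uminus, of F G] by simp

lemma trig_polys_prod [intro]:
  "(\<And>i. i \<in> I \<Longrightarrow> F i \<in> trig_polys) \<Longrightarrow> (\<lambda>\<xi>. \<Prod>i\<in>I. F i \<xi>) \<in> trig_polys"
  by (induction I rule: infinite_finite_induct) (auto intro!: trig_polys_mult)

lemma trig_polys_power [intro]: "F \<in> trig_polys \<Longrightarrow> (\<lambda>\<xi>. F \<xi> ^ n) \<in> trig_polys"
  by (induction n) auto

lemma trig_polys_cnj [intro]: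
  assumes "F \<in> trig_polys" shows "(\<lambda>\<xi>. cnj (F \<xi>)) \<in> trig_polys"
proof -
  obtain u where uv: "u \<in> l0" "F = fseries u"
    using assms by (auto simp: trig_polys_def)
  have "(\<lambda>\<xi>. \<Sum>k | u k \<noteq> 0. cnj (u k) * chr (- k) \<xi>) \<in> trig_polys"
    by (intro trig_polys_sum trig_polys_chr)
  also have "(\<lambda>\<xi>. \<Sum>k | u k \<noteq> 0. cnj (u k) * chr (- k) \<xi>) = (\<lambda>\<xi>. cnj (F \<xi>))"
    by (simp add: uv fseries_chr chr_minus)
  finally show ?thesis .
qed

lemma trig_polys_actT [intro]:
  assumes "F \<in> trig_polys" shows "(\<lambda>\<xi>. F (actT M \<xi>)) \<in> trig_polys"
proof -
  obtain u where uv: "u \<in> l0" "F = fseries u"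
    using assms by (auto simp: trig_polys_def)
  have "(\<lambda>\<xi>. \<Sum>k | u k \<noteq> 0. u k * chr (M *v k) \<xi>) \<in> trig_polys"
    by (intro trig_polys_sum trig_polys_chr)
  also have "(\<lambda>\<xi>. \<Sum>k | u k \<noteq> 0. u k * chr (M *v k) \<xi>) = (\<lambda>\<xi>. F (actT M \<xi>))"
    by (simp add: uv fseries_chr chr_actT)
  finally show ?thesis .
qed

lemma trig_polys_actT_pow [intro]:
  assumes "F \<in> trig_polys" shows "(\<lambda>\<xi>. F ((actT M ^^ n) \<xi>)) \<in> trig_polys"
  using assms
proof (induction n arbitrary: F)
  case (Suc n)
  from Suc.IH[OF trig_polys_actT[OF Suc.prems]] show ?case by simp
qed auto

section \<open>Convolution and reflection\<close>

lemma conv_superset: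
  assumes "finite S" "\<And>j. j \<notin> S \<Longrightarrow> u j = 0"
  shows "conv u v k = (\<Sum>j\<in>S. u j * v (k - j))"
  unfolding conv_def
  by (rule sum.mono_neutral_left) (use assms in auto)

text \<open>The weight \<open>g\<close> is arbitrary because two instances are needed: a character
  gives the Fourier series of a convolution, a polynomial gives its moments.\<close>

lemma conv_sum:
  assumes "u \<in> l0" "v \<in> l0"
  shows "conv u v \<in> l0 \<and> (\<Sum>k | conv u v k \<noteq> 0. conv u v k * g k) =
    (\<Sum>j | u j \<noteq> 0. \<Sum>l | v l \<noteq> 0. u j * v l * g (j + l))"
proof -
  let ?S = "(\<lambda>(k, l). k + l) ` ({k. u k \<noteq> 0} \<times> {k. v k \<noteq> 0})"
  have S: "finite ?S" using assms by (auto simp: l0_def)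
  have z: "conv u v k = 0" if "k \<notin> ?S" for k
    unfolding conv_def
  proof (intro sum.neutral ballI)
    fix j assume "j \<in> {k. u k \<noteq> 0}"
    then have "v (k - j) = 0" using that by (force simp: image_iff)
    then show "u j * v (k - j) = 0" by simp
  qed
  have "(\<Sum>k | conv u v k \<noteq> 0. conv u v k * g k) = (\<Sum>k\<in>?S. conv u v k * g k)"
    by (rule sum.mono_neutral_left[OF S]) (use z in auto)
  also have "\<dots> = (\<Sum>k\<in>?S. \<Sum>j | u j \<noteq> 0. u j * v (k - j) * g k)"
    by (simp add: conv_def sum_distrib_right)
  also have "\<dots> = (\<Sum>j | u j \<noteq> 0. \<Sum>k\<in>?S. u j * v (k - j) * g k)"
    by (rule sum.swap)
  also have "\<dots> = (\<Sum>j | u j \<noteq> 0. \<Sum>l | v l \<noteq> 0. u j * v l * g (j + l))"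
  proof (rule sum.cong[OF refl])
    fix j assume j: "j \<in> {j. u j \<noteq> 0}"
    have "(\<Sum>k\<in>?S. u j * v (k - j) * g k) = (\<Sum>k\<in>(\<lambda>l. j + l) ` {l. v l \<noteq> 0}. u j * v (k - j) * g k)"
    proof (rule sum.mono_neutral_right[OF S])
      show "(\<lambda>l. j + l) ` {l. v l \<noteq> 0} \<subseteq> ?S" using j by auto
      show "\<forall>i\<in>?S - (\<lambda>l. j + l) ` {l. v l \<noteq> 0}. u j * v (i - j) * g i = 0"
      proof
        fix i assume "i \<in> ?S - (\<lambda>l. j + l) ` {l. v l \<noteq> 0}"
        then have "v (i - j) = 0" by (auto simp: image_iff)
        then show "u j * v (i - j) * g i = 0" by simp
      qed
    qed
    also have "\<dots> = (\<Sum>l | v l \<noteq> 0. u j * v l * g (j + l))"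
      by (subst sum.reindex) (auto simp: inj_on_def)
    finally show "(\<Sum>k\<in>?S. u j * v (k - j) * g k) = (\<Sum>l | v l \<noteq> 0. u j * v l * g (j + l))" .
  qed
  finally have "(\<Sum>k | conv u v k \<noteq> 0. conv u v k * g k) =
    (\<Sum>j | u j \<noteq> 0. \<Sum>l | v l \<noteq> 0. u j * v l * g (j + l))" .
  moreover have "conv u v \<in> l0" using S z by (rule l0I)
  ultimately show ?thesis by simp
qed

lemmas conv_l0 [intro] = conv_sum[THEN conjunct1]

lemma fseries_conv:
  assumes "u \<in> l0" "v \<in> l0"
  shows "fseries (conv u v) \<xi> = fseries u \<xi> * fseries v \<xi>"
  unfolding fseries_chr conv_sum[OF assms, of "\<lambda>k. chr k \<xi>", THEN conjunct2]
  by (simp add: sum_product chr_add mult_ac)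

text \<open>The filter of the conjugate Fourier series; \<open>conv u (flip u)\<close> is the
  autocorrelation of \<open>u\<close>, with series \<open>|u^|^2\<close>.\<close>

definition flip :: "('n::finite) filt \<Rightarrow> 'n filt" where
  "flip u k = cnj (u (- k))"

lemma flip_sum: "(\<Sum>k | flip u k \<noteq> 0. flip u k * g k) = (\<Sum>k | u k \<noteq> 0. cnj (u k) * g (- k))"
proof -
  have "{k. flip u k \<noteq> 0} = uminus ` {k. u k \<noteq> 0}"
    by (auto simp: flip_def image_iff) (metis minus_minus)
  then show ?thesis by (simp add: sum.reindex flip_def)
qed

lemma flip_l0 [intro]: "u \<in> l0 \<Longrightarrow> flip u \<in> l0"
  by (rule l0I[of "uminus ` {k. u k \<noteq> 0}"]) (simp add: l0_def, force simp: flip_def image_iff)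

lemma fseries_flip: "fseries (flip u) \<xi> = cnj (fseries u \<xi>)"
  unfolding fseries_chr flip_sum by (simp add: chr_minus)

lemma conv_assoc:
  assumes "u \<in> l0" "v \<in> l0" "w \<in> l0"
  shows "conv (conv u v) w = conv u (conv v w)"
  by (rule fseries_inject) (use assms in \<open>auto simp: fseries_conv conv_l0\<close>)

lemma conv_commute:
  assumes "u \<in> l0" "v \<in> l0"
  shows "conv u v = conv v u"
  by (rule fseries_inject) (use assms in \<open>auto simp: fseries_conv\<close>)

section \<open>Cosets of the lattice and orthogonality of characters\<close>

lemma of_int_det:
  fixes A :: "int ^ 'n ^ 'n"
  shows "of_int (det A) = (det (\<chi> i j. of_int (A $ i $ j)) :: 'a::comm_ring_1)"
  unfolding det_def by simp

definition floor_vec :: "real ^ 'n \<Rightarrow> int ^ 'n" where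
  "floor_vec x = (\<chi> i. \<lfloor>x $ i\<rfloor>)"

lemma floor_vec_cube: "x - rvec (floor_vec x) \<in> unit_cube"
  by (simp add: unit_cube_def floor_vec_def rvec_def) linarith

lemma floor_vec_unique:
  assumes "x - rvec k \<in> unit_cube" shows "floor_vec x = k"
  using assms unfolding unit_cube_def floor_vec_def rvec_def vec_eq_iff
  by (auto intro!: floor_unique) (smt (verit))+

lemma bounded_unit_cube: "bounded (unit_cube :: (real ^ 'n) set)"
proof -
  have "unit_cube \<subseteq> (cbox 0 (\<chi> i. 1) :: (real ^ 'n) set)"
    by (auto simp: unit_cube_def mem_box_cart less_imp_le)
  then show ?thesis using bounded_cbox bounded_subset by blast
qed

lemma bounded_act_image: "bounded S \<Longrightarrow> bounded (act M ` S)"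
  unfolding act_def by (intro bounded_linear_image) (auto simp: linear_linear matrix_vector_mul_linear)

lemma bounded_actT_image: "bounded S \<Longrightarrow> bounded (actT M ` S)"
  unfolding actT_def by (intro bounded_linear_image) (auto simp: linear_linear matrix_vector_mul_linear)

lemma matrix_inv_inverse:
  assumes "invertible A" shows "A ** matrix_inv A = mat 1 \<and> matrix_inv A ** A = mat 1"
  using assms unfolding invertible_def matrix_inv_def by (rule someI_ex)

text \<open>The cardinality of \<open>Gamma_set M\<close> is read off the enumeration given in the
  theorem. It is the link between the determinant and the index of the lattice, on which character
  sums and the change of variables rest.\<close>

locale expanding =
  fixes M :: "int ^ 'n ^ 'n"
  assumes dilation: "dilation_matrix M"
    and card_Gamma: "card (Gamma_set M) = dM M"
begin

lemma det_nz: "det M \<noteq> 0"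
proof
  assume "det M = 0"
  let ?C = "\<chi> i j. complex_of_int (M $ i $ j)"
  have "det ?C = 0" using of_int_det[of M, where 'a = complex] \<open>det M = 0\<close> by simp
  then have "\<not> invertible ?C" by (simp add: invertible_det_nz)
  then have "\<not> (\<exists>B. B ** ?C = mat 1)" by (simp add: invertible_left_inverse)
  then obtain v where "?C *v v = 0" "v \<noteq> 0" by (auto simp: matrix_left_invertible_ker)
  then have "0 \<in> eigenvals M" unfolding eigenvals_def by auto
  then show False using dilation by (auto simp: dilation_matrix_def)
qed

lemma dM_pos: "dM M > 0"
  using det_nz by (simp add: dM_def)

lemma det_rmat: "\<bar>det (rmat M)\<bar> = real (dM M)"
  using of_int_det[of M, where 'a = real] by (simp add: rmat_def dM_def flip: of_int_abs)

lemma invertible_rmat: "invertible (rmat M)"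
  using det_rmat dM_pos by (auto simp: invertible_det_nz)

lemma matrix_inv_rmat:
  "matrix_inv (rmat M) ** rmat M = mat 1" "rmat M ** matrix_inv (rmat M) = mat 1"
  "matrix_inv (transpose (rmat M)) ** transpose (rmat M) = mat 1"
  "transpose (rmat M) ** matrix_inv (transpose (rmat M)) = mat 1"
  using matrix_inv_inverse[OF invertible_rmat] matrix_inv_inverse[OF transpose_invertible[OF invertible_rmat]]
  by auto

definition ainv :: "real ^ 'n \<Rightarrow> real ^ 'n" where
  "ainv x = matrix_inv (rmat M) *v x"

lemma act_ainv [simp]: "act M (ainv x) = x"
  by (simp add: act_def ainv_def matrix_vector_mul_assoc matrix_inv_rmat)

lemma ainv_act [simp]: "ainv (act M x) = x"
  by (simp add: act_def ainv_def matrix_vector_mul_assoc matrix_inv_rmat)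

lemma actT_invT [simp]: "actT M (act_invT M x) = x"
  by (simp add: actT_def act_invT_def matrix_vector_mul_assoc matrix_inv_rmat del: transpose_matrix_vector)

lemma invT_actT [simp]: "act_invT M (actT M x) = x"
  by (simp add: actT_def act_invT_def matrix_vector_mul_assoc matrix_inv_rmat del: transpose_matrix_vector)

lemma act_diff: "act M (x - y) = act M x - act M y"
  by (simp add: act_def matrix_vector_mult_diff_distrib)

lemma ainv_diff: "ainv (x - y) = ainv x - ainv y"
  by (simp add: ainv_def matrix_vector_mult_diff_distrib)

lemma act_add: "act M (x + y) = act M x + act M y"
  by (simp add: act_def matrix_vector_right_distrib)

lemma ainv_add: "ainv (x + y) = ainv x + ainv y"
  by (simp add: ainv_def matrix_vector_right_distrib)

lemma act_rvec: "act M (rvec k) = rvec (M *v k)"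
  by (simp add: act_def rvec_mult)

lemma ainv_rvec [simp]: "ainv (rvec (M *v k)) = rvec k"
  by (simp flip: act_rvec)

lemma inner_act_invT: "x \<bullet> act_invT M y = ainv x \<bullet> y"
proof -
  have "x \<bullet> act_invT M y = act M (ainv x) \<bullet> act_invT M y" by simp
  also have "\<dots> = ainv x \<bullet> actT M (act_invT M y)"
    unfolding act_def actT_def inner_transpose_mult ..
  finally show ?thesis by simp
qed

lemma actT_add: "actT M (x + y) = actT M x + actT M y"
  by (simp add: actT_def matrix_vector_right_distrib)

lemma actT_scale: "actT M (c *\<^sub>R x) = c *\<^sub>R actT M x"
  by (simp add: actT_def matrix_vector_mult_scaleR)

lemma mult_inj: "M *v j = M *v k \<Longrightarrow> j = k"
  by (metis ainv_rvec rvec_inject)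

lemma mult_inj_iff [simp]: "M *v j = M *v k \<longleftrightarrow> j = k"
  using mult_inj by blast

text \<open>Division with remainder by \<open>M\<close>: \<open>cquo\<close> is the quotient and
  \<open>crep\<close> the remainder, which lies in \<open>Gamma_set M\<close>. Membership in a
  common coset is always expressed as \<open>crep k = crep l\<close>.\<close>

definition cquo :: "int ^ 'n \<Rightarrow> int ^ 'n" where
  "cquo k = floor_vec (ainv (rvec k))"

definition crep :: "int ^ 'n \<Rightarrow> int ^ 'n" where
  "crep k = k - M *v cquo k"

lemma crep_cquo: "crep k + M *v cquo k = k"
  by (simp add: crep_def)

lemma Gamma_iff: "k \<in> Gamma_set M \<longleftrightarrow> ainv (rvec k) \<in> unit_cube"
  unfolding Gamma_set_def by (auto intro: image_eqI[of _ _ "ainv (rvec k)"])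

lemma crep_Gamma: "crep k \<in> Gamma_set M"
  using floor_vec_cube[of "ainv (rvec k)"] by (simp add: Gamma_iff crep_def cquo_def rvec_diff ainv_diff)

lemma cquo_Gamma: "\<gamma> \<in> Gamma_set M \<Longrightarrow> cquo (\<gamma> + M *v j) = j"
  unfolding cquo_def by (rule floor_vec_unique) (simp add: Gamma_iff rvec_add ainv_add)

lemma crep_Gamma_add: "\<gamma> \<in> Gamma_set M \<Longrightarrow> crep (\<gamma> + M *v j) = \<gamma>"
  by (simp add: crep_def cquo_Gamma)

lemma zero_Gamma [simp]: "0 \<in> Gamma_set M"
  by (simp add: Gamma_iff ainv_def unit_cube_def)

lemma crep_mult [simp]: "crep (M *v j) = 0" "cquo (M *v j) = j"
  using crep_Gamma_add[OF zero_Gamma, of j] cquo_Gamma[OF zero_Gamma, of j] by simp_all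

lemma crep_0 [simp]: "crep 0 = 0" "cquo 0 = 0"
  using crep_mult[of 0] by simp_all

lemma matrix_vector_mult_add_int: "M *v (j + k) = M *v j + M *v k"
  by (simp add: matrix_vector_right_distrib)

lemma matrix_vector_mult_diff_int: "M *v (j - k) = M *v j - M *v k"
  by (metis add_diff_cancel_right' diff_add_cancel matrix_vector_mult_add_int)

lemma crep_eq_0_iff: "crep k = 0 \<longleftrightarrow> (\<exists>j. k = M *v j)"
  by (metis crep_cquo crep_mult(1) add_0)

lemma crep_add_mult [simp]: "crep (k + M *v j) = crep k"
  by (metis crep_cquo crep_Gamma_add crep_Gamma add.assoc matrix_vector_mult_add_int)

lemma crep_diff_eq_0: "crep (k - l) = 0 \<longleftrightarrow> crep k = crep l"
proof
  assume "crep (k - l) = 0"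
  then obtain j where "k - l = M *v j" by (auto simp: crep_eq_0_iff)
  then have "k = l + M *v j" by (simp add: algebra_simps)
  then show "crep k = crep l" by simp
next
  assume "crep k = crep l"
  then have "k - l = M *v (cquo k - cquo l)"
    unfolding crep_def by (simp add: matrix_vector_mult_diff_int algebra_simps)
  then show "crep (k - l) = 0" by (simp add: crep_eq_0_iff)
qed

lemma finite_Gamma [simp]: "finite (Gamma_set M)"
proof (rule finite_int_vec_bounded)
  have "rvec ` Gamma_set M \<subseteq> act M ` unit_cube" by (auto simp: Gamma_set_def)
  then show "bounded (rvec ` Gamma_set M)"
    using bounded_act_image[OF bounded_unit_cube] bounded_subset by blast
qed

lemma Omega_iff: "\<omega> \<in> Omega M \<longleftrightarrow> \<omega> \<in> unit_cube \<and> (\<exists>k. actT M \<omega> = rvec k)"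
  unfolding Omega_def by (auto intro: image_eqI[of _ _ "_"]) (metis invT_actT rangeI)

lemma zero_Omega [simp]: "0 \<in> Omega M"
  by (simp add: Omega_iff unit_cube_def actT_def exI[of _ 0])

lemma finite_Omega [simp]: "finite (Omega M)"
proof -
  let ?K = "{k. rvec k \<in> actT M ` unit_cube}"
  have "finite ?K"
  proof (rule finite_int_vec_bounded)
    have "rvec ` ?K \<subseteq> actT M ` unit_cube" by auto
    then show "bounded (rvec ` ?K)"
      using bounded_actT_image[OF bounded_unit_cube] bounded_subset by blast
  qed
  moreover have "Omega M \<subseteq> (\<lambda>k. act_invT M (rvec k)) ` ?K"
  proof
    fix \<omega> assume "\<omega> \<in> Omega M"
    then obtain k where "\<omega> \<in> unit_cube" "actT M \<omega> = rvec k" by (auto simp: Omega_iff)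
    then show "\<omega> \<in> (\<lambda>k. act_invT M (rvec k)) ` ?K"
      by (intro image_eqI[of _ _ k]) (auto, metis invT_actT, metis imageI)
  qed
  ultimately show ?thesis using finite_surj by blast
qed

lemma chr_Omega_mult:
  assumes "\<omega> \<in> Omega M" shows "ochr (M *v j) \<omega> = 1"
proof -
  obtain k where "actT M \<omega> = rvec k" using assms by (auto simp: Omega_iff)
  then show ?thesis by (simp add: actT_scale chr_2pi_rvec flip: chr_actT)
qed

lemma chr_Omega_crep:
  assumes "\<omega> \<in> Omega M" shows "ochr (crep k) \<omega> = ochr k \<omega>"
proof -
  have "ochr k \<omega> = ochr (crep k + M *v cquo k) \<omega>"
    by (simp only: crep_cquo)
  then show ?thesis by (simp add: chr_add chr_Omega_mult[OF assms])
qed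

lemma fseries_actT_Omega:
  assumes "\<omega> \<in> Omega M"
  shows "fseries u (actT M (\<xi> + (2 * pi) *\<^sub>R \<omega>)) = fseries u (actT M \<xi>)"
  by (simp add: fseries_chr chr_actT chr_plus chr_Omega_mult[OF assms])

lemma exp_eq_1_unit:
  assumes "0 \<le> t" "t < 1" "exp (- (\<i> * of_real (2 * pi * t))) = 1"
  shows "t = 0"
proof -
  obtain n :: int where "Im (- (\<i> * of_real (2 * pi * t))) = of_int (2 * n) * pi"
    using assms(3) exp_eq_1 by blast
  then have "- (2 * pi * t) = 2 * real_of_int n * pi" by simp
  then have "pi * (t + real_of_int n) = 0" by (simp add: algebra_simps)
  then have "t = real_of_int (- n)" by simp
  then show ?thesis using assms(1,2) by simp
qed

text \<open>For \<omega> \<noteq> 0 some unit vector \<open>e\<close> has a character value other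
  than 1. Adding \<open>e\<close> permutes the representatives modulo \<open>M\<close>, so the sum
  equals itself times that value and must vanish.\<close>

lemma chr_sum_Gamma:
  assumes \<omega>: "\<omega> \<in> Omega M"
  shows "(\<Sum>\<gamma>\<in>Gamma_set M. ochr \<gamma> \<omega>) = (if \<omega> = 0 then of_nat (dM M) else 0)"
proof (cases "\<omega> = 0")
  case False
  let ?f = "\<lambda>k. ochr k \<omega>"
  obtain i where i: "\<omega> $ i \<noteq> 0" using False by (auto simp: vec_eq_iff)
  define e where "e = (axis i 1 :: int ^ 'n)"
  have e: "?f e \<noteq> 1"
    using \<omega> i exp_eq_1_unit[of "\<omega> $ i"]
    by (auto simp: e_def chr_axis Omega_iff unit_cube_def mult.assoc)
  have inj: "inj_on (\<lambda>\<gamma>. crep (\<gamma> + e)) (Gamma_set M)"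
  proof
    fix x y assume xy: "x \<in> Gamma_set M" "y \<in> Gamma_set M" "crep (x + e) = crep (y + e)"
    then have "crep (x - y) = 0" using crep_diff_eq_0[of "x + e" "y + e"] by simp
    then have "crep x = crep y" by (simp add: crep_diff_eq_0)
    then show "x = y" using crep_Gamma_add[OF xy(1), of 0] crep_Gamma_add[OF xy(2), of 0] by simp
  qed
  have img: "(\<lambda>\<gamma>. crep (\<gamma> + e)) ` Gamma_set M = Gamma_set M"
    by (rule endo_inj_surj[OF finite_Gamma _ inj]) (auto simp: crep_Gamma)
  have "sum ?f (Gamma_set M) = sum ?f ((\<lambda>\<gamma>. crep (\<gamma> + e)) ` Gamma_set M)"
    by (simp only: img)
  also have "\<dots> = (\<Sum>\<gamma>\<in>Gamma_set M. ?f (crep (\<gamma> + e)))"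
    using inj by (subst sum.reindex) auto
  also have "\<dots> = ?f e * sum ?f (Gamma_set M)"
    unfolding chr_Omega_crep[OF \<omega>] chr_add by (simp add: sum_distrib_left mult.commute)
  finally have "(1 - ?f e) * sum ?f (Gamma_set M) = 0" by (simp add: algebra_simps)
  then show ?thesis using e False by auto
qed (simp add: card_Gamma)

definition frac_vec :: "real ^ 'n \<Rightarrow> real ^ 'n" where
  "frac_vec x = x - rvec (floor_vec x)"

lemma chr_frac_vec: "chr k ((2 * pi) *\<^sub>R frac_vec x) = chr k ((2 * pi) *\<^sub>R x)"
proof -
  have "(2 * pi) *\<^sub>R x = (2 * pi) *\<^sub>R frac_vec x + (2 * pi) *\<^sub>R rvec (floor_vec x)"
    by (simp add: frac_vec_def algebra_simps)
  then show ?thesis by (simp add: chr_plus chr_2pi_rvec)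
qed

lemma actT_rvec_int: "\<exists>l. actT M (rvec k) = rvec l"
proof -
  have "actT M (rvec k) = rvec (transpose M *v k)"
    by (simp add: actT_def rmat_def transpose_def rvec_def matrix_vector_mult_def vec_eq_iff)
  then show ?thesis by blast
qed

lemma frac_vec_Omega:
  assumes "actT M x = rvec k" shows "frac_vec x \<in> Omega M"
proof -
  obtain l where "actT M (rvec (floor_vec x)) = rvec l" using actT_rvec_int by blast
  moreover have "actT M x = actT M (frac_vec x) + actT M (rvec (floor_vec x))"
    by (simp add: frac_vec_def flip: actT_add)
  ultimately have "actT M (frac_vec x) = rvec (k - l)" using assms by (simp add: rvec_diff)
  then show ?thesis using floor_vec_cube[of x] by (auto simp: Omega_iff frac_vec_def)
qed

text \<open>The argument of \<open>chr_sum_Gamma\<close> on the dual side: translation by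
  \<open>\<omega>0\<close>, a column of the inverse transpose, permutes \<open>Omega M\<close>
  modulo integers and multiplies the sum by a value other than 1.\<close>

lemma chr_sum_Omega_aux:
  assumes "crep k \<noteq> 0"
  shows "(\<Sum>\<omega>\<in>Omega M. ochr k \<omega>) = 0"
proof -
  let ?f = "\<lambda>\<omega>. ochr k \<omega>"
  have g: "crep k \<in> Gamma_set M" by (rule crep_Gamma)
  have "ainv (rvec (crep k)) \<noteq> 0"
    using assms act_ainv[of "rvec (crep k)"] rvec_inject[of "crep k" 0] by (auto simp: act_def)
  then obtain i where i: "ainv (rvec (crep k)) $ i \<noteq> 0" by (auto simp: vec_eq_iff)
  define \<omega>0 where "\<omega>0 = act_invT M (axis i 1)"
  have int: "actT M \<omega>0 = rvec (axis i 1)" by (simp add: \<omega>0_def rvec_axis)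
  have "ochr (crep k) \<omega>0 =
      exp (- (\<i> * of_real (2 * pi * (ainv (rvec (crep k)) $ i))))"
    by (simp add: chr_def \<omega>0_def inner_act_invT inner_axis)
  moreover have "0 \<le> ainv (rvec (crep k)) $ i" "ainv (rvec (crep k)) $ i < 1"
    using g by (auto simp: Gamma_iff unit_cube_def)
  ultimately have "ochr (crep k) \<omega>0 \<noteq> 1" using exp_eq_1_unit i by metis
  moreover have "ochr (M *v cquo k) \<omega>0 = 1"
    by (simp add: actT_scale int chr_2pi_rvec flip: chr_actT)
  ultimately have ne: "?f \<omega>0 \<noteq> 1"
    using chr_add[of "crep k" "M *v cquo k" "(2 * pi) *\<^sub>R \<omega>0"] by (simp add: crep_cquo)
  let ?s = "\<lambda>\<omega>. frac_vec (\<omega> + \<omega>0)"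
  have inj: "inj_on ?s (Omega M)"
  proof
    fix x y assume xy: "x \<in> Omega M" "y \<in> Omega M" "?s x = ?s y"
    then have "x - rvec (floor_vec (x + \<omega>0) - floor_vec (y + \<omega>0)) = y"
      by (simp add: frac_vec_def rvec_diff algebra_simps)
    moreover from this have "floor_vec x = floor_vec (x + \<omega>0) - floor_vec (y + \<omega>0)"
      using xy by (intro floor_vec_unique) (simp add: Omega_iff)
    moreover have "floor_vec x = 0" using xy by (intro floor_vec_unique) (simp add: Omega_iff)
    ultimately show "x = y" by simp
  qed
  have "?s \<omega> \<in> Omega M" if \<omega>: "\<omega> \<in> Omega M" for \<omega>
  proof -
    obtain l where "actT M \<omega> = rvec l" using \<omega> by (auto simp: Omega_iff)
    then have "actT M (\<omega> + \<omega>0) = rvec (l + axis i 1)" by (simp add: actT_add int rvec_add)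
    then show ?thesis by (rule frac_vec_Omega)
  qed
  then have img: "?s ` Omega M = Omega M"
    by (intro endo_inj_surj[OF finite_Omega _ inj]) auto
  have "sum ?f (Omega M) = sum ?f (?s ` Omega M)"
    by (simp only: img)
  also have "\<dots> = (\<Sum>\<omega>\<in>Omega M. ?f (?s \<omega>))"
    using inj by (subst sum.reindex) auto
  also have "\<dots> = ?f \<omega>0 * sum ?f (Omega M)"
    unfolding chr_frac_vec scaleR_add_right chr_plus by (simp add: sum_distrib_left mult.commute)
  finally have "(1 - ?f \<omega>0) * sum ?f (Omega M) = 0" by (simp add: algebra_simps)
  then show ?thesis using ne by auto
qed

lemma chr_mult_Omega:
  "crep k = 0 \<Longrightarrow> \<omega> \<in> Omega M \<Longrightarrow> ochr k \<omega> = 1"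
  using chr_Omega_mult by (auto simp: crep_eq_0_iff)

text \<open>The double sum of characters over \<open>Omega M\<close> and \<open>Gamma_set M\<close>
  is evaluated in both orders: only \<omega> = 0 survives in one, only \<gamma> = 0 in the
  other.\<close>

lemma card_Omega: "card (Omega M) = dM M"
proof -
  have "(\<Sum>\<omega>\<in>Omega M. \<Sum>\<gamma>\<in>Gamma_set M. ochr \<gamma> \<omega>) = of_nat (dM M)"
    by (simp add: chr_sum_Gamma sum.delta)
  also have "(\<Sum>\<omega>\<in>Omega M. \<Sum>\<gamma>\<in>Gamma_set M. ochr \<gamma> \<omega>) =
    (\<Sum>\<gamma>\<in>Gamma_set M. \<Sum>\<omega>\<in>Omega M. ochr \<gamma> \<omega>)"
    by (rule sum.swap)
  also have "\<dots> = (\<Sum>\<gamma>\<in>Gamma_set M. if \<gamma> = 0 then of_nat (card (Omega M)) else 0)"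
  proof (intro sum.cong refl)
    fix \<gamma> assume g: "\<gamma> \<in> Gamma_set M"
    then have "crep \<gamma> = \<gamma>" using crep_Gamma_add[of \<gamma> 0] by simp
    then show "(\<Sum>\<omega>\<in>Omega M. ochr \<gamma> \<omega>) = (if \<gamma> = 0 then of_nat (card (Omega M)) else 0)"
      using chr_sum_Omega_aux[of \<gamma>] by auto
  qed
  also have "\<dots> = of_nat (card (Omega M))" by (simp add: sum.delta)
  finally show ?thesis by simp
qed

lemma chr_sum_Omega:
  "(\<Sum>\<omega>\<in>Omega M. ochr k \<omega>) = (if crep k = 0 then of_nat (dM M) else 0)"
  using chr_sum_Omega_aux[of k] chr_mult_Omega[of k] card_Omega by auto

text \<open>Places \<open>u\<close> on the coset of \<gamma>, with 0 elsewhere. It is inverse to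
  \<open>coset_filter\<close> on that coset and realizes the filters \<open>b_extra\<close>.\<close>

definition upsample :: "int ^ 'n \<Rightarrow> 'n filt \<Rightarrow> 'n filt" where
  "upsample \<gamma> u k = (if crep (k - \<gamma>) = 0 then u (cquo (k - \<gamma>)) else 0)"

lemma upsample_simps [simp]: "upsample \<gamma> u (\<gamma> + M *v j) = u j"
  by (simp add: upsample_def)

lemma upsample_sum:
  assumes "u \<in> l0"
  shows "upsample \<gamma> u \<in> l0 \<and> {k. upsample \<gamma> u k \<noteq> 0} = (\<lambda>j. \<gamma> + M *v j) ` {j. u j \<noteq> 0}
    \<and> (\<Sum>k | upsample \<gamma> u k \<noteq> 0. upsample \<gamma> u k * g k) = (\<Sum>j | u j \<noteq> 0. u j * g (\<gamma> + M *v j))"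
proof -
  have eq: "{k. upsample \<gamma> u k \<noteq> 0} = (\<lambda>j. \<gamma> + M *v j) ` {j. u j \<noteq> 0}"
  proof safe
    fix k assume k: "upsample \<gamma> u k \<noteq> 0"
    then have "crep (k - \<gamma>) = 0" by (auto simp: upsample_def split: if_splits)
    then obtain j where j: "k - \<gamma> = M *v j" by (auto simp: crep_eq_0_iff)
    then have "k = \<gamma> + M *v j" by (simp add: algebra_simps)
    then show "k \<in> (\<lambda>j. \<gamma> + M *v j) ` {j. u j \<noteq> 0}" using k by auto
  qed simp
  have "inj_on (\<lambda>j. \<gamma> + M *v j) {j. u j \<noteq> 0}" by (auto simp: inj_on_def)
  then show ?thesis using assms unfolding eq by (simp add: l0_def eq sum.reindex)
qed

lemmas upsample_l0 [intro] = upsample_sum[THEN conjunct1]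

lemma fseries_upsample:
  assumes "u \<in> l0" shows "fseries (upsample \<gamma> u) \<xi> = chr \<gamma> \<xi> * fseries u (actT M \<xi>)"
  unfolding fseries_chr upsample_sum[OF assms, of \<gamma> "\<lambda>k. chr k \<xi>", THEN conjunct2, THEN conjunct2]
  by (simp add: chr_add chr_actT sum_distrib_left mult_ac)

lemma coset_l0 [intro]:
  assumes "u \<in> l0" shows "coset_filter u \<gamma> M \<in> l0"
proof (rule l0I[of "(\<lambda>k. cquo (k - \<gamma>)) ` {k. u k \<noteq> 0}"])
  fix k assume k: "k \<notin> (\<lambda>k. cquo (k - \<gamma>)) ` {k. u k \<noteq> 0}"
  have "k = cquo ((\<gamma> + M *v k) - \<gamma>)" by simp
  then show "coset_filter u \<gamma> M k = 0"
    using k unfolding coset_filter_def by blast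
qed (use assms in \<open>simp add: l0_def\<close>)

lemma upsample_coset:
  "upsample \<gamma> (coset_filter u \<gamma> M) k = (if crep k = crep \<gamma> then u k else 0)"
proof -
  have "crep (k - \<gamma>) = 0 \<Longrightarrow> M *v cquo (k - \<gamma>) = k - \<gamma>" using crep_cquo[of "k - \<gamma>"] by simp
  then show ?thesis by (auto simp: upsample_def coset_filter_def crep_diff_eq_0)
qed

lemma fseries_coset:
  assumes "u \<in> l0"
  shows "chr \<gamma> \<xi> * fseries (coset_filter u \<gamma> M) (actT M \<xi>) =
    (\<Sum>k | u k \<noteq> 0. if crep k = crep \<gamma> then u k * chr k \<xi> else 0)"
proof -
  have "chr \<gamma> \<xi> * fseries (coset_filter u \<gamma> M) (actT M \<xi>) =
    fseries (\<lambda>k. if crep k = crep \<gamma> then u k else 0) \<xi>"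
    using assms by (simp add: fseries_upsample[symmetric] coset_l0 upsample_coset[abs_def])
  also have "\<dots> = (\<Sum>k | u k \<noteq> 0. (if crep k = crep \<gamma> then u k else 0) * chr k \<xi>)"
    by (rule fseries_superset) (use assms in \<open>auto simp: l0_def\<close>)
  also have "\<dots> = (\<Sum>k | u k \<noteq> 0. if crep k = crep \<gamma> then u k * chr k \<xi> else 0)"
    by (intro sum.cong) auto
  finally show ?thesis .
qed

lemma crep_id: "\<gamma> \<in> Gamma_set M \<Longrightarrow> crep \<gamma> = \<gamma>"
  using crep_Gamma_add[of \<gamma> 0] by simp

lemma fseries_coset_decomp:
  assumes "u \<in> l0"
  shows "fseries u \<xi> = (\<Sum>\<gamma>\<in>Gamma_set M. chr \<gamma> \<xi> * fseries (coset_filter u \<gamma> M) (actT M \<xi>))"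
proof -
  have "(\<Sum>\<gamma>\<in>Gamma_set M. chr \<gamma> \<xi> * fseries (coset_filter u \<gamma> M) (actT M \<xi>)) =
     (\<Sum>\<gamma>\<in>Gamma_set M. \<Sum>k | u k \<noteq> 0. if crep k = \<gamma> then u k * chr k \<xi> else 0)"
    unfolding fseries_coset[OF assms] by (intro sum.cong) (auto simp: crep_id)
  also have "\<dots> = (\<Sum>k | u k \<noteq> 0. \<Sum>\<gamma>\<in>Gamma_set M. if crep k = \<gamma> then u k * chr k \<xi> else 0)"
    by (rule sum.swap)
  also have "\<dots> = fseries u \<xi>"
    unfolding fseries_chr by (intro sum.cong refl) (simp add: sum.delta crep_Gamma)
  finally show ?thesis by simp
qed

text \<open>Orthogonality in its working form: averaging over \<open>Omega M\<close> against a
  conjugate character selects one coset. It turns the sum rules into statements on cosets, and later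
  the filter bank identity into relations between coefficients.\<close>

lemma sum_Omega_coset:
  assumes "finite S"
  shows "(\<Sum>\<omega>\<in>Omega M. cnj (ochr \<gamma> \<omega>) * (\<Sum>k\<in>S. g k * ochr k \<omega>)) =
    of_nat (dM M) * (\<Sum>k\<in>S. if crep k = crep \<gamma> then g k else 0)"
proof -
  have "(\<Sum>\<omega>\<in>Omega M. cnj (ochr \<gamma> \<omega>) * (\<Sum>k\<in>S. g k * ochr k \<omega>)) =
      (\<Sum>\<omega>\<in>Omega M. \<Sum>k\<in>S. g k * ochr (k - \<gamma>) \<omega>)"
    unfolding sum_distrib_left diff_conv_add_uminus chr_add chr_minus by (simp add: mult_ac)
  also have "\<dots> = (\<Sum>k\<in>S. \<Sum>\<omega>\<in>Omega M. g k * ochr (k - \<gamma>) \<omega>)"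
    by (rule sum.swap)
  also have "\<dots> = (\<Sum>k\<in>S. g k * (if crep k = crep \<gamma> then of_nat (dM M) else 0))"
    unfolding sum_distrib_left[symmetric] chr_sum_Omega crep_diff_eq_0 ..
  finally show ?thesis by (simp add: sum_distrib_left mult_ac if_distrib cong: if_cong)
qed

end

section \<open>Derivatives of trigonometric polynomials and vanishing moments\<close>

lemma chr_has_vector_derivative:
  "((\<lambda>t. chr k (x + t *\<^sub>R axis i 1)) has_vector_derivative (- \<i> * of_int (k $ i)) * chr k x) (at 0)"
proof -
  have "((\<lambda>z. chr k x * exp (- (\<i> * of_int (k $ i)) * z)) has_field_derivative
      (- \<i> * of_int (k $ i)) * chr k x) (at (complex_of_real 0))"
    by (auto intro!: derivative_eq_intros)
  from has_vector_derivative_real_field[OF this, of UNIV]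
  show ?thesis
    by (simp add: chr_plus) (simp add: chr_def inner_axis rvec_nth mult_ac)
qed

lemma partial_deriv_trig_poly:
  assumes "finite S"
  shows "partial_deriv i (\<lambda>\<xi>. \<Sum>k\<in>S. c k * chr k \<xi>) =
    (\<lambda>\<xi>. \<Sum>k\<in>S. (c k * (- \<i> * of_int (k $ i))) * chr k \<xi>)"
proof
  fix x
  have "((\<lambda>t. \<Sum>k\<in>S. c k * chr k (x + t *\<^sub>R axis i 1)) has_vector_derivative
      (\<Sum>k\<in>S. c k * ((- \<i> * of_int (k $ i)) * chr k x))) (at 0)"
    by (intro has_vector_derivative_sum has_vector_derivative_mult_right chr_has_vector_derivative)
  from vector_derivative_at[OF this]
  show "partial_deriv i (\<lambda>\<xi>. \<Sum>k\<in>S. c k * chr k \<xi>) x =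
    (\<Sum>k\<in>S. (c k * (- \<i> * of_int (k $ i))) * chr k x)"
    unfolding partial_deriv_def by (simp only: mult.assoc)
qed

lemma foldr_partial_deriv_trig_poly:
  assumes "finite S"
  shows "foldr partial_deriv w (\<lambda>\<xi>. \<Sum>k\<in>S. c k * chr k \<xi>) =
    (\<lambda>\<xi>. \<Sum>k\<in>S. (c k * prod_list (map (\<lambda>i. - \<i> * of_int (k $ i)) w)) * chr k \<xi>)"
proof (induction w)
  case (Cons i w)
  show ?case
    unfolding foldr.simps comp_apply Cons partial_deriv_trig_poly[OF assms]
    by (intro ext sum.cong refl) (simp add: mult_ac)
qed simp

lemma prod_list_count:
  fixes f :: "'n::finite \<Rightarrow> 'a::comm_monoid_mult"
  shows "prod_list (map f w) = (\<Prod>i\<in>UNIV. f i ^ count_list w i)"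
proof (induction w)
  case (Cons x w)
  have "(\<Prod>i\<in>UNIV. f i ^ count_list (x # w) i) =
      (\<Prod>i\<in>UNIV. (if i = x then f i else 1) * f i ^ count_list w i)"
    by (intro prod.cong) auto
  also have "\<dots> = f x * (\<Prod>i\<in>UNIV. f i ^ count_list w i)"
    by (simp add: prod.distrib prod.delta)
  finally show ?case by (simp add: Cons)
qed simp

lemma count_list_replicate_eq: "count_list (replicate n x) i = (if i = x then n else 0)"
  by (induction n) auto

lemma ex_count_list:
  fixes \<mu> :: "'n::finite \<Rightarrow> nat"
  shows "\<exists>w. \<forall>i. count_list w i = \<mu> i"
proof -
  have "\<exists>w. \<forall>i. count_list w i = (if i \<in> S then \<mu> i else 0)" if "finite S" for S
    using that
  proof (induction S)
    case empty
    show ?case by (rule exI[of _ "[]"]) simp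
  next
    case (insert x S)
    then obtain w where "\<forall>i. count_list w i = (if i \<in> S then \<mu> i else 0)" by blast
    with insert.hyps show ?case
      by (intro exI[of _ "w @ replicate (\<mu> x) x"]) (auto simp: count_list_replicate_eq)
  qed
  from this[of UNIV] show ?thesis by simp
qed

text \<open>The word chosen by \<open>SOME\<close> in \<open>multi_deriv\<close> is unknown, but the
  iterated derivatives computed here multiply commuting factors, one per letter, so the letter
  counts determine the result.\<close>

lemma multi_deriv_word:
  obtains w where "\<And>i. count_list w i = \<mu> i" "\<And>f. multi_deriv \<mu> f = foldr partial_deriv w f"
  using that[of "SOME w. \<forall>i. count_list w i = \<mu> i"] someI_ex[OF ex_count_list[of \<mu>]]
  unfolding multi_deriv_def by simp

lemma multi_deriv_trig_poly:
  assumes "finite S"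
  shows "multi_deriv \<mu> (\<lambda>\<xi>. \<Sum>k\<in>S. c k * chr k \<xi>) \<xi> =
    (\<Sum>k\<in>S. c k * (\<Prod>i\<in>UNIV. (- \<i> * of_int (k $ i)) ^ \<mu> i) * chr k \<xi>)"
proof -
  obtain w where "\<And>i. count_list w i = \<mu> i" "\<And>f. multi_deriv \<mu> f = foldr partial_deriv w f"
    using multi_deriv_word[of \<mu>] by metis
  then show ?thesis by (simp add: foldr_partial_deriv_trig_poly[OF assms] prod_list_count)
qed

lemma multi_deriv_zero [simp]: "multi_deriv \<mu> (\<lambda>_. 0) \<xi> = 0"
  using multi_deriv_trig_poly[of "{}" \<mu> "\<lambda>_. 0" \<xi>] by simp

inductive polydeg :: "nat \<Rightarrow> (real ^ 'n \<Rightarrow> complex) \<Rightarrow> bool" where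
  const: "polydeg n (\<lambda>_. c)"
| add: "polydeg n p \<Longrightarrow> polydeg n q \<Longrightarrow> polydeg n (\<lambda>x. p x + q x)"
| coord: "polydeg n p \<Longrightarrow> polydeg (Suc n) (\<lambda>x. of_real (x $ i) * p x)"

lemma polydeg_mono: "polydeg n p \<Longrightarrow> n \<le> m \<Longrightarrow> polydeg m p"
proof (induction arbitrary: m rule: polydeg.induct)
  case (coord n p i)
  then obtain m' where "m = Suc m'" "n \<le> m'" by (cases m) auto
  with coord show ?case by (auto intro: polydeg.coord)
qed (auto intro: polydeg.intros)

lemma polydeg_0_const: "polydeg n p \<Longrightarrow> n = 0 \<Longrightarrow> \<exists>c. p = (\<lambda>_. c)"
  by (induction rule: polydeg.induct) (auto simp: fun_eq_iff)

lemma polydeg_scale: "polydeg n p \<Longrightarrow> polydeg n (\<lambda>x. c * p x)"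
proof (induction rule: polydeg.induct)
  case (add n p q)
  then show ?case by (simp add: distrib_left polydeg.add)
next
  case (coord n p i)
  from polydeg.coord[OF coord.IH, of i] show ?case by (simp add: mult_ac)
qed (rule polydeg.const)

lemma polydeg_mult: "polydeg n p \<Longrightarrow> polydeg m q \<Longrightarrow> polydeg (n + m) (\<lambda>x. p x * q x)"
proof (induction rule: polydeg.induct)
  case (const n c)
  then show ?case using polydeg_mono[OF polydeg_scale[of m q c], of "n + m"] by simp
next
  case (add n p q)
  then show ?case by (simp add: distrib_right polydeg.add)
next
  case (coord n p i)
  from polydeg.coord[OF coord.IH[OF coord.prems], of i] show ?case by (simp add: mult_ac)
qed

lemma polydeg_sum: "(\<And>i. i \<in> I \<Longrightarrow> polydeg n (p i)) \<Longrightarrow> polydeg n (\<lambda>x. \<Sum>i\<in>I. p i x)"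
  by (induction I rule: infinite_finite_induct) (auto intro: polydeg.intros)

lemma polydeg_prod:
  "finite I \<Longrightarrow> (\<And>i. i \<in> I \<Longrightarrow> polydeg (n i) (p i)) \<Longrightarrow> polydeg (\<Sum>i\<in>I. n i) (\<lambda>x. \<Prod>i\<in>I. p i x)"
  by (induction I rule: finite_induct) (auto intro!: polydeg_mult polydeg.const)

lemma polydeg_power: "polydeg n p \<Longrightarrow> polydeg (k * n) (\<lambda>x. p x ^ k)"
  by (induction k) (auto intro!: polydeg_mult polydeg.const)

lemma polydeg_coord: "polydeg 1 (\<lambda>x. of_real (x $ i))"
  using polydeg.coord[OF polydeg.const[of 0 1], of i] by simp

lemma polydeg_monom: "polydeg (\<Sum>i\<in>UNIV. \<mu> i) (\<lambda>x. \<Prod>i\<in>UNIV. of_real (x $ i) ^ \<mu> i)"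
  using polydeg_power[OF polydeg_coord] by (intro polydeg_prod) auto

text \<open>This closure is the reason for working with whole spaces of polynomials instead of
  monomials: dilations, translations and reflections mix monomials but never raise the
  degree.\<close>

lemma polydeg_affine:
  fixes A :: "real ^ 'n ^ 'n"
  shows "polydeg n p \<Longrightarrow> polydeg n (\<lambda>x. p (A *v x + b))"
proof (induction rule: polydeg.induct)
  case (coord n p i)
  let ?q = "\<lambda>x. p (A *v x + b)"
  have "polydeg (Suc n) (\<lambda>x. (\<Sum>j\<in>UNIV. of_real (A $ i $ j) * (of_real (x $ j) * ?q x)) + of_real (b $ i) * ?q x)"
    by (intro polydeg.add polydeg_sum polydeg_scale polydeg.coord coord.IH polydeg_mono[OF coord.IH]) auto
  also have "(\<lambda>x. (\<Sum>j\<in>UNIV. of_real (A $ i $ j) * (of_real (x $ j) * ?q x)) + of_real (b $ i) * ?q x) =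
      (\<lambda>x. of_real ((A *v x + b) $ i) * ?q x)"
  proof
    fix x
    have "complex_of_real ((A *v x + b) $ i) =
        (\<Sum>j\<in>UNIV. of_real (A $ i $ j) * of_real (x $ j)) + of_real (b $ i)"
      by (simp add: matrix_vector_mult_def)
    then show "(\<Sum>j\<in>UNIV. of_real (A $ i $ j) * (of_real (x $ j) * ?q x)) + of_real (b $ i) * ?q x =
        of_real ((A *v x + b) $ i) * ?q x"
      by (simp only: distrib_right sum_distrib_right mult.assoc)
  qed
  finally show ?case .
qed (auto intro: polydeg.intros)

lemma polydeg_shift: "polydeg n p \<Longrightarrow> polydeg n (\<lambda>x. p (x + b))"
  using polydeg_affine[of n p "mat 1" b] by simp

lemma polydeg_reflect: "polydeg n p \<Longrightarrow> polydeg n (\<lambda>x. p (b - x))"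
proof -
  assume p: "polydeg n p"
  have "(- mat 1 :: real ^ 'a ^ 'a) *v x = - x" for x
  proof -
    have "(- mat 1 :: real ^ 'a ^ 'a) $ i $ j * x $ j = (if j = i then - (x $ i) else 0)" for i j
      by (simp add: mat_def)
    then show ?thesis by (simp add: matrix_vector_mult_def vec_eq_iff)
  qed
  with polydeg_affine[OF p, of "- mat 1" b] show ?thesis by simp
qed

lemma polydeg_cnj: "polydeg n p \<Longrightarrow> polydeg n (\<lambda>x. cnj (p x))"
  by (induction rule: polydeg.induct) (auto intro: polydeg.intros)

section \<open>Discrete vanishing moments\<close>

abbreviation moment :: "('n::finite) filt \<Rightarrow> (real ^ 'n \<Rightarrow> complex) \<Rightarrow> complex" where
  "moment u p \<equiv> \<Sum>k | u k \<noteq> 0. u k * p (rvec k)"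

text \<open>The coefficient form of vanishing to order \<open>r\<close> at the origin
  (\<open>vanishes_iff_annih\<close>). It is used instead of derivatives because affine changes of
  the index preserve it.\<close>

definition annih :: "nat \<Rightarrow> ('n::finite) filt \<Rightarrow> bool" where
  "annih r u \<longleftrightarrow> (\<forall>n p. n < r \<longrightarrow> polydeg n p \<longrightarrow> moment u p = 0)"

lemma annihD: "annih r u \<Longrightarrow> polydeg n p \<Longrightarrow> n < r \<Longrightarrow> moment u p = 0"
  by (auto simp: annih_def)

lemma annih_mono: "annih r u \<Longrightarrow> s \<le> r \<Longrightarrow> annih s u"
  unfolding annih_def by (meson less_le_trans)

lemma sum_superset:
  fixes u g :: "'b \<Rightarrow> 'a::semiring_0"
  assumes "finite S" "\<And>k. k \<notin> S \<Longrightarrow> u k = 0"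
  shows "(\<Sum>k | u k \<noteq> 0. u k * g k) = (\<Sum>k\<in>S. u k * g k)"
  by (rule sum.mono_neutral_left) (use assms in auto)

lemma multi_deriv_fseries_0:
  assumes "u \<in> l0"
  shows "multi_deriv \<mu> (fseries u) 0 = (\<Prod>i\<in>UNIV. (- \<i>) ^ \<mu> i) *
    (\<Sum>k | u k \<noteq> 0. u k * (\<Prod>i\<in>UNIV. of_real (rvec k $ i) ^ \<mu> i))"
proof -
  have "multi_deriv \<mu> (fseries u) 0 = (\<Sum>k | u k \<noteq> 0. u k * (\<Prod>i\<in>UNIV. (- \<i> * of_int (k $ i)) ^ \<mu> i) * chr k 0)"
    using multi_deriv_trig_poly[OF l0_finite[OF assms], of \<mu> u 0] by (simp add: fseries_chr[abs_def])
  then show ?thesis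
    unfolding power_mult_distrib prod.distrib by (simp add: sum_distrib_left rvec_nth mult_ac)
qed

text \<open>The derivatives at 0 are the monomial moments up to powers of -i. For general
  polynomials the induction carries a monomial prefactor \<mu>, which absorbs each coordinate factor
  that \<open>polydeg\<close> peels off.\<close>

lemma vanishes_iff_annih:
  assumes "u \<in> l0"
  shows "vanishes_O (fseries u) r \<longleftrightarrow> annih r u"
proof
  assume "vanishes_O (fseries u) r"
  then have mom: "(\<Sum>k | u k \<noteq> 0. u k * (\<Prod>i\<in>UNIV. of_real (rvec k $ i) ^ \<mu> i)) = 0"
    if "(\<Sum>i\<in>UNIV. \<mu> i) < r" for \<mu>
    using that multi_deriv_fseries_0[OF assms, of \<mu>] unfolding eq_mod_O_def by simp
  have "(\<Sum>k | u k \<noteq> 0. u k * ((\<Prod>i\<in>UNIV. of_real (rvec k $ i) ^ \<mu> i) * p (rvec k))) = 0"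
    if "polydeg n p" "(\<Sum>i\<in>UNIV. \<mu> i) + n < r" for n p \<mu>
    using that
  proof (induction arbitrary: \<mu> rule: polydeg.induct)
    case (const n c)
    then show ?case using mom[of \<mu>] by (simp add: sum_distrib_right[symmetric] mult.assoc[symmetric])
  next
    case (add n p q)
    then show ?case by (simp add: distrib_left sum.distrib)
  next
    case (coord n p j)
    let ?\<nu> = "\<mu>(j := Suc (\<mu> j))"
    have "(\<Sum>i\<in>UNIV. ?\<nu> i) = (\<Sum>i\<in>UNIV. \<mu> i + (if i = j then 1 else 0))"
      by (intro sum.cong) auto
    then have "(\<Sum>i\<in>UNIV. ?\<nu> i) + n < r"
      using coord.prems by (simp add: sum.distrib)
    from coord.IH[OF this] have *: "(\<Sum>k | u k \<noteq> 0. u k * ((\<Prod>i\<in>UNIV. of_real (rvec k $ i) ^ ?\<nu> i) * p (rvec k))) = 0" .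
    have "(\<Prod>i\<in>UNIV. of_real (rvec k $ i) ^ ?\<nu> i) =
        (\<Prod>i\<in>UNIV. of_real (rvec k $ i) ^ \<mu> i) * (of_real (rvec k $ j) :: complex)" for k
    proof -
      have "(\<Prod>i\<in>UNIV. of_real (rvec k $ i) ^ ?\<nu> i) =
        (\<Prod>i\<in>UNIV. of_real (rvec k $ i) ^ \<mu> i * (if i = j then of_real (rvec k $ j) else 1 :: complex))"
        by (intro prod.cong) auto
      then show ?thesis by (simp add: prod.distrib)
    qed
    with * show ?case by (simp only: mult.assoc)
  qed
  from this[where \<mu> = "\<lambda>_. 0"] show "annih r u" unfolding annih_def by auto
next
  assume an: "annih r u"
  show "vanishes_O (fseries u) r"
    unfolding eq_mod_O_def
  proof (intro allI impI)
    fix \<mu> :: "'a \<Rightarrow> nat" assume "(\<Sum>i\<in>UNIV. \<mu> i) < r"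
    from annihD[OF an polydeg_monom this]
    have *: "(\<Sum>k | u k \<noteq> 0. u k * (\<Prod>i\<in>UNIV. of_real (rvec k $ i) ^ \<mu> i)) = 0" .
    then show "multi_deriv \<mu> (fseries u) 0 = multi_deriv \<mu> (\<lambda>_. 0) 0" by (simp add: multi_deriv_fseries_0[OF assms])
  qed
qed

lemma vm_filter_ge:
  assumes "u \<in> l0" "annih r u" shows "vm_filter u \<ge> enat r"
  unfolding vm_filter_def using assms by (intro Sup_upper) (auto simp: vanishes_iff_annih)

text \<open>A finite supremum of a nonempty set of extended naturals is a maximum;
  \<open>n > 0\<close> excludes the empty set, whose supremum is 0.\<close>

lemma Sup_enat_attained:
  assumes "Sup A = enat n" "n > 0" shows "enat n \<in> A"
proof -
  have "A \<noteq> {}" "finite A" using assms by (auto simp: Sup_enat_def zero_enat_def split: if_splits)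
  then show ?thesis using assms Max_in[of A] by (simp add: Sup_enat_def)
qed

text \<open>Up to degree \<open>r - 1\<close> both sequences act on polynomials as multiples of
  evaluation at 0, and the constants are chosen to cancel. Applied to the coset filters and to
  \<open>h_filter\<close>.\<close>

lemma annih_delta_diff:
  fixes v :: "('n::finite) filt"
  assumes v: "v \<in> l0" "\<And>n p. n < r \<Longrightarrow> polydeg n p \<Longrightarrow> moment v p = z * p 0"
    and c: "c1 = c2 * z"
  shows "annih r (\<lambda>k. c1 * delta k - c2 * v k)"
  unfolding annih_def
proof (intro allI impI)
  fix n and p :: "real ^ 'n \<Rightarrow> complex" assume n: "n < r" and p: "polydeg n p"
  let ?S = "insert 0 {k. v k \<noteq> 0}" and ?w = "\<lambda>k. c1 * delta k - c2 * v k"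
  have S: "finite ?S" using l0_finite[OF v(1)] by simp
  have "moment ?w p = (\<Sum>k\<in>?S. ?w k * p (rvec k))"
    by (rule sum_superset[OF S]) (auto simp: delta_def)
  also have "\<dots> = (\<Sum>k\<in>?S. if k = 0 then c1 * p 0 else 0) - c2 * (\<Sum>k\<in>?S. v k * p (rvec k))"
    unfolding left_diff_distrib sum_subtractf sum_distrib_left mult.assoc
    by (intro arg_cong2[where f = minus] sum.cong) (auto simp: delta_def)
  also have "(\<Sum>k\<in>?S. v k * p (rvec k)) = z * p 0"
    using v(2)[OF n p] sum_superset[OF S, of v "\<lambda>k. p (rvec k)"] by auto
  finally show "moment ?w p = 0" using S by (simp add: c)
qed

section \<open>Sum rules of an interpolatory filter\<close>

locale interp_filter = expanding M for M :: "int ^ 'n ^ 'n" +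
  fixes a :: "'n filt" and m :: nat
  assumes a_l0: "a \<in> l0" and interp: "interpolatory M a" and a_hat_0: "fseries a 0 = 1"
    and m_pos: "m \<ge> 1" and sr: "sr a M = enat (2 * m)"
begin

lemma a_mult: "a (M *v k) = (if k = 0 then 1 / of_nat (dM M) else 0)"
  using interp by (simp add: interpolatory_def delta_def)

text \<open>The supremum \<open>sr\<close> is attained, so order 2 m holds at every nonzero
  \<omega>. Modulating \<open>a\<close> by the character of \<omega> carries that frequency to the
  origin, where vanishing is a moment condition.\<close>

lemma sum_rules:
  assumes "\<omega> \<in> Omega M" "\<omega> \<noteq> 0" "polydeg n p" "n < 2 * m"
  shows "(\<Sum>k | a k \<noteq> 0. a k * p (rvec k) * ochr k \<omega>) = 0"
proof -
  have "enat (2 * m) \<in> {enat m |m. \<forall>\<omega> \<in> Omega M - {0}. vanishes_O (\<lambda>\<xi>. fseries a (\<xi> + (2 * pi) *\<^sub>R \<omega>)) m}"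
    using sr m_pos unfolding sr_def by (intro Sup_enat_attained) auto
  then have "vanishes_O (\<lambda>\<xi>. fseries a (\<xi> + (2 * pi) *\<^sub>R \<omega>)) (2 * m)" using assms by auto
  also have "(\<lambda>\<xi>. fseries a (\<xi> + (2 * pi) *\<^sub>R \<omega>)) = fseries (\<lambda>k. a k * ochr k \<omega>)"
    by (intro ext) (simp add: fseries_chr chr_plus mult_ac)
  finally have "annih (2 * m) (\<lambda>k. a k * ochr k \<omega>)"
    using a_l0 by (subst (asm) vanishes_iff_annih) auto
  from annihD[OF this assms(3,4)] show ?thesis by (simp add: mult_ac)
qed

text \<open>In the average over \<open>Omega M\<close> only \<omega> = 0 survives the sum rules, so
  all cosets carry the same share of a moment. On the coset of 0 interpolation leaves the single
  coefficient \<open>a 0\<close>, which fixes the share and hence the total.\<close>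

lemma coset_moment:
  assumes "polydeg n p" "n < 2 * m"
  shows "(\<Sum>k | a k \<noteq> 0. if crep k = crep \<gamma> then a k * p (rvec k) else 0) = p 0 / of_nat (dM M)"
    and total_moment: "moment a p = p 0"
proof -
  let ?T = "\<Sum>k | a k \<noteq> 0. a k * p (rvec k)"
  let ?C = "\<lambda>\<gamma>. \<Sum>k | a k \<noteq> 0. if crep k = crep \<gamma> then a k * p (rvec k) else 0"
  have T: "?T = of_nat (dM M) * ?C \<gamma>" for \<gamma>
  proof -
    have "of_nat (dM M) * ?C \<gamma> = (\<Sum>\<omega>\<in>Omega M. cnj (ochr \<gamma> \<omega>) *
        (\<Sum>k | a k \<noteq> 0. a k * p (rvec k) * ochr k \<omega>))"
      by (rule sum_Omega_coset[symmetric]) (rule l0_finite[OF a_l0])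
    also have "\<dots> = (\<Sum>\<omega>\<in>Omega M. if \<omega> = 0 then ?T else 0)"
      using sum_rules[OF _ _ assms] by (intro sum.cong) auto
    also have "\<dots> = ?T" by simp
    finally show ?thesis by simp
  qed
  have "?C 0 = (\<Sum>k | a k \<noteq> 0. if k = 0 then a 0 * p 0 else 0)"
  proof (rule sum.cong[OF refl])
    fix k
    show "(if crep k = crep 0 then a k * p (rvec k) else 0) = (if k = 0 then a 0 * p 0 else 0)"
    proof (cases "crep k = 0")
      case True
      then obtain j where "k = M *v j" by (auto simp: crep_eq_0_iff)
      then show ?thesis using a_mult[of j] mult_inj_iff[of j 0] by auto
    qed auto
  qed
  also have "\<dots> = p 0 / of_nat (dM M)"
    using a_mult[of 0] dM_pos by (simp add: l0_finite[OF a_l0])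
  finally have C0: "?C 0 = p 0 / of_nat (dM M)" .
  show "?T = p 0" using T[of 0] C0 dM_pos by simp
  then show "?C \<gamma> = p 0 / of_nat (dM M)" using T[of \<gamma>] dM_pos by (simp add: field_simps)
qed

abbreviation "cos_f \<gamma> \<equiv> coset_filter a \<gamma> M"

lemma upsample_coset_moment:
  assumes "polydeg n p" "n < 2 * m"
  shows "(\<Sum>k | upsample \<gamma> (cos_f \<gamma>) k \<noteq> 0. upsample \<gamma> (cos_f \<gamma>) k * p (rvec k)) = p 0 / of_nat (dM M)"
proof -
  have "(\<Sum>k | upsample \<gamma> (cos_f \<gamma>) k \<noteq> 0. upsample \<gamma> (cos_f \<gamma>) k * p (rvec k)) =
      (\<Sum>k | a k \<noteq> 0. upsample \<gamma> (cos_f \<gamma>) k * p (rvec k))"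
    by (rule sum_superset[OF l0_finite[OF a_l0]]) (simp add: upsample_coset)
  also have "\<dots> = (\<Sum>k | a k \<noteq> 0. if crep k = crep \<gamma> then a k * p (rvec k) else 0)"
    by (intro sum.cong) (auto simp: upsample_coset)
  finally show ?thesis using coset_moment(1)[OF assms] by simp
qed

text \<open>To order 2 m the coset filter is thus a point evaluation divided by \<open>d\<close>, so
  its Fourier series agrees there with an exponential of modulus 1 / d. This is why
  \<open>h_filter\<close> vanishes to order 2 m.\<close>

lemma coset_filter_moment:
  assumes "polydeg n p" "n < 2 * m"
  shows "(\<Sum>k | cos_f \<gamma> k \<noteq> 0. cos_f \<gamma> k * p (rvec k)) = p (- ainv (rvec \<gamma>)) / of_nat (dM M)"
proof -
  let ?q = "\<lambda>x. p (matrix_inv (rmat M) *v x + (- ainv (rvec \<gamma>)))"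
  have q: "polydeg n ?q" by (rule polydeg_affine) fact
  have "p (- ainv (rvec \<gamma>)) / of_nat (dM M) = ?q 0 / of_nat (dM M)" by simp
  also have "\<dots> = (\<Sum>k | upsample \<gamma> (cos_f \<gamma>) k \<noteq> 0. upsample \<gamma> (cos_f \<gamma>) k * ?q (rvec k))"
    using upsample_coset_moment[OF q assms(2)] by simp
  also have "\<dots> = (\<Sum>j | cos_f \<gamma> j \<noteq> 0. cos_f \<gamma> j * ?q (rvec (\<gamma> + M *v j)))"
    by (rule upsample_sum[OF coset_l0[OF a_l0], THEN conjunct2, THEN conjunct2, of \<gamma> \<gamma> "\<lambda>k. ?q (rvec k)"])
  also have "\<dots> = (\<Sum>j | cos_f \<gamma> j \<noteq> 0. cos_f \<gamma> j * p (rvec j))"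
    by (simp add: ainv_add rvec_add flip: ainv_def)
  finally show ?thesis by simp
qed

end

section \<open>The ideals of trigonometric polynomials vanishing at the origin\<close>

definition diff_poly :: "('n::finite \<Rightarrow> nat) \<Rightarrow> real ^ 'n \<Rightarrow> complex" where
  "diff_poly \<mu> \<xi> = (\<Prod>i\<in>UNIV. (1 - chr (axis i 1) \<xi>) ^ \<mu> i)"

text \<open>The ideal generated by the products of \<open>r\<close> factors, listed by adding one
  multiple of a generator at a time. The resulting induction treats a single product, both for the
  sums of squares and for the decay under iteration.\<close>

inductive_set vanish_ideal :: "nat \<Rightarrow> (real ^ 'n \<Rightarrow> complex) set" for r where
  zero: "(\<lambda>_. 0) \<in> vanish_ideal r"
| add_prod: "F \<in> vanish_ideal r \<Longrightarrow> Q \<in> trig_polys \<Longrightarrow> (\<Sum>i\<in>UNIV. \<mu> i) = r \<Longrightarrow>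
    (\<lambda>\<xi>. F \<xi> + diff_poly \<mu> \<xi> * Q \<xi>) \<in> vanish_ideal r"

lemma diff_poly_trig [intro, simp]: "diff_poly \<mu> \<in> trig_polys"
  unfolding diff_poly_def by (intro trig_polys_prod trig_polys_power trig_polys_diff trig_polys_const trig_polys_chr1)

lemma diff_poly_add: "diff_poly \<mu> \<xi> * diff_poly \<nu> \<xi> = diff_poly (\<lambda>i. \<mu> i + \<nu> i) \<xi>"
  by (simp add: diff_poly_def power_add prod.distrib)

lemma diff_poly_single: "diff_poly (\<lambda>j. if j = i then n else 0) \<xi> = (1 - chr (axis i 1) \<xi>) ^ n"
proof -
  have "diff_poly (\<lambda>j. if j = i then n else 0) \<xi> =
      (\<Prod>j\<in>UNIV. if j = i then (1 - chr (axis i 1) \<xi>) ^ n else 1)"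
    unfolding diff_poly_def by (intro prod.cong) auto
  then show ?thesis by simp
qed

lemma vanish_ideal_add:
  "F \<in> vanish_ideal r \<Longrightarrow> G \<in> vanish_ideal r \<Longrightarrow> (\<lambda>\<xi>. F \<xi> + G \<xi>) \<in> vanish_ideal r"
proof (induction rule: vanish_ideal.induct)
  case (add_prod F Q \<mu>)
  from vanish_ideal.add_prod[OF add_prod.IH[OF add_prod.prems] add_prod.hyps(2,3)]
  show ?case by (simp add: add_ac)
qed simp

lemma vanish_ideal_sum:
  "(\<And>i. i \<in> I \<Longrightarrow> F i \<in> vanish_ideal r) \<Longrightarrow> (\<lambda>\<xi>. \<Sum>i\<in>I. F i \<xi>) \<in> vanish_ideal r"
  by (induction I rule: infinite_finite_induct) (auto intro: vanish_ideal_add vanish_ideal.zero)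

lemma vanish_ideal_prod:
  "Q \<in> trig_polys \<Longrightarrow> (\<Sum>i\<in>UNIV. \<mu> i) = r \<Longrightarrow> (\<lambda>\<xi>. diff_poly \<mu> \<xi> * Q \<xi>) \<in> vanish_ideal r"
  using vanish_ideal.add_prod[OF vanish_ideal.zero] by simp

lemma vanish_ideal_shift:
  "F \<in> vanish_ideal r \<Longrightarrow> (\<lambda>\<xi>. (1 - chr (axis i 1) \<xi>) ^ n * F \<xi>) \<in> vanish_ideal (n + r)"
proof (induction rule: vanish_ideal.induct)
  case zero
  show ?case using vanish_ideal.zero by simp
next
  case (add_prod F Q \<mu>)
  let ?\<nu> = "\<lambda>j. (if j = i then n else 0) + \<mu> j"
  have "(\<lambda>\<xi>. (1 - chr (axis i 1) \<xi>) ^ n * F \<xi> + diff_poly ?\<nu> \<xi> * Q \<xi>) \<in> vanish_ideal (n + r)"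
    by (rule vanish_ideal.add_prod[OF add_prod.IH add_prod.hyps(2)])
      (simp add: sum.distrib add_prod.hyps)
  then show ?case
    by (simp add: distrib_left diff_poly_single mult.assoc flip: diff_poly_add)
qed

lemma vanish_ideal_0: "F \<in> trig_polys \<Longrightarrow> F \<in> vanish_ideal 0"
  using vanish_ideal_prod[of F "\<lambda>_. 0" 0] by (simp add: diff_poly_def)

text \<open>By Pascal's rule, multiplying the truncated Newton series of (1 - D)^x by 1 - D raises
  \<open>x\<close> by one, up to an explicit boundary term. As \<open>x\<close> is arbitrary, the
  step can also be read backwards to negative integers.\<close>

lemma newton_pascal:
  fixes D x :: complex
  shows "(1 - D) * (\<Sum>j<Suc r. (- 1) ^ j * (x gchoose j) * D ^ j) =
    (\<Sum>j<Suc r. (- 1) ^ j * ((x + 1) gchoose j) * D ^ j) - (- 1) ^ r * (x gchoose r) * D ^ Suc r"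
proof (induction r)
  case (Suc r)
  have "(1 - D) * (\<Sum>j<Suc (Suc r). (- 1) ^ j * (x gchoose j) * D ^ j) =
      (1 - D) * (\<Sum>j<Suc r. (- 1) ^ j * (x gchoose j) * D ^ j) +
      (1 - D) * ((- 1) ^ Suc r * (x gchoose Suc r) * D ^ Suc r)"
    unfolding sum.lessThan_Suc[of _ "Suc r"] by (simp only: distrib_left)
  also have "\<dots> = (\<Sum>j<Suc r. (- 1) ^ j * ((x + 1) gchoose j) * D ^ j) +
      (- 1) ^ Suc r * ((x gchoose r) + (x gchoose Suc r)) * D ^ Suc r -
      (- 1) ^ Suc r * (x gchoose Suc r) * D ^ Suc (Suc r)"
    unfolding Suc by (simp add: algebra_simps)
  finally show ?case using gbinomial_Suc_Suc[of x r] by simp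
qed simp

text \<open>Newton's expansion of \<open>z^k = (1 - D)^k\<close> in powers of \<open>D = 1 - z\<close>, for \<open>z = e^{- i \<xi>\<^sub>i}\<close> and integral \<open>k\<close>,
  with a trigonometric polynomial as cofactor in the remainder.\<close>

lemma chr_axis_expansion:
  fixes k :: int and r :: nat and i :: "'n::finite"
  shows "\<exists>R \<in> trig_polys. \<forall>\<xi>. chr (axis i k) \<xi> =
    (\<Sum>j<r. (- 1) ^ j * (of_int k gchoose j) * (1 - chr (axis i 1) \<xi>) ^ j) +
    (1 - chr (axis i 1) \<xi>) ^ r * R \<xi>"
proof (cases r)
  case 0
  then show ?thesis by (intro bexI[of _ "chr (axis i k)"]) auto
next
  case (Suc r')
  let ?D = "\<lambda>\<xi>. 1 - chr (axis i 1) \<xi>"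
  let ?P = "\<lambda>k \<xi>. \<Sum>j<r. (- 1) ^ j * ((of_int k :: complex) gchoose j) * ?D \<xi> ^ j"
  let ?claim = "\<lambda>k. \<exists>R \<in> trig_polys. \<forall>\<xi>. chr (axis i k) \<xi> = ?P k \<xi> + ?D \<xi> ^ r * R \<xi>"
  let ?c = "\<lambda>k. (- 1) ^ r' * ((of_int k :: complex) gchoose r')"
  have axis_add: "axis i (k + 1) = axis i k + (axis i 1 :: int ^ 'n)" for k
    by (simp add: axis_def vec_eq_iff)
  have pascal: "(1 - ?D \<xi>) * ?P k \<xi> = ?P (k + 1) \<xi> - ?c k * ?D \<xi> ^ r" for k \<xi>
    using newton_pascal[of "?D \<xi>" "of_int k" r'] unfolding Suc by simp
  have up: "?claim (k + 1)" if "?claim k" for k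
  proof -
    from that obtain R where R: "R \<in> trig_polys" "\<And>\<xi>. chr (axis i k) \<xi> = ?P k \<xi> + ?D \<xi> ^ r * R \<xi>"
      by blast
    have "chr (axis i (k + 1)) \<xi> = ?P (k + 1) \<xi> + ?D \<xi> ^ r * (chr (axis i 1) \<xi> * R \<xi> - ?c k)" for \<xi>
    proof -
      have "chr (axis i (k + 1)) \<xi> = (1 - ?D \<xi>) * ?P k \<xi> + ?D \<xi> ^ r * (chr (axis i 1) \<xi> * R \<xi>)"
        unfolding axis_add chr_add R(2) by (simp add: algebra_simps)
      then show ?thesis unfolding pascal by (simp add: algebra_simps)
    qed
    moreover have "(\<lambda>\<xi>. chr (axis i 1) \<xi> * R \<xi> - ?c k) \<in> trig_polys"
      by (intro trig_polys_diff trig_polys_mult trig_polys_chr1 R trig_polys_const)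
    ultimately show ?thesis
      by (intro bexI[of _ "\<lambda>\<xi>. chr (axis i 1) \<xi> * R \<xi> - ?c k"] allI)
  qed
  \<comment> \<open>The step is inverted by dividing by the character, that is, by multiplying with
    its conjugate; the remainder stays a trigonometric polynomial.\<close>
  have down: "?claim k" if "?claim (k + 1)" for k
  proof -
    from that obtain R where R: "R \<in> trig_polys" "\<And>\<xi>. chr (axis i (k + 1)) \<xi> = ?P (k + 1) \<xi> + ?D \<xi> ^ r * R \<xi>"
      by blast
    have "chr (axis i k) \<xi> = ?P k \<xi> + ?D \<xi> ^ r * (cnj (chr (axis i 1) \<xi>) * (R \<xi> + ?c k))" for \<xi>
    proof -
      have "chr (axis i 1) \<xi> * chr (axis i k) \<xi> = chr (axis i 1) \<xi> * ?P k \<xi> + ?D \<xi> ^ r * (R \<xi> + ?c k)"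
        using pascal[of \<xi> k] R(2)[of \<xi>] unfolding axis_add chr_add by (simp add: algebra_simps)
      then have "cnj (chr (axis i 1) \<xi>) * (chr (axis i 1) \<xi> * chr (axis i k) \<xi>) =
          cnj (chr (axis i 1) \<xi>) * (chr (axis i 1) \<xi> * ?P k \<xi> + ?D \<xi> ^ r * (R \<xi> + ?c k))" by simp
      then show ?thesis
        by (simp only: distrib_left mult.assoc[symmetric] chr_mult_cnj) (simp add: mult_ac)
    qed
    moreover have "(\<lambda>\<xi>. cnj (chr (axis i 1) \<xi>) * (R \<xi> + ?c k)) \<in> trig_polys"
      by (intro trig_polys_add trig_polys_mult trig_polys_cnj trig_polys_chr1 R trig_polys_const)
    ultimately show ?thesis
      by (intro bexI[of _ "\<lambda>\<xi>. cnj (chr (axis i 1) \<xi>) * (R \<xi> + ?c k)"] allI)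
  qed
  have "?claim 0"
  proof (intro bexI[of _ "\<lambda>_. 0"] allI)
    fix \<xi>
    have ax: "axis i (0 :: int) = (0 :: int ^ 'n)" by (simp add: axis_def vec_eq_iff)
    show "chr (axis i 0) \<xi> = ?P 0 \<xi> + ?D \<xi> ^ r * 0"
      unfolding Suc sum.lessThan_Suc_shift ax by simp
  qed simp
  moreover have "?claim (k - 1)" if "?claim k" for k using down[of "k - 1"] that by simp
  ultimately show ?thesis by (induction k rule: int_induct[of _ 0]) (use up in blast)+
qed

lemma polydeg_gchoose: "polydeg j (\<lambda>x. of_real (x $ i) gchoose j)"
proof -
  have "polydeg (\<Sum>t\<in>{0..<j}. 1) (\<lambda>x. \<Prod>t\<in>{0..<j}. of_real (x $ i) + (- of_nat t))"
    by (intro polydeg_prod polydeg.add polydeg_coord polydeg.const finite_atLeastLessThan)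
  then have "polydeg j (\<lambda>x. (1 / fact j) * (\<Prod>t\<in>{0..<j}. of_real (x $ i) + (- of_nat t)))"
    by (intro polydeg_scale) simp
  then show ?thesis by (simp add: gbinomial_prod_rev)
qed

text \<open>Induction over the set \<open>S\<close> of coordinates: expanding in the coordinate \<open>i\<close> multiplies the
  coefficients by binomial polynomials in \<open>k\<^sub>i\<close>, which lowers the number of annihilated degrees by
  exactly the power of the factor \<open>1 - e^{- i \<xi>\<^sub>i}\<close> that is split off.\<close>

lemma annih_vanish_ideal_aux:
  assumes "finite S" "u \<in> l0" "annih r u"
  shows "(\<lambda>\<xi>. \<Sum>k | u k \<noteq> 0. u k * (\<Prod>i\<in>S. chr (axis i (k $ i)) \<xi>)) \<in> vanish_ideal r"
  using assms
proof (induction S arbitrary: u r rule: finite_induct)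
  case empty
  show ?case
  proof (cases "r = 0")
    case True
    then show ?thesis by (simp add: vanish_ideal_0)
  next
    case False
    then have "(\<Sum>k | u k \<noteq> 0. u k * (\<lambda>_. 1) (rvec k)) = 0"
      using annihD[OF empty(2) polydeg.const[of 0 1]] by simp
    then show ?thesis by (simp add: vanish_ideal.zero)
  qed
next
  case (insert i S)
  let ?D = "\<lambda>\<xi>. 1 - chr (axis i 1) \<xi>"
  let ?b = "\<lambda>j k. (- 1) ^ j * ((of_int (k $ i) :: complex) gchoose j)"
  let ?Z = "\<lambda>k \<xi>. \<Prod>i\<in>S. chr (axis i (k $ i)) \<xi>"
  obtain R where R: "\<And>k. R k \<in> trig_polys"
    "\<And>k \<xi>. chr (axis i k) \<xi> = (\<Sum>j<r. (- 1) ^ j * (of_int k gchoose j) * ?D \<xi> ^ j) + ?D \<xi> ^ r * R k \<xi>"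
  proof -
    have "\<forall>k. \<exists>R. R \<in> trig_polys \<and> (\<forall>\<xi>. chr (axis i k) \<xi> =
        (\<Sum>j<r. (- 1) ^ j * (of_int k gchoose j) * ?D \<xi> ^ j) + ?D \<xi> ^ r * R \<xi>)"
      using chr_axis_expansion[of i _ r] by blast
    from choice[OF this] that show ?thesis by blast
  qed
  have Zt: "?Z k \<in> trig_polys" for k
    by (intro trig_polys_prod trig_polys_chr1)
  have "(\<lambda>\<xi>. (\<Sum>j<r. ?D \<xi> ^ j * (\<Sum>k | ?b j k * u k \<noteq> 0. ?b j k * u k * ?Z k \<xi>)) +
      ?D \<xi> ^ r * (\<Sum>k | u k \<noteq> 0. u k * (R (k $ i) \<xi> * ?Z k \<xi>))) \<in> vanish_ideal r"
  proof (intro vanish_ideal_add vanish_ideal_sum)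
    fix j assume j: "j \<in> {..<r}"
    have "annih (r - j) (\<lambda>k. ?b j k * u k)"
      unfolding annih_def
    proof (intro allI impI)
      fix n and p :: "real ^ 'a \<Rightarrow> complex" assume n: "n < r - j" and p: "polydeg n p"
      have "polydeg (j + n) (\<lambda>x. (- 1) ^ j * ((of_real (x $ i) gchoose j) * p x))"
        by (intro polydeg_scale polydeg_mult polydeg_gchoose p)
      from annihD[OF insert.prems(2) this]
      have "(\<Sum>k | u k \<noteq> 0. u k * ((- 1) ^ j * ((of_real (rvec k $ i) gchoose j) * p (rvec k)))) = 0"
        using n by simp
      moreover have "(\<Sum>k | ?b j k * u k \<noteq> 0. ?b j k * u k * p (rvec k)) = (\<Sum>k | u k \<noteq> 0. ?b j k * u k * p (rvec k))"
        by (rule sum_superset) (use insert.prems l0_finite in auto)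
      ultimately show "(\<Sum>k | ?b j k * u k \<noteq> 0. ?b j k * u k * p (rvec k)) = 0"
        by (simp add: rvec_nth mult_ac)
    qed
    from vanish_ideal_shift[OF insert.IH[OF l0_scale[OF insert.prems(1)] this], where i = i and n = j]
    show "(\<lambda>\<xi>. ?D \<xi> ^ j * (\<Sum>k | ?b j k * u k \<noteq> 0. ?b j k * u k * ?Z k \<xi>)) \<in> vanish_ideal r"
      using j by simp
  next
    have "(\<lambda>\<xi>. \<Sum>k | u k \<noteq> 0. u k * (R (k $ i) \<xi> * ?Z k \<xi>)) \<in> trig_polys"
      by (intro trig_polys_sum trig_polys_mult trig_polys_const R Zt)
    from vanish_ideal_shift[OF vanish_ideal_0[OF this], where n = r and i = i]
    show "(\<lambda>\<xi>. ?D \<xi> ^ r * (\<Sum>k | u k \<noteq> 0. u k * (R (k $ i) \<xi> * ?Z k \<xi>))) \<in> vanish_ideal r"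
      by simp
  qed
  also have "(\<lambda>\<xi>. (\<Sum>j<r. ?D \<xi> ^ j * (\<Sum>k | ?b j k * u k \<noteq> 0. ?b j k * u k * ?Z k \<xi>)) +
      ?D \<xi> ^ r * (\<Sum>k | u k \<noteq> 0. u k * (R (k $ i) \<xi> * ?Z k \<xi>))) =
      (\<lambda>\<xi>. \<Sum>k | u k \<noteq> 0. u k * (\<Prod>i\<in>insert i S. chr (axis i (k $ i)) \<xi>))"
  proof
    fix \<xi>
    have "(\<Sum>k | u k \<noteq> 0. u k * (\<Prod>i\<in>insert i S. chr (axis i (k $ i)) \<xi>)) =
        (\<Sum>k | u k \<noteq> 0. (\<Sum>j<r. ?D \<xi> ^ j * (?b j k * u k * ?Z k \<xi>)) + ?D \<xi> ^ r * (u k * (R (k $ i) \<xi> * ?Z k \<xi>)))"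
    proof (rule sum.cong[OF refl])
      fix k
      show "u k * (\<Prod>i\<in>insert i S. chr (axis i (k $ i)) \<xi>) =
        (\<Sum>j<r. ?D \<xi> ^ j * (?b j k * u k * ?Z k \<xi>)) + ?D \<xi> ^ r * (u k * (R (k $ i) \<xi> * ?Z k \<xi>))"
        unfolding prod.insert[OF insert.hyps] R(2)[of "k $ i"] distrib_right distrib_left sum_distrib_right sum_distrib_left
        by (simp only: mult_ac)
    qed
    also have "\<dots> = (\<Sum>j<r. ?D \<xi> ^ j * (\<Sum>k | u k \<noteq> 0. ?b j k * u k * ?Z k \<xi>)) +
      ?D \<xi> ^ r * (\<Sum>k | u k \<noteq> 0. u k * (R (k $ i) \<xi> * ?Z k \<xi>))"
      unfolding sum.distrib sum_distrib_left by (subst sum.swap) simp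
    also have "(\<Sum>j<r. ?D \<xi> ^ j * (\<Sum>k | u k \<noteq> 0. ?b j k * u k * ?Z k \<xi>)) =
        (\<Sum>j<r. ?D \<xi> ^ j * (\<Sum>k | ?b j k * u k \<noteq> 0. ?b j k * u k * ?Z k \<xi>))"
    proof -
      have "(\<Sum>k | ?b j k * u k \<noteq> 0. ?b j k * u k * ?Z k \<xi>) = (\<Sum>k | u k \<noteq> 0. ?b j k * u k * ?Z k \<xi>)" for j
        by (rule sum_superset) (use insert.prems l0_finite in auto)
      then show ?thesis by simp
    qed
    finally show "(\<Sum>j<r. ?D \<xi> ^ j * (\<Sum>k | ?b j k * u k \<noteq> 0. ?b j k * u k * ?Z k \<xi>)) +
      ?D \<xi> ^ r * (\<Sum>k | u k \<noteq> 0. u k * (R (k $ i) \<xi> * ?Z k \<xi>)) =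
      (\<Sum>k | u k \<noteq> 0. u k * (\<Prod>i\<in>insert i S. chr (axis i (k $ i)) \<xi>))" by simp
  qed
  finally show ?case .
qed

lemma chr_prod_axis: "(\<Prod>i\<in>UNIV. chr (axis i (k $ i)) \<xi>) = chr k \<xi>"
  unfolding chr_axis_int by (simp add: chr_def inner_vec_def rvec_nth sum_distrib_left sum_negf flip: exp_sum)

lemma annih_vanish_ideal:
  assumes "u \<in> l0" "annih r u" shows "fseries u \<in> vanish_ideal r"
  using annih_vanish_ideal_aux[OF finite_class.finite_UNIV assms] by (simp add: chr_prod_axis fseries_chr[abs_def])

section \<open>Signed sums of squares\<close>

lemma annih_conv_left:
  assumes "u \<in> l0" "v \<in> l0" "annih r u" shows "annih r (conv u v)"
  unfolding annih_def
proof (intro allI impI)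
  fix n and p :: "real ^ 'a \<Rightarrow> complex" assume n: "n < r" and p: "polydeg n p"
  have "moment (conv u v) p =
     (\<Sum>j | u j \<noteq> 0. \<Sum>l | v l \<noteq> 0. u j * v l * p (rvec (j + l)))"
    by (rule conv_sum[OF assms(1,2), of "\<lambda>k. p (rvec k)", THEN conjunct2])
  also have "\<dots> = (\<Sum>l | v l \<noteq> 0. \<Sum>j | u j \<noteq> 0. u j * v l * p (rvec (j + l)))"
    by (rule sum.swap)
  also have "\<dots> = (\<Sum>l | v l \<noteq> 0. v l * (\<Sum>j | u j \<noteq> 0. u j * p (rvec j + rvec l)))"
    by (simp add: sum_distrib_left rvec_add mult_ac)
  also have "\<dots> = 0"
    using annihD[OF assms(3) polydeg_shift[OF p] n] by simp
  finally show "moment (conv u v) p = 0" .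
qed

lemma annih_add:
  assumes "u \<in> l0" "v \<in> l0" "annih r u" "annih r v" shows "annih r (\<lambda>k. u k + v k)"
  unfolding annih_def
proof (intro allI impI)
  fix n and p :: "real ^ 'a \<Rightarrow> complex" assume n: "n < r" and p: "polydeg n p"
  let ?S = "{k. u k \<noteq> 0} \<union> {k. v k \<noteq> 0}"
  have S: "finite ?S" using assms by (auto simp: l0_def)
  have "(\<Sum>k | u k + v k \<noteq> 0. (u k + v k) * p (rvec k)) = (\<Sum>k\<in>?S. (u k + v k) * p (rvec k))"
    by (rule sum_superset[OF S]) auto
  also have "\<dots> = (\<Sum>k\<in>?S. u k * p (rvec k)) + (\<Sum>k\<in>?S. v k * p (rvec k))"
    by (simp add: distrib_right sum.distrib)
  also have "(\<Sum>k\<in>?S. u k * p (rvec k)) = moment u p"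
    by (rule sum_superset[OF S, symmetric]) auto
  also have "(\<Sum>k\<in>?S. v k * p (rvec k)) = moment v p"
    by (rule sum_superset[OF S, symmetric]) auto
  finally show "(\<Sum>k | u k + v k \<noteq> 0. (u k + v k) * p (rvec k)) = 0"
    using annihD[OF assms(3) p n] annihD[OF assms(4) p n] by simp
qed

lemma annih_scale:
  assumes "annih r u" shows "annih r (\<lambda>k. c * u k)"
proof (cases "c = 0")
  case False
  then show ?thesis using assms
    by (simp add: annih_def mult.assoc flip: sum_distrib_left)
qed (simp add: annih_def)

text \<open>A factor 1 - e^{-i \<xi>_i} acts on test polynomials as a difference, which lowers the
  degree by one. A filter is built factor by factor, and uniqueness of coefficients identifies it
  with \<open>v\<close>.\<close>

lemma diff_poly_annih:
  assumes "fseries v = diff_poly \<mu>" "v \<in> l0"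
  shows "annih (\<Sum>i\<in>UNIV. \<mu> i) v"
proof -
  have "\<exists>v\<in>l0. fseries v = diff_poly \<mu> \<and> annih (\<Sum>i\<in>UNIV. \<mu> i) v"
  proof (induction "\<Sum>i\<in>UNIV. \<mu> i" arbitrary: \<mu>)
    case 0
    then have "diff_poly \<mu> \<xi> = 1" for \<xi> by (simp add: diff_poly_def)
    then have "fseries delta = diff_poly \<mu>" by (simp add: fun_eq_iff)
    moreover have "annih (\<Sum>i\<in>UNIV. \<mu> i) delta" unfolding 0[symmetric] by (simp add: annih_def)
    ultimately show ?case by (intro bexI[of _ delta] conjI l0_delta)
  next
    case (Suc n)
    then obtain i where i: "\<mu> i > 0" by (metis gr0I nat.distinct(1) sum.neutral)
    define \<nu> where "\<nu> = \<mu>(i := \<mu> i - 1)"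
    have \<mu>: "\<mu> = (\<lambda>j. (if j = i then 1 else 0) + \<nu> j)" using i by (auto simp: \<nu>_def)
    then have sum: "(\<Sum>i\<in>UNIV. \<mu> i) = Suc (\<Sum>i\<in>UNIV. \<nu> i)" by (simp add: sum.distrib)
    then obtain v where v: "v \<in> l0" "fseries v = diff_poly \<nu>" "annih n v"
      using Suc(1)[of \<nu>] Suc(2) by auto
    let ?e = "\<lambda>k. delta k - (if k = axis i 1 then 1 else 0 :: complex)"
    have e: "?e \<in> l0" "fseries ?e \<xi> = 1 - chr (axis i 1) \<xi>" for \<xi>
      by (auto simp: fseries_diff fseries_single l0_single)
    have "fseries (conv ?e v) \<xi> = diff_poly \<mu> \<xi>" for \<xi>
      unfolding \<mu> using e v by (simp add: fseries_conv diff_poly_single flip: diff_poly_add)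
    moreover have "annih (Suc n) (conv ?e v)"
      unfolding annih_def
    proof (intro allI impI)
      fix N and p :: "real ^ 'a \<Rightarrow> complex" assume N: "N < Suc n" and p: "polydeg N p"
      have "moment (conv ?e v) p =
         (\<Sum>j | ?e j \<noteq> 0. \<Sum>l | v l \<noteq> 0. ?e j * v l * p (rvec (j + l)))"
        by (rule conv_sum[OF e(1) v(1), of "\<lambda>k. p (rvec k)", THEN conjunct2])
      also have "\<dots> = (\<Sum>j | ?e j \<noteq> 0. ?e j * (\<Sum>l | v l \<noteq> 0. v l * p (rvec (j + l))))"
        by (simp add: sum_distrib_left mult_ac)
      also have "\<dots> = (\<Sum>j\<in>{0, axis i 1}. ?e j * (\<Sum>l | v l \<noteq> 0. v l * p (rvec (j + l))))"
        by (rule sum_superset) (auto simp: delta_def)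
      also have "\<dots> = moment v p - (\<Sum>l | v l \<noteq> 0. v l * p (rvec l + axis i 1))"
        by (simp add: delta_def rvec_add rvec_axis axis_eq_0_iff add.commute)
      also have "\<dots> = - (\<Sum>l | v l \<noteq> 0. v l * (p (rvec l + axis i 1) - p (rvec l)))"
        by (simp add: right_diff_distrib sum_subtractf)
      also have "\<dots> = 0"
      proof (cases N)
        case 0
        then show ?thesis using polydeg_0_const[OF p] by fastforce
      next
        case (Suc N')
        \<comment> \<open>For x_j p the difference is x_j times the difference of p plus b_j times a
          translate of p, so the degree drops by induction.\<close>
        have drop: "polydeg N' (\<lambda>x. p (x + b) - p x)" if "polydeg N p" "N = Suc N'" for N p N' and b :: "real ^ 'a"
          using that
        proof (induction arbitrary: N' rule: polydeg.induct)
          case (add n p q)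
          from polydeg.add[OF add.IH(1)[OF add.prems] add.IH(2)[OF add.prems]]
          show ?case by (simp add: algebra_simps)
        next
          case (coord n p j)
          have "polydeg n (\<lambda>x. of_real (x $ j) * (p (x + b) - p x))"
          proof (cases n)
            case 0
            then show ?thesis using polydeg_0_const[OF coord.hyps] by (fastforce intro: polydeg.const)
          next
            case (Suc n')
            from polydeg.coord[OF coord.IH[OF this], of j] Suc show ?thesis by simp
          qed
          from polydeg.add[OF this polydeg_scale[OF polydeg_shift[OF coord.hyps], of "of_real (b $ j)" b]]
          show ?case using coord.prems by (simp add: algebra_simps)
        qed (simp add: polydeg.const)
        from annihD[OF v(3) drop[OF p Suc]] N Suc show ?thesis by simp
      qed
      finally show "moment (conv ?e v) p = 0" .
    qed
    ultimately show ?case using Suc(2) conv_l0[OF e(1) v(1)] by (intro bexI[of _ "conv ?e v"]) auto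
  qed
  then obtain w where "w \<in> l0" "fseries w = diff_poly \<mu>" "annih (\<Sum>i\<in>UNIV. \<mu> i) w" by blast
  moreover have "v = w" by (rule fseries_inject) (use assms calculation in auto)
  ultimately show ?thesis by simp
qed

definition square_sum :: "(int \<times> ('n::finite) filt) list \<Rightarrow> real ^ 'n \<Rightarrow> complex" where
  "square_sum ps \<xi> = (\<Sum>(e, u)\<leftarrow>ps. of_int e * of_real ((cmod (fseries u \<xi>))\<^sup>2))"

lemma vanish_ideal_square_sum:
  fixes F :: "real ^ 'n \<Rightarrow> complex"
  assumes "F \<in> vanish_ideal (2 * m)"
  shows "\<exists>ps. (\<forall>(e, u) \<in> set ps. e \<in> {-1, 1} \<and> u \<in> l0 \<and> annih m u) \<and>
    (\<forall>\<xi>. of_real (Re (F \<xi>)) = square_sum ps \<xi>)"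
  using assms
proof (induction rule: vanish_ideal.induct)
  case zero
  show ?case by (rule exI[of _ "[]"]) (simp add: square_sum_def)
next
  case (add_prod F Q \<mu>)
  then obtain ps where ps: "\<forall>(e, u) \<in> set ps. e \<in> {-1, 1} \<and> u \<in> l0 \<and> annih m u"
    "\<And>\<xi>. of_real (Re (F \<xi>)) = square_sum ps \<xi>" by blast
  \<comment> \<open>Half of the exponents, taken one unit at a time below \<open>\<mu>\<close>, so
    that each of the two factors vanishes to order \<open>m\<close>.\<close>
  obtain \<alpha> where \<alpha>: "\<And>i. \<alpha> i \<le> \<mu> i" "(\<Sum>i\<in>UNIV. \<alpha> i) = m"
  proof -
    have "\<exists>\<alpha>. (\<forall>i. \<alpha> i \<le> \<mu> i) \<and> (\<Sum>i\<in>UNIV. \<alpha> i) = k" if "k \<le> (\<Sum>i\<in>UNIV. \<mu> i)" for k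
      using that
    proof (induction k)
      case 0
      show ?case by (rule exI[of _ "\<lambda>_. 0"]) simp
    next
      case (Suc k)
      then obtain \<alpha> where \<alpha>: "\<forall>i. \<alpha> i \<le> \<mu> i" "(\<Sum>i\<in>UNIV. \<alpha> i) = k" by auto
      then obtain i where i: "\<alpha> i < \<mu> i"
        using Suc.prems by (metis Suc_n_not_le_n not_le sum_mono order.trans)
      have "(\<Sum>j\<in>UNIV. (\<alpha>(i := Suc (\<alpha> i))) j) = (\<Sum>j\<in>UNIV. \<alpha> j + (if j = i then 1 else 0))"
        by (intro sum.cong) auto
      then have "(\<Sum>j\<in>UNIV. (\<alpha>(i := Suc (\<alpha> i))) j) = Suc k"
        using \<alpha> by (simp add: sum.distrib)
      then show ?case using \<alpha> i by (intro exI[of _ "\<alpha>(i := Suc (\<alpha> i))"]) auto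
    qed
    from this[of m] that show ?thesis using add_prod.hyps by auto
  qed
  define \<beta> where "\<beta> i = \<mu> i - \<alpha> i" for i
  have \<mu>: "\<mu> = (\<lambda>i. \<alpha> i + \<beta> i)" using \<alpha> by (auto simp: \<beta>_def)
  have \<beta>: "(\<Sum>i\<in>UNIV. \<beta> i) = m" using \<alpha>(2) add_prod.hyps(3) by (simp add: \<mu> sum.distrib)
  obtain u where u: "u \<in> l0" "fseries u = diff_poly \<alpha>"
    using diff_poly_trig[of \<alpha>] by (force simp: trig_polys_def)
  obtain v where v: "v \<in> l0" "fseries v = diff_poly \<beta>"
    using diff_poly_trig[of \<beta>] by (force simp: trig_polys_def)
  obtain q where q: "q \<in> l0" "fseries q = Q"
    using add_prod.hyps(2) by (force simp: trig_polys_def)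
  \<comment> \<open>Reflection and conjugation keep the degree of the test polynomial, so
    \<open>flip u\<close>, whose series is the conjugate of \<open>diff_poly \<alpha>\<close>,
    annihilates as much as \<open>u\<close> does.\<close>
  have fu: "annih m (flip u)"
    unfolding annih_def
  proof (intro allI impI)
    fix n and p :: "real ^ 'n \<Rightarrow> complex" assume n: "n < m" and p: "polydeg n p"
    have z: "(\<Sum>k | u k \<noteq> 0. u k * cnj (p (0 - rvec k))) = 0"
      by (rule annihD[OF diff_poly_annih[OF u(2,1)] polydeg_cnj[OF polydeg_reflect[OF p]]]) (use \<alpha> n in simp)
    have "moment (flip u) p = cnj (\<Sum>k | u k \<noteq> 0. u k * cnj (p (0 - rvec k)))"
      unfolding flip_sum by (simp add: rvec_minus)
    also have "\<dots> = 0" unfolding z by simp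
    finally show "moment (flip u) p = 0" .
  qed
  have vq: "annih m (conv v q)"
    using annih_conv_left[OF v(1) q(1) diff_poly_annih[OF v(2,1)]] \<beta> by simp
  let ?x = "\<lambda>k. (1 / 2) * (flip u k + conv v q k)" and ?y = "\<lambda>k. (1 / 2) * (flip u k + (- 1) * conv v q k)"
  have l0: "?x \<in> l0" "?y \<in> l0" by (intro l0_scale l0_add flip_l0 conv_l0 u v q)+
  have an: "annih m ?x" "annih m ?y"
    by (intro annih_scale annih_add l0_scale flip_l0 conv_l0 u v q fu vq)+
  have fx: "fseries ?x \<xi> = (cnj (diff_poly \<alpha> \<xi>) + diff_poly \<beta> \<xi> * Q \<xi>) / 2" for \<xi>
    unfolding fseries_scale using u v q by (subst fseries_add) (auto simp: fseries_conv fseries_flip)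
  have fy: "fseries ?y \<xi> = (cnj (diff_poly \<alpha> \<xi>) - diff_poly \<beta> \<xi> * Q \<xi>) / 2" for \<xi>
    unfolding fseries_scale using u v q
    by (subst fseries_add) (auto simp: fseries_conv fseries_flip fseries_scale[of "-1", simplified] intro!: l0_scale[of _ "\<lambda>_. -1", simplified])
  have polar: "Re (c * z) = (cmod ((cnj c + z) / 2))\<^sup>2 - (cmod ((cnj c - z) / 2))\<^sup>2" for c z
  proof -
    have "(cmod (cnj c + z))\<^sup>2 - (cmod (cnj c - z))\<^sup>2 = 4 * Re (c * z)"
      unfolding cmod_power2 by (simp add: power2_eq_square algebra_simps)
    then show ?thesis by (simp add: norm_divide power_divide flip: diff_divide_distrib)
  qed
  show ?case
  proof (intro exI[of _ "(1, ?x) # (- 1, ?y) # ps"] conjI allI)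
    fix \<xi>
    have "Re (F \<xi> + diff_poly \<mu> \<xi> * Q \<xi>) = Re (F \<xi>) + Re (diff_poly \<alpha> \<xi> * (diff_poly \<beta> \<xi> * Q \<xi>))"
      unfolding \<mu> diff_poly_add[symmetric] by (simp add: mult.assoc)
    then have "complex_of_real (Re (F \<xi> + diff_poly \<mu> \<xi> * Q \<xi>)) = square_sum ps \<xi> +
        of_real ((cmod (fseries ?x \<xi>))\<^sup>2 - (cmod (fseries ?y \<xi>))\<^sup>2)"
      unfolding polar fx fy by (simp add: ps(2))
    then show "complex_of_real (Re (F \<xi> + diff_poly \<mu> \<xi> * Q \<xi>)) = square_sum ((1, ?x) # (- 1, ?y) # ps) \<xi>"
      by (simp add: square_sum_def)
  qed (use ps l0 an in auto)
qed

section \<open>The filter bank\<close>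

lemma sum_nth_zip:
  assumes "length es = length bs"
  shows "(\<Sum>l<length bs. f (es ! l) (bs ! l)) = (\<Sum>(e, b)\<leftarrow>zip es bs. f e b)"
  using assms by (simp add: sum_list_sum_nth atLeast0LessThan)

lemma zip_concat_map:
  "zip (concat (map (\<lambda>j. map (f j) (L j)) J)) (concat (map (\<lambda>j. map (g j) (L j)) J)) =
    concat (map (\<lambda>j. map (\<lambda>t. (f j t, g j t)) (L j)) J)"
  by (induction J) (simp_all add: zip_map_map zip_same_conv_map)

lemma sum_list_upt: "(\<Sum>j\<leftarrow>[a..<b]. f j) = (\<Sum>j\<in>{a..<b}. f j)"
  by (simp add: interv_sum_list_conv_sum_set_nat)

lemma sum_list_concat_map: "(\<Sum>x\<leftarrow>concat xss. f x) = (\<Sum>xs\<leftarrow>xss. \<Sum>x\<leftarrow>xs. f x)"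
  by (induction xss) simp_all

lemma length_all_filters: "length (all_signs M s \<epsilon>) = length (all_filters M a \<gamma> s u)"
  by (simp add: all_signs_def all_filters_def length_concat comp_def)

text \<open>Removes the list bookkeeping once, for any quantity \<open>X\<close> attached to a
  filter, so that the identity of the bank can be computed with ordinary sums over \<open>j\<close>
  and \<open>t\<close>.\<close>

lemma signed_sum_all_filters:
  "(\<Sum>l<length (all_filters M a \<gamma> s u). of_int (all_signs M s \<epsilon> ! l) * X (all_filters M a \<gamma> s u ! l)) =
    - X (b_first a) + (\<Sum>j=2..dM M. X (b_coset M a (\<gamma> j))) +
    (\<Sum>j=2..dM M. \<Sum>t=1..s j. of_int (\<epsilon> j t) * X (b_extra M (\<gamma> j) (u j t)) :: complex)"
proof -
  let ?J = "[2..<dM M + 1]"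
  have "(\<Sum>l<length (all_filters M a \<gamma> s u). of_int (all_signs M s \<epsilon> ! l) * X (all_filters M a \<gamma> s u ! l)) =
      (\<Sum>(e, b)\<leftarrow>zip (all_signs M s \<epsilon>) (all_filters M a \<gamma> s u). of_int e * X b)"
    by (rule sum_nth_zip[OF length_all_filters, where f = "\<lambda>e b. of_int e * X b"])
  also have "zip (all_signs M s \<epsilon>) (all_filters M a \<gamma> s u) =
     (- 1, b_first a) # map (\<lambda>j. (1, b_coset M a (\<gamma> j))) ?J @
      concat (map (\<lambda>j. map (\<lambda>t. (\<epsilon> j t, b_extra M (\<gamma> j) (u j t))) [1..<s j + 1]) ?J)"
    unfolding all_signs_def all_filters_def zip_Cons_Cons
    by (subst zip_append) (simp_all add: zip_concat_map zip_map_map zip_same_conv_map del: upt_Suc)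
  also have "(\<Sum>(e, b)\<leftarrow>\<dots>. of_int e * X b) = - X (b_first a) + (\<Sum>j\<leftarrow>?J. X (b_coset M a (\<gamma> j))) +
    (\<Sum>j\<leftarrow>?J. \<Sum>t\<leftarrow>[1..<s j + 1]. of_int (\<epsilon> j t) * X (b_extra M (\<gamma> j) (u j t)))"
    by (simp add: sum_list_concat_map comp_def del: upt_Suc)
  also have "\<dots> = - X (b_first a) + (\<Sum>j=2..dM M. X (b_coset M a (\<gamma> j))) +
    (\<Sum>j=2..dM M. \<Sum>t=1..s j. of_int (\<epsilon> j t) * X (b_extra M (\<gamma> j) (u j t)))"
    unfolding sum_list_upt by (simp add: atLeastLessThanSuc_atLeastAtMost)
  finally show ?thesis .
qed

lemma set_all_filters:
  "set (all_filters M a \<gamma> s u) = {b_first a} \<union> (\<lambda>j. b_coset M a (\<gamma> j)) ` {2..dM M} \<union>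
    (\<Union>j\<in>{2..dM M}. (\<lambda>t. b_extra M (\<gamma> j) (u j t)) ` {1..s j})"
  unfolding all_filters_def by (auto simp: atLeastLessThanSuc_atLeastAtMost simp del: upt_Suc)

lemma set_all_signs:
  "set (all_signs M s \<epsilon>) \<subseteq> {-1, 1} \<union> (\<Union>j\<in>{2..dM M}. \<epsilon> j ` {1..s j})"
  unfolding all_signs_def by (auto simp: atLeastLessThanSuc_atLeastAtMost simp del: upt_Suc)

context expanding
begin

lemma dM_powr:
  "complex_of_real (real (dM M) powr (- 1 / 2)) * of_real (real (dM M) powr (- 1 / 2)) = 1 / of_nat (dM M)"
  "complex_of_real (real (dM M) powr (1 / 2)) * of_real (real (dM M) powr (1 / 2)) = of_nat (dM M)"
  "complex_of_real (real (dM M) powr (- 1 / 2)) * of_real (real (dM M) powr (1 / 2)) = 1"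
  "complex_of_real (real (dM M) powr (1 / 2)) / of_nat (dM M) = of_real (real (dM M) powr (- 1 / 2))"
proof -
  have d: "real (dM M) > 0" using dM_pos by simp
  have r: "real (dM M) powr (- 1 / 2) * real (dM M) powr (- 1 / 2) = 1 / real (dM M)"
    "real (dM M) powr (1 / 2) * real (dM M) powr (1 / 2) = real (dM M)"
    "real (dM M) powr (- 1 / 2) * real (dM M) powr (1 / 2) = 1"
    unfolding powr_add[symmetric] using d by (simp_all add: powr_minus_divide)
  show "complex_of_real (real (dM M) powr (- 1 / 2)) * of_real (real (dM M) powr (- 1 / 2)) = 1 / of_nat (dM M)"
    unfolding of_real_mult[symmetric] r by simp
  show *: "complex_of_real (real (dM M) powr (1 / 2)) * of_real (real (dM M) powr (1 / 2)) = of_nat (dM M)"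
    unfolding of_real_mult[symmetric] r by simp
  show **: "complex_of_real (real (dM M) powr (- 1 / 2)) * of_real (real (dM M) powr (1 / 2)) = 1"
    unfolding of_real_mult[symmetric] r by simp
  then show "complex_of_real (real (dM M) powr (1 / 2)) / of_nat (dM M) = of_real (real (dM M) powr (- 1 / 2))"
    unfolding *[symmetric] using d by (simp add: field_simps)
qed

end

context interp_filter
begin

lemma b_first_props:
  "b_first a = (\<lambda>k. delta k - a k)" "b_first a \<in> l0" "fseries (b_first a) \<xi> = 1 - fseries a \<xi>"
  "annih (2 * m) (b_first a)" "k \<noteq> 0 \<Longrightarrow> b_first a (M *v k) = 0"
proof -
  show eq: "b_first a = (\<lambda>k. delta k - a k)"
    unfolding b_first_def by (rule filter_of_eqI) (auto simp: fseries_diff a_l0)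
  show l0: "b_first a \<in> l0" unfolding eq using a_l0 by auto
  show "fseries (b_first a) \<xi> = 1 - fseries a \<xi>" unfolding eq by (simp add: fseries_diff a_l0)
  show "b_first a (M *v k) = 0" if "k \<noteq> 0"
    using that mult_inj_iff[of k 0] unfolding eq by (simp add: delta_def a_mult)
  show "annih (2 * m) (b_first a)"
    unfolding annih_def
  proof (intro allI impI)
    fix n and p :: "real ^ 'n \<Rightarrow> complex" assume n: "n < 2 * m" and p: "polydeg n p"
    let ?S = "insert 0 {k. a k \<noteq> 0}"
    have S: "finite ?S" using l0_finite[OF a_l0] by simp
    have "(\<Sum>k | b_first a k \<noteq> 0. b_first a k * p (rvec k)) = (\<Sum>k\<in>?S. b_first a k * p (rvec k))"
      by (rule sum_superset[OF S]) (auto simp: eq delta_def)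
    also have "\<dots> = (\<Sum>k\<in>?S. delta k * p (rvec k)) - (\<Sum>k\<in>?S. a k * p (rvec k))"
      by (simp only: eq left_diff_distrib sum_subtractf)
    also have "(\<Sum>k\<in>?S. delta k * p (rvec k)) = (\<Sum>k\<in>?S. if k = 0 then p 0 else 0)"
      by (intro sum.cong) (auto simp: delta_def)
    also have "\<dots> = p 0" using S by (subst sum.delta) auto
    also have "(\<Sum>k\<in>?S. a k * p (rvec k)) = p 0"
      using total_moment[OF p n] sum_superset[OF S, of a "\<lambda>k. p (rvec k)"] by auto
    finally show "(\<Sum>k | b_first a k \<noteq> 0. b_first a k * p (rvec k)) = 0" by simp
  qed
qed

lemma b_coset_props:
  fixes \<gamma> :: "int ^ 'n"
  defines "c1 \<equiv> complex_of_real (real (dM M) powr (- 1 / 2))" and "c2 \<equiv> complex_of_real (real (dM M) powr (1 / 2))"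
  shows "b_coset M a \<gamma> = (\<lambda>k. c1 * delta k - c2 * upsample \<gamma> (cos_f \<gamma>) k)" "b_coset M a \<gamma> \<in> l0"
    "fseries (b_coset M a \<gamma>) \<xi> = c1 - c2 * (chr \<gamma> \<xi> * fseries (cos_f \<gamma>) (actT M \<xi>))"
    "annih (2 * m) (b_coset M a \<gamma>)"
    "\<gamma> \<in> Gamma_set M \<Longrightarrow> \<gamma> \<noteq> 0 \<Longrightarrow> k \<noteq> 0 \<Longrightarrow> b_coset M a \<gamma> (M *v k) = 0"
proof -
  let ?v = "upsample \<gamma> (cos_f \<gamma>)"
  have l0: "(\<lambda>k. c1 * delta k) \<in> l0" "(\<lambda>k. c2 * ?v k) \<in> l0" "?v \<in> l0"
    using a_l0 by (auto intro!: l0_scale)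
  have f: "fseries (\<lambda>k. c1 * delta k - c2 * ?v k) \<xi> = c1 - c2 * (chr \<gamma> \<xi> * fseries (cos_f \<gamma>) (actT M \<xi>))" for \<xi>
    by (simp add: fseries_diff l0 fseries_scale fseries_upsample coset_l0 a_l0)
  show eq: "b_coset M a \<gamma> = (\<lambda>k. c1 * delta k - c2 * ?v k)"
    unfolding b_coset_def
    by (rule filter_of_eqI[OF l0_diff[OF l0(1,2)]], unfold f) (simp add: c1_def c2_def chr_def)
  show "b_coset M a \<gamma> \<in> l0" unfolding eq using l0 by auto
  show "fseries (b_coset M a \<gamma>) \<xi> = c1 - c2 * (chr \<gamma> \<xi> * fseries (cos_f \<gamma>) (actT M \<xi>))"
    unfolding eq by (rule f)
  show "b_coset M a \<gamma> (M *v k) = 0" if "\<gamma> \<in> Gamma_set M" "\<gamma> \<noteq> 0" "k \<noteq> 0"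
    using that mult_inj_iff[of k 0] unfolding eq by (simp add: delta_def upsample_coset crep_id)
  show "annih (2 * m) (b_coset M a \<gamma>)"
    unfolding eq
  proof (rule annih_delta_diff[OF l0(3)])
    show "c1 = c2 * (1 / of_nat (dM M))" unfolding c1_def c2_def using dM_powr(4) by simp
  qed (simp add: upsample_coset_moment)
qed

lemma b_extra_props:
  assumes "u \<in> l0"
  shows "b_extra M \<gamma> u = upsample \<gamma> u" "b_extra M \<gamma> u \<in> l0"
    "fseries (b_extra M \<gamma> u) \<xi> = chr \<gamma> \<xi> * fseries u (actT M \<xi>)"
    "annih r u \<Longrightarrow> annih r (b_extra M \<gamma> u)"
    "\<gamma> \<in> Gamma_set M \<Longrightarrow> \<gamma> \<noteq> 0 \<Longrightarrow> b_extra M \<gamma> u (M *v k) = 0"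
proof -
  show eq: "b_extra M \<gamma> u = upsample \<gamma> u"
    unfolding b_extra_def
    by (rule filter_of_eqI) (use assms in \<open>auto simp: fseries_upsample chr_def\<close>)
  show "b_extra M \<gamma> u \<in> l0" unfolding eq using assms by auto
  show "fseries (b_extra M \<gamma> u) \<xi> = chr \<gamma> \<xi> * fseries u (actT M \<xi>)"
    unfolding eq using assms by (rule fseries_upsample)
  show "b_extra M \<gamma> u (M *v k) = 0" if "\<gamma> \<in> Gamma_set M" "\<gamma> \<noteq> 0"
    using that unfolding eq by (simp add: upsample_def crep_diff_eq_0 crep_id)
  show "annih r (b_extra M \<gamma> u)" if an: "annih r u"
    unfolding annih_def eq
  proof (intro allI impI)
    fix n and p :: "real ^ 'n \<Rightarrow> complex" assume n: "n < r" and p: "polydeg n p"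
    have "(\<Sum>k | upsample \<gamma> u k \<noteq> 0. upsample \<gamma> u k * p (rvec k)) =
       (\<Sum>j | u j \<noteq> 0. u j * p (rvec (\<gamma> + M *v j)))"
      by (rule upsample_sum[OF assms, THEN conjunct2, THEN conjunct2, of \<gamma> "\<lambda>k. p (rvec k)"])
    also have "\<dots> = (\<Sum>j | u j \<noteq> 0. u j * p (rmat M *v rvec j + rvec \<gamma>))"
      by (simp add: rvec_add rvec_mult add.commute)
    also have "\<dots> = 0" by (rule annihD[OF an polydeg_affine[OF p] n])
    finally show "(\<Sum>k | upsample \<gamma> u k \<noteq> 0. upsample \<gamma> u k * p (rvec k)) = 0" .
  qed
qed

lemma h_filter_props:
  "h_filter M a \<gamma> \<in> l0"
  "fseries (h_filter M a \<gamma>) \<xi> = complex_of_real (1 / real (dM M) - real (dM M) * (cmod (fseries (cos_f \<gamma>) \<xi>))\<^sup>2)"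
  "annih (2 * m) (h_filter M a \<gamma>)"
proof -
  let ?A = "cos_f \<gamma>"
  let ?v = "conv ?A (flip ?A)"
  let ?d = "of_nat (dM M) :: complex"
  let ?h = "\<lambda>k. (1 / ?d) * delta k - ?d * ?v k"
  have A: "?A \<in> l0" using a_l0 by auto
  then have v: "?v \<in> l0" by auto
  have l0: "(\<lambda>k. (1 / ?d) * delta k) \<in> l0" "(\<lambda>k. ?d * ?v k) \<in> l0"
    by (intro l0_scale l0_delta v)+
  have f: "fseries ?h \<xi> = complex_of_real (1 / real (dM M) - real (dM M) * (cmod (fseries ?A \<xi>))\<^sup>2)" for \<xi>
    unfolding fseries_diff[OF l0] fseries_scale fseries_conv[OF A flip_l0[OF A]] fseries_flip complex_norm_square[symmetric]
    by simp
  have eq: "h_filter M a \<gamma> = ?h"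
    unfolding h_filter_def by (rule filter_of_eqI[OF l0_diff[OF l0] f])
  show "h_filter M a \<gamma> \<in> l0" unfolding eq by (rule l0_diff[OF l0])
  show "fseries (h_filter M a \<gamma>) \<xi> = complex_of_real (1 / real (dM M) - real (dM M) * (cmod (fseries (cos_f \<gamma>) \<xi>))\<^sup>2)"
    unfolding eq by (rule f)
  show "annih (2 * m) (h_filter M a \<gamma>)"
    unfolding eq
  proof (rule annih_delta_diff[OF v])
    fix n and p :: "real ^ 'n \<Rightarrow> complex" assume n: "n < 2 * m" and p: "polydeg n p"
    \<comment> \<open>The reflected filter evaluates at the opposite point, so the two translations
      by \<open>ainv (rvec \<gamma>)\<close> cancel and the autocorrelation evaluates at 0.\<close>
    have inner: "(\<Sum>j | flip ?A j \<noteq> 0. flip ?A j * p (rvec l + rvec j)) = p (rvec l + ainv (rvec \<gamma>)) / ?d" for l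
    proof -
      have "(\<Sum>j | flip ?A j \<noteq> 0. flip ?A j * p (rvec l + rvec j)) =
          cnj (\<Sum>j | ?A j \<noteq> 0. ?A j * cnj (p (rvec l - rvec j)))"
        unfolding flip_sum by (simp add: rvec_minus)
      also have "\<dots> = cnj (cnj (p (rvec l - - ainv (rvec \<gamma>))) / ?d)"
        by (subst coset_filter_moment[OF polydeg_cnj[OF polydeg_reflect[OF p]] n]) simp
      finally show ?thesis by simp
    qed
    have "moment ?v p =
       (\<Sum>l | ?A l \<noteq> 0. \<Sum>j | flip ?A j \<noteq> 0. ?A l * flip ?A j * p (rvec (l + j)))"
      by (rule conv_sum[OF A flip_l0[OF A], of "\<lambda>k. p (rvec k)", THEN conjunct2])
    also have "\<dots> = (\<Sum>l | ?A l \<noteq> 0. ?A l * (\<Sum>j | flip ?A j \<noteq> 0. flip ?A j * p (rvec l + rvec j)))"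
      by (simp add: sum_distrib_left rvec_add mult.assoc)
    also have "\<dots> = (\<Sum>l | ?A l \<noteq> 0. ?A l * p (rvec l + ainv (rvec \<gamma>))) / ?d"
      by (simp add: inner sum_divide_distrib)
    also have "\<dots> = p 0 / ?d / ?d"
      using coset_filter_moment[OF polydeg_shift[OF p, of "ainv (rvec \<gamma>)"] n] by simp
    finally show "moment ?v p = (1 / ?d / ?d) * p 0" by simp
  qed (use dM_pos in simp)
qed

lemma ex_signed_squares: "\<exists>s u \<epsilon>. signed_squares (h_filter M a \<gamma>) m s u \<epsilon>"
proof -
  obtain ps where ps: "\<forall>(e, u) \<in> set ps. e \<in> {-1, 1} \<and> u \<in> l0 \<and> annih m u"
    "\<And>\<xi>. of_real (Re (fseries (h_filter M a \<gamma>) \<xi>)) = square_sum ps \<xi>"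
    using vanish_ideal_square_sum[OF annih_vanish_ideal[OF h_filter_props(1,3)]] by blast
  \<comment> \<open>A zero square is added because \<open>signed_squares\<close> asks for at least
    one term, while \<open>ps\<close> may be empty.\<close>
  define qs where "qs = (1 :: int, (\<lambda>_. 0) :: 'n filt) # ps"
  have qs: "\<forall>(e, u) \<in> set qs. e \<in> {-1, 1} \<and> u \<in> l0 \<and> annih m u"
    using ps(1) by (auto simp: qs_def annih_def intro!: l0I[of "{}"])
  have nth: "fst (qs ! i) \<in> {-1, 1}" "snd (qs ! i) \<in> l0" "annih m (snd (qs ! i))" if "i < length qs" for i
    using qs nth_mem[OF that] by (auto simp: case_prod_unfold)
  have "signed_squares (h_filter M a \<gamma>) m (length qs) (\<lambda>t. snd (qs ! (t - 1))) (\<lambda>t. fst (qs ! (t - 1)))"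
    unfolding signed_squares_def
  proof (intro conjI allI ballI)
    fix \<xi>
    have "fseries (h_filter M a \<gamma>) \<xi> = of_real (Re (fseries (h_filter M a \<gamma>) \<xi>))"
      by (simp add: h_filter_props(2))
    also have "\<dots> = square_sum qs \<xi>" unfolding ps(2) by (simp add: qs_def square_sum_def)
    also have "\<dots> = (\<Sum>i<length qs. of_int (fst (qs ! i)) * of_real ((cmod (fseries (snd (qs ! i)) \<xi>))\<^sup>2))"
      unfolding square_sum_def sum_list_sum_nth by (simp add: case_prod_unfold atLeast0LessThan)
    also have "\<dots> = (\<Sum>t=1..length qs. of_int (fst (qs ! (t - 1))) * of_real ((cmod (fseries (snd (qs ! (t - 1))) \<xi>))\<^sup>2))"
      by (simp add: sum.atLeast1_atMost_eq)
    finally show "fseries (h_filter M a \<gamma>) \<xi> = \<dots>" .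
  next
    fix t assume "t \<in> {1..length qs}"
    then have t: "t - 1 < length qs" by auto
    show "snd (qs ! (t - 1)) \<in> l0" "fst (qs ! (t - 1)) \<in> {- 1, 1}" using nth[OF t] by auto
    show "vanishes_O (fseries (snd (qs ! (t - 1)))) m"
      using nth[OF t] by (simp add: vanishes_iff_annih)
  qed (simp add: qs_def)
  then show ?thesis by blast
qed

end

locale filter_bank = interp_filter M a m for M :: "int ^ 'n ^ 'n" and a m +
  fixes \<gamma> :: "nat \<Rightarrow> int ^ 'n" and s :: "nat \<Rightarrow> nat" and u :: "nat \<Rightarrow> nat \<Rightarrow> 'n filt" and \<epsilon> :: "nat \<Rightarrow> nat \<Rightarrow> int"
  assumes \<gamma>_bij: "bij_betw \<gamma> {1..dM M} (Gamma_set M)" and \<gamma>_1: "\<gamma> 1 = 0"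
    and squares: "\<And>j. j \<in> {2..dM M} \<Longrightarrow> signed_squares (h_filter M a (\<gamma> j)) m (s j) (u j) (\<epsilon> j)"
begin

abbreviation "bs \<equiv> all_filters M a \<gamma> s u"
abbreviation "\<epsilon>s \<equiv> all_signs M s \<epsilon>"

lemma \<gamma>_Gamma: "j \<in> {2..dM M} \<Longrightarrow> \<gamma> j \<in> Gamma_set M" "j \<in> {2..dM M} \<Longrightarrow> \<gamma> j \<noteq> 0"
proof -
  assume j: "j \<in> {2..dM M}"
  then show "\<gamma> j \<in> Gamma_set M" using \<gamma>_bij by (auto simp: bij_betw_def)
  show "\<gamma> j \<noteq> 0"
  proof
    assume "\<gamma> j = 0"
    then have "j = 1" using inj_onD[OF bij_betw_imp_inj_on[OF \<gamma>_bij], of j 1] \<gamma>_1 j by simp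
    then show False using j by simp
  qed
qed

lemma sum_Gamma: "(\<Sum>g\<in>Gamma_set M. f g) = f 0 + (\<Sum>j=2..dM M. f (\<gamma> j) :: complex)"
proof -
  have "(\<Sum>g\<in>Gamma_set M. f g) = (\<Sum>j\<in>{1..dM M}. f (\<gamma> j))"
    using sum.reindex_bij_betw[OF \<gamma>_bij, of f] by simp
  also have "{1..dM M} = insert 1 {2..dM M}" using dM_pos by auto
  finally show ?thesis using \<gamma>_1 by simp
qed

lemma signs: "set \<epsilon>s \<subseteq> {-1, 1}"
  using set_all_signs[of M s \<epsilon>] squares by (fastforce simp: signed_squares_def)

lemma bs_props:
  assumes "b \<in> set bs"
  shows "b \<in> l0" "annih m b" "k \<noteq> 0 \<Longrightarrow> b (M *v k) = 0"
proof -
  have "b \<in> l0 \<and> annih m b \<and> (\<forall>k. k \<noteq> 0 \<longrightarrow> b (M *v k) = 0)"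
    using assms unfolding set_all_filters
  proof (elim UnE)
    assume "b \<in> {b_first a}"
    then show ?thesis using b_first_props annih_mono[OF b_first_props(4)] by simp
  next
    assume "b \<in> (\<lambda>j. b_coset M a (\<gamma> j)) ` {2..dM M}"
    then obtain j where j: "j \<in> {2..dM M}" "b = b_coset M a (\<gamma> j)" by blast
    show ?thesis
      using b_coset_props(2,5) annih_mono[OF b_coset_props(4)] \<gamma>_Gamma[OF j(1)] unfolding j(2) by simp
  next
    assume "b \<in> (\<Union>j\<in>{2..dM M}. (\<lambda>t. b_extra M (\<gamma> j) (u j t)) ` {1..s j})"
    then obtain j t where j: "j \<in> {2..dM M}" "t \<in> {1..s j}" "b = b_extra M (\<gamma> j) (u j t)" by blast
    have "u j t \<in> l0" "vanishes_O (fseries (u j t)) m" using squares[OF j(1)] j(2) by (auto simp: signed_squares_def)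
    then show ?thesis using b_extra_props[of "u j t"] \<gamma>_Gamma[OF j(1)] unfolding j(3) by (simp add: vanishes_iff_annih)
  qed
  then show "b \<in> l0" "annih m b" "k \<noteq> 0 \<Longrightarrow> b (M *v k) = 0" by auto
qed

text \<open>In terms of the cosets, \<open>A\<close> is the coset series, \<open>E\<close> the
  character at \<xi> and \<open>X\<close> the character at \<omega>. The squares of \<open>a\<close>
  cancel against \<open>b_first\<close>, the products \<open>|A|^2\<close> against the extra
  filters, the linear terms between \<open>a\<close> and \<open>b_coset\<close>; a character sum
  over \<open>Gamma_set M\<close> remains.\<close>

lemma filter_bank_identity:
  assumes \<omega>: "\<omega> \<in> Omega M"
  shows "cnj (fseries a \<xi>) * fseries a (\<xi> + (2 * pi) *\<^sub>R \<omega>) +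
        (\<Sum>l<length bs. of_int (\<epsilon>s ! l) *
           (cnj (fseries (bs ! l) \<xi>) * fseries (bs ! l) (\<xi> + (2 * pi) *\<^sub>R \<omega>))) = delta \<omega>"
proof -
  let ?d = "of_nat (dM M) :: complex"
  let ?\<eta> = "\<xi> + (2 * pi) *\<^sub>R \<omega>"
  let ?C = "\<lambda>g. cnj (fseries (b_coset M a g) \<xi>) * fseries (b_coset M a g) ?\<eta>"
  let ?X = "\<lambda>j. \<Sum>t=1..s j. of_int (\<epsilon> j t) * (cnj (fseries (b_extra M (\<gamma> j) (u j t)) \<xi>) * fseries (b_extra M (\<gamma> j) (u j t)) ?\<eta>)"
  define X where "X \<gamma> = ochr \<gamma> \<omega>" for \<gamma>
  define A where "A \<gamma> = fseries (cos_f \<gamma>) (actT M \<xi>)" for \<gamma>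
  define E where "E \<gamma> = chr \<gamma> \<xi>" for \<gamma>
  have E: "cnj (E g) * E g = 1" for g by (simp add: E_def)
  have d: "?d \<noteq> 0" using dM_pos by simp
  \<comment> \<open>Interpolation enters here: the coset of 0 contributes a constant, which makes
    \<gamma> = 0 exceptional and lets the index start at 2.\<close>
  have A0: "A 0 = 1 / ?d"
  proof -
    have "cos_f 0 = (\<lambda>k. if k = 0 then 1 / ?d else 0)" by (simp add: coset_filter_def a_mult fun_eq_iff)
    then show ?thesis by (simp add: A_def fseries_single)
  qed
  have ahat: "fseries a \<xi> = 1 / ?d + (\<Sum>j=2..dM M. E (\<gamma> j) * A (\<gamma> j))"
    unfolding fseries_coset_decomp[OF a_l0, of \<xi>] sum_Gamma using A0 by (simp add: A_def E_def)
  have ahat': "fseries a ?\<eta> = 1 / ?d + (\<Sum>j=2..dM M. E (\<gamma> j) * X (\<gamma> j) * A (\<gamma> j))"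
    unfolding fseries_coset_decomp[OF a_l0, of ?\<eta>] sum_Gamma fseries_actT_Omega[OF \<omega>] chr_plus
    using A0 by (simp add: A_def E_def X_def)
  have delta: "(1 + (\<Sum>j=2..dM M. X (\<gamma> j))) / ?d = delta \<omega>"
    using chr_sum_Gamma[OF \<omega>] d unfolding sum_Gamma by (simp add: X_def delta_def)
  have coset: "?C g =
      1 / ?d - cnj (E g * A g) - E g * X g * A g + ?d * X g * (cnj (A g) * A g)" for g
  proof -
    let ?p = "complex_of_real (real (dM M) powr (- 1 / 2))"
    let ?q = "complex_of_real (real (dM M) powr (1 / 2))"
    have "?C g =
        (?p - ?q * cnj (E g * A g)) * (?p - ?q * (E g * X g * A g))"
      unfolding b_coset_props(3) fseries_actT_Omega[OF \<omega>] chr_plus by (simp add: A_def E_def X_def)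
    also have "\<dots> = ?p * ?p - (?p * ?q) * cnj (E g * A g) - (?p * ?q) * (E g * X g * A g) +
        (?q * ?q) * ((cnj (E g) * E g) * X g * (cnj (A g) * A g))"
      by (simp add: algebra_simps)
    finally show ?thesis unfolding dM_powr E by simp
  qed
  have extra: "?X j = X (\<gamma> j) * (1 / ?d) - ?d * X (\<gamma> j) * (cnj (A (\<gamma> j)) * A (\<gamma> j))" if j: "j \<in> {2..dM M}" for j
  proof -
    have sq: "fseries (h_filter M a (\<gamma> j)) (actT M \<xi>) =
        (\<Sum>t=1..s j. of_int (\<epsilon> j t) * complex_of_real ((cmod (fseries (u j t) (actT M \<xi>)))\<^sup>2))"
      using squares[OF j] unfolding signed_squares_def by blast
    have "?X j =
      (\<Sum>t=1..s j. X (\<gamma> j) * (of_int (\<epsilon> j t) * of_real ((cmod (fseries (u j t) (actT M \<xi>)))\<^sup>2)))"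
    proof (rule sum.cong[OF refl])
      fix t assume "t \<in> {1..s j}"
      then have ut: "u j t \<in> l0" using squares[OF j] by (auto simp: signed_squares_def)
      let ?U = "fseries (u j t) (actT M \<xi>)"
      have "cnj (fseries (b_extra M (\<gamma> j) (u j t)) \<xi>) * fseries (b_extra M (\<gamma> j) (u j t)) ?\<eta> =
          (cnj (E (\<gamma> j)) * E (\<gamma> j)) * X (\<gamma> j) * (?U * cnj ?U)"
        unfolding b_extra_props(3)[OF ut] fseries_actT_Omega[OF \<omega>] chr_plus
        by (simp add: E_def X_def mult_ac)
      then show "of_int (\<epsilon> j t) * (cnj (fseries (b_extra M (\<gamma> j) (u j t)) \<xi>) * fseries (b_extra M (\<gamma> j) (u j t)) ?\<eta>) =
          X (\<gamma> j) * (of_int (\<epsilon> j t) * of_real ((cmod ?U)\<^sup>2))"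
        unfolding complex_norm_square E by simp
    qed
    also have "\<dots> = X (\<gamma> j) * fseries (h_filter M a (\<gamma> j)) (actT M \<xi>)"
      unfolding sq sum_distrib_left ..
    also have "fseries (h_filter M a (\<gamma> j)) (actT M \<xi>) = 1 / ?d - ?d * (cnj (A (\<gamma> j)) * A (\<gamma> j))"
      unfolding h_filter_props(2) of_real_diff of_real_mult complex_norm_square by (simp add: A_def)
    finally show ?thesis by (simp add: algebra_simps)
  qed
  let ?J = "{2..dM M}"
  let ?S1 = "\<Sum>j\<in>?J. E (\<gamma> j) * A (\<gamma> j)" and ?S2 = "\<Sum>j\<in>?J. E (\<gamma> j) * X (\<gamma> j) * A (\<gamma> j)"
  have cardJ: "of_nat (card ?J) = ?d - 1" using dM_pos by (simp add: of_nat_diff)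
  \<comment> \<open>The terms with \<open>|A|^2\<close> cancel between \<open>coset\<close> and
    \<open>extra\<close> for each \<open>j\<close>; what is left is linear in
    \<open>A\<close>.\<close>
  have main: "(\<Sum>j\<in>?J. ?C (\<gamma> j)) +
     (\<Sum>j\<in>?J. ?X j)
     = (?d - 1) / ?d - cnj ?S1 - ?S2 + (\<Sum>j\<in>?J. X (\<gamma> j)) / ?d"
  proof -
    have "(\<Sum>j\<in>?J. ?C (\<gamma> j)) +
     (\<Sum>j\<in>?J. ?X j)
      = (\<Sum>j\<in>?J. 1 / ?d - cnj (E (\<gamma> j) * A (\<gamma> j)) - E (\<gamma> j) * X (\<gamma> j) * A (\<gamma> j) + X (\<gamma> j) / ?d)"
      unfolding sum.distrib[symmetric]
    proof (rule sum.cong[OF refl])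
      fix j assume j: "j \<in> ?J"
      show "?C (\<gamma> j) +
        ?X j =
        1 / ?d - cnj (E (\<gamma> j) * A (\<gamma> j)) - E (\<gamma> j) * X (\<gamma> j) * A (\<gamma> j) + X (\<gamma> j) / ?d"
        unfolding coset extra[OF j] by simp
    qed
    also have "\<dots> = of_nat (card ?J) * (1 / ?d) - cnj ?S1 - ?S2 + (\<Sum>j\<in>?J. X (\<gamma> j)) / ?d"
      unfolding sum.distrib sum_subtractf sum_constant sum_divide_distrib cnj_sum ..
    finally show ?thesis unfolding cardJ by simp
  qed
  have "cnj (fseries a \<xi>) * fseries a ?\<eta> + (\<Sum>l<length bs. of_int (\<epsilon>s ! l) *
           (cnj (fseries (bs ! l) \<xi>) * fseries (bs ! l) ?\<eta>)) =
     cnj (fseries a \<xi>) * fseries a ?\<eta> - cnj (1 - fseries a \<xi>) * (1 - fseries a ?\<eta>) +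
     ((?d - 1) / ?d - cnj ?S1 - ?S2 + (\<Sum>j\<in>?J. X (\<gamma> j)) / ?d)"
    unfolding main[symmetric] signed_sum_all_filters[where X = "\<lambda>b. cnj (fseries b \<xi>) * fseries b ?\<eta>"] b_first_props(3)
    by simp
  also have "\<dots> = cnj (fseries a \<xi>) - cnj ?S1 + (fseries a ?\<eta> - ?S2) - 1 +
     ((?d - 1) / ?d + (\<Sum>j\<in>?J. X (\<gamma> j)) / ?d)"
    by (simp add: algebra_simps)
  also have "cnj (fseries a \<xi>) - cnj ?S1 = 1 / ?d" unfolding ahat by simp
  also have "fseries a ?\<eta> - ?S2 = 1 / ?d" unfolding ahat' by simp
  also have "1 / ?d + 1 / ?d - 1 + ((?d - 1) / ?d + (\<Sum>j\<in>?J. X (\<gamma> j)) / ?d) = delta \<omega>"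
    unfolding delta[symmetric] using d by (simp add: field_simps)
  finally show ?thesis .
qed

lemma quasi_tight_bank: "quasi_tight_filter_bank M a bs \<epsilon>s"
  unfolding quasi_tight_filter_bank_def
  using a_l0 bs_props(1) length_all_filters signs filter_bank_identity by (simp add: mult.assoc subset_iff)

lemma bs_vm: "l < length bs \<Longrightarrow> vm_filter (bs ! l) \<ge> enat m"
  using bs_props(1,2)[OF nth_mem, of l] by (auto intro!: vm_filter_ge)

end

section \<open>Powers of the inverse dilation\<close>

text \<open>The vector p(B) v by Horner's scheme, which needs only the action of \<open>B\<close> on
  vectors.\<close>

definition papp :: "complex ^ 'n ^ 'n \<Rightarrow> complex ^ 'n \<Rightarrow> complex poly \<Rightarrow> complex ^ 'n" where
  "papp B v p = fold_coeffs (\<lambda>c x. c *s v + B *v x) p 0"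

lemma papp_0 [simp]: "papp B v 0 = 0"
  by (simp add: papp_def)

lemma papp_pCons [simp]: "papp B v (pCons c p) = c *s v + B *v papp B v p"
  by (cases "c = 0"; cases "p = 0") (simp_all add: papp_def)

lemma papp_add: "papp B v (p + q) = papp B v p + papp B v q"
proof (induction p q rule: poly_induct2)
  case (pCons a p b q)
  then show ?case by (simp add: vector_sadd_rdistrib matrix_vector_right_distrib)
qed simp

lemma papp_smult: "papp B v (smult c p) = c *s papp B v p"
  by (induction p) (simp_all add: vector_add_ldistrib vector_scalar_commute)

lemma papp_diff: "papp B v (p - q) = papp B v p - papp B v q"
  using papp_add[of B v "p - q" q] by (simp add: algebra_simps)

lemma papp_linear_factor: "papp B v ([:-z, 1:] * q) = B *v papp B v q - z *s papp B v q"
  by (simp add: papp_diff papp_smult)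

lemma papp_linear_factor': "papp B (B *v v - z *s v) q = B *v papp B v q - z *s papp B v q"
proof (induction q)
  case (pCons c q)
  then show ?case
    by (simp add: matrix_vector_mult_diff_distrib matrix_vector_right_distrib vector_add_ldistrib
        vector_sub_rdistrib vector_ssub_ldistrib vector_scalar_commute vector_smult_assoc mult.commute)
qed simp

lemma papp_monom: "papp B v (monom c i) = c *s ((\<lambda>x. B *v x) ^^ i) v"
  by (induction i) (simp_all add: monom_0 monom_Suc vector_scalar_commute)

lemma papp_sum: "papp B v (\<Sum>i\<in>I. p i) = (\<Sum>i\<in>I. papp B v (p i))"
  by (induction I rule: infinite_finite_induct) (simp_all add: papp_add)

lemma scaleR_conv_smult: "c *\<^sub>R (x :: complex ^ 'n) = of_real c *s x"
  unfolding vec_eq_iff vector_scaleR_component vector_smult_component by (simp add: scaleR_conv_of_real)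

text \<open>Among DIM + 1 iterates of \<open>v\<close> two coincide or a linear relation holds. The
  relation is real, because dimension and dependence are those of the real vector space; its
  coefficients are then read as complex numbers.\<close>

lemma ex_annihilating_poly: "\<exists>p. p \<noteq> 0 \<and> papp B v p = 0"
proof -
  let ?D = "DIM(complex ^ 'a)"
  let ?x = "\<lambda>i. ((\<lambda>x. B *v x) ^^ i) v"
  show ?thesis
  proof (cases "inj_on ?x {..?D}")
    case False
    then obtain i j where ij: "?x i = ?x j" "i \<noteq> j" by (auto simp: inj_on_def)
    let ?p = "monom 1 i + monom (- 1) j :: complex poly"
    have "coeff ?p i = 1" using ij by simp
    then have "?p \<noteq> 0" by (metis coeff_0 zero_neq_one)
    moreover have "papp B v ?p = 0" using ij by (simp add: papp_add papp_monom)
    ultimately show ?thesis by blast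
  next
    case True
    let ?S = "?x ` {..?D}"
    have "card ?S = Suc ?D" using True by (simp add: card_image)
    then have "dependent ?S" using independent_bound by fastforce
    then obtain c where c: "\<exists>y\<in>?S. c y \<noteq> 0" "(\<Sum>y\<in>?S. c y *\<^sub>R y) = 0"
      using dependent_finite[of ?S] by auto
    let ?p = "\<Sum>i\<le>?D. monom (complex_of_real (c (?x i))) i"
    obtain i where i: "i \<le> ?D" "c (?x i) \<noteq> 0" using c(1) by auto
    have "coeff ?p i = of_real (c (?x i))"
      using i by (simp add: coeff_sum if_distrib[of complex_of_real] sum.delta' )
    then have "?p \<noteq> 0" using i by (metis coeff_0 of_real_eq_0_iff)
    moreover have "papp B v ?p = 0"
      using c(2) True by (simp add: papp_sum papp_monom sum.reindex scaleR_conv_smult)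
    ultimately show ?thesis by blast
  qed
qed

primrec factors_app :: "complex ^ 'n ^ 'n \<Rightarrow> complex list \<Rightarrow> complex ^ 'n \<Rightarrow> complex ^ 'n" where
  "factors_app B [] v = v"
| "factors_app B (z # zs) v = factors_app B zs (B *v v - z *s v)"

lemma ex_eigen_factors:
  "\<exists>zs. (\<forall>z\<in>set zs. \<exists>w. w \<noteq> 0 \<and> B *v w = z *s w) \<and> factors_app B zs v = 0"
proof -
  have "\<exists>zs. (\<forall>z\<in>set zs. \<exists>w. w \<noteq> 0 \<and> B *v w = z *s w) \<and> factors_app B zs v = 0"
    if "p \<noteq> 0" "papp B v p = 0" for p v
    using that
  proof (induction "degree p" arbitrary: p v)
    case 0
    then obtain c where "p = [:c:]" "c \<noteq> 0" by (metis degree_eq_zeroE pCons_0_0)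
    then have "v = 0" using 0(3) by simp
    then show ?case by (intro exI[of _ "[]"]) simp
  next
    case (Suc n)
    then obtain z where "poly p z = 0"
      using fundamental_theorem_of_algebra[of p] by (auto simp: constant_degree)
    then obtain q where p: "p = [:-z, 1:] * q" by (auto simp: poly_eq_0_iff_dvd dvd_def)
    then have q0: "q \<noteq> 0" using Suc.prems by auto
    have "degree ([:-z, 1:] * q) = 1 + degree q" using q0 by (subst degree_mult_eq) auto
    then have deg: "n = degree q" using Suc.hyps(2) p by simp
    show ?case
    proof (cases "papp B v q = 0")
      case True
      then show ?thesis using Suc.hyps(1)[OF deg q0] by blast
    next
      case False
      have eig: "B *v papp B v q - z *s papp B v q = 0"
        using Suc.prems(2) unfolding p papp_linear_factor .
      then have "papp B (B *v v - z *s v) q = 0" unfolding papp_linear_factor' .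
      from Suc.hyps(1)[OF deg q0 this] obtain zs where
        "\<forall>z\<in>set zs. \<exists>w. w \<noteq> 0 \<and> B *v w = z *s w" "factors_app B zs (B *v v - z *s v) = 0" by blast
      then show ?thesis using False eig by (intro exI[of _ "z # zs"]) auto
    qed
  qed
  then show ?thesis using ex_annihilating_poly[of B v] by blast
qed

lemma contraction_tendsto_0:
  fixes x :: "nat \<Rightarrow> complex"
  assumes "\<And>n. x (Suc n) = z * x n + e n" "e \<longlonglongrightarrow> 0" "cmod z < 1"
  shows "x \<longlonglongrightarrow> 0"
proof (rule LIMSEQ_I)
  fix \<delta> :: real assume "\<delta> > 0"
  let ?r = "cmod z" and ?\<eta> = "\<delta> / 2"
  have "?\<eta> * (1 - ?r) > 0" using \<open>\<delta> > 0\<close> assms(3) by simp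
  then obtain N where N: "\<And>n. n \<ge> N \<Longrightarrow> cmod (e n) < ?\<eta> * (1 - ?r)"
    using LIMSEQ_D[OF assms(2)] by (metis diff_zero)
  have step: "cmod (x (N + k)) \<le> ?\<eta> + ?r ^ k * cmod (x N)" for k
  proof (induction k)
    case (Suc k)
    have "cmod (x (N + Suc k)) \<le> ?r * cmod (x (N + k)) + cmod (e (N + k))"
      using norm_triangle_ineq[of "z * x (N + k)" "e (N + k)"] assms(1) by (simp add: norm_mult)
    also have "\<dots> \<le> ?r * (?\<eta> + ?r ^ k * cmod (x N)) + ?\<eta> * (1 - ?r)"
      using Suc N[of "N + k"] by (intro add_mono mult_left_mono) auto
    also have "\<dots> = ?\<eta> + ?r ^ Suc k * cmod (x N)" by (simp add: field_simps)
    finally show ?case .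
  qed (use \<open>\<delta> > 0\<close> in simp)
  have "(\<lambda>k. ?r ^ k * cmod (x N)) \<longlonglongrightarrow> 0"
    using assms(3) by (intro tendsto_mult_left_zero LIMSEQ_power_zero) auto
  from LIMSEQ_D[OF this, of ?\<eta>] \<open>\<delta> > 0\<close> obtain K where K: "\<And>k. k \<ge> K \<Longrightarrow> ?r ^ k * cmod (x N) < ?\<eta>"
    by auto
  show "\<exists>no. \<forall>n\<ge>no. norm (x n - 0) < \<delta>"
  proof (intro exI allI impI)
    fix n assume "n \<ge> N + K"
    then obtain k where k: "n = N + k" "k \<ge> K" by (metis add.assoc le_Suc_ex le_add1)
    show "norm (x n - 0) < \<delta>" using step[of k] K[OF k(2)] k(1) by simp
  qed
qed

text \<open>The iterates w_n of (B - z) v tend to 0 by induction, and those of \<open>v\<close>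
  satisfy x_(n+1) = z x_n + w_n, a contraction with vanishing perturbation. Treating one factor at a
  time does the work of a normal form.\<close>

lemma powers_tendsto_0_aux:
  assumes "factors_app B zs v = 0" "\<And>z. z \<in> set zs \<Longrightarrow> cmod z < 1"
  shows "(\<lambda>n. (((\<lambda>x. B *v x) ^^ n) v) $ i) \<longlonglongrightarrow> 0"
  using assms
proof (induction zs arbitrary: v i)
  case Nil
  have "((\<lambda>x. B *v x) ^^ n) 0 = 0" for n by (induction n) simp_all
  then show ?case using Nil by simp
next
  case (Cons z zs)
  let ?w = "B *v v - z *s v"
  have pow: "((\<lambda>x. B *v x) ^^ n) ?w = ((\<lambda>x. B *v x) ^^ Suc n) v - z *s ((\<lambda>x. B *v x) ^^ n) v" for n
    by (induction n) (simp_all add: matrix_vector_mult_diff_distrib vector_scalar_commute)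
  have "(\<lambda>n. (((\<lambda>x. B *v x) ^^ n) ?w) $ i) \<longlonglongrightarrow> 0"
    using Cons.prems by (intro Cons.IH) auto
  moreover have "(((\<lambda>x. B *v x) ^^ Suc n) v) $ i =
      z * (((\<lambda>x. B *v x) ^^ n) v) $ i + (((\<lambda>x. B *v x) ^^ n) ?w) $ i" for n
    unfolding pow by simp
  ultimately show ?case using Cons.prems(2)[of z] by (intro contraction_tendsto_0[of "\<lambda>n. _ n $ i"]) auto
qed

context expanding
begin

abbreviation Mc :: "complex ^ 'n ^ 'n" where "Mc \<equiv> \<chi> i j. complex_of_int (M $ i $ j)"

lemma det_Mc: "det Mc \<noteq> 0"
  using of_int_det[of M, where 'a = complex] det_nz by (metis of_int_eq_0_iff)

lemma Mc_inverse: "matrix_inv Mc ** Mc = mat 1" "Mc ** matrix_inv Mc = mat 1"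
  using matrix_inv_inverse[of Mc] det_Mc by (auto simp: invertible_det_nz)

lemma inverse_eigenvalue:
  assumes "w \<noteq> 0" "matrix_inv Mc *v w = z *s w" shows "cmod z < 1"
proof -
  have "w = Mc *v (matrix_inv Mc *v w)" by (simp add: matrix_vector_mul_assoc Mc_inverse)
  also have "\<dots> = z *s (Mc *v w)" unfolding assms(2) by (simp add: vector_scalar_commute)
  finally have w: "w = z *s (Mc *v w)" .
  then have z: "z \<noteq> 0" using assms(1) by auto
  have "(1 / z) *s w = (1 / z) *s (z *s (Mc *v w))" using w by simp
  then have "Mc *v w = (1 / z) *s w" using z by (simp add: vector_smult_assoc)
  then have "1 / z \<in> eigenvals M" using assms(1) unfolding eigenvals_def by blast
  then have "cmod (1 / z) > 1" using dilation by (auto simp: dilation_matrix_def)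
  then show ?thesis using z by (simp add: norm_divide field_simps)
qed

definition cvec :: "real ^ 'n \<Rightarrow> complex ^ 'n" where "cvec x = (\<chi> i. of_real (x $ i))"

lemma cvec_act: "Mc *v cvec x = cvec (act M x)"
  by (simp add: cvec_def act_def rmat_def matrix_vector_mult_def vec_eq_iff)

lemma cvec_ainv: "matrix_inv Mc *v cvec x = cvec (ainv x)"
proof -
  have "matrix_inv Mc *v cvec x = matrix_inv Mc *v (Mc *v cvec (ainv x))" by (simp add: cvec_act)
  then show ?thesis by (simp only: matrix_vector_mul_assoc Mc_inverse matrix_vector_mul_lid)
qed

lemma cvec_ainv_pow: "((\<lambda>x. matrix_inv Mc *v x) ^^ n) (cvec x) = cvec ((ainv ^^ n) x)"
  by (induction n) (simp_all add: cvec_ainv)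

lemma ainv_pow_tendsto_0: "(\<lambda>n. (ainv ^^ n) x) \<longlonglongrightarrow> 0"
proof (rule vec_tendstoI)
  fix i
  obtain zs where zs: "\<forall>z\<in>set zs. \<exists>w. w \<noteq> 0 \<and> matrix_inv Mc *v w = z *s w" "factors_app (matrix_inv Mc) zs (cvec x) = 0"
    using ex_eigen_factors by blast
  have "(\<lambda>n. (((\<lambda>x. matrix_inv Mc *v x) ^^ n) (cvec x)) $ i) \<longlonglongrightarrow> 0"
    using zs inverse_eigenvalue by (intro powers_tendsto_0_aux) auto
  then have "(\<lambda>n. complex_of_real ((ainv ^^ n) x $ i)) \<longlonglongrightarrow> of_real 0"
    unfolding cvec_ainv_pow by (simp add: cvec_def)
  then show "(\<lambda>n. (ainv ^^ n) x $ i) \<longlonglongrightarrow> 0 $ i" by (simp only: tendsto_of_real_iff zero_index)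
qed

lemma linear_ainv: "linear ainv"
  unfolding ainv_def[abs_def] by simp

lemma linear_ainv_pow: "linear (ainv ^^ n)"
proof (induction n)
  case (Suc n)
  then show ?case using linear_compose[OF _ linear_ainv] by (simp add: comp_def)
qed (simp add: linear_ident)

lemma ainv_pow_add: "(ainv ^^ n) (x + y) = (ainv ^^ n) x + (ainv ^^ n) y"
  by (rule linear_add[OF linear_ainv_pow])

lemma ainv_pow_diff: "(ainv ^^ n) (x - y) = (ainv ^^ n) x - (ainv ^^ n) y"
  by (rule linear_diff[OF linear_ainv_pow])

text \<open>Convergence on the finitely many basis vectors yields a block of \<open>N\<close> steps
  that halves every norm; a geometric rate follows by division of \<open>n\<close> by
  \<open>N\<close>.\<close>

lemma ainv_pow_bound:
  "\<exists>C l. C > 0 \<and> 0 < l \<and> l < 1 \<and> (\<forall>n x. norm ((ainv ^^ n) x) \<le> C * l ^ n * norm x)"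
proof -
  let ?c = "real CARD('n)"
  have c: "?c > 0" by simp
  \<comment> \<open>Summing over the \<open>?c\<close> coordinates of a vector turns this bound on
    the basis into the factor 1 / 2.\<close>
  have "\<forall>i. \<forall>\<^sub>F n in sequentially. norm ((ainv ^^ n) (axis i 1)) < 1 / (2 * ?c)"
  proof
    fix i
    show "\<forall>\<^sub>F n in sequentially. norm ((ainv ^^ n) (axis i 1)) < 1 / (2 * ?c)"
      using tendstoD[OF ainv_pow_tendsto_0[of "axis i 1"], of "1 / (2 * ?c)"] c by simp
  qed
  then have "\<forall>\<^sub>F n in sequentially. \<forall>i. norm ((ainv ^^ n) (axis i 1)) < 1 / (2 * ?c)"
    by (simp add: eventually_all_finite)
  from eventually_conj[OF this eventually_gt_at_top[of 0]]
  obtain N where N: "\<And>i. norm ((ainv ^^ N) (axis i 1)) < 1 / (2 * ?c)" "N > 0"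
    by (auto simp: eventually_sequentially)
  have half: "norm ((ainv ^^ N) x) \<le> (1 / 2) * norm x" for x
  proof -
    have "(ainv ^^ N) x = (ainv ^^ N) (\<Sum>i\<in>UNIV. x $ i *\<^sub>R axis i 1)"
      using basis_expansion[of x] by (simp add: scalar_mult_eq_scaleR)
    also have "\<dots> = (\<Sum>i\<in>UNIV. x $ i *\<^sub>R (ainv ^^ N) (axis i 1))"
      by (simp add: linear_sum[OF linear_ainv_pow] linear_cmul[OF linear_ainv_pow])
    also have "norm \<dots> \<le> (\<Sum>i\<in>(UNIV :: 'n set). norm x * (1 / (2 * ?c)))"
    proof (rule sum_norm_le)
      fix i
      have "\<bar>x $ i\<bar> * norm ((ainv ^^ N) (axis i 1)) \<le> norm x * (1 / (2 * ?c))"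
        by (intro mult_mono component_le_norm_cart less_imp_le[OF N(1)]) auto
      then show "norm (x $ i *\<^sub>R (ainv ^^ N) (axis i 1)) \<le> norm x * (1 / (2 * ?c))" by simp
    qed
    finally show ?thesis by simp
  qed
  have "\<exists>K. \<forall>n<N. \<forall>x. norm ((ainv ^^ n) x) \<le> K * norm x"
  proof -
    have "\<forall>n. \<exists>K. \<forall>x. norm ((ainv ^^ n) x) \<le> K * norm x"
      using linear_bounded[OF linear_ainv_pow] by blast
    then obtain K where K: "\<And>n x. norm ((ainv ^^ n) x) \<le> K n * norm x" by metis
    have "norm ((ainv ^^ n) x) \<le> Max (K ` {..<N}) * norm x" if "n < N" for n x
      using K[of n x] that by (meson Max_ge finite_imageI finite_lessThan imageI lessThan_iff mult_right_mono norm_ge_zero order_trans)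
    then show ?thesis by blast
  qed
  then obtain K where K: "\<And>n x. n < N \<Longrightarrow> norm ((ainv ^^ n) x) \<le> K * norm x" by blast
  define K' where "K' = max K 1"
  have K': "norm ((ainv ^^ n) x) \<le> K' * norm x" if "n < N" for n x
    using K[OF that, of x] by (smt (verit) K'_def mult_right_mono norm_ge_zero)
  \<comment> \<open>The rate of one step is the N-th root of the rate of a block; an incomplete
    block costs at most the factor 2.\<close>
  define l where "l = root N (1 / 2)"
  have l: "0 < l" "l < 1" "l ^ N = 1 / 2" using N(2) by (auto simp: l_def real_root_lt_1_iff)
  have blocks: "norm ((ainv ^^ (N * q)) x) \<le> (1 / 2) ^ q * norm x" for q x
  proof (induction q)
    case (Suc q)
    have "(ainv ^^ (N * Suc q)) x = (ainv ^^ N) ((ainv ^^ (N * q)) x)" by (simp add: funpow_add)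
    then show ?case using half[of "(ainv ^^ (N * q)) x"] Suc by simp
  qed simp
  have "norm ((ainv ^^ n) x) \<le> (2 * K') * l ^ n * norm x" for n x
  proof -
    have n: "n = n mod N + N * (n div N)" by simp
    have "(ainv ^^ n) x = (ainv ^^ (n mod N)) ((ainv ^^ (N * (n div N))) x)"
      by (subst n) (simp only: funpow_add comp_apply)
    then have "norm ((ainv ^^ n) x) \<le> K' * ((1 / 2) ^ (n div N) * norm x)"
      using K'[of "n mod N" "(ainv ^^ (N * (n div N))) x"] blocks[of "n div N" x] N(2)
      by (smt (verit) K'_def mod_less_divisor mult_left_mono)
    also have "(1 / 2) ^ (n div N) = l ^ (N * (n div N))" by (simp add: power_mult l(3))
    also have "\<dots> \<le> 2 * l ^ n"
    proof -
      have "l ^ N \<le> l ^ (n mod N)" using l N(2) by (intro power_decreasing) (auto intro: less_imp_le)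
      then have "l ^ (N * (n div N)) * (1 / 2) \<le> l ^ (N * (n div N)) * l ^ (n mod N)"
        using l by (intro mult_left_mono) auto
      also have "\<dots> = l ^ n" using n by (metis power_add add.commute)
      finally show ?thesis by simp
    qed
    finally show ?thesis using K'_def by (simp add: mult.assoc mult_left_mono mult_right_mono)
  qed
  then show ?thesis using l K'_def by (intro exI[of _ "2 * K'"] exI[of _ l]) auto
qed

definition invC :: real where
  "invC = (SOME C. \<exists>l. C > 0 \<and> 0 < l \<and> l < 1 \<and> (\<forall>n x. norm ((ainv ^^ n) x) \<le> C * l ^ n * norm x))"

definition invL :: real where
  "invL = (SOME l. invC > 0 \<and> 0 < l \<and> l < 1 \<and> (\<forall>n x. norm ((ainv ^^ n) x) \<le> invC * l ^ n * norm x))"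

lemma inv_bounds: "invC > 0" "0 < invL" "invL < 1" "norm ((ainv ^^ n) x) \<le> invC * invL ^ n * norm x"
proof -
  have "\<exists>l. invC > 0 \<and> 0 < l \<and> l < 1 \<and> (\<forall>n x. norm ((ainv ^^ n) x) \<le> invC * l ^ n * norm x)"
    unfolding invC_def by (rule someI_ex[OF ainv_pow_bound])
  from someI_ex[OF this, folded invL_def]
  show "invC > 0" "0 < invL" "invL < 1" "norm ((ainv ^^ n) x) \<le> invC * invL ^ n * norm x" by blast+
qed

lemma inner_invT_pow: "x \<bullet> (act_invT M ^^ n) y = (ainv ^^ n) x \<bullet> y"
proof (induction n arbitrary: x)
  case (Suc n)
  have "x \<bullet> (act_invT M ^^ Suc n) y = ainv x \<bullet> (act_invT M ^^ n) y" by (simp add: inner_act_invT)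
  also have "\<dots> = (ainv ^^ n) (ainv x) \<bullet> y" by (rule Suc)
  finally show ?case by (simp only: funpow_Suc_right comp_apply)
qed simp

text \<open>The adjoint inherits the bound with the same constants: the squared norm of the iterate
  is the inner product of its image under \<open>ainv ^^ n\<close> with \<open>y\<close>.\<close>

lemma invT_bound: "norm ((act_invT M ^^ n) y) \<le> invC * invL ^ n * norm y"
proof -
  let ?z = "(act_invT M ^^ n) y"
  have "norm ?z * norm ?z = (ainv ^^ n) ?z \<bullet> y"
    by (simp add: inner_invT_pow[symmetric] dot_square_norm power2_eq_square)
  also have "\<dots> \<le> norm ((ainv ^^ n) ?z) * norm y" by (rule norm_cauchy_schwarz)
  also have "\<dots> \<le> (invC * invL ^ n * norm ?z) * norm y"
    by (intro mult_right_mono inv_bounds) simp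
  finally have "norm ?z * norm ?z \<le> (invC * invL ^ n * norm y) * norm ?z" by (simp add: mult_ac)
  then show ?thesis
    using inv_bounds by (cases "?z = 0") (auto simp: mult_le_cancel_right)
qed

text \<open>\<open>spec_radius\<close> is a \<open>Max\<close>, which is meaningful for a finite
  nonempty set only. The eigenvalues are roots of a polynomial whose value at 0 is the determinant,
  hence nonzero.\<close>

lemma eigenvals_finite: "finite (eigenvals M)"
proof -
  define P where "P = (\<chi> i j. [: complex_of_int (M $ i $ j), - (if i = j then 1 else 0) :]) "
  have P: "poly (det P) z = det (\<chi> i j. complex_of_int (M $ i $ j) - (if i = j then z else 0))" for z
    unfolding det_def by (simp add: P_def poly_sum poly_prod if_distrib[of "\<lambda>x. z * x"] cong: if_cong)
  have "poly (det P) 0 \<noteq> 0"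
  proof -
    have "(\<chi> i j. complex_of_int (M $ i $ j) - (if i = j then 0 else 0)) = Mc" by (simp add: vec_eq_iff)
    then show ?thesis unfolding P using det_Mc by simp
  qed
  then have "det P \<noteq> 0" by auto
  moreover have "eigenvals M \<subseteq> {z. poly (det P) z = 0}"
  proof
    fix z assume "z \<in> eigenvals M"
    then obtain v where v: "v \<noteq> 0" "Mc *v v = z *s v" by (auto simp: eigenvals_def)
    let ?Q = "\<chi> i j. complex_of_int (M $ i $ j) - (if i = j then z else 0)"
    have "?Q *v v = Mc *v v - z *s v"
      by (simp add: matrix_vector_mult_def vec_eq_iff left_diff_distrib sum_subtractf if_distrib[of "\<lambda>x. x * _"] cong: if_cong)
    then have "?Q *v v = 0" using v by simp
    then have "\<not> invertible ?Q" using v(1) unfolding invertible_left_inverse matrix_left_invertible_ker by blast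
    then show "z \<in> {z. poly (det P) z = 0}" by (simp add: P invertible_det_nz)
  qed
  ultimately show ?thesis using poly_roots_finite finite_subset by blast
qed

text \<open>A nonzero vector is not killed by the empty list of factors, so the list from
  \<open>ex_eigen_factors\<close> has an entry.\<close>

lemma eigenvals_nonempty: "eigenvals M \<noteq> {}"
proof -
  obtain zs where zs: "\<forall>z\<in>set zs. \<exists>w. w \<noteq> 0 \<and> Mc *v w = z *s w" "factors_app Mc zs (\<chi> i. 1) = 0"
    using ex_eigen_factors by blast
  have "zs \<noteq> []" using zs(2) by (auto simp: vec_eq_iff)
  then obtain z where "z \<in> set zs" by (cases zs) auto
  then show ?thesis using zs(1) unfolding eigenvals_def by blast
qed

lemma spec_radius_gt_1: "spec_radius M > 1"
  unfolding spec_radius_def using eigenvals_finite eigenvals_nonempty dilation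
  by (auto simp: dilation_matrix_def Max_gr_iff)

end

section \<open>Growth of differences under subdivision\<close>

text \<open>Echelon form: eliminating one point of the finite support at a time produces a spanning list
  with respect to which coordinates are bounded by the sup norm.\<close>

lemma bounded_coordinates:
  fixes W :: "('k \<Rightarrow> complex) set"
  assumes "finite K" "\<And>w k. w \<in> W \<Longrightarrow> k \<notin> K \<Longrightarrow> w k = 0"
    "\<And>v w. v \<in> W \<Longrightarrow> w \<in> W \<Longrightarrow> (\<lambda>k. v k + w k) \<in> W" "\<And>c w. w \<in> W \<Longrightarrow> (\<lambda>k. c * w k) \<in> W"
  shows "\<exists>B C. set B \<subseteq> W \<and> C \<ge> 0 \<and> (\<forall>w\<in>W. \<forall>N. (\<forall>k. cmod (w k) \<le> N) \<longrightarrow>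
    (\<exists>t. (\<forall>k. w k = (\<Sum>i<length B. t i * (B ! i) k)) \<and> (\<forall>i<length B. cmod (t i) \<le> C * N)))"
  using assms
proof (induction K arbitrary: W rule: finite_induct)
  case empty
  show ?case by (rule exI[of _ "[]"], rule exI[of _ 0]) (use empty in auto)
next
  case (insert k0 K)
  show ?case
  proof (cases "\<forall>w\<in>W. w k0 = 0")
    case True
    have "w k = 0" if "w \<in> W" "k \<notin> K" for w k
      using insert.prems(1)[OF that(1), of k] True that by (cases "k = k0") auto
    then show ?thesis by (rule insert.IH) (use insert.prems in auto)
  next
    case False
    then obtain w0 where w0: "w0 \<in> W" "w0 k0 \<noteq> 0" by blast
    define w1 where "w1 = (\<lambda>k. (1 / w0 k0) * w0 k)"
    have w1: "w1 \<in> W" "w1 k0 = 1"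
      unfolding w1_def using insert.prems(3)[OF w0(1), of "1 / w0 k0"] w0(2) by auto
    define A where "A = (\<Sum>k\<in>insert k0 K. cmod (w1 k))"
    have A: "cmod (w1 k) \<le> A" "A \<ge> 0" for k
    proof -
      show "A \<ge> 0" by (simp add: A_def sum_nonneg)
      then show "cmod (w1 k) \<le> A"
        using insert.prems(1)[OF w1(1), of k] member_le_sum[of k "insert k0 K" "\<lambda>k. cmod (w1 k)"] insert.hyps
        by (cases "k \<in> insert k0 K") (auto simp: A_def)
    qed
    let ?W = "{w \<in> W. w k0 = 0}"
    have W0: "w k = 0" if "w \<in> ?W" "k \<notin> K" for w k
      using insert.prems(1)[of w k] that by (cases "k = k0") auto
    have "\<exists>B C. set B \<subseteq> ?W \<and> C \<ge> 0 \<and> (\<forall>w\<in>?W. \<forall>N. (\<forall>k. cmod (w k) \<le> N) \<longrightarrow>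
      (\<exists>t. (\<forall>k. w k = (\<Sum>i<length B. t i * (B ! i) k)) \<and> (\<forall>i<length B. cmod (t i) \<le> C * N)))"
      by (rule insert.IH) (rule W0, assumption+, use insert.prems in auto)
    then obtain B C where B: "set B \<subseteq> ?W" "C \<ge> 0" and
      coord: "\<And>w N. w \<in> ?W \<Longrightarrow> (\<And>k. cmod (w k) \<le> N) \<Longrightarrow>
        \<exists>t. (\<forall>k. w k = (\<Sum>i<length B. t i * (B ! i) k)) \<and> (\<forall>i<length B. cmod (t i) \<le> C * N)"
      by blast
    \<comment> \<open>The new coordinate is the value at \<open>k0\<close>, at most
      \<open>N\<close>. Clearing it with \<open>w1\<close> enlarges the sup norm by the factor
      \<open>1 + A\<close>, hence the constant \<open>1 + C * (1 + A)\<close>.\<close>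
    show ?thesis
    proof (rule exI[of _ "w1 # B"], rule exI[of _ "1 + C * (1 + A)"], intro conjI ballI allI impI)
      show "set (w1 # B) \<subseteq> W" using B w1 by auto
      show "0 \<le> 1 + C * (1 + A)" using B(2) A(2) by simp
      fix w N assume w: "w \<in> W" and N: "\<forall>k. cmod (w k) \<le> N"
      then have N0: "N \<ge> 0" using norm_ge_zero order_trans by blast
      let ?v = "\<lambda>k. w k + (- w k0) * w1 k"
      have "?v \<in> ?W" using insert.prems(2)[OF w insert.prems(3)[OF w1(1), of "- w k0"]] w1(2) by simp
      moreover have "cmod (?v k) \<le> N * (1 + A)" for k
      proof -
        have "cmod (?v k) \<le> cmod (w k) + cmod (w k0) * cmod (w1 k)"
          using norm_triangle_ineq[of "w k" "(- w k0) * w1 k"] by (simp add: norm_mult)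
        also have "\<dots> \<le> N + N * A" using N A(1) N0 by (intro add_mono mult_mono) auto
        finally show ?thesis by (simp add: algebra_simps)
      qed
      ultimately obtain t where t: "\<And>k. ?v k = (\<Sum>i<length B. t i * (B ! i) k)"
        "\<And>i. i < length B \<Longrightarrow> cmod (t i) \<le> C * (N * (1 + A))"
        using coord[of ?v "N * (1 + A)"] by blast
      show "\<exists>t. (\<forall>k. w k = (\<Sum>i<length (w1 # B). t i * ((w1 # B) ! i) k)) \<and>
          (\<forall>i<length (w1 # B). cmod (t i) \<le> (1 + C * (1 + A)) * N)"
      proof (intro exI[of _ "case_nat (w k0) t"] conjI allI impI)
        fix k
        show "w k = (\<Sum>i<length (w1 # B). (case i of 0 \<Rightarrow> w k0 | Suc i \<Rightarrow> t i) * ((w1 # B) ! i) k)"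
          using t(1)[of k] unfolding length_Cons sum.lessThan_Suc_shift by (simp add: algebra_simps)
      next
        fix i assume i: "i < length (w1 # B)"
        have "cmod (w k0) \<le> N" using N by blast
        moreover have "0 \<le> C * (1 + A) * N" using B(2) A(2) N0 by simp
        ultimately show "cmod (case i of 0 \<Rightarrow> w k0 | Suc i \<Rightarrow> t i) \<le> (1 + C * (1 + A)) * N"
          using t(2)[of "i - 1"] i N0 by (cases i) (auto simp: algebra_simps)
      qed
    qed
  qed
qed

text \<open>Fekete's lemma in multiplicative form: \<open>K\<close> is absorbed into
  \<open>y\<close>, the limit is the infimum of the roots, and division of \<open>n\<close> by a
  nearly optimal \<open>q\<close> gives the upper estimate. It legitimizes the \<open>lim\<close> in
  \<open>rho_inf\<close>.\<close>

lemma root_submultiplicative_convergent: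
  fixes z :: "nat \<Rightarrow> real"
  assumes nonneg: "\<And>n. z n \<ge> 0" and K: "K > 0" and submult: "\<And>n p. z (n + p) \<le> K * z n * z p"
  shows "\<exists>L\<ge>0. (\<lambda>n. root n (z n)) \<longlonglongrightarrow> L"
proof -
  define y where "y n = K * z n" for n
  have y0: "y n \<ge> 0" for n using nonneg K by (simp add: y_def)
  have ysub: "y (n + p) \<le> y n * y p" for n p
    using mult_left_mono[OF submult[of n p], of K] K by (simp add: y_def mult_ac)
  define L where "L = (INF n\<in>{1..}. root n (y n))"
  have bdd: "bdd_below ((\<lambda>n. root n (y n)) ` {1..})"
    using y0 by (intro bdd_belowI[of _ 0]) (auto intro: real_root_ge_zero)
  have L0: "L \<ge> 0" unfolding L_def using y0 by (intro cINF_greatest) (auto intro: real_root_ge_zero)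
  have lower: "L \<le> root n (y n)" if "n \<ge> 1" for n
    unfolding L_def using that by (intro cINF_lower bdd) auto
  have upper: "\<forall>\<^sub>F n in sequentially. root n (y n) < L + \<epsilon>" if "\<epsilon> > 0" for \<epsilon>
  proof -
    define b where "b = L + \<epsilon> / 2"
    have b: "b > 0" using L0 that by (simp add: b_def)
    have "L < b" using that by (simp add: b_def)
    then obtain q where q: "q \<ge> 1" "root q (y q) < b"
      unfolding L_def by (subst (asm) cINF_less_iff[OF _ bdd]) auto
    have yq: "y q \<le> b ^ q"
    proof -
      have "y q = root q (y q) ^ q" using q(1) y0 by (simp add: real_root_pow_pos2)
      also have "\<dots> \<le> b ^ q" using q y0 by (intro power_mono) (auto intro: real_root_ge_zero)
      finally show ?thesis .
    qed
    have blocks: "y (q * k + r) \<le> (b ^ q) ^ k * y r" for k r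
    proof (induction k)
      case (Suc k)
      have "y (q * Suc k + r) = y (q + (q * k + r))" by (simp add: algebra_simps)
      also have "\<dots> \<le> y q * y (q * k + r)" by (rule ysub)
      also have "\<dots> \<le> b ^ q * ((b ^ q) ^ k * y r)" using yq Suc y0 b by (intro mult_mono) auto
      finally show ?case by (simp add: mult_ac)
    qed simp
    define A where "A = 1 + (\<Sum>r<q. y r / b ^ r)"
    have A: "A > 0" using y0 b by (auto simp: A_def intro!: add_pos_nonneg sum_nonneg)
    have bound: "y n \<le> A * b ^ n" for n
    proof -
      let ?k = "n div q" and ?r = "n mod q"
      have r: "?r < q" using q(1) by simp
      have n: "n = q * ?k + ?r" by simp
      have "y ?r / b ^ ?r \<le> A"
        using r y0 b member_le_sum[of ?r "{..<q}" "\<lambda>r. y r / b ^ r"] by (simp add: A_def)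
      then have "y ?r \<le> A * b ^ ?r" using b by (simp add: field_simps)
      then have "y n \<le> (b ^ q) ^ ?k * (A * b ^ ?r)"
        using blocks[of ?k ?r] b n by (smt (verit) mult_left_mono zero_le_power)
      also have "\<dots> = A * b ^ n"
      proof -
        have "b ^ n = (b ^ q) ^ ?k * b ^ ?r" by (subst n) (simp only: power_add power_mult)
        then show ?thesis by (simp add: mult_ac)
      qed
      finally show ?thesis .
    qed
    have "(\<lambda>n. root n A * b) \<longlonglongrightarrow> 1 * b" using A by (intro tendsto_intros LIMSEQ_root_const)
    moreover have "1 * b < L + \<epsilon>" using that by (simp add: b_def)
    ultimately have "\<forall>\<^sub>F n in sequentially. root n A * b < L + \<epsilon>" by (rule order_tendstoD)
    then show ?thesis
    proof (rule eventually_elim2[OF _ eventually_ge_at_top[of 1]])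
      fix n assume n: "root n A * b < L + \<epsilon>" "(1 :: nat) \<le> n"
      have "root n (y n) \<le> root n (A * b ^ n)" using bound n(2) by (intro real_root_le_mono) auto
      also have "\<dots> = root n A * b" using n(2) b by (simp add: real_root_mult real_root_power_cancel)
      finally show "root n (y n) < L + \<epsilon>" using n(1) by simp
    qed
  qed
  have "(\<lambda>n. root n (y n)) \<longlonglongrightarrow> L"
  proof (rule order_tendstoI)
    fix c assume "c < L"
    then show "\<forall>\<^sub>F n in sequentially. c < root n (y n)"
      using lower by (intro eventually_sequentiallyI[of 1]) (auto intro: less_le_trans)
  next
    fix c assume "L < c"
    then show "\<forall>\<^sub>F n in sequentially. root n (y n) < c" using upper[of "c - L"] by simp
  qed
  moreover have "(\<lambda>n. root n K) \<longlonglongrightarrow> 1" using K by (rule LIMSEQ_root_const)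
  ultimately have T: "(\<lambda>n. root n (y n) / root n K) \<longlonglongrightarrow> L / 1" by (intro tendsto_divide) auto
  have E: "\<forall>\<^sub>F n in sequentially. root n (y n) / root n K = root n (z n)"
    using K by (intro eventually_sequentiallyI[of 1]) (simp add: y_def real_root_mult)
  have "(\<lambda>n. root n (z n)) \<longlonglongrightarrow> L" using Lim_transform_eventually[OF T E] by simp
  then show ?thesis using L0 by blast
qed

lemma eventually_le_bound:
  fixes f g :: "nat \<Rightarrow> real"
  assumes "\<forall>\<^sub>F n in sequentially. f n \<le> g n" "\<And>n. g n > 0"
  shows "\<exists>K\<ge>0. \<forall>n. f n \<le> K * g n"
proof -
  obtain N where N: "\<And>n. n \<ge> N \<Longrightarrow> f n \<le> g n" using assms(1) by (auto simp: eventually_sequentially)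
  define K where "K = 1 + (\<Sum>n<N. \<bar>f n\<bar> / g n)"
  have s0: "(\<Sum>n<N. \<bar>f n\<bar> / g n) \<ge> 0" using assms(2) by (intro sum_nonneg) (simp add: less_imp_le)
  have "f n \<le> K * g n" for n
  proof (cases "n < N")
    case True
    then have "\<bar>f n\<bar> / g n \<le> (\<Sum>n<N. \<bar>f n\<bar> / g n)"
      using assms(2) by (intro member_le_sum[of n "{..<N}" "\<lambda>n. \<bar>f n\<bar> / g n"]) (auto simp: less_imp_le)
    then have "\<bar>f n\<bar> / g n \<le> K" by (simp add: K_def)
    then have "\<bar>f n\<bar> \<le> K * g n" using assms(2)[of n] by (simp add: field_simps)
    then show ?thesis by linarith
  next
    case False
    then have "f n \<le> 1 * g n" using N by simp
    also have "\<dots> \<le> K * g n" using s0 assms(2)[of n] by (intro mult_right_mono) (auto simp: K_def)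
    finally show ?thesis .
  qed
  then show ?thesis using s0 by (intro exI[of _ K]) (simp add: K_def)
qed

lemma linf_norm_ge: "u \<in> l0 \<Longrightarrow> cmod (u k) \<le> linf_norm u"
proof -
  assume u: "u \<in> l0"
  have "range (\<lambda>k. cmod (u k)) \<subseteq> insert 0 ((\<lambda>k. cmod (u k)) ` {k. u k \<noteq> 0})" by auto
  then have "finite (range (\<lambda>k. cmod (u k)))" using l0_finite[OF u] by (meson finite.insertI finite_imageI finite_subset)
  then show ?thesis unfolding linf_norm_def by (intro cSUP_upper bdd_above_finite) auto
qed

lemma linf_norm_le: "(\<And>k. cmod (u k) \<le> B) \<Longrightarrow> linf_norm u \<le> B"
  unfolding linf_norm_def by (intro cSUP_least) auto

lemma linf_norm_nonneg: "u \<in> l0 \<Longrightarrow> linf_norm u \<ge> 0"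
  using linf_norm_ge[of u 0] norm_ge_zero order_trans by blast

lemma l0_bounded: "u \<in> l0 \<Longrightarrow> \<exists>R\<ge>0. \<forall>k. u k \<noteq> 0 \<longrightarrow> norm (rvec k) \<le> R"
proof -
  assume u: "u \<in> l0"
  let ?R = "\<Sum>k | u k \<noteq> 0. norm (rvec k)"
  have "norm (rvec k) \<le> ?R" if "u k \<noteq> 0" for k
    using that l0_finite[OF u] by (intro member_le_sum[of k _ "\<lambda>k. norm (rvec k)"]) auto
  then show ?thesis by (intro exI[of _ ?R]) (auto intro: sum_nonneg)
qed

lemma l0_shift:
  assumes "u \<in> l0" shows "(\<lambda>k. u (k - j)) \<in> l0"
proof (rule l0I[of "(\<lambda>k. k + j) ` {k. u k \<noteq> 0}"])
  fix k assume k: "k \<notin> (\<lambda>k. k + j) ` {k. u k \<noteq> 0}"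
  have "k = (k - j) + j" by simp
  with k show "u (k - j) = 0" by blast
qed (use assms in \<open>simp add: l0_def\<close>)

lemma fseries_shift:
  assumes "u \<in> l0" shows "fseries (\<lambda>k. u (k - j)) \<xi> = chr j \<xi> * fseries u \<xi>"
proof -
  have "{k. u (k - j) \<noteq> 0} = (\<lambda>k. k + j) ` {k. u k \<noteq> 0}"
    by (auto simp: image_iff) (metis diff_add_cancel)
  then show ?thesis
    unfolding fseries_chr by (simp add: sum.reindex chr_add sum_distrib_left mult_ac)
qed

lemma fseries_sum:
  "(\<And>i. i \<in> I \<Longrightarrow> u i \<in> l0) \<Longrightarrow> fseries (\<lambda>k. \<Sum>i\<in>I. u i k) \<xi> = (\<Sum>i\<in>I. fseries (u i) \<xi>)"
proof (induction I rule: infinite_finite_induct)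
  case (insert i I)
  have "(\<lambda>k. \<Sum>i\<in>I. u i k) \<in> l0" using insert.prems by (intro l0_sum) auto
  then show ?case using insert by (simp add: fseries_add)
qed simp_all

lemma conv_norm_le:
  assumes "u \<in> l0" "\<And>k. cmod (v k) \<le> B"
  shows "cmod (conv u v k) \<le> (\<Sum>j | u j \<noteq> 0. cmod (u j)) * B"
  unfolding conv_def sum_distrib_right
  by (intro sum_norm_le) (auto simp: norm_mult intro!: mult_left_mono assms)

lemma conv_add_left:
  assumes "u \<in> l0" "v \<in> l0" "w \<in> l0"
  shows "conv (\<lambda>k. u k + v k) w k = conv u w k + conv v w k"
proof -
  have "conv (\<lambda>k. u k + v k) w = (\<lambda>k. conv u w k + conv v w k)"
    by (rule fseries_inject) (use assms in \<open>auto simp: fseries_conv fseries_add distrib_right l0_add conv_l0\<close>)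
  then show ?thesis by simp
qed

lemma nabla_delta_props: "nabla_delta \<mu> \<in> l0" "fseries (nabla_delta \<mu>) = diff_poly \<mu>"
proof -
  have "(\<lambda>\<xi>. \<Prod>i\<in>UNIV. (1 - exp (- (\<i> * of_real (\<xi> $ i)))) ^ \<mu> i) = diff_poly \<mu>"
    by (simp add: diff_poly_def chr_axis fun_eq_iff)
  then have "nabla_delta \<mu> = filter_of (diff_poly \<mu>)" by (simp add: nabla_delta_def)
  then show "nabla_delta \<mu> \<in> l0" "fseries (nabla_delta \<mu>) = diff_poly \<mu>" using filter_of_props[OF diff_poly_trig] by auto
qed

section \<open>Powers of the dilation on the lattice and iterated filters\<close>

context expanding
begin

definition Mpow :: "nat \<Rightarrow> int ^ 'n \<Rightarrow> int ^ 'n" where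
  "Mpow n = (\<lambda>j. M *v j) ^^ n"

lemma Mpow_0 [simp]: "Mpow 0 k = k" and Mpow_1 [simp]: "Mpow (Suc 0) k = M *v k"
  by (simp_all add: Mpow_def)

lemma Mpow_Suc: "Mpow (Suc n) k = M *v Mpow n k"
  by (simp add: Mpow_def)

lemma Mpow_Suc2: "Mpow (Suc n) k = Mpow n (M *v k)"
  by (simp add: Mpow_def funpow_swap1)

lemma Mpow_diff: "Mpow n (j - k) = Mpow n j - Mpow n k"
  by (induction n) (simp_all add: Mpow_Suc matrix_vector_mult_diff_int)

lemma rvec_Mpow: "rvec (Mpow n k) = (act M ^^ n) (rvec k)"
  by (induction n) (simp_all add: Mpow_Suc flip: act_rvec)

lemma ainv_act_pow [simp]: "(ainv ^^ n) ((act M ^^ n) x) = x"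
  by (induction n arbitrary: x) (simp_all add: funpow_swap1)

lemma act_ainv_pow [simp]: "(act M ^^ n) ((ainv ^^ n) x) = x"
  by (induction n arbitrary: x) (simp_all add: funpow_swap1)

lemma ainv_Mpow [simp]: "(ainv ^^ n) (rvec (Mpow n k)) = rvec k"
  by (simp add: rvec_Mpow)

lemma chr_actT_pow: "chr k ((actT M ^^ n) \<xi>) = chr (Mpow n k) \<xi>"
  by (induction n arbitrary: k) (simp_all add: chr_actT Mpow_Suc2)

text \<open>Convolution of \<open>u\<close> with \<open>v\<close> stretched by the n-th power of
  \<open>M\<close>, so that the series of \<open>v\<close> is taken at the dilated frequency. With
  \<open>u\<close> and \<open>v\<close> iterated filters it expresses the semigroup law
  \<open>an_add\<close>.\<close>

definition upconv :: "nat \<Rightarrow> 'n filt \<Rightarrow> 'n filt \<Rightarrow> 'n filt" where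
  "upconv n u v k = (\<Sum>j | v j \<noteq> 0. v j * u (k - Mpow n j))"

lemma upconv_l0:
  assumes "u \<in> l0" shows "upconv n u v \<in> l0"
  unfolding upconv_def by (intro l0_sum l0_scale l0_shift assms)

lemma fseries_upconv:
  assumes "u \<in> l0" shows "fseries (upconv n u v) \<xi> = fseries u \<xi> * fseries v ((actT M ^^ n) \<xi>)"
proof -
  have "fseries (upconv n u v) \<xi> = (\<Sum>j | v j \<noteq> 0. v j * (chr (Mpow n j) \<xi> * fseries u \<xi>))"
    unfolding upconv_def using assms by (subst fseries_sum) (auto simp: fseries_scale fseries_shift intro!: l0_scale l0_shift)
  then show ?thesis by (simp add: fseries_chr[of v] chr_actT_pow sum_distrib_left mult_ac)
qed

text \<open>Division with remainder by the n-th power of \<open>M\<close>. The remainder is rescaled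
  to the unit cube, which keeps the sequences on cosets inside one finite window for all
  \<open>n\<close>.\<close>

lemma lattice_decomp: "\<exists>\<beta> l. k = \<beta> + Mpow n l \<and> (ainv ^^ n) (rvec \<beta>) \<in> unit_cube"
proof -
  let ?l = "floor_vec ((ainv ^^ n) (rvec k))"
  have "(ainv ^^ n) (rvec (k - Mpow n ?l)) \<in> unit_cube"
    using floor_vec_cube[of "(ainv ^^ n) (rvec k)"] by (simp add: rvec_diff ainv_pow_diff)
  then show ?thesis by (intro exI[of _ "k - Mpow n ?l"] exI[of _ ?l]) simp
qed

end

context interp_filter
begin

abbreviation "an \<equiv> iter_filter a M"

lemma an_props: "an n \<in> l0" "fseries (an n) \<xi> = (\<Prod>j<n. fseries a ((actT M ^^ j) \<xi>))"
proof -
  have "(\<lambda>\<xi>. \<Prod>j<n. fseries a ((actT M ^^ j) \<xi>)) \<in> trig_polys"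
    by (intro trig_polys_prod trig_polys_actT_pow trig_polys_fseries a_l0)
  from filter_of_props[OF this]
  show "an n \<in> l0" "fseries (an n) \<xi> = (\<Prod>j<n. fseries a ((actT M ^^ j) \<xi>))"
    by (auto simp: iter_filter_def)
qed

lemma fseries_an_add: "fseries (an (n + p)) \<xi> = fseries (an n) \<xi> * fseries (an p) ((actT M ^^ n) \<xi>)"
  unfolding an_props(2)
proof (induction p)
  case (Suc p)
  have "(actT M ^^ (n + p)) \<xi> = (actT M ^^ p) ((actT M ^^ n) \<xi>)" by (simp add: funpow_add add.commute[of n])
  with Suc show ?case by simp
qed simp

lemma an_0: "an 0 = delta"
  by (rule fseries_inject) (auto simp: an_props)

lemma an_1: "an (Suc 0) = a"
  by (rule fseries_inject) (auto simp: an_props a_l0)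

lemma an_add: "an (n + p) = upconv n (an n) (an p)"
  by (rule fseries_inject) (auto simp: an_props(1) fseries_an_add fseries_upconv upconv_l0)

lemma conv_an_add:
  assumes "D \<in> l0"
  shows "conv D (an (n + p)) = upconv n (conv D (an n)) (an p)"
  by (rule fseries_inject)
    (use assms in \<open>auto simp: conv_l0 an_props(1) fseries_an_add fseries_conv fseries_upconv upconv_l0\<close>)

text \<open>One more factor moves the rescaled support by at most a term of a geometric series, so
  the supports stay in a ball independent of \<open>n\<close>.\<close>

lemma an_support: "\<exists>R\<ge>0. \<forall>n k. an n k \<noteq> 0 \<longrightarrow> norm ((ainv ^^ n) (rvec k)) \<le> R"
proof -
  obtain Ra where Ra: "Ra \<ge> 0" "\<And>k. a k \<noteq> 0 \<Longrightarrow> norm (rvec k) \<le> Ra" using l0_bounded[OF a_l0] by blast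
  have step: "norm ((ainv ^^ n) (rvec k)) \<le> invC * Ra * (\<Sum>i\<le>n. invL ^ i)" if "an n k \<noteq> 0" for n k
    using that
  proof (induction n arbitrary: k)
    case 0
    then have "k = 0" by (auto simp: an_0 delta_def split: if_splits)
    then show ?case using inv_bounds(1) Ra(1) by simp
  next
    case (Suc n)
    have "upconv 1 a (an n) k \<noteq> 0" using Suc.prems an_add[of 1 n] by (simp add: an_1)
    then obtain j where j: "an n j \<noteq> 0" "a (k - M *v j) \<noteq> 0"
      unfolding upconv_def by (auto elim: sum.not_neutral_contains_not_neutral)
    let ?l = "k - M *v j"
    have "rvec k = rvec (M *v j) + rvec ?l" by (simp add: rvec_diff)
    then have "(ainv ^^ Suc n) (rvec k) = (ainv ^^ Suc n) (rvec (M *v j)) + (ainv ^^ Suc n) (rvec ?l)"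
      by (simp only: ainv_pow_add)
    also have "(ainv ^^ Suc n) (rvec (M *v j)) = (ainv ^^ n) (rvec j)"
      by (simp only: funpow_Suc_right comp_apply ainv_rvec)
    finally have "norm ((ainv ^^ Suc n) (rvec k)) \<le> norm ((ainv ^^ n) (rvec j)) + norm ((ainv ^^ Suc n) (rvec ?l))"
      using norm_triangle_ineq by metis
    also have "\<dots> \<le> invC * Ra * (\<Sum>i\<le>n. invL ^ i) + invC * invL ^ Suc n * Ra"
    proof (intro add_mono Suc.IH j)
      have "norm ((ainv ^^ Suc n) (rvec ?l)) \<le> invC * invL ^ Suc n * norm (rvec ?l)" by (rule inv_bounds)
      also have "\<dots> \<le> invC * invL ^ Suc n * Ra"
        using Ra(2)[OF j(2)] inv_bounds(1,2) by (intro mult_left_mono) auto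
      finally show "norm ((ainv ^^ Suc n) (rvec ?l)) \<le> invC * invL ^ Suc n * Ra" .
    qed
    also have "\<dots> = invC * Ra * (\<Sum>i\<le>Suc n. invL ^ i)" by (simp add: algebra_simps)
    finally show ?case .
  qed
  have geo: "(\<Sum>i\<le>n. invL ^ i) \<le> 1 / (1 - invL)" for n
  proof -
    have "(\<Sum>i\<in>{..n}. invL ^ i) \<le> (\<Sum>i. invL ^ i)"
      using inv_bounds(2,3) by (intro sum_le_suminf summable_geometric) auto
    then show ?thesis using inv_bounds(2,3) by (simp add: suminf_geometric)
  qed
  show ?thesis
  proof (intro exI[of _ "invC * Ra * (1 / (1 - invL))"] conjI allI impI)
    fix n k assume "an n k \<noteq> 0"
    then show "norm ((ainv ^^ n) (rvec k)) \<le> invC * Ra * (1 / (1 - invL))"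
      using order_trans[OF step[of n k] mult_left_mono[OF geo[of n], of "invC * Ra"]] inv_bounds(1) Ra(1) by simp
  qed (use inv_bounds Ra(1) in simp)
qed

text \<open>On a coset of the n-th power of \<open>M\<close>, the sequence for \<open>n + p\<close>
  is \<open>an p\<close> convolved with the restriction of the sequence for \<open>n\<close>. These
  restrictions live on a fixed finite window, in a space on whose members \<open>an p\<close> acts
  with norm O(x p); a finite spanning list makes the constant uniform in \<open>n\<close>.\<close>

lemma conv_an_submult:
  assumes D: "D \<in> l0"
  defines "x \<equiv> \<lambda>n. linf_norm (conv D (an n))"
  shows "\<exists>K>0. \<forall>n p. x (n + p) \<le> K * x n * x p"
proof -
  let ?w = "\<lambda>n. conv D (an n)"
  have w_l0: "?w n \<in> l0" for n using D an_props(1) by auto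
  have x0: "x n \<ge> 0" for n unfolding x_def by (rule linf_norm_nonneg[OF w_l0])
  have xge: "cmod (?w n k) \<le> x n" for n k unfolding x_def by (rule linf_norm_ge[OF w_l0])
  obtain R where R: "R \<ge> 0" "\<And>n k. an n k \<noteq> 0 \<Longrightarrow> norm ((ainv ^^ n) (rvec k)) \<le> R"
    using an_support by blast
  obtain RD where RD: "RD \<ge> 0" "\<And>k. D k \<noteq> 0 \<Longrightarrow> norm (rvec k) \<le> RD" using l0_bounded[OF D] by blast
  obtain Rc where Rc: "\<And>y :: real ^ 'n. y \<in> unit_cube \<Longrightarrow> norm y \<le> Rc"
    using bounded_unit_cube by (auto simp: bounded_iff)
  define R' where "R' = invC * RD + R + Rc"
  define K where "K = {k :: int ^ 'n. norm (rvec k) \<le> R'}"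
  have finK: "finite K" by (rule finite_int_vec_bounded) (auto simp: bounded_iff K_def)
  have supp: "norm ((ainv ^^ n) (rvec k)) \<le> invC * RD + R" if nz: "?w n k \<noteq> 0" for n k
  proof -
    obtain j where j: "D j \<noteq> 0" "an n (k - j) \<noteq> 0"
      using nz unfolding conv_def by (auto elim: sum.not_neutral_contains_not_neutral)
    have "rvec k = rvec j + rvec (k - j)" by (simp add: rvec_diff)
    then have "norm ((ainv ^^ n) (rvec k)) \<le> norm ((ainv ^^ n) (rvec j)) + norm ((ainv ^^ n) (rvec (k - j)))"
      by (metis ainv_pow_add norm_triangle_ineq)
    moreover have "norm ((ainv ^^ n) (rvec j)) \<le> invC * RD"
    proof -
      have "norm ((ainv ^^ n) (rvec j)) \<le> invC * invL ^ n * norm (rvec j)" by (rule inv_bounds)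
      also have "\<dots> \<le> invC * 1 * RD"
        using inv_bounds(1-3) RD j by (intro mult_mono power_le_one) auto
      finally show ?thesis by simp
    qed
    ultimately show ?thesis using R(2)[OF j(2)] by linarith
  qed
  \<comment> \<open>The growth condition is made part of the definition, with a constant that may
    depend on \<open>v\<close>; finite dimension then supplies a common one.\<close>
  define V where "V = {v. (\<forall>k. k \<notin> K \<longrightarrow> v k = 0) \<and> (\<exists>C\<ge>0. \<forall>p l. cmod (conv (an p) v l) \<le> C * x p)}"
  have V_add: "(\<lambda>k. v k + w k) \<in> V" if vw: "v \<in> V" "w \<in> V" for v w
  proof -
    obtain C1 C2 where C: "C1 \<ge> 0" "\<And>p l. cmod (conv (an p) v l) \<le> C1 * x p"
      "C2 \<ge> 0" "\<And>p l. cmod (conv (an p) w l) \<le> C2 * x p" using vw by (auto simp: V_def)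
    have "conv (an p) (\<lambda>k. v k + w k) l = conv (an p) v l + conv (an p) w l" for p l
      by (simp add: conv_def distrib_left sum.distrib)
    then have "cmod (conv (an p) (\<lambda>k. v k + w k) l) \<le> (C1 + C2) * x p" for p l
      using norm_triangle_ineq[of "conv (an p) v l" "conv (an p) w l"] C(2)[of p l] C(4)[of p l]
      by (simp add: distrib_right)
    then show ?thesis using vw C(1,3) unfolding V_def by (auto intro!: exI[of _ "C1 + C2"])
  qed
  have V_scale: "(\<lambda>k. c * v k) \<in> V" if v: "v \<in> V" for c v
  proof -
    obtain C where C: "C \<ge> 0" "\<And>p l. cmod (conv (an p) v l) \<le> C * x p" using v by (auto simp: V_def)
    have "conv (an p) (\<lambda>k. c * v k) l = c * conv (an p) v l" for p l
      by (simp add: conv_def sum_distrib_left mult_ac)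
    then have "cmod (conv (an p) (\<lambda>k. c * v k) l) \<le> (cmod c * C) * x p" for p l
      using mult_left_mono[OF C(2)[of p l], of "cmod c"] by (simp add: norm_mult mult_ac)
    then show ?thesis using v C(1) unfolding V_def by (auto intro!: exI[of _ "cmod c * C"])
  qed
  have conv_v: "conv (an p) (\<lambda>l. ?w n (\<beta> + Mpow n l)) l = ?w (n + p) (\<beta> + Mpow n l)" for n p \<beta> l
    unfolding conv_an_add[OF D] upconv_def conv_def[of "an p"] by (simp add: Mpow_diff algebra_simps)
  have V_coset: "(\<lambda>l. ?w n (\<beta> + Mpow n l)) \<in> V" if \<beta>: "(ainv ^^ n) (rvec \<beta>) \<in> unit_cube" for n \<beta>
  proof -
    have "?w n (\<beta> + Mpow n l) = 0" if l: "l \<notin> K" for l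
    proof (rule ccontr)
      assume "?w n (\<beta> + Mpow n l) \<noteq> 0"
      then have "norm ((ainv ^^ n) (rvec (\<beta> + Mpow n l))) \<le> invC * RD + R" by (rule supp)
      then have "norm ((ainv ^^ n) (rvec \<beta>) + rvec l) \<le> invC * RD + R" by (simp add: rvec_add ainv_pow_add)
      moreover have "norm (rvec l) \<le> norm ((ainv ^^ n) (rvec \<beta>) + rvec l) + norm ((ainv ^^ n) (rvec \<beta>))"
        using norm_triangle_ineq4[of "(ainv ^^ n) (rvec \<beta>) + rvec l" "(ainv ^^ n) (rvec \<beta>)"] by simp
      ultimately show False using Rc[OF \<beta>] l by (simp add: K_def R'_def)
    qed
    \<comment> \<open>The semigroup law is read here in the other order, with \<open>an n\<close> as
      the outer filter. The resulting constant grows with \<open>n\<close>, which is harmless for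
      mere membership in \<open>V\<close>.\<close>
    moreover have "cmod (conv (an p) (\<lambda>l. ?w n (\<beta> + Mpow n l)) l) \<le> (\<Sum>j | an n j \<noteq> 0. cmod (an n j)) * x p" for p l
    proof -
      have "cmod (?w (p + n) k) \<le> (\<Sum>j | an n j \<noteq> 0. cmod (an n j)) * x p" for k
        unfolding conv_an_add[OF D] upconv_def sum_distrib_right
        by (intro sum_norm_le) (auto simp: norm_mult intro!: mult_left_mono xge)
      then show ?thesis unfolding conv_v by (simp add: add.commute)
    qed
    ultimately show ?thesis unfolding V_def by (auto intro!: exI[of _ "\<Sum>j | an n j \<noteq> 0. cmod (an n j)"] sum_nonneg)
  qed
  have V_K: "w k = 0" if "w \<in> V" "k \<notin> K" for w k using that by (simp add: V_def)
  obtain B C where B: "set B \<subseteq> V" "C \<ge> 0" and coord': "\<forall>w\<in>V. \<forall>N. (\<forall>k. cmod (w k) \<le> N) \<longrightarrow>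
      (\<exists>t. (\<forall>k. w k = (\<Sum>i<length B. t i * (B ! i) k)) \<and> (\<forall>i<length B. cmod (t i) \<le> C * N))"
  proof -
    have "\<exists>B C. set B \<subseteq> V \<and> C \<ge> 0 \<and> (\<forall>w\<in>V. \<forall>N. (\<forall>k. cmod (w k) \<le> N) \<longrightarrow>
      (\<exists>t. (\<forall>k. w k = (\<Sum>i<length B. t i * (B ! i) k)) \<and> (\<forall>i<length B. cmod (t i) \<le> C * N)))"
      by (rule bounded_coordinates[OF finK]) ((rule V_K V_add V_scale; assumption)+)
    then show ?thesis using that by blast
  qed
  have coord: "\<exists>t. (\<forall>k. w k = (\<Sum>i<length B. t i * (B ! i) k)) \<and> (\<forall>i<length B. cmod (t i) \<le> C * N)"
    if "w \<in> V" "\<And>k. cmod (w k) \<le> N" for w N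
    using coord' that by blast
  have "\<forall>i<length B. \<exists>C\<ge>0. \<forall>p l. cmod (conv (an p) (B ! i) l) \<le> C * x p"
    using B(1) nth_mem by (fastforce simp: V_def)
  then obtain CB where CB: "\<And>i. i < length B \<Longrightarrow> CB i \<ge> 0"
    "\<And>i p l. i < length B \<Longrightarrow> cmod (conv (an p) (B ! i) l) \<le> CB i * x p" by metis
  define S where "S = C * (\<Sum>i<length B. CB i)"
  have S: "S \<ge> 0" using B(2) CB(1) by (auto simp: S_def intro!: mult_nonneg_nonneg sum_nonneg)
  have main: "cmod (?w (n + p) k) \<le> S * x n * x p" for n p k
  proof -
    obtain \<beta> l where k: "k = \<beta> + Mpow n l" "(ainv ^^ n) (rvec \<beta>) \<in> unit_cube" using lattice_decomp by blast
    let ?v = "\<lambda>l. ?w n (\<beta> + Mpow n l)"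
    obtain t where t: "\<And>k. ?v k = (\<Sum>i<length B. t i * (B ! i) k)"
      "\<And>i. i < length B \<Longrightarrow> cmod (t i) \<le> C * x n"
      using coord[OF V_coset[OF k(2)], of "x n"] xge by blast
    have "?w (n + p) k = conv (an p) ?v l" unfolding conv_v k(1) ..
    also have "\<dots> = (\<Sum>i<length B. t i * conv (an p) (B ! i) l)"
      unfolding conv_def[of "an p"] t(1) sum_distrib_left by (subst sum.swap) (simp add: mult_ac)
    also have "cmod \<dots> \<le> (\<Sum>i<length B. (C * x n) * (CB i * x p))"
      using t(2) CB x0 B(2) by (intro sum_norm_le) (auto simp: norm_mult intro!: mult_mono)
    also have "\<dots> = S * x n * x p" by (simp add: S_def sum_distrib_left sum_distrib_right mult_ac)
    finally show ?thesis .
  qed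
  have "x (n + p) \<le> (S + 1) * x n * x p" for n p
  proof -
    have "x (n + p) \<le> S * x n * x p" unfolding x_def by (rule linf_norm_le) (use main in \<open>simp add: x_def\<close>)
    also have "\<dots> \<le> (S + 1) * x n * x p" using x0 by (intro mult_right_mono) auto
    finally show ?thesis .
  qed
  then show ?thesis using S by (intro exI[of _ "S + 1"]) auto
qed

text \<open>The logarithm has a base above 1, so \<open>\<rho> \<ge> 1\<close> would make the
  exponent nonpositive; the infinite value at \<open>\<rho> = 0\<close> does not interfere.\<close>

lemma rho_lt_1:
  assumes "sm_inf a M > 0" shows "rho_inf (2 * m) a M < 1"
proof (rule ccontr)
  assume "\<not> rho_inf (2 * m) a M < 1"
  then have r: "rho_inf (2 * m) a M \<ge> 1" by simp
  then have "sm_inf a M = ereal (- log (spec_radius M) (rho_inf (2 * m) a M))"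
    by (simp add: sm_inf_def sr)
  moreover have "log (spec_radius M) (rho_inf (2 * m) a M) \<ge> 0"
    using r spec_radius_gt_1 by (simp add: zero_le_log_cancel_iff)
  ultimately show False using assms by (simp add: zero_ereal_def)
qed

lemma nabla_decay:
  assumes "sm_inf a M > 0"
  shows "\<exists>r. 0 < r \<and> r < 1 \<and> (\<forall>\<mu>. (\<Sum>i\<in>UNIV. \<mu> i) = 2 * m \<longrightarrow>
    (\<exists>K\<ge>0. \<forall>n. real (dM M) ^ n * linf_norm (conv (nabla_delta \<mu>) (an n)) \<le> K * r ^ n))"
proof -
  let ?rho = "rho_inf (2 * m) a M"
  let ?I = "{\<mu> :: 'n \<Rightarrow> nat. (\<Sum>i\<in>UNIV. \<mu> i) = 2 * m}"
  let ?x = "\<lambda>\<mu> n. linf_norm (conv (nabla_delta \<mu>) (an n))"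
  \<comment> \<open>A common rate strictly between \<rho> and 1; the maximum with 0 keeps it
    positive.\<close>
  define r where "r = (1 + max ?rho 0) / 2"
  have r: "0 < r" "r < 1" "?rho < r" using rho_lt_1[OF assms] by (auto simp: r_def)
  have d: "real (dM M) > 0" using dM_pos by simp
  have "?I \<subseteq> Pi\<^sub>E UNIV (\<lambda>_. {..2 * m})"
  proof (intro subsetI PiE_I)
    fix \<mu> i assume "\<mu> \<in> ?I"
    then show "\<mu> i \<in> {..2 * m}" using member_le_sum[of i UNIV \<mu>] by simp
  qed auto
  then have finI: "finite ?I" by (rule finite_subset) (auto intro: finite_PiE)
  have "\<exists>K\<ge>0. \<forall>n. real (dM M) ^ n * ?x \<mu> n \<le> K * r ^ n" if \<mu>: "(\<Sum>i\<in>UNIV. \<mu> i) = 2 * m" for \<mu>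
  proof -
    have w_l0: "conv (nabla_delta \<mu>) (an n) \<in> l0" for n using nabla_delta_props(1) an_props(1) by auto
    have x0: "?x \<mu> n \<ge> 0" for n by (rule linf_norm_nonneg[OF w_l0])
    \<comment> \<open>The existence of this limit gives the \<open>lim\<close> in
      \<open>rho_inf\<close> its meaning, as finiteness of the index set does for the
      \<open>SUP\<close>.\<close>
    obtain L where L: "(\<lambda>n. root n (?x \<mu> n)) \<longlonglongrightarrow> L"
      using root_submultiplicative_convergent[of "?x \<mu>"] x0 conv_an_submult[OF nabla_delta_props(1)[of \<mu>]] by blast
    have "lim (\<lambda>n. root n (?x \<mu> n)) \<le> (SUP \<mu>\<in>?I. lim (\<lambda>n. root n (?x \<mu> n)))"
      using finI \<mu> by (intro cSUP_upper bdd_above_finite) auto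
    then have "real (dM M) * L \<le> ?rho"
      unfolding rho_inf_def limI[OF L] using d by (intro mult_left_mono) auto
    then have "L < r / real (dM M)" using r(3) d by (simp add: field_simps)
    from order_tendstoD(2)[OF L this]
    have "\<forall>\<^sub>F n in sequentially. ?x \<mu> n \<le> (r / real (dM M)) ^ n"
    proof (rule eventually_elim2[OF _ eventually_ge_at_top[of 1]])
      fix n assume n: "root n (?x \<mu> n) < r / real (dM M)" "(1 :: nat) \<le> n"
      have "?x \<mu> n = root n (?x \<mu> n) ^ n" using n(2) x0 by (simp add: real_root_pow_pos2)
      also have "\<dots> \<le> (r / real (dM M)) ^ n" using n x0 by (intro power_mono) (auto intro: real_root_ge_zero)
      finally show "?x \<mu> n \<le> (r / real (dM M)) ^ n" .
    qed
    from eventually_le_bound[OF this] obtain K where K: "K \<ge> 0" "\<And>n. ?x \<mu> n \<le> K * (r / real (dM M)) ^ n"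
      using r(1) d by auto
    have "real (dM M) ^ n * ?x \<mu> n \<le> K * r ^ n" for n
    proof -
      have "real (dM M) ^ n * ?x \<mu> n \<le> real (dM M) ^ n * (K * (r / real (dM M)) ^ n)"
        using K(2) d by (intro mult_left_mono) auto
      also have "\<dots> = K * r ^ n" using d by (simp add: power_divide)
      finally show ?thesis .
    qed
    then show ?thesis using K(1) by blast
  qed
  then show ?thesis using r by blast
qed

text \<open>The hypothesis concerns pure differences only. A filter with 2 m vanishing moments is a
  combination of such differences with filters as coefficients; these enter through their l1 norms,
  so only the constant and not the rate depends on the filter.\<close>

lemma annih_decay:
  assumes "sm_inf a M > 0"
  shows "\<exists>r. 0 < r \<and> r < 1 \<and> (\<forall>v\<in>l0. annih (2 * m) v \<longrightarrow>
    (\<exists>K\<ge>0. \<forall>n k. real (dM M) ^ n * cmod (conv v (an n) k) \<le> K * r ^ n))"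
proof -
  obtain r where r: "0 < r" "r < 1" and decay: "\<And>\<mu>. (\<Sum>i\<in>UNIV. \<mu> i) = 2 * m \<Longrightarrow>
    \<exists>K\<ge>0. \<forall>n. real (dM M) ^ n * linf_norm (conv (nabla_delta \<mu>) (an n)) \<le> K * r ^ n"
    using nabla_decay[OF assms] by blast
  have d: "real (dM M) \<ge> 0" by simp
  have "\<exists>v\<in>l0. fseries v = F \<and> (\<exists>K\<ge>0. \<forall>n k. real (dM M) ^ n * cmod (conv v (an n) k) \<le> K * r ^ n)"
    if "F \<in> vanish_ideal (2 * m)" for F
    using that
  proof (induction rule: vanish_ideal.induct)
    case zero
    show ?case by (rule bexI[of _ "\<lambda>_. 0"]) (auto simp: conv_def intro!: exI[of _ 0] l0I[of "{}"])
  next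
    case (add_prod F Q \<mu>)
    then obtain v K where v: "v \<in> l0" "fseries v = F" "K \<ge> 0"
      "\<And>n k. real (dM M) ^ n * cmod (conv v (an n) k) \<le> K * r ^ n" by blast
    obtain q where q: "q \<in> l0" "fseries q = Q" using add_prod.hyps(2) by (force simp: trig_polys_def)
    obtain K' where K': "K' \<ge> 0" "\<And>n. real (dM M) ^ n * linf_norm (conv (nabla_delta \<mu>) (an n)) \<le> K' * r ^ n"
      using decay[OF add_prod.hyps(3)] by blast
    let ?D = "nabla_delta \<mu>"
    let ?S = "\<Sum>j | q j \<noteq> 0. cmod (q j)"
    let ?u = "\<lambda>k. v k + conv q ?D k"
    have S: "?S \<ge> 0" by (intro sum_nonneg) simp
    have l0: "?D \<in> l0" "conv q ?D \<in> l0" using nabla_delta_props(1) q(1) by auto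
    have bound: "real (dM M) ^ n * cmod (conv ?u (an n) k) \<le> (K + ?S * K') * r ^ n" for n k
    proof -
      have "conv ?u (an n) k = conv v (an n) k + conv q (conv ?D (an n)) k"
        using conv_add_left[OF v(1) l0(2) an_props(1)] conv_assoc[OF q(1) l0(1) an_props(1)] by simp
      moreover have "cmod (conv q (conv ?D (an n)) k) \<le> ?S * linf_norm (conv ?D (an n))"
        by (rule conv_norm_le[OF q(1) linf_norm_ge[OF conv_l0[OF l0(1) an_props(1)]]])
      ultimately have "cmod (conv ?u (an n) k) \<le> cmod (conv v (an n) k) + ?S * linf_norm (conv ?D (an n))"
        using norm_triangle_ineq[of "conv v (an n) k" "conv q (conv ?D (an n)) k"] by simp
      then have "real (dM M) ^ n * cmod (conv ?u (an n) k) \<le>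
          real (dM M) ^ n * cmod (conv v (an n) k) + ?S * (real (dM M) ^ n * linf_norm (conv ?D (an n)))"
        using mult_left_mono[of _ _ "real (dM M) ^ n"] by (fastforce simp: algebra_simps)
      also have "\<dots> \<le> K * r ^ n + ?S * (K' * r ^ n)"
        using v(4) K'(2) S by (intro add_mono mult_left_mono) auto
      finally show ?thesis by (simp add: algebra_simps)
    qed
    show ?case
    proof (intro bexI[of _ ?u] conjI)
      show "fseries ?u = (\<lambda>\<xi>. F \<xi> + diff_poly \<mu> \<xi> * Q \<xi>)"
        using v q l0 by (simp add: fun_eq_iff fseries_add fseries_conv nabla_delta_props(2) mult.commute)
      show "\<exists>K\<ge>0. \<forall>n k. real (dM M) ^ n * cmod (conv ?u (an n) k) \<le> K * r ^ n"
        using bound v(3) K'(1) S by (intro exI[of _ "K + ?S * K'"]) auto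
    qed (use v l0 in auto)
  qed
  then have "\<exists>K\<ge>0. \<forall>n k. real (dM M) ^ n * cmod (conv v (an n) k) \<le> K * r ^ n"
    if "v \<in> l0" "annih (2 * m) v" for v
    using annih_vanish_ideal[OF that] fseries_inject[OF _ that(1)] by metis
  then show ?thesis using r by blast
qed

end

section \<open>A Lipschitz kernel reproducing polynomials\<close>

lemma lagrange_interpolation:
  fixes A :: "real set" and p :: "real poly"
  assumes "finite A" "degree p < card A"
  shows "(\<Sum>j\<in>A. poly p j * (\<Prod>i\<in>A - {j}. (x - i) / (j - i))) = poly p x"
proof -
  define b where "b j = (\<Prod>i\<in>A - {j}. smult (1 / (j - i)) [:- i, 1:])" for j
  have b: "poly (b j) x = (\<Prod>i\<in>A - {j}. (x - i) / (j - i))" for j x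
    by (simp add: b_def poly_prod diff_divide_distrib)
  have deg: "degree (smult (poly p j) (b j)) < card A" if "j \<in> A" for j
  proof -
    have "degree (b j) \<le> sum (degree \<circ> (\<lambda>i. smult (1 / (j - i)) [:- i, 1:])) (A - {j})"
      unfolding b_def by (rule degree_prod_sum_le) (use assms(1) in simp)
    also have "\<dots> \<le> (\<Sum>i\<in>A - {j}. 1)" by (intro sum_mono) simp
    also have "\<dots> < card A" using card_Diff1_less[OF assms(1) that] by simp
    finally show ?thesis using degree_smult_le[of "poly p j" "b j"] by linarith
  qed
  let ?q = "\<Sum>j\<in>A. smult (poly p j) (b j)"
  have "degree ?q < card A"
    using degree_sum_less[of A "\<lambda>j. smult (poly p j) (b j)" "card A"] deg assms(2) by simp
  moreover have "poly ?q y = poly p y" if y: "y \<in> A" for y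
  proof -
    have "poly (smult (poly p j) (b j)) y = (if j = y then poly p y else 0)" if "j \<in> A" for j
      using that y assms(1) by (auto simp: b intro!: prod.neutral)
    then have "poly ?q y = (\<Sum>j\<in>A. if j = y then poly p y else 0)"
      unfolding poly_sum by (intro sum.cong refl)
    then show ?thesis using y assms(1) by simp
  qed
  ultimately have "?q = p" using assms by (intro poly_eqI_degree[of A]) auto
  then have "poly p x = poly ?q x" by simp
  then show ?thesis by (simp add: poly_sum b)
qed

text \<open>Boundedness is included to make the class closed under products, from which the kernel
  is assembled.\<close>

definition bounded_lipschitz :: "('a::metric_space \<Rightarrow> real) \<Rightarrow> bool" where
  "bounded_lipschitz f \<longleftrightarrow> (\<exists>B L. B \<ge> 0 \<and> L \<ge> 0 \<and> (\<forall>x. \<bar>f x\<bar> \<le> B) \<and> (\<forall>x y. \<bar>f x - f y\<bar> \<le> L * dist x y))"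

lemma bounded_lipschitz_const: "bounded_lipschitz (\<lambda>_. c)"
  unfolding bounded_lipschitz_def by (rule exI[of _ "\<bar>c\<bar>"], rule exI[of _ 0]) simp

lemma bounded_lipschitz_add:
  assumes "bounded_lipschitz f" "bounded_lipschitz g" shows "bounded_lipschitz (\<lambda>x. f x + g x)"
proof -
  obtain B L B' L' where f: "B \<ge> 0" "L \<ge> 0" "\<And>x. \<bar>f x\<bar> \<le> B" "\<And>x y. \<bar>f x - f y\<bar> \<le> L * dist x y"
    and g: "B' \<ge> 0" "L' \<ge> 0" "\<And>x. \<bar>g x\<bar> \<le> B'" "\<And>x y. \<bar>g x - g y\<bar> \<le> L' * dist x y"
    using assms unfolding bounded_lipschitz_def by blast
  have "\<bar>f x + g x\<bar> \<le> B + B'" for x using f(3)[of x] g(3)[of x] by linarith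
  moreover have "\<bar>(f x + g x) - (f y + g y)\<bar> \<le> (L + L') * dist x y" for x y
    using f(4)[of x y] g(4)[of x y] unfolding distrib_right by linarith
  ultimately show ?thesis unfolding bounded_lipschitz_def using f g by (intro exI[of _ "B + B'"] exI[of _ "L + L'"]) auto
qed

lemma bounded_lipschitz_mult:
  assumes "bounded_lipschitz f" "bounded_lipschitz g" shows "bounded_lipschitz (\<lambda>x. f x * g x)"
proof -
  obtain B L B' L' where f: "B \<ge> 0" "L \<ge> 0" "\<And>x. \<bar>f x\<bar> \<le> B" "\<And>x y. \<bar>f x - f y\<bar> \<le> L * dist x y"
    and g: "B' \<ge> 0" "L' \<ge> 0" "\<And>x. \<bar>g x\<bar> \<le> B'" "\<And>x y. \<bar>g x - g y\<bar> \<le> L' * dist x y"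
    using assms unfolding bounded_lipschitz_def by blast
  have "\<bar>f x * g x\<bar> \<le> B * B'" for x using f g by (simp add: abs_mult mult_mono)
  moreover have "\<bar>f x * g x - f y * g y\<bar> \<le> (L * B' + B * L') * dist x y" for x y
  proof -
    have "f x * g x - f y * g y = (f x - f y) * g x + f y * (g x - g y)" by (simp add: algebra_simps)
    then have "\<bar>f x * g x - f y * g y\<bar> \<le> \<bar>f x - f y\<bar> * \<bar>g x\<bar> + \<bar>f y\<bar> * \<bar>g x - g y\<bar>"
      by (metis abs_mult abs_triangle_ineq)
    also have "\<dots> \<le> (L * dist x y) * B' + B * (L' * dist x y)"
      using f g by (intro add_mono mult_mono) auto
    finally show ?thesis by (simp add: algebra_simps)
  qed
  ultimately show ?thesis unfolding bounded_lipschitz_def using f g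
    by (intro exI[of _ "B * B'"] exI[of _ "L * B' + B * L'"]) auto
qed

lemma bounded_lipschitz_sum:
  "(\<And>i. i \<in> I \<Longrightarrow> bounded_lipschitz (f i)) \<Longrightarrow> bounded_lipschitz (\<lambda>x. \<Sum>i\<in>I. f i x)"
  by (induction I rule: infinite_finite_induct) (auto intro: bounded_lipschitz_const bounded_lipschitz_add)

lemma bounded_lipschitz_prod:
  "(\<And>i. i \<in> I \<Longrightarrow> bounded_lipschitz (f i)) \<Longrightarrow> bounded_lipschitz (\<lambda>x. \<Prod>i\<in>I. f i x)"
  by (induction I rule: infinite_finite_induct) (auto intro: bounded_lipschitz_const bounded_lipschitz_mult)

lemma bounded_lipschitz_nth:
  fixes f :: "real \<Rightarrow> real"
  assumes "bounded_lipschitz f" shows "bounded_lipschitz (\<lambda>x :: real ^ 'n. f (x $ i))"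
proof -
  obtain B L where f: "B \<ge> 0" "L \<ge> 0" "\<And>x. \<bar>f x\<bar> \<le> B" "\<And>x y. \<bar>f x - f y\<bar> \<le> L * dist x y"
    using assms unfolding bounded_lipschitz_def by blast
  have "\<bar>f (x $ i) - f (y $ i)\<bar> \<le> L * dist x y" for x y :: "real ^ 'n"
    using f(4)[of "x $ i" "y $ i"] mult_left_mono[OF dist_vec_nth_le[of x i y] f(2)] by linarith
  then show ?thesis unfolding bounded_lipschitz_def using f by blast
qed

definition hat :: "real \<Rightarrow> real" where
  "hat x = max 0 (1 - \<bar>x\<bar>)"

text \<open>At each point the data are blended, with the hat functions as weights, from the Lagrange
  interpolants on the nodes \<open>k, \<dots>, k + N - 1\<close>; the kernel is the response to unit data at \<open>0\<close>.\<close>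

definition kernel1 :: "nat \<Rightarrow> real \<Rightarrow> real" where
  "kernel1 N x = (\<Sum>k\<in>{- int N<..0}. hat (x - of_int k) *
    (\<Prod>i\<in>{k..<k + int N} - {0}. (x - of_int i) / (0 - of_int i)))"

text \<open>The Lagrange factors are unbounded, but each is multiplied by a hat function vanishing
  outside [k - 1, k + 1]; clamping the argument to this interval changes nothing and makes every
  factor bounded and Lipschitz.\<close>

lemma kernel1_bounded_lipschitz: "bounded_lipschitz (kernel1 N)"
proof -
  define cl where "cl k x = max (real_of_int k - 1) (min (of_int k + 1) x)" for k x
  have hatcl: "bounded_lipschitz (\<lambda>x. hat (x - of_int k))" for k
    unfolding bounded_lipschitz_def hat_def
    by (rule exI[of _ 1], rule exI[of _ 1]) (auto simp: dist_real_def)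
  have clbl: "bounded_lipschitz (\<lambda>x. (cl k x - of_int i) / (0 - of_int i))" for k i
  proof -
    have "bounded_lipschitz (cl k)"
      unfolding bounded_lipschitz_def cl_def
      by (rule exI[of _ "\<bar>real_of_int k\<bar> + 1"], rule exI[of _ 1]) (auto simp: dist_real_def)
    from bounded_lipschitz_mult[OF bounded_lipschitz_add[OF this bounded_lipschitz_const[of "- of_int i"]]
        bounded_lipschitz_const[of "1 / (0 - of_int i)"]]
    show ?thesis by simp
  qed
  have "kernel1 N = (\<lambda>x. \<Sum>k\<in>{- int N<..0}. hat (x - of_int k) *
    (\<Prod>i\<in>{k..<k + int N} - {0}. (cl k x - of_int i) / (0 - of_int i)))"
  proof
    fix x
    have alt: "cl k x = x \<or> hat (x - of_int k) = 0" for k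
      by (auto simp: cl_def hat_def)
    show "kernel1 N x = (\<Sum>k\<in>{- int N<..0}. hat (x - of_int k) *
      (\<Prod>i\<in>{k..<k + int N} - {0}. (cl k x - of_int i) / (0 - of_int i)))"
      unfolding kernel1_def
    proof (rule sum.cong[OF refl])
      fix k
      show "hat (x - of_int k) * (\<Prod>i\<in>{k..<k + int N} - {0}. (x - of_int i) / (0 - of_int i)) =
        hat (x - of_int k) * (\<Prod>i\<in>{k..<k + int N} - {0}. (cl k x - of_int i) / (0 - of_int i))"
        using alt[of k] by (elim disjE) (simp_all only: mult_zero_left)
    qed
  qed
  then show ?thesis
    by (simp only:) (intro bounded_lipschitz_sum bounded_lipschitz_mult bounded_lipschitz_prod hatcl clbl)
qed

lemma kernel1_support: "kernel1 N x \<noteq> 0 \<Longrightarrow> \<bar>x\<bar> \<le> of_nat N + 1"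
proof -
  assume "kernel1 N x \<noteq> 0"
  then obtain k where k: "k \<in> {- int N<..0}" "hat (x - of_int k) \<noteq> 0"
    unfolding kernel1_def by (metis (no_types, lifting) mult_zero_left sum.not_neutral_contains_not_neutral)
  then have "\<bar>x - of_int k\<bar> < 1" by (auto simp: hat_def max_def split: if_splits)
  moreover have "- real N \<le> of_int k" "real_of_int k \<le> 0" using k(1) by auto
  ultimately show ?thesis by linarith
qed

lemma hat_int: "hat (of_int n - of_int k) = (if k = n then 1 else 0)"
proof -
  have "\<bar>real_of_int n - of_int k\<bar> \<ge> 1" if "k \<noteq> n"
  proof -
    have "\<bar>n - k\<bar> \<ge> 1" using that by simp
    then have "real_of_int \<bar>n - k\<bar> \<ge> 1" by linarith
    then show ?thesis by simp
  qed
  then show ?thesis by (auto simp: hat_def)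
qed

text \<open>At an integer only the window starting there has a nonzero weight, and for
  \<open>n \<noteq> 0\<close> the Lagrange product of that window contains the vanishing factor of
  the node \<open>n\<close>.\<close>

lemma kernel1_int:
  assumes "N \<ge> 1" shows "kernel1 N (of_int n) = (if n = 0 then 1 else 0)"
proof -
  have "kernel1 N (of_int n) = (\<Sum>k\<in>{- int N<..0}. if k = n then
      (\<Prod>i\<in>{n..<n + int N} - {0}. (of_int n - of_int i) / (0 - of_int i)) else 0)"
    unfolding kernel1_def by (intro sum.cong) (auto simp: hat_int)
  also have "\<dots> = (if n \<in> {- int N<..0} then (\<Prod>i\<in>{n..<n + int N} - {0}. (of_int n - of_int i) / (0 - of_int i)) else 0)"
    by (simp add: sum.delta)
  also have "\<dots> = (if n = 0 then 1 else 0)"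
  proof (cases "n = 0")
    case True
    then show ?thesis using assms by (auto intro!: prod.neutral)
  next
    case False
    then have "n \<in> {n..<n + int N} - {0}" using assms by auto
    then have "(\<Prod>i\<in>{n..<n + int N} - {0}. (real_of_int n - of_int i) / (0 - of_int i)) = 0"
      by (intro prod_zero) (auto intro!: bexI[of _ n])
    then show ?thesis using False by simp
  qed
  finally show ?thesis .
qed

text \<open>Only the windows starting at the floor of \<open>x\<close> and at the next integer have
  weight at \<open>x\<close>. Each interpolates \<open>p\<close> exactly, and the two hat values sum
  to 1.\<close>

lemma kernel1_repro:
  fixes p :: "real poly"
  assumes p: "degree p < N" and S: "finite S" "\<And>n. n \<notin> S \<Longrightarrow> kernel1 N (x - of_int n) = 0"
  shows "(\<Sum>n\<in>S. poly p (of_int n) * kernel1 N (x - of_int n)) = poly p x"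
proof -
  let ?f = "\<lfloor>x\<rfloor>"
  let ?l = "\<lambda>k n. \<Prod>i\<in>{k..<k + int N} - {n}. (x - of_int i) / (of_int n - of_int i)"
  have shift: "kernel1 N (x - of_int n) = (\<Sum>k\<in>{n - int N<..n}. hat (x - of_int k) * ?l k n)" for n
  proof -
    have "kernel1 N (x - of_int n) = (\<Sum>k\<in>{- int N<..0}. hat (x - of_int (k + n)) * ?l (k + n) n)"
      unfolding kernel1_def
    proof (rule sum.cong[OF refl])
      fix k assume "k \<in> {- int N<..0}"
      have "(\<Prod>i\<in>{k..<k + int N} - {0}. (x - of_int n - of_int i) / (0 - of_int i)) = ?l (k + n) n"
        by (rule prod.reindex_bij_witness[of _ "\<lambda>i. i - n" "\<lambda>i. i + n"]) auto
      then show "hat (x - of_int n - of_int k) * (\<Prod>i\<in>{k..<k + int N} - {0}. (x - of_int n - of_int i) / (0 - of_int i)) =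
          hat (x - of_int (k + n)) * ?l (k + n) n"
        by (simp add: algebra_simps)
    qed
    also have "\<dots> = (\<Sum>k\<in>{n - int N<..n}. hat (x - of_int k) * ?l k n)"
      by (rule sum.reindex_bij_witness[of _ "\<lambda>k. k - n" "\<lambda>k. k + n"]) auto
    finally show ?thesis .
  qed
  have hat0: "hat (x - of_int k) = 0" if "k \<noteq> ?f" "k \<noteq> ?f + 1" for k
  proof -
    have "k \<le> ?f - 1 \<or> k \<ge> ?f + 2" using that by linarith
    then have "real_of_int k \<le> of_int ?f - 1 \<or> real_of_int k \<ge> of_int ?f + 2" by linarith
    then show ?thesis unfolding hat_def by linarith
  qed
  have two: "kernel1 N (x - of_int n) = (\<Sum>k\<in>{?f, ?f + 1}. if n \<in> {k..<k + int N} then hat (x - of_int k) * ?l k n else 0)" for n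
  proof -
    have "kernel1 N (x - of_int n) = (\<Sum>k\<in>{n - int N<..n} \<inter> {?f, ?f + 1}. hat (x - of_int k) * ?l k n)"
      unfolding shift by (rule sum.mono_neutral_right) (use hat0 in auto)
    also have "\<dots> = (\<Sum>k\<in>{?f, ?f + 1}. if k \<in> {n - int N<..n} then hat (x - of_int k) * ?l k n else 0)"
      by (subst Int_commute) (simp only: sum.inter_restrict[of "{?f, ?f + 1}"] finite.intros)
    also have "\<dots> = (\<Sum>k\<in>{?f, ?f + 1}. if n \<in> {k..<k + int N} then hat (x - of_int k) * ?l k n else 0)"
      by (intro sum.cong) auto
    finally show ?thesis .
  qed
  have lag: "(\<Sum>n\<in>{k..<k + int N}. poly p (of_int n) * ?l k n) = poly p x" for k
  proof -
    let ?A = "real_of_int ` {k..<k + int N}"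
    have "poly p x = (\<Sum>j\<in>?A. poly p j * (\<Prod>i\<in>?A - {j}. (x - i) / (j - i)))"
    proof (rule lagrange_interpolation[symmetric])
      have "card ?A = N" by (subst card_image) (auto simp: inj_on_def)
      then show "degree p < card ?A" using p by simp
    qed simp
    also have "\<dots> = (\<Sum>n\<in>{k..<k + int N}. poly p (of_int n) * (\<Prod>i\<in>?A - {of_int n}. (x - i) / (of_int n - i)))"
      by (subst sum.reindex) (auto simp: inj_on_def)
    also have "\<dots> = (\<Sum>n\<in>{k..<k + int N}. poly p (of_int n) * ?l k n)"
    proof (rule sum.cong[OF refl])
      fix n
      have "?A - {of_int n} = real_of_int ` ({k..<k + int N} - {n})" by auto
      then have "(\<Prod>i\<in>?A - {of_int n}. (x - i) / (of_int n - i)) = ?l k n"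
        by (simp only:) (subst prod.reindex, auto simp: inj_on_def)
      then show "poly p (of_int n) * (\<Prod>i\<in>?A - {of_int n}. (x - i) / (of_int n - i)) = poly p (of_int n) * ?l k n"
        by simp
    qed
    finally show ?thesis by simp
  qed
  let ?h = "\<lambda>k n. if n \<in> {k..<k + int N} then hat (x - of_int k) * (poly p (of_int n) * ?l k n) else 0"
  \<comment> \<open>\<open>S\<close> need only contain the nodes where the whole kernel is nonzero.
    After splitting into windows, both windows must be complete for the interpolation formula, hence
    the enlargement.\<close>
  let ?T = "S \<union> {?f..<?f + 1 + int N}"
  have T: "finite ?T" using S(1) by simp
  have "(\<Sum>n\<in>S. poly p (of_int n) * kernel1 N (x - of_int n)) = (\<Sum>n\<in>?T. poly p (of_int n) * kernel1 N (x - of_int n))"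
    by (rule sum.mono_neutral_left[OF T]) (use S in auto)
  also have "\<dots> = (\<Sum>n\<in>?T. \<Sum>k\<in>{?f, ?f + 1}. ?h k n)"
    unfolding two sum_distrib_left by (intro sum.cong refl) auto
  also have "\<dots> = (\<Sum>k\<in>{?f, ?f + 1}. \<Sum>n\<in>?T. ?h k n)"
    by (rule sum.swap)
  also have "\<dots> = (\<Sum>k\<in>{?f, ?f + 1}. hat (x - of_int k) * poly p x)"
  proof (rule sum.cong[OF refl])
    fix k assume k: "k \<in> {?f, ?f + 1}"
    have "(\<Sum>n\<in>?T. ?h k n) =
        (\<Sum>n\<in>?T \<inter> {k..<k + int N}. hat (x - of_int k) * (poly p (of_int n) * ?l k n))"
      by (rule sum.inter_restrict[OF T, symmetric])
    also have "?T \<inter> {k..<k + int N} = {k..<k + int N}" using k by auto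
    finally show "(\<Sum>n\<in>?T. ?h k n) =
        hat (x - of_int k) * poly p x"
      unfolding sum_distrib_left[symmetric] lag .
  qed
  also have "\<dots> = (hat (x - of_int ?f) + hat (x - of_int (?f + 1))) * poly p x" by (simp add: algebra_simps)
  also have "hat (x - of_int ?f) + hat (x - of_int (?f + 1)) = 1"
  proof -
    have "of_int ?f \<le> x" "x < of_int ?f + 1" by linarith+
    then have "hat (x - of_int ?f) = 1 - (x - of_int ?f)" "hat (x - of_int (?f + 1)) = x - of_int ?f"
      unfolding hat_def of_int_add by (auto simp only: max_def abs_if of_int_1 split: if_splits)
    then show ?thesis by simp
  qed
  finally show ?thesis by simp
qed

lemma lattice_ball_finite: "finite {k. norm (x - rvec k) \<le> R}"
proof (rule finite_int_vec_bounded)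
  show "bounded (rvec ` {k. norm (x - rvec k) \<le> R})"
    unfolding bounded_iff
  proof (intro exI ballI)
    fix y assume "y \<in> rvec ` {k. norm (x - rvec k) \<le> R}"
    then have "norm (x - y) \<le> R" by auto
    then show "norm y \<le> norm x + R" using norm_triangle_ineq4[of x "x - y"] by simp
  qed
qed

text \<open>Translating by the integer part of \<open>x\<close> moves the ball near the origin,
  which makes the count uniform. It serves later as a bound on the number of overlapping
  supports.\<close>

lemma lattice_ball_card: "\<exists>C. \<forall>x :: real ^ 'n. card {k. norm (x - rvec k) \<le> R} \<le> C"
proof -
  obtain Rc where Rc: "\<And>y :: real ^ 'n. y \<in> unit_cube \<Longrightarrow> norm y \<le> Rc"
    using bounded_unit_cube by (auto simp: bounded_iff)
  have "card {k. norm (x - rvec k) \<le> R} \<le> card {k :: int ^ 'n. norm (0 - rvec k) \<le> R + Rc}" for x :: "real ^ 'n"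
  proof (rule card_inj_on_le[OF _ _ lattice_ball_finite])
    show "inj_on (\<lambda>k. k - floor_vec x) {k. norm (x - rvec k) \<le> R}" by (simp add: inj_on_def)
    show "(\<lambda>k. k - floor_vec x) ` {k. norm (x - rvec k) \<le> R} \<subseteq> {k. norm (0 - rvec k) \<le> R + Rc}"
    proof clarify
      fix k assume k: "norm (x - rvec k) \<le> R"
      have "0 - rvec (k - floor_vec x) = (x - rvec k) - (x - rvec (floor_vec x))" by (simp add: rvec_diff)
      then have "norm (0 - rvec (k - floor_vec x)) \<le> norm (x - rvec k) + norm (x - rvec (floor_vec x))"
        by (simp only: norm_triangle_ineq4)
      then show "norm (0 - rvec (k - floor_vec x)) \<le> R + Rc" using k Rc[OF floor_vec_cube[of x]] by linarith
    qed
  qed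
  then show ?thesis by blast
qed

text \<open>The lattice sum is written over any finite set off which the terms vanish. This avoids
  infinite sums and leaves later proofs free to enlarge the index set.\<close>

definition reproduces :: "nat \<Rightarrow> (real ^ 'n \<Rightarrow> complex) \<Rightarrow> bool" where
  "reproduces N h \<longleftrightarrow> (\<forall>n p x S. n < N \<longrightarrow> polydeg n p \<longrightarrow> finite S \<longrightarrow> (\<forall>k. k \<notin> S \<longrightarrow> h (x - rvec k) = 0) \<longrightarrow>
    (\<Sum>k\<in>S. p (rvec k) * h (x - rvec k)) = p x)"

lemma reproducesD:
  "reproduces N h \<Longrightarrow> polydeg n p \<Longrightarrow> n < N \<Longrightarrow> finite S \<Longrightarrow> (\<And>k. k \<notin> S \<Longrightarrow> h (x - rvec k) = 0) \<Longrightarrow>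
    (\<Sum>k\<in>S. p (rvec k) * h (x - rvec k)) = p x"
  unfolding reproduces_def by blast

definition kernel :: "nat \<Rightarrow> real ^ 'n \<Rightarrow> complex" where
  "kernel N x = of_real (\<Prod>i\<in>UNIV. kernel1 N (x $ i))"

lemma kernel_lipschitz:
  "\<exists>B L. B \<ge> 0 \<and> L \<ge> 0 \<and> (\<forall>x. cmod (kernel N x) \<le> B) \<and>
    (\<forall>x y. cmod (kernel N x - kernel N y) \<le> L * norm (x - y))"
proof -
  have "bounded_lipschitz (\<lambda>x :: real ^ 'n. \<Prod>i\<in>UNIV. kernel1 N (x $ i))"
    by (intro bounded_lipschitz_prod bounded_lipschitz_nth kernel1_bounded_lipschitz)
  then show ?thesis unfolding bounded_lipschitz_def kernel_def dist_norm
    by (metis norm_of_real of_real_diff)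
qed

lemma kernel_support: "\<exists>R\<ge>0. \<forall>x :: real ^ 'n. kernel N x \<noteq> 0 \<longrightarrow> norm x \<le> R"
proof -
  have "norm x \<le> (\<Sum>i\<in>(UNIV :: 'n set). of_nat N + 1)" if "kernel N x \<noteq> 0" for x :: "real ^ 'n"
  proof -
    have "kernel1 N (x $ i) \<noteq> 0" for i using that by (auto simp: kernel_def)
    then have "(\<Sum>i\<in>UNIV. \<bar>x $ i\<bar>) \<le> (\<Sum>i\<in>(UNIV :: 'n set). of_nat N + 1)"
      by (intro sum_mono kernel1_support)
    then show ?thesis using norm_le_l1_cart[of x] by linarith
  qed
  then show ?thesis by (intro exI[of _ "\<Sum>i\<in>(UNIV :: 'n set). of_nat N + 1"]) (auto intro: sum_nonneg)
qed

lemma kernel_rvec: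
  assumes "N \<ge> 1" shows "kernel N (rvec k) = delta k"
proof (cases "k = 0")
  case False
  then obtain i where "k $ i \<noteq> 0" by (auto simp: vec_eq_iff)
  then show ?thesis using False assms by (auto simp: kernel_def rvec_nth kernel1_int delta_def intro!: prod_zero)
qed (use assms kernel1_int[OF assms, of 0] in \<open>simp add: kernel_def delta_def\<close>)

text \<open>For a monomial the sum over a box factorizes into one-dimensional sums. General
  polynomials follow by the induction of \<open>vanishes_iff_annih\<close>, with a monomial
  prefactor that absorbs coordinate factors.\<close>

lemma kernel_reproduces: "reproduces N (kernel N :: real ^ 'n \<Rightarrow> complex)"
  unfolding reproduces_def
proof (intro allI impI)
  fix n and p :: "real ^ 'n \<Rightarrow> complex" and x :: "real ^ 'n" and S :: "(int ^ 'n) set"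
  assume n: "n < N" and p: "polydeg n p" and S: "finite S" "\<forall>k. k \<notin> S \<longrightarrow> kernel N (x - rvec k) = 0"
  define T where "T i = {\<lfloor>x $ i\<rfloor> - int N - 2..\<lfloor>x $ i\<rfloor> + int N + 2}" for i
  have T: "kernel1 N (x $ i - of_int t) = 0" if "t \<notin> T i" for i t
  proof (rule ccontr)
    assume "kernel1 N (x $ i - of_int t) \<noteq> 0"
    from kernel1_support[OF this] have "t \<in> T i" unfolding T_def atLeastAtMost_iff by linarith
    then show False using that by simp
  qed
  define box where "box = {k :: int ^ 'n. \<forall>i. k $ i \<in> T i}"
  have bij: "bij_betw vec_nth box (Pi\<^sub>E UNIV T)"
  proof (rule bij_betwI[of _ _ _ vec_lambda])
    show "vec_nth \<in> box \<rightarrow> Pi\<^sub>E UNIV T" "vec_lambda \<in> Pi\<^sub>E UNIV T \<rightarrow> box" by (auto simp: box_def PiE_def)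
  qed auto
  have finbox: "finite box"
    using bij_betw_finite[OF bij] finite_PiE[of "UNIV :: 'n set" T] by (simp add: T_def)
  have S_box: "(\<Sum>k\<in>S. h k * kernel N (x - rvec k)) = (\<Sum>k\<in>box. h k * kernel N (x - rvec k))" for h
  proof -
    have "kernel N (x - rvec k) = 0" if "k \<notin> box" for k
      using that T unfolding box_def kernel_def by (auto simp: rvec_nth intro!: prod_zero)
    then have "(\<Sum>k\<in>box. h k * kernel N (x - rvec k)) = (\<Sum>k\<in>S \<union> box. h k * kernel N (x - rvec k))"
      using S finbox by (intro sum.mono_neutral_left) auto
    also have "\<dots> = (\<Sum>k\<in>S. h k * kernel N (x - rvec k))"
      using S finbox by (intro sum.mono_neutral_right) auto
    finally show ?thesis by simp
  qed
  have monom: "(\<Sum>k\<in>S. (\<Prod>i\<in>UNIV. of_real (rvec k $ i) ^ \<mu> i) * kernel N (x - rvec k)) = (\<Prod>i\<in>UNIV. of_real (x $ i) ^ \<mu> i)"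
    if \<mu>: "(\<Sum>i\<in>UNIV. \<mu> i) < N" for \<mu>
  proof -
    have one: "(\<Sum>t\<in>T i. real_of_int t ^ \<mu> i * kernel1 N (x $ i - of_int t)) = x $ i ^ \<mu> i" for i
    proof -
      have "\<mu> i < N" using member_le_sum[of i UNIV \<mu>] \<mu> by simp
      then show ?thesis
        using kernel1_repro[of "monom 1 (\<mu> i)" N "T i" "x $ i"] T by (auto simp: degree_monom_eq poly_monom T_def)
    qed
    have "(\<Prod>i\<in>UNIV. x $ i ^ \<mu> i) = (\<Prod>i\<in>UNIV. \<Sum>t\<in>T i. real_of_int t ^ \<mu> i * kernel1 N (x $ i - of_int t))"
      by (simp add: one)
    also have "\<dots> = (\<Sum>g\<in>Pi\<^sub>E UNIV T. \<Prod>i\<in>UNIV. real_of_int (g i) ^ \<mu> i * kernel1 N (x $ i - of_int (g i)))"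
      by (rule prod_sum_PiE) (auto simp: T_def)
    also have "\<dots> = (\<Sum>k\<in>box. \<Prod>i\<in>UNIV. real_of_int (k $ i) ^ \<mu> i * kernel1 N (x $ i - of_int (k $ i)))"
      by (rule sum.reindex_bij_betw[OF bij, symmetric])
    finally have "complex_of_real (\<Prod>i\<in>UNIV. x $ i ^ \<mu> i) =
        of_real (\<Sum>k\<in>box. \<Prod>i\<in>UNIV. real_of_int (k $ i) ^ \<mu> i * kernel1 N (x $ i - of_int (k $ i)))" by simp
    then show ?thesis unfolding S_box by (simp add: kernel_def rvec_nth prod.distrib)
  qed
  have "(\<Sum>k\<in>S. (\<Prod>i\<in>UNIV. of_real (rvec k $ i) ^ \<mu> i) * p (rvec k) * kernel N (x - rvec k)) =
      (\<Prod>i\<in>UNIV. of_real (x $ i) ^ \<mu> i) * p x" if "(\<Sum>i\<in>UNIV. \<mu> i) + n < N" for \<mu>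
    using p that
  proof (induction arbitrary: \<mu> rule: polydeg.induct)
    case (const n c)
    then have "(\<Sum>i\<in>UNIV. \<mu> i) < N" by simp
    from arg_cong[OF monom[OF this], of "\<lambda>z. c * z"] show ?case
      by (simp add: sum_distrib_left mult_ac)
  next
    case (add n p q)
    then show ?case by (simp add: distrib_left distrib_right sum.distrib)
  next
    case (coord n p j)
    let ?\<nu> = "\<mu>(j := Suc (\<mu> j))"
    have "(\<Sum>i\<in>UNIV. ?\<nu> i) = (\<Sum>i\<in>UNIV. \<mu> i + (if i = j then 1 else 0))"
      by (intro sum.cong) auto
    then have lt: "(\<Sum>i\<in>UNIV. ?\<nu> i) + n < N" using coord.prems by (simp add: sum.distrib)
    have split: "(\<Prod>i\<in>UNIV. of_real (y $ i) ^ ?\<nu> i) = (\<Prod>i\<in>UNIV. of_real (y $ i) ^ \<mu> i) * (of_real (y $ j) :: complex)"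
      for y :: "real ^ 'n"
    proof -
      have "(\<Prod>i\<in>UNIV. of_real (y $ i) ^ ?\<nu> i) =
        (\<Prod>i\<in>UNIV. of_real (y $ i) ^ \<mu> i * (if i = j then of_real (y $ j) else 1 :: complex))"
        by (intro prod.cong) auto
      then show ?thesis by (simp add: prod.distrib)
    qed
    from coord.IH[OF lt] show ?case unfolding split by (simp only: mult.assoc)
  qed
  from this[of "\<lambda>_. 0"] n show "(\<Sum>k\<in>S. p (rvec k) * kernel N (x - rvec k)) = p x" by simp
qed

section \<open>The cascade algorithm\<close>

lemma geometric_Cauchy:
  fixes x :: "nat \<Rightarrow> complex"
  assumes step: "\<And>n. cmod (x (Suc n) - x n) \<le> C * r ^ n" and r: "0 < r" "r < 1"
  shows "convergent x \<and> (\<forall>n. cmod (x n - lim x) \<le> C / (1 - r) * r ^ n)"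
proof -
  have C: "C \<ge> 0" using order_trans[OF norm_ge_zero step[of 0]] by simp
  have tail: "cmod (x (n + p) - x n) \<le> C * r ^ n * (\<Sum>i<p. r ^ i)" for n p
  proof (induction p)
    case (Suc p)
    have "cmod (x (n + Suc p) - x n) \<le> cmod (x (Suc (n + p)) - x (n + p)) + cmod (x (n + p) - x n)"
      using norm_triangle_ineq[of "x (Suc (n + p)) - x (n + p)" "x (n + p) - x n"] by simp
    also have "\<dots> \<le> C * r ^ (n + p) + C * r ^ n * (\<Sum>i<p. r ^ i)" by (intro add_mono step Suc)
    finally show ?case by (simp add: algebra_simps power_add)
  qed simp
  have tail': "cmod (x (n + p) - x n) \<le> C / (1 - r) * r ^ n" for n p
  proof -
    have "(\<Sum>i\<in>{..<p}. r ^ i) \<le> (\<Sum>i. r ^ i)"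
      using r by (intro sum_le_suminf summable_geometric) auto
    then have "(\<Sum>i<p. r ^ i) \<le> 1 / (1 - r)" using r by (simp add: suminf_geometric)
    then have "C * r ^ n * (\<Sum>i<p. r ^ i) \<le> C * r ^ n * (1 / (1 - r))"
      using C r by (intro mult_left_mono) auto
    then show ?thesis using tail[of n p] by simp
  qed
  have z: "(\<lambda>n. C / (1 - r) * r ^ n) \<longlonglongrightarrow> 0"
    using r by (intro tendsto_mult_right_zero LIMSEQ_power_zero) auto
  have "Cauchy x"
  proof (rule metric_CauchyI)
    fix e :: real assume "0 < e"
    then obtain N where N: "C / (1 - r) * r ^ N < e / 2"
      using order_tendstoD(2)[OF z, of "e / 2"] by (auto simp: eventually_sequentially)
    have near: "dist (x n) (x N) < e / 2" if "n \<ge> N" for n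
    proof -
      have "cmod (x n - x N) \<le> C / (1 - r) * r ^ N" using tail'[of N "n - N"] that by simp
      then show ?thesis unfolding dist_norm using N by linarith
    qed
    show "\<exists>N. \<forall>m\<ge>N. \<forall>n\<ge>N. dist (x m) (x n) < e"
    proof (intro exI allI impI)
      fix m n assume "N \<le> m" "N \<le> n"
      then show "dist (x m) (x n) < e" using near[of m] near[of n] by (metis dist_triangle_half_l)
    qed
  qed
  then have conv: "convergent x" by (rule Cauchy_convergent)
  then have lim: "x \<longlonglongrightarrow> lim x" by (simp add: convergent_LIMSEQ_iff)
  have "cmod (x n - lim x) \<le> C / (1 - r) * r ^ n" for n
  proof (rule Lim_bounded)
    show "(\<lambda>p. cmod (x n - x p)) \<longlonglongrightarrow> cmod (x n - lim x)" by (intro tendsto_intros lim)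
    show "\<forall>p\<ge>n. cmod (x n - x p) \<le> C / (1 - r) * r ^ n"
    proof (intro allI impI)
      fix p assume "n \<le> p"
      then show "cmod (x n - x p) \<le> C / (1 - r) * r ^ n"
        using tail'[of n "p - n"] by (simp add: norm_minus_commute)
    qed
  qed
  with conv show ?thesis by blast
qed

definition csupp :: "('a::real_normed_vector \<Rightarrow> 'b::zero) \<Rightarrow> bool" where
  "csupp h \<longleftrightarrow> (\<exists>R\<ge>0. \<forall>x. h x \<noteq> 0 \<longrightarrow> norm x \<le> R)"

context expanding
begin

text \<open>On the Fourier side this multiplies the dilated transform of \<open>h\<close> by the
  dilated series of \<open>b\<close>; the factor \<open>d\<close> compensates the change of
  variables. With \<open>b = a\<close> it is a cascade step, and with a high-pass filter it produces
  a framelet generator from \<phi>.\<close>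

definition refine :: "'n filt \<Rightarrow> (real ^ 'n \<Rightarrow> complex) \<Rightarrow> real ^ 'n \<Rightarrow> complex" where
  "refine b h x = of_nat (dM M) * (\<Sum>l | b l \<noteq> 0. b l * h (act M x - rvec l))"

lemma sum_coset_reindex:
  fixes h :: "int ^ 'n \<Rightarrow> complex"
  assumes "finite S" "\<And>k. k \<notin> S \<Longrightarrow> h k = 0" "finite T" "\<And>k. M *v k + l \<in> S \<Longrightarrow> k \<in> T"
  shows "(\<Sum>k\<in>T. h (M *v k + l)) = (\<Sum>k\<in>S. if crep k = crep l then h k else 0)"
proof -
  have inj: "inj_on (\<lambda>k. M *v k + l) T" by (simp add: inj_on_def)
  have "(\<Sum>k\<in>S. if crep k = crep l then h k else 0) = sum h (S \<inter> {k. crep k = crep l})"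
    using assms(1) by (simp add: sum.inter_restrict)
  also have "\<dots> = sum h ((\<lambda>k. M *v k + l) ` T)"
  proof (rule sum.mono_neutral_left)
    show "S \<inter> {k. crep k = crep l} \<subseteq> (\<lambda>k. M *v k + l) ` T"
    proof
      fix k assume k: "k \<in> S \<inter> {k. crep k = crep l}"
      then have "crep (k - l) = 0" by (simp add: crep_diff_eq_0)
      then obtain j where "k - l = M *v j" by (auto simp: crep_eq_0_iff)
      then have "k = M *v j + l" by (simp add: algebra_simps)
      then show "k \<in> (\<lambda>k. M *v k + l) ` T" using k assms(4) by auto
    qed
    show "\<forall>i\<in>(\<lambda>k. M *v k + l) ` T - S \<inter> {k. crep k = crep l}. h i = 0"
      using assms(2) crep_add_mult[of l] by (auto simp: add.commute)
  qed (use assms(3) in simp)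
  also have "\<dots> = (\<Sum>k\<in>T. h (M *v k + l))"
    by (subst sum.reindex[OF inj]) simp
  finally show ?thesis by simp
qed

lemma csupp_refine:
  assumes "b \<in> l0" "csupp h" shows "csupp (refine b h)"
proof -
  obtain R where R: "R \<ge> 0" "\<And>x. h x \<noteq> 0 \<Longrightarrow> norm x \<le> R" using assms(2) by (auto simp: csupp_def)
  obtain Rb where Rb: "Rb \<ge> 0" "\<And>k. b k \<noteq> 0 \<Longrightarrow> norm (rvec k) \<le> Rb" using l0_bounded[OF assms(1)] by blast
  have "norm x \<le> invC * invL * (R + Rb)" if nz: "refine b h x \<noteq> 0" for x
  proof -
    obtain l where l: "b l \<noteq> 0" "h (act M x - rvec l) \<noteq> 0"
      using nz unfolding refine_def by (auto elim: sum.not_neutral_contains_not_neutral)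
    have "norm (act M x) \<le> norm (act M x - rvec l) + norm (rvec l)"
      using norm_triangle_ineq[of "act M x - rvec l" "rvec l"] by simp
    then have "norm (act M x) \<le> R + Rb" using R(2)[OF l(2)] Rb(2)[OF l(1)] by linarith
    then have "invC * invL * norm (act M x) \<le> invC * invL * (R + Rb)"
      using inv_bounds(1,2) by (intro mult_left_mono) auto
    moreover have "norm x \<le> invC * invL * norm (act M x)"
      using inv_bounds(4)[of 1 "act M x"] by simp
    ultimately show ?thesis by linarith
  qed
  then show ?thesis unfolding csupp_def using R(1) Rb(1) inv_bounds(1,2)
    by (intro exI[of _ "invC * invL * (R + Rb)"]) auto
qed

lemma refine_bounded:
  assumes "\<And>x. cmod (h x) \<le> B"
  shows "cmod (refine b h x) \<le> real (dM M) * ((\<Sum>l | b l \<noteq> 0. cmod (b l)) * B)"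
  unfolding refine_def norm_mult sum_distrib_right
  by (intro mult_mono sum_norm_le) (auto simp: norm_mult intro!: mult_left_mono assms)

lemma upconv_sum:
  assumes "u \<in> l0" "v \<in> l0"
  shows "(\<Sum>k | upconv n u v k \<noteq> 0. upconv n u v k * g k) =
    (\<Sum>j | v j \<noteq> 0. v j * (\<Sum>k | u k \<noteq> 0. u k * g (k + Mpow n j)))"
proof -
  let ?T = "\<Union>j\<in>{j. v j \<noteq> 0}. (\<lambda>k. k + Mpow n j) ` {k. u k \<noteq> 0}"
  have T: "finite ?T" using l0_finite[OF assms(1)] l0_finite[OF assms(2)] by simp
  have outT: "u (k - Mpow n j) = 0" if "v j \<noteq> 0" "k \<notin> (\<lambda>k. k + Mpow n j) ` {k. u k \<noteq> 0}" for j k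
  proof -
    have "k = (k - Mpow n j) + Mpow n j" by simp
    with that(2) show ?thesis by blast
  qed
  have "(\<Sum>k | upconv n u v k \<noteq> 0. upconv n u v k * g k) = (\<Sum>k\<in>?T. upconv n u v k * g k)"
  proof (rule sum_superset[OF T])
    fix k assume "k \<notin> ?T"
    then show "upconv n u v k = 0" unfolding upconv_def using outT by (intro sum.neutral) auto
  qed
  also have "\<dots> = (\<Sum>j | v j \<noteq> 0. \<Sum>k\<in>?T. v j * (u (k - Mpow n j) * g k))"
    unfolding upconv_def sum_distrib_right by (subst sum.swap) (simp add: mult.assoc)
  also have "\<dots> = (\<Sum>j | v j \<noteq> 0. v j * (\<Sum>k | u k \<noteq> 0. u k * g (k + Mpow n j)))"
  proof (rule sum.cong[OF refl])
    fix j assume j: "j \<in> {j. v j \<noteq> 0}"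
    have "(\<Sum>k\<in>?T. u (k - Mpow n j) * g k) = (\<Sum>k\<in>(\<lambda>k. k + Mpow n j) ` {k. u k \<noteq> 0}. u (k - Mpow n j) * g k)"
      by (rule sum.mono_neutral_right[OF T]) (use j outT in auto)
    also have "\<dots> = (\<Sum>k | u k \<noteq> 0. u k * g (k + Mpow n j))"
      by (subst sum.reindex) (auto simp: inj_on_def)
    finally show "(\<Sum>k\<in>?T. v j * (u (k - Mpow n j) * g k)) = v j * (\<Sum>k | u k \<noteq> 0. u k * g (k + Mpow n j))"
      by (simp flip: sum_distrib_left)
  qed
  finally show ?thesis .
qed

lemma act_pow_diff: "(act M ^^ n) (x - y) = (act M ^^ n) x - (act M ^^ n) y"
  by (induction n) (simp_all add: act_diff)

lemma act_pow_continuous: "continuous_on UNIV (act M ^^ n)"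
proof (induction n)
  case (Suc n)
  have "continuous_on UNIV (act M)"
    unfolding act_def[abs_def] by (rule linear_continuous_on) (simp add: linear_linear)
  then have "continuous_on UNIV (act M \<circ> (act M ^^ n))"
    by (intro continuous_on_compose Suc) (auto elim: continuous_on_subset)
  then show ?case by simp
qed (simp add: continuous_on_id)

lemma act_pow_bound: "\<exists>A\<ge>1. \<forall>n x. norm ((act M ^^ n) x) \<le> A ^ n * norm x"
proof -
  have "linear (act M)" unfolding act_def[abs_def] by simp
  from linear_bounded[OF this] obtain B where B: "\<And>x. norm (act M x) \<le> B * norm x" by blast
  define A where "A = max 1 B"
  have A: "norm (act M x) \<le> A * norm x" for x
    using B[of x] mult_right_mono[of B A "norm x"] by (simp add: A_def)
  have "norm ((act M ^^ n) x) \<le> A ^ n * norm x" for n x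
  proof (induction n)
    case (Suc n)
    have "norm ((act M ^^ Suc n) x) \<le> A * norm ((act M ^^ n) x)" using A by simp
    also have "\<dots> \<le> A * (A ^ n * norm x)" using Suc by (intro mult_left_mono) (auto simp: A_def)
    finally show ?case by simp
  qed simp
  then show ?thesis by (intro exI[of _ A]) (auto simp: A_def)
qed

end

context interp_filter
begin

text \<open>After exchanging sums, a fine lattice point \<open>k\<close> meets the coefficients of
  \<open>a\<close> on its own coset only. The coset moment collapses them to \<open>p\<close> at the
  preimage of \<open>k\<close>, and \<open>h\<close> reproduces this affine image of
  \<open>p\<close> at \<open>act M x\<close>.\<close>

lemma refine_reproduces:
  assumes h: "reproduces (2 * m) h" "csupp h" shows "reproduces (2 * m) (refine a h)"
  unfolding reproduces_def
proof (intro allI impI)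
  fix n and p :: "real ^ 'n \<Rightarrow> complex" and x and S
  assume n: "n < 2 * m" and p: "polydeg n p" and S: "finite S" "\<forall>k. k \<notin> S \<longrightarrow> refine a h (x - rvec k) = 0"
  let ?d = "of_nat (dM M) :: complex"
  obtain R where R: "\<And>y. h y \<noteq> 0 \<Longrightarrow> norm y \<le> R" using h(2) by (auto simp: csupp_def)
  let ?z = "act M x"
  define S' where "S' = {k. norm (?z - rvec k) \<le> R}"
  have S': "finite S'" "\<And>k. k \<notin> S' \<Longrightarrow> h (?z - rvec k) = 0"
    using lattice_ball_finite R by (auto simp: S'_def)
  define T where "T = S \<union> (\<Union>l\<in>{l. a l \<noteq> 0}. {k. M *v k + l \<in> S'})"
  have T: "finite T"
  proof -
    have "finite {k. M *v k + l \<in> S'}" for l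
      using finite_vimageI[OF S'(1), of "\<lambda>k. M *v k + l"] by (simp add: inj_on_def vimage_def)
    then show ?thesis using S(1) l0_finite[OF a_l0] by (simp add: T_def)
  qed
  have "(\<Sum>k\<in>S. p (rvec k) * refine a h (x - rvec k)) = (\<Sum>k\<in>T. p (rvec k) * refine a h (x - rvec k))"
    by (rule sum.mono_neutral_left[OF T]) (use S in \<open>auto simp: T_def\<close>)
  also have "\<dots> = ?d * (\<Sum>k\<in>T. \<Sum>l | a l \<noteq> 0. a l * (p (rvec k) * h (?z - rvec (M *v k + l))))"
    unfolding refine_def sum_distrib_left by (simp add: act_diff act_rvec rvec_add diff_diff_eq mult_ac)
  also have "\<dots> = ?d * (\<Sum>l | a l \<noteq> 0. a l * (\<Sum>k\<in>T. p (rvec k) * h (?z - rvec (M *v k + l))))"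
    unfolding sum_distrib_left by (subst sum.swap) simp
  also have "\<dots> = ?d * (\<Sum>l | a l \<noteq> 0. a l * (\<Sum>k\<in>S'. if crep k = crep l then p (ainv (rvec k - rvec l)) * h (?z - rvec k) else 0))"
  proof -
    have "(\<Sum>k\<in>T. p (rvec k) * h (?z - rvec (M *v k + l))) =
        (\<Sum>k\<in>S'. if crep k = crep l then p (ainv (rvec k - rvec l)) * h (?z - rvec k) else 0)" if l: "a l \<noteq> 0" for l
    proof -
      have "(\<Sum>k\<in>T. (\<lambda>k. p (ainv (rvec k - rvec l)) * h (?z - rvec k)) (M *v k + l)) =
        (\<Sum>k\<in>S'. if crep k = crep l then p (ainv (rvec k - rvec l)) * h (?z - rvec k) else 0)"
        by (rule sum_coset_reindex[OF S'(1) _ T]) (use l S'(2) in \<open>auto simp: T_def\<close>)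
      then show ?thesis by (simp add: rvec_add)
    qed
    then show ?thesis by simp
  qed
  also have "\<dots> = (\<Sum>k\<in>S'. (?d * (\<Sum>l | a l \<noteq> 0. if crep l = crep k then a l * p (ainv (rvec k - rvec l)) else 0)) * h (?z - rvec k))"
    unfolding sum_distrib_left sum_distrib_right by (subst sum.swap) (intro sum.cong refl, auto)
  also have "\<dots> = (\<Sum>k\<in>S'. p (ainv (rvec k)) * h (?z - rvec k))"
  proof (rule sum.cong[OF refl])
    fix k
    have "polydeg n (\<lambda>y. p (ainv (rvec k - y)))"
      unfolding ainv_def using polydeg_reflect[OF polydeg_affine[OF p, of "matrix_inv (rmat M)" 0]] by simp
    from coset_moment(1)[OF this n, of k]
    show "(?d * (\<Sum>l | a l \<noteq> 0. if crep l = crep k then a l * p (ainv (rvec k - rvec l)) else 0)) * h (?z - rvec k) =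
        p (ainv (rvec k)) * h (?z - rvec k)" using dM_pos by simp
  qed
  also have "\<dots> = p (ainv ?z)"
  proof -
    have "polydeg n (\<lambda>y. p (ainv y))" unfolding ainv_def using polydeg_affine[OF p, of "matrix_inv (rmat M)" 0] by simp
    from reproducesD[OF h(1) this n S'(1) S'(2)] show ?thesis by simp
  qed
  finally show "(\<Sum>k\<in>S. p (rvec k) * refine a h (x - rvec k)) = p x" by simp
qed

lemma refine_pow_sum:
  "(refine a ^^ n) h x = (\<Sum>k | an n k \<noteq> 0. of_nat (dM M) ^ n * an n k * h ((act M ^^ n) x - rvec k))"
proof (induction n arbitrary: x)
  case 0
  have "(\<Sum>k | an 0 k \<noteq> 0. of_nat (dM M) ^ 0 * an 0 k * h ((act M ^^ 0) x - rvec k)) =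
      (\<Sum>k\<in>{0}. an 0 k * h (x - rvec k))"
    unfolding an_0 by (simp add: delta_def)
  then show ?case by (simp add: an_0 delta_def)
next
  case (Suc n)
  let ?d = "of_nat (dM M) :: complex"
  let ?g = "\<lambda>k. ?d ^ Suc n * h ((act M ^^ Suc n) x - rvec k)"
  have arg: "(act M ^^ n) (act M x - rvec l) - rvec k = (act M ^^ Suc n) x - rvec (k + Mpow n l)" for k l
    by (simp add: act_pow_diff rvec_add rvec_Mpow funpow_swap1)
  have "(refine a ^^ Suc n) h x = ?d * (\<Sum>l | a l \<noteq> 0. a l * (refine a ^^ n) h (act M x - rvec l))"
    by (simp add: refine_def)
  also have "\<dots> = (\<Sum>l | a l \<noteq> 0. a l * (\<Sum>k | an n k \<noteq> 0. an n k * ?g (k + Mpow n l)))"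
    unfolding Suc arg sum_distrib_left by (simp add: mult_ac)
  also have "\<dots> = (\<Sum>k | upconv n (an n) a k \<noteq> 0. upconv n (an n) a k * ?g k)"
    by (rule upconv_sum[OF an_props(1) a_l0, symmetric])
  also have "upconv n (an n) a = an (Suc n)" using an_add[of n 1] by (simp add: an_1)
  finally show ?case by (simp add: mult_ac)
qed

abbreviation "ker \<equiv> kernel (2 * m) :: real ^ 'n \<Rightarrow> complex"

definition casc :: "nat \<Rightarrow> real ^ 'n \<Rightarrow> complex" where
  "casc n = (refine a ^^ n) ker"

lemma casc_Suc: "casc (Suc n) x = refine a (casc n) x"
  by (simp add: casc_def)

lemma ker_csupp: "csupp ker"
  using kernel_support[of "2 * m"] unfolding csupp_def by blast

lemma casc_csupp: "csupp (casc n)" and casc_reproduces: "reproduces (2 * m) (casc n)"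
proof (induction n)
  case (Suc n)
  have eq: "casc (Suc n) = refine a (casc n)" by (simp add: fun_eq_iff casc_Suc)
  { case 1 show ?case unfolding eq by (rule csupp_refine[OF a_l0 Suc(1)]) }
  { case 2 show ?case unfolding eq by (rule refine_reproduces[OF Suc(2,1)]) }
qed (simp_all add: casc_def ker_csupp kernel_reproduces)

lemma casc_uniform_support: "\<exists>R\<ge>0. \<forall>n x. casc n x \<noteq> 0 \<longrightarrow> norm x \<le> R"
proof -
  obtain R where R: "R \<ge> 0" "\<And>n k. an n k \<noteq> 0 \<Longrightarrow> norm ((ainv ^^ n) (rvec k)) \<le> R"
    using an_support by blast
  obtain Rk where Rk: "Rk \<ge> 0" "\<And>x. ker x \<noteq> 0 \<Longrightarrow> norm x \<le> Rk" using ker_csupp by (auto simp: csupp_def)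
  have "norm x \<le> R + invC * Rk" if nz: "casc n x \<noteq> 0" for n x
  proof -
    obtain k where k: "an n k \<noteq> 0" "ker ((act M ^^ n) x - rvec k) \<noteq> 0"
      using nz unfolding casc_def refine_pow_sum by (auto elim: sum.not_neutral_contains_not_neutral)
    let ?y = "(act M ^^ n) x - rvec k"
    have "x = (ainv ^^ n) (rvec k) + (ainv ^^ n) ?y" by (simp add: ainv_pow_diff)
    then have "norm x \<le> norm ((ainv ^^ n) (rvec k)) + norm ((ainv ^^ n) ?y)" by (metis norm_triangle_ineq)
    moreover have "norm ((ainv ^^ n) ?y) \<le> invC * Rk"
    proof -
      have "norm ((ainv ^^ n) ?y) \<le> invC * invL ^ n * norm ?y" by (rule inv_bounds)
      also have "\<dots> \<le> invC * 1 * Rk"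
        using inv_bounds(1-3) Rk(2)[OF k(2)] Rk(1) by (intro mult_mono power_le_one) auto
      finally show ?thesis by simp
    qed
    ultimately show ?thesis using R(2)[OF k(1)] by linarith
  qed
  then show ?thesis using R(1) Rk(1) inv_bounds(1) by (intro exI[of _ "R + invC * Rk"]) auto
qed

text \<open>At lattice points a cascade step reads \<open>a\<close> on the sublattice only, where it
  is interpolatory, so delta data are preserved at every stage.\<close>

lemma casc_rvec: "casc n (rvec k) = delta k"
proof (induction n arbitrary: k)
  case 0
  then show ?case using m_pos by (simp add: casc_def kernel_rvec)
next
  case (Suc n)
  have "casc (Suc n) (rvec k) = of_nat (dM M) * (\<Sum>l | a l \<noteq> 0. a l * delta (M *v k - l))"
    by (simp add: casc_Suc refine_def act_rvec Suc flip: rvec_diff)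
  also have "(\<Sum>l | a l \<noteq> 0. a l * delta (M *v k - l)) = (\<Sum>l | a l \<noteq> 0. if l = M *v k then a l else 0)"
    by (intro sum.cong) (auto simp: delta_def)
  also have "\<dots> = a (M *v k)" using l0_finite[OF a_l0] by simp
  finally show ?case using dM_pos by (simp add: a_mult delta_def)
qed

text \<open>The rescaled coefficients of \<open>an n\<close> are values of the n-th cascade iterate
  on the refined grid. A uniform bound on the iterates therefore bounds these coefficients, as
  \<open>phi_modulus\<close> requires.\<close>

lemma casc_grid: "casc n ((ainv ^^ n) (rvec k)) = of_nat (dM M) ^ n * an n k"
proof -
  have "casc n ((ainv ^^ n) (rvec k)) = (\<Sum>j | an n j \<noteq> 0. of_nat (dM M) ^ n * an n j * delta (k - j))"
    unfolding casc_def refine_pow_sum using m_pos by (simp add: kernel_rvec flip: rvec_diff)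
  also have "\<dots> = (\<Sum>j | an n j \<noteq> 0. if j = k then of_nat (dM M) ^ n * an n j else 0)"
    by (intro sum.cong) (auto simp: delta_def)
  also have "\<dots> = of_nat (dM M) ^ n * an n k" using l0_finite[OF an_props(1)] by simp
  finally show ?thesis .
qed

end

locale smooth_filter = interp_filter +
  assumes smooth: "sm_inf a M > 0"
begin

text \<open>For each \<open>y\<close> the sequence \<open>k \<mapsto> H(y + k)\<close>, \<open>H = Q G - G\<close>, kills the polynomials that both
  \<open>G\<close> and \<open>Q G\<close> reproduce, so its convolution with \<open>a\<^sub>n\<close> is controlled by the differences of order \<open>2 m\<close>.\<close>

lemma casc_step:
  "\<exists>C r. 0 < r \<and> r < 1 \<and> (\<forall>n x. cmod (casc (Suc n) x - casc n x) \<le> C * r ^ n)"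
proof -
  obtain r where r: "0 < r" "r < 1" and decay: "\<And>v. v \<in> l0 \<Longrightarrow> annih (2 * m) v \<Longrightarrow>
    \<exists>K\<ge>0. \<forall>n k. real (dM M) ^ n * cmod (conv v (an n) k) \<le> K * r ^ n"
    using annih_decay[OF smooth] by blast
  let ?H = "\<lambda>x. refine a ker x - ker x"
  obtain B L where B: "B \<ge> 0" "\<And>x. cmod (ker x) \<le> B" using kernel_lipschitz[of "2 * m"] by blast
  define NH where "NH = real (dM M) * ((\<Sum>l | a l \<noteq> 0. cmod (a l)) * B) + B"
  have NH: "cmod (?H x) \<le> NH" for x
    using norm_triangle_ineq4[of "refine a ker x" "ker x"] refine_bounded[of ker B a x, OF B(2)] B(2)[of x]
    by (simp add: NH_def)
  obtain R1 R2 where R12: "\<And>x. ker x \<noteq> 0 \<Longrightarrow> norm x \<le> R1" "\<And>x. refine a ker x \<noteq> 0 \<Longrightarrow> norm x \<le> R2"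
    using ker_csupp csupp_refine[OF a_l0 ker_csupp] by (auto simp: csupp_def)
  define R where "R = max R1 R2"
  have R: "ker x = 0" "refine a ker x = 0" if "norm x > R" for x
    using R12[of x] that by (auto simp: R_def)
  obtain Rc where Rc: "\<And>y :: real ^ 'a. y \<in> unit_cube \<Longrightarrow> norm y \<le> Rc"
    using bounded_unit_cube by (auto simp: bounded_iff)
  define K where "K = {k :: int ^ 'a. norm (0 - rvec k) \<le> R + Rc}"
  have finK: "finite K" unfolding K_def by (rule lattice_ball_finite)
  \<comment> \<open>The constants of decay depend on the filter. As \<open>W\<close> is finite
    dimensional, those of the finitely many members of \<open>Bs\<close> serve every point of the
    unit cube.\<close>
  define W where "W = {v. (\<forall>k. k \<notin> K \<longrightarrow> v k = 0) \<and> annih (2 * m) v}"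
  have W_l0: "v \<in> l0" if "v \<in> W" for v using that finK by (intro l0I[of K]) (auto simp: W_def)
  have W_K: "w k = 0" if "w \<in> W" "k \<notin> K" for w k using that by (simp add: W_def)
  have W_add: "(\<lambda>k. v k + w k) \<in> W" if "v \<in> W" "w \<in> W" for v w
    using that W_l0[OF that(1)] W_l0[OF that(2)] by (auto simp: W_def intro: annih_add)
  have W_scale: "(\<lambda>k. c * v k) \<in> W" if "v \<in> W" for c v using that by (auto simp: W_def intro: annih_scale)
  obtain Bs C where Bs: "set Bs \<subseteq> W" "C \<ge> 0" and coord': "\<forall>w\<in>W. \<forall>N. (\<forall>k. cmod (w k) \<le> N) \<longrightarrow>
      (\<exists>t. (\<forall>k. w k = (\<Sum>i<length Bs. t i * (Bs ! i) k)) \<and> (\<forall>i<length Bs. cmod (t i) \<le> C * N))"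
  proof -
    have "\<exists>B C. set B \<subseteq> W \<and> C \<ge> 0 \<and> (\<forall>w\<in>W. \<forall>N. (\<forall>k. cmod (w k) \<le> N) \<longrightarrow>
      (\<exists>t. (\<forall>k. w k = (\<Sum>i<length B. t i * (B ! i) k)) \<and> (\<forall>i<length B. cmod (t i) \<le> C * N)))"
      by (rule bounded_coordinates[OF finK]) ((rule W_K W_add W_scale; assumption)+)
    then show ?thesis using that by blast
  qed
  have BsW: "Bs ! i \<in> W" if "i < length Bs" for i using Bs(1) that nth_mem by blast
  have "\<forall>i<length Bs. \<exists>K\<ge>0. \<forall>n k. real (dM M) ^ n * cmod (conv (Bs ! i) (an n) k) \<le> K * r ^ n"
    using decay W_l0 BsW by (auto simp: W_def)
  then obtain CB where CB: "\<And>i. i < length Bs \<Longrightarrow> CB i \<ge> 0"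
    "\<And>i n k. i < length Bs \<Longrightarrow> real (dM M) ^ n * cmod (conv (Bs ! i) (an n) k) \<le> CB i * r ^ n" by metis
  have HW: "(\<lambda>k. ?H (y + rvec k)) \<in> W" if y: "y \<in> unit_cube" for y
  proof -
    let ?v = "\<lambda>k. ?H (y + rvec k)"
    have vK: "?v k = 0" if "k \<notin> K" for k
    proof -
      have "norm (rvec k) \<le> norm (y + rvec k) + norm y"
        using norm_triangle_ineq4[of "y + rvec k" y] by simp
      then have "norm (y + rvec k) > R" using that Rc[OF y] by (simp add: K_def)
      then show ?thesis using R by simp
    qed
    have "annih (2 * m) ?v"
      unfolding annih_def
    proof (intro allI impI)
      fix n and p :: "real ^ 'a \<Rightarrow> complex" assume n: "n < 2 * m" and p: "polydeg n p"
      let ?p = "\<lambda>x. p (0 - x)"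
      let ?S = "uminus ` K"
      have p': "polydeg n ?p" by (rule polydeg_reflect[OF p])
      have out: "ker (y - rvec k) = 0" "refine a ker (y - rvec k) = 0" if "k \<notin> ?S" for k
      proof -
        have "- k \<notin> K" using that by (metis image_eqI minus_minus)
        then have "norm (rvec k) > R + Rc" by (simp add: K_def rvec_minus)
        moreover have "norm (rvec k) \<le> norm (y - rvec k) + norm y"
          using norm_triangle_ineq4[of y "y - rvec k"] by simp
        ultimately have "norm (y - rvec k) > R" using Rc[OF y] by linarith
        then show "ker (y - rvec k) = 0" "refine a ker (y - rvec k) = 0" using R by auto
      qed
      have "moment ?v p = (\<Sum>k\<in>K. ?v k * p (rvec k))"
        by (rule sum_superset[OF finK vK])
      also have "\<dots> = (\<Sum>k\<in>?S. ?p (rvec k) * ?H (y - rvec k))"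
        by (subst sum.reindex) (auto simp: rvec_minus mult.commute)
      also have "\<dots> = (\<Sum>k\<in>?S. ?p (rvec k) * refine a ker (y - rvec k)) - (\<Sum>k\<in>?S. ?p (rvec k) * ker (y - rvec k))"
        by (simp only: right_diff_distrib sum_subtractf)
      also have "(\<Sum>k\<in>?S. ?p (rvec k) * refine a ker (y - rvec k)) = ?p y"
        by (rule reproducesD[OF refine_reproduces[OF kernel_reproduces ker_csupp] p' n]) (use finK out in auto)
      also have "(\<Sum>k\<in>?S. ?p (rvec k) * ker (y - rvec k)) = ?p y"
        by (rule reproducesD[OF kernel_reproduces p' n]) (use finK out in auto)
      finally show "moment ?v p = 0" by simp
    qed
    then show ?thesis using vK by (simp add: W_def)
  qed
  have "cmod (casc (Suc n) x - casc n x) \<le> (C * NH * (\<Sum>i<length Bs. CB i)) * r ^ n" for n x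
  proof -
    let ?z = "(act M ^^ n) x"
    \<comment> \<open>The integer part of the dilated point only shifts the index; the sequence
      \<open>?v\<close> depends on the fractional part alone and lies in \<open>W\<close>.\<close>
    let ?\<beta> = "floor_vec ?z"
    let ?y = "?z - rvec ?\<beta>"
    let ?v = "\<lambda>k. ?H (?y + rvec k)"
    have y: "?y \<in> unit_cube" by (rule floor_vec_cube)
    have "casc (Suc n) x = (refine a ^^ n) (refine a ker) x" by (simp add: casc_def funpow_swap1)
    then have "casc (Suc n) x - casc n x = (\<Sum>k | an n k \<noteq> 0. of_nat (dM M) ^ n * an n k * ?H (?z - rvec k))"
      unfolding casc_def[of n] refine_pow_sum by (simp add: right_diff_distrib sum_subtractf)
    also have "\<dots> = of_nat (dM M) ^ n * conv (an n) ?v ?\<beta>"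
      unfolding conv_def by (simp add: rvec_diff sum_distrib_left mult.assoc)
    also have "conv (an n) ?v ?\<beta> = conv ?v (an n) ?\<beta>"
      using conv_commute[OF an_props(1) W_l0[OF HW[OF y]]] by simp
    finally have eq: "casc (Suc n) x - casc n x = of_nat (dM M) ^ n * conv ?v (an n) ?\<beta>" .
    have "\<exists>t. (\<forall>k. ?v k = (\<Sum>i<length Bs. t i * (Bs ! i) k)) \<and> (\<forall>i<length Bs. cmod (t i) \<le> C * NH)"
      by (rule coord'[rule_format, OF HW[OF y]]) (rule NH)
    then obtain t where t': "\<forall>k. ?v k = (\<Sum>i<length Bs. t i * (Bs ! i) k)" "\<forall>i<length Bs. cmod (t i) \<le> C * NH"
      by (elim exE conjE) (rule that; assumption)
    note t = t'[rule_format]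
    have "conv ?v (an n) ?\<beta> = (\<Sum>j\<in>K. ?v j * an n (?\<beta> - j))"
      by (rule conv_superset[OF finK]) (rule W_K[OF HW[OF y]])
    also have "\<dots> = (\<Sum>i<length Bs. t i * (\<Sum>j\<in>K. (Bs ! i) j * an n (?\<beta> - j)))"
      unfolding t(1) sum_distrib_left sum_distrib_right by (subst sum.swap) (simp add: mult.assoc)
    also have "\<dots> = (\<Sum>i<length Bs. t i * conv (Bs ! i) (an n) ?\<beta>)"
    proof (rule sum.cong[OF refl])
      fix i assume "i \<in> {..<length Bs}"
      then have "conv (Bs ! i) (an n) ?\<beta> = (\<Sum>j\<in>K. (Bs ! i) j * an n (?\<beta> - j))"
        using BsW by (intro conv_superset[OF finK] W_K) auto
      then show "t i * (\<Sum>j\<in>K. (Bs ! i) j * an n (?\<beta> - j)) = t i * conv (Bs ! i) (an n) ?\<beta>" by simp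
    qed
    finally have "casc (Suc n) x - casc n x = (\<Sum>i<length Bs. t i * (of_nat (dM M) ^ n * conv (Bs ! i) (an n) ?\<beta>))"
      unfolding eq by (simp add: sum_distrib_left mult_ac)
    also have "cmod \<dots> \<le> (\<Sum>i<length Bs. (C * NH) * (CB i * r ^ n))"
    proof (rule sum_norm_le)
      fix i assume i: "i \<in> {..<length Bs}"
      have "cmod (t i) * (real (dM M) ^ n * cmod (conv (Bs ! i) (an n) ?\<beta>)) \<le> (C * NH) * (CB i * r ^ n)"
        using i order_trans[OF norm_ge_zero t(2)[of i]] by (intro mult_mono[of _ _ "real (dM M) ^ n * _"] t(2) CB(2)) auto
      then show "cmod (t i * (of_nat (dM M) ^ n * conv (Bs ! i) (an n) ?\<beta>)) \<le> (C * NH) * (CB i * r ^ n)"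
        by (simp add: norm_mult norm_power)
    qed
    also have "\<dots> = (C * NH * (\<Sum>i<length Bs. CB i)) * r ^ n" by (simp add: sum_distrib_left sum_distrib_right mult_ac)
    finally show ?thesis .
  qed
  then show ?thesis using r by blast
qed

section \<open>The limit function of the cascade\<close>

definition phi :: "real ^ 'a \<Rightarrow> complex" where
  "phi x = lim (\<lambda>n. casc n x)"

lemma casc_phi: "\<exists>C r. 0 < r \<and> r < 1 \<and> C \<ge> 0 \<and> (\<forall>n x. cmod (casc n x - phi x) \<le> C * r ^ n)"
proof -
  obtain C r where r: "0 < r" "r < 1" and C: "\<And>n x. cmod (casc (Suc n) x - casc n x) \<le> C * r ^ n"
    using casc_step by blast
  have "cmod (casc n x - phi x) \<le> C / (1 - r) * r ^ n" for n x
    using geometric_Cauchy[of "\<lambda>n. casc n x" C r] C r by (simp add: phi_def)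
  moreover have "C / (1 - r) \<ge> 0" using order_trans[OF norm_ge_zero C[of 0 0]] r by simp
  ultimately show ?thesis using r by blast
qed

lemma casc_tendsto: "(\<lambda>n. casc n x) \<longlonglongrightarrow> phi x"
proof -
  obtain C r where r: "0 < r" "r < 1" and C: "\<And>n x. cmod (casc (Suc n) x - casc n x) \<le> C * r ^ n"
    using casc_step by blast
  have "convergent (\<lambda>n. casc n x)" using geometric_Cauchy[of "\<lambda>n. casc n x" C r] C r by simp
  then show ?thesis by (simp add: phi_def convergent_LIMSEQ_iff)
qed

lemma phi_csupp: "csupp phi"
proof -
  obtain R where R: "R \<ge> 0" "\<And>n x. casc n x \<noteq> 0 \<Longrightarrow> norm x \<le> R" using casc_uniform_support by blast
  have "phi x = 0" if "norm x > R" for x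
  proof -
    have "casc n x = 0" for n using R(2)[of n x] that by auto
    then show ?thesis using casc_tendsto[of x] by (simp add: LIMSEQ_const_iff)
  qed
  then show ?thesis using R(1) unfolding csupp_def by (metis linorder_not_le)
qed

lemma phi_refine: "phi x = refine a phi x"
proof (rule LIMSEQ_unique)
  show "(\<lambda>n. casc (Suc n) x) \<longlonglongrightarrow> phi x" by (rule LIMSEQ_Suc[OF casc_tendsto])
  show "(\<lambda>n. casc (Suc n) x) \<longlonglongrightarrow> refine a phi x"
    unfolding casc_Suc refine_def by (intro tendsto_intros casc_tendsto)
qed

lemma phi_rvec: "phi (rvec k) = delta k"
  using casc_tendsto[of "rvec k"] unfolding casc_rvec by (simp add: LIMSEQ_const_iff)

text \<open>Every cascade iterate reproduces constants, and the supports are uniformly bounded, so a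
  common finite sum passes to the limit.\<close>

lemma phi_partition:
  assumes "finite S" "\<And>k. k \<notin> S \<Longrightarrow> phi (x - rvec k) = 0"
  shows "(\<Sum>k\<in>S. phi (x - rvec k)) = 1"
proof -
  obtain R where R: "R \<ge> 0" "\<And>n x. casc n x \<noteq> 0 \<Longrightarrow> norm x \<le> R" using casc_uniform_support by blast
  let ?T = "S \<union> {k. norm (x - rvec k) \<le> R}"
  have T: "finite ?T" using assms(1) lattice_ball_finite by simp
  have "(\<Sum>k\<in>?T. (\<lambda>_. 1) (rvec k) * casc n (x - rvec k)) = 1" for n
    by (rule reproducesD[OF casc_reproduces polydeg.const[of 0]]) (use m_pos T R(2) in auto)
  moreover have "(\<lambda>n. \<Sum>k\<in>?T. casc n (x - rvec k)) \<longlonglongrightarrow> (\<Sum>k\<in>?T. phi (x - rvec k))"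
    by (intro tendsto_intros casc_tendsto)
  ultimately have "(\<Sum>k\<in>?T. phi (x - rvec k)) = 1" by (simp add: LIMSEQ_const_iff)
  moreover have "(\<Sum>k\<in>?T. phi (x - rvec k)) = (\<Sum>k\<in>S. phi (x - rvec k))"
    by (rule sum.mono_neutral_right[OF T]) (use assms in auto)
  ultimately show ?thesis by simp
qed

lemma phi_bounded: "\<exists>B\<ge>0. (\<forall>x. cmod (phi x) \<le> B) \<and> (\<forall>n x. cmod (casc n x) \<le> B)"
proof -
  obtain C r where r: "0 < r" "r < 1" "C \<ge> 0" and C: "\<And>n x. cmod (casc n x - phi x) \<le> C * r ^ n"
    using casc_phi by blast
  obtain B where B: "B \<ge> 0" "\<And>x. cmod (ker x) \<le> B" using kernel_lipschitz[of "2 * m"] by blast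
  have phi: "cmod (phi x) \<le> B + C" for x
    using C[of 0 x] B(2)[of x] norm_triangle_ineq4[of "casc 0 x" "casc 0 x - phi x"] by (simp add: casc_def)
  have "cmod (casc n x) \<le> B + C + C" for n x
  proof -
    have "C * r ^ n \<le> C * 1" using r by (intro mult_left_mono power_le_one) auto
    then have "cmod (casc n x - phi x) \<le> C" using C[of n x] by simp
    then show ?thesis using phi[of x] norm_triangle_ineq[of "casc n x - phi x" "phi x"] by simp
  qed
  moreover have "cmod (phi x) \<le> B + C + C" for x using phi[of x] r(3) by simp
  ultimately show ?thesis using B(1) r(3) by (intro exI[of _ "B + C + C"]) auto
qed

text \<open>\<open>r ^ n\<close> is the uniform distance to the n-th iterate and
  \<open>A ^ n\<close> the growth of its Lipschitz constant: by \<open>casc_grid\<close> the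
  coefficients are bounded, and only boundedly many kernels are nonzero at \<open>x\<close> or
  \<open>y\<close>. The index \<open>n\<close> stays free, to be balanced later.\<close>

lemma phi_modulus:
  "\<exists>C r A. C \<ge> 0 \<and> 0 < r \<and> r < 1 \<and> A \<ge> 1 \<and> (\<forall>n x y. cmod (phi x - phi y) \<le> C * (r ^ n + A ^ n * norm (x - y)))"
proof -
  obtain C r where r: "0 < r" "r < 1" "C \<ge> 0" and C: "\<And>n x. cmod (casc n x - phi x) \<le> C * r ^ n"
    using casc_phi by blast
  obtain L where L: "L \<ge> 0" "\<And>x y. cmod (ker x - ker y) \<le> L * norm (x - y)" using kernel_lipschitz[of "2 * m"] by blast
  obtain B where B: "B \<ge> 0" "\<And>n x. cmod (casc n x) \<le> B" using phi_bounded by blast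
  obtain Rk where Rk: "\<And>x. ker x \<noteq> 0 \<Longrightarrow> norm x \<le> Rk" using ker_csupp by (auto simp: csupp_def)
  obtain CC where CC: "\<And>x :: real ^ 'a. card {k. norm (x - rvec k) \<le> Rk} \<le> CC" using lattice_ball_card by blast
  obtain A where A: "A \<ge> 1" "\<And>n x. norm ((act M ^^ n) x) \<le> A ^ n * norm x" using act_pow_bound by blast
  have lip: "cmod (casc n x - casc n y) \<le> real (2 * CC) * (B * L) * (A ^ n * norm (x - y))" for n x y
  proof -
    let ?X = "(act M ^^ n) x" and ?Y = "(act M ^^ n) y"
    let ?S = "{k. norm (?X - rvec k) \<le> Rk} \<union> {k. norm (?Y - rvec k) \<le> Rk}"
    have S: "finite ?S" using lattice_ball_finite by blast
    have cardS: "card ?S \<le> 2 * CC"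
      using card_Un_le[of "{k. norm (?X - rvec k) \<le> Rk}" "{k. norm (?Y - rvec k) \<le> Rk}"] CC[of ?X] CC[of ?Y] by linarith
    let ?t = "\<lambda>k. of_nat (dM M) ^ n * an n k * (ker (?X - rvec k) - ker (?Y - rvec k))"
    have "casc n x - casc n y = (\<Sum>k | an n k \<noteq> 0. ?t k)"
      unfolding casc_def refine_pow_sum by (simp add: right_diff_distrib sum_subtractf)
    also have "\<dots> = (\<Sum>k\<in>{k. an n k \<noteq> 0} \<inter> ?S. ?t k)"
    proof (rule sum.mono_neutral_right)
      have "ker (?X - rvec k) = 0 \<and> ker (?Y - rvec k) = 0" if "k \<notin> ?S" for k using Rk that by blast
      then show "\<forall>k\<in>{k. an n k \<noteq> 0} - {k. an n k \<noteq> 0} \<inter> ?S. ?t k = 0" by fastforce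
    qed (use l0_finite[OF an_props(1)] in auto)
    finally have eq: "casc n x - casc n y = (\<Sum>k\<in>{k. an n k \<noteq> 0} \<inter> ?S. ?t k)" .
    have le1: "cmod (casc n x - casc n y) \<le> of_nat (card ({k. an n k \<noteq> 0} \<inter> ?S)) * (B * L * (A ^ n * norm (x - y)))"
      unfolding eq
    proof (rule sum_norm_bound)
      fix k
      have "cmod (of_nat (dM M) ^ n * an n k) \<le> B" using B(2)[of n "(ainv ^^ n) (rvec k)"] by (simp add: casc_grid)
      moreover have "cmod (ker (?X - rvec k) - ker (?Y - rvec k)) \<le> L * (A ^ n * norm (x - y))"
      proof -
        have "cmod (ker (?X - rvec k) - ker (?Y - rvec k)) \<le> L * norm (?X - ?Y)"
          using L(2)[of "?X - rvec k" "?Y - rvec k"] by simp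
        moreover have "L * norm (?X - ?Y) \<le> L * (A ^ n * norm (x - y))"
          using A(2)[of n "x - y"] L(1) by (intro mult_left_mono) (simp_all add: act_pow_diff)
        ultimately show ?thesis by linarith
      qed
      ultimately have "cmod (?t k) \<le> B * (L * (A ^ n * norm (x - y)))"
        unfolding norm_mult[of "of_nat (dM M) ^ n * an n k"] using B(1) by (intro mult_mono) auto
      then show "cmod (?t k) \<le> B * L * (A ^ n * norm (x - y))" by (simp add: mult.assoc)
    qed
    have le2: "of_nat (card ({k. an n k \<noteq> 0} \<inter> ?S)) * (B * L * (A ^ n * norm (x - y))) \<le> real (2 * CC) * (B * L * (A ^ n * norm (x - y)))"
    proof (intro mult_right_mono)
      have "card ({k. an n k \<noteq> 0} \<inter> ?S) \<le> card ?S" by (rule card_mono[OF S]) auto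
      then show "real (card ({k. an n k \<noteq> 0} \<inter> ?S)) \<le> real (2 * CC)" using cardS by linarith
      show "0 \<le> B * L * (A ^ n * norm (x - y))" using B(1) L(1) A(1) by simp
    qed
    show ?thesis using order_trans[OF le1 le2] by (simp only: mult.assoc)
  qed
  define D where "D = 2 * C + real (2 * CC) * (B * L)"
  have "cmod (phi x - phi y) \<le> D * (r ^ n + A ^ n * norm (x - y))" for n x y
  proof -
    have "phi x - phi y = - (casc n x - phi x) + (casc n x - casc n y) + (casc n y - phi y)" by simp
    then have "cmod (phi x - phi y) \<le> cmod (casc n x - phi x) + cmod (casc n x - casc n y) + cmod (casc n y - phi y)"
      by (metis norm_minus_cancel norm_triangle_ineq norm_triangle_mono order_refl)
    also have "\<dots> \<le> 2 * C * r ^ n + real (2 * CC) * (B * L) * (A ^ n * norm (x - y))"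
      using C[of n x] C[of n y] lip[of n x y] by linarith
    also have "\<dots> \<le> D * r ^ n + D * (A ^ n * norm (x - y))"
      using r(1,3) B(1) L(1) A(1) by (intro add_mono mult_right_mono) (auto simp: D_def)
    finally show ?thesis by (simp add: distrib_left)
  qed
  moreover have "D \<ge> 0" using r(3) B(1) L(1) by (simp add: D_def)
  ultimately show ?thesis using r A(1) by blast
qed

lemma phi_continuous: "continuous_on UNIV phi"
proof -
  obtain C r where r: "0 < r" "r < 1" and C: "C \<ge> 0" "\<And>n x. cmod (casc n x - phi x) \<le> C * r ^ n"
    using casc_phi by blast
  have contk: "continuous_on UNIV ker"
  proof -
    obtain L where "L \<ge> 0" "\<And>x y. cmod (ker x - ker y) \<le> L * norm (x - y)" using kernel_lipschitz[of "2 * m"] by blast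
    then have "L-lipschitz_on UNIV ker" by (intro lipschitz_onI) (auto simp: dist_norm)
    then show ?thesis by (rule lipschitz_on_continuous_on)
  qed
  have "continuous_on UNIV (casc n)" for n
  proof -
    have "continuous_on UNIV (\<lambda>x. ker ((act M ^^ n) x - rvec k))" for k
      by (rule continuous_on_compose2[OF contk]) (auto intro!: continuous_intros act_pow_continuous)
    then show ?thesis unfolding casc_def refine_pow_sum[abs_def] by (intro continuous_intros)
  qed
  moreover have "uniform_limit UNIV casc phi sequentially"
  proof (rule uniform_limitI)
    fix e :: real assume "e > 0"
    have "(\<lambda>n. C * r ^ n) \<longlonglongrightarrow> 0" using r by (intro tendsto_mult_right_zero LIMSEQ_power_zero) auto
    from order_tendstoD(2)[OF this \<open>e > 0\<close>]
    show "\<forall>\<^sub>F n in sequentially. \<forall>x\<in>UNIV. dist (casc n x) (phi x) < e"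
      by (rule eventually_mono) (use C(2) in \<open>auto simp: dist_norm intro: le_less_trans\<close>)
  qed
  ultimately show ?thesis by (intro uniform_limit_theorem[where F = sequentially]) auto
qed

lemma phi_fundamental: "fundamental phi"
  by (simp add: fundamental_def phi_continuous phi_rvec)

end

section \<open>Integrals of compactly supported functions\<close>

lemmas LINT_nonneg = Bochner_Integration.integral_nonneg
  and LINT_cong = Bochner_Integration.integral_cong
  and LINT_sum = Bochner_Integration.integral_sum
  and integrable_dominated = Bochner_Integration.integrable_bound

lemma lebesgue_integral_borel:
  fixes f :: "'a::euclidean_space \<Rightarrow> 'b::{banach, second_countable_topology}"
  assumes "f \<in> borel_measurable borel"
  shows "(LINT x|lebesgue. f x) = (LINT x|lborel. f x)"
  by (rule integral_completion) (use assms in simp)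

lemma integrable_lebesgue_borel:
  fixes f :: "'a::euclidean_space \<Rightarrow> 'b::{banach, second_countable_topology}"
  assumes "f \<in> borel_measurable borel"
  shows "integrable lebesgue f \<longleftrightarrow> integrable lborel f"
  by (rule integrable_completion) (use assms in simp)

lemma bounded_csupp_integrable:
  fixes f :: "'a::euclidean_space \<Rightarrow> 'b::{banach, second_countable_topology}"
  assumes f: "f \<in> borel_measurable borel" "\<And>x. norm (f x) \<le> B" "csupp f"
  shows "integrable lborel f"
proof -
  obtain R where R: "\<And>x. f x \<noteq> 0 \<Longrightarrow> norm x \<le> R" using f(3) by (auto simp: csupp_def)
  have "integrable lborel (\<lambda>x. indicator (cball 0 R) x *\<^sub>R B)"
    by (intro integrable_scaleR_left integrable_real_indicator emeasure_lborel_cball_finite) auto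
  then show ?thesis
  proof (rule integrable_dominated)
    show "AE x in lborel. norm (f x) \<le> norm (indicator (cball 0 R) x *\<^sub>R B)"
    proof (rule AE_I2)
      fix x
      show "norm (f x) \<le> norm (indicator (cball 0 R) x *\<^sub>R B)"
        using R[of x] f(2)[of x] by (cases "f x = 0") (auto simp: indicator_def)
    qed
  qed (use f in simp)
qed

lemma integral_translate:
  fixes f :: "'a::euclidean_space \<Rightarrow> 'b::{banach, second_countable_topology}"
  assumes "f \<in> borel_measurable borel"
  shows "(LINT x|lborel. f (x + t)) = (LINT x|lborel. f x)"
proof -
  have "(LINT x|distr lborel borel ((+) t). f x) = (LINT x|lborel. f (t + x))"
    using assms by (intro integral_distr) auto
  then show ?thesis by (simp add: lborel_distr_plus add.commute)
qed

lemma sets_unit_cube: "(unit_cube :: (real ^ 'n) set) \<in> sets borel"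
proof -
  have eq: "unit_cube = (\<Inter>i. {x :: real ^ 'n. 0 \<le> x $ i} \<inter> {x. x $ i < 1})" by (auto simp: unit_cube_def)
  have "{x :: real ^ 'n. 0 \<le> x $ i} \<inter> {x. x $ i < 1} \<in> sets borel" for i
    by (intro sets.Int borel_closed[OF closed_Collect_le] borel_open[OF open_Collect_less] continuous_intros)
  then show ?thesis unfolding eq by (intro sets.finite_INT) auto
qed

lemma emeasure_unit_cube: "emeasure lborel (unit_cube :: (real ^ 'n) set) = 1"
proof (rule antisym)
  have nth: "x $ i = x \<bullet> axis i 1" for x :: "real ^ 'n" and i by (simp add: inner_axis)
  have "unit_cube \<subseteq> (cbox 0 One :: (real ^ 'n) set)"
  proof
    fix x :: "real ^ 'n" assume x: "x \<in> unit_cube"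
    show "x \<in> cbox 0 One"
      unfolding mem_box
    proof
      fix b :: "real ^ 'n" assume b: "b \<in> Basis"
      then obtain i where "b = axis i 1" by (auto simp: Basis_vec_def)
      then have "0 \<le> x \<bullet> b \<and> x \<bullet> b \<le> 1" using x by (auto simp: unit_cube_def inner_axis less_imp_le)
      then show "0 \<bullet> b \<le> x \<bullet> b \<and> x \<bullet> b \<le> One \<bullet> b" using b by simp
    qed
  qed
  then have "emeasure lborel (unit_cube :: (real ^ 'n) set) \<le> emeasure lborel (cbox 0 One :: (real ^ 'n) set)"
    by (intro emeasure_mono) auto
  also have "\<dots> = 1" by (subst emeasure_lborel_cbox) (auto simp: inner_diff_left)
  finally show "emeasure lborel (unit_cube :: (real ^ 'n) set) \<le> 1" .
  have "(box 0 One :: (real ^ 'n) set) \<subseteq> unit_cube"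
  proof
    fix x :: "real ^ 'n" assume x: "x \<in> box 0 One"
    have "0 < x $ i \<and> x $ i < 1" for i
    proof -
      have "axis i (1 :: real) \<in> (Basis :: (real ^ 'n) set)" by (auto simp: Basis_vec_def)
      then show ?thesis using x unfolding mem_box nth by fastforce
    qed
    then show "x \<in> unit_cube" by (simp add: unit_cube_def less_imp_le)
  qed
  then have "emeasure lborel (box 0 One :: (real ^ 'n) set) \<le> emeasure lborel (unit_cube :: (real ^ 'n) set)"
    using sets_unit_cube by (intro emeasure_mono) auto
  also have "emeasure lborel (box 0 One :: (real ^ 'n) set) = 1" by (subst emeasure_lborel_box) (auto simp: inner_diff_left)
  finally show "1 \<le> emeasure lborel (unit_cube :: (real ^ 'n) set)" .
qed

lemma integral_unit_cube: "(LINT x|lborel. indicator (unit_cube :: (real ^ 'n) set) x *\<^sub>R c) = (c :: complex)"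
proof -
  have "integrable lborel (indicator (unit_cube :: (real ^ 'n) set) :: _ \<Rightarrow> real)"
    by (intro integrable_real_indicator) (simp_all add: sets_unit_cube emeasure_unit_cube)
  then have "(LINT x|lborel. indicator (unit_cube :: (real ^ 'n) set) x *\<^sub>R c) =
      (LINT x|lborel. indicator (unit_cube :: (real ^ 'n) set) x) *\<^sub>R c"
    by (intro integral_scaleR_left) simp
  also have "(LINT x|lborel. indicator (unit_cube :: (real ^ 'n) set) x) = (1 :: real)"
    by (simp add: measure_def emeasure_unit_cube sets_unit_cube)
  finally show ?thesis by simp
qed

text \<open>The integer translates of the half-open unit cube tile the space: \<open>x\<close> lies
  in the translate by \<open>floor_vec x\<close> and in no other.\<close>

lemma integral_periodize:
  fixes f :: "real ^ 'n \<Rightarrow> complex"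
  assumes f: "integrable lborel f" and S: "finite S" "\<And>x k. x \<in> unit_cube \<Longrightarrow> k \<notin> S \<Longrightarrow> f (x + rvec k) = 0"
  shows "(LINT x|lborel. f x) = (LINT x|lborel. indicator unit_cube x *\<^sub>R (\<Sum>k\<in>S. f (x + rvec k)))"
proof -
  have fb: "f \<in> borel_measurable borel" using f by simp
  have ind: "(indicator unit_cube :: real ^ 'n \<Rightarrow> real) \<in> borel_measurable borel"
    by (intro borel_measurable_indicator sets_unit_cube)
  have sh: "(\<lambda>x :: real ^ 'n. x + t) \<in> borel_measurable borel" for t by simp
  let ?g = "\<lambda>k x. indicator unit_cube (x - rvec k) *\<^sub>R f x"
  have gi: "integrable lborel (?g k)" for k
  proof (rule integrable_dominated[OF f])
    have "(\<lambda>x. indicator unit_cube (x - rvec k) :: real) \<in> borel_measurable borel"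
      using measurable_compose[OF sh[of "- rvec k"] ind] by simp
    then show "?g k \<in> borel_measurable lborel" using fb by simp
    show "AE x in lborel. norm (?g k x) \<le> norm (f x)" by (auto simp: indicator_def)
  qed
  have "f x = (\<Sum>k\<in>S. ?g k x)" for x
  proof (cases "floor_vec x \<in> S")
    case True
    have "(\<Sum>k\<in>S. ?g k x) = (\<Sum>k\<in>S. if k = floor_vec x then f x else 0)"
    proof (rule sum.cong[OF refl])
      fix k
      show "?g k x = (if k = floor_vec x then f x else 0)"
        using floor_vec_cube[of x] floor_vec_unique[of x k]
        by (cases "x - rvec k \<in> unit_cube") auto
    qed
    then show ?thesis using True S(1) by simp
  next
    case False
    have "f x = f ((x - rvec (floor_vec x)) + rvec (floor_vec x))" by simp
    then have "f x = 0" using S(2)[OF floor_vec_cube[of x] False] by simp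
    then show ?thesis by simp
  qed
  then have "(LINT x|lborel. f x) = (LINT x|lborel. (\<Sum>k\<in>S. ?g k x))" by simp
  also have "\<dots> = (\<Sum>k\<in>S. (LINT x|lborel. ?g k x))" using gi by (intro LINT_sum)
  also have "\<dots> = (\<Sum>k\<in>S. (LINT x|lborel. indicator unit_cube x *\<^sub>R f (x + rvec k)))"
  proof (rule sum.cong[OF refl])
    fix k
    show "(LINT x|lborel. ?g k x) = (LINT x|lborel. indicator unit_cube x *\<^sub>R f (x + rvec k))"
      using integral_translate[of "?g k" "rvec k"] gi[of k] by simp
  qed
  also have "\<dots> = (LINT x|lborel. (\<Sum>k\<in>S. indicator unit_cube x *\<^sub>R f (x + rvec k)))"
  proof (rule LINT_sum[symmetric])
    fix k
    have "integrable (distr lborel borel ((+) (rvec k))) (?g k)" unfolding lborel_distr_plus by (rule gi)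
    then have "integrable lborel (\<lambda>x. ?g k (rvec k + x))" by (subst (asm) integrable_distr_eq) (use gi[of k] in auto)
    then show "integrable lborel (\<lambda>x. indicator unit_cube x *\<^sub>R f (x + rvec k))" by (simp add: add.commute)
  qed
  finally show ?thesis by (simp add: scaleR_sum_right)
qed

lemma LINT_norm_le:
  fixes f :: "'a::euclidean_space \<Rightarrow> 'b::{banach, second_countable_topology}"
  assumes "integrable lebesgue f" "integrable lebesgue g" "\<And>x. norm (f x) \<le> g x"
  shows "norm (LINT x|lebesgue. f x) \<le> (LINT x|lebesgue. g x)"
  by (rule order_trans[OF integral_norm_bound integral_mono]) (use assms in auto)

text \<open>The class in which all integrands are kept: its members are Borel, bounded and
  integrable, and it is stable under translation, dilation, sums and multiplication by continuous
  functions.\<close>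

definition cc :: "(real ^ 'n \<Rightarrow> complex) \<Rightarrow> bool" where
  "cc h \<longleftrightarrow> continuous_on UNIV h \<and> csupp h"

lemma cc_borel: "cc h \<Longrightarrow> h \<in> borel_measurable borel"
  by (simp add: cc_def borel_measurable_continuous_onI)

lemma cc_bounded: "cc h \<Longrightarrow> \<exists>B\<ge>0. \<forall>x. cmod (h x) \<le> B"
proof -
  assume h: "cc h"
  obtain R where R: "\<And>x. h x \<noteq> 0 \<Longrightarrow> norm x \<le> R" using h by (auto simp: cc_def csupp_def)
  have "compact (h ` cball 0 R)"
    using h by (intro compact_continuous_image) (auto simp: cc_def intro: continuous_on_subset)
  then obtain B where B: "\<And>x. x \<in> cball 0 R \<Longrightarrow> cmod (h x) \<le> B"
    by (metis bounded_iff compact_imp_bounded imageI)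
  have "cmod (h x) \<le> max 0 B" for x using R[of x] B[of x] by (cases "h x = 0") auto
  then show ?thesis by (intro exI[of _ "max 0 B"]) auto
qed

lemma cc_integrable_lborel: "cc h \<Longrightarrow> integrable lborel h"
  using cc_bounded bounded_csupp_integrable cc_borel by (metis cc_def)

lemma cc_integrable: "cc h \<Longrightarrow> integrable lebesgue h"
  by (simp add: integrable_lebesgue_borel cc_borel cc_integrable_lborel)

lemma cc_mult: "cc h \<Longrightarrow> continuous_on UNIV g \<Longrightarrow> cc (\<lambda>x. h x * g x)"
  unfolding cc_def csupp_def by (auto intro: continuous_on_mult)

lemma cc_translate: "cc h \<Longrightarrow> cc (\<lambda>x. h (x + t))"
  unfolding cc_def
proof
  assume h: "continuous_on UNIV h \<and> csupp h"
  show "continuous_on UNIV (\<lambda>x. h (x + t))"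
    by (rule continuous_on_compose2[of UNIV h]) (use h in \<open>auto intro!: continuous_intros\<close>)
  obtain R where R: "R \<ge> 0" "\<And>x. h x \<noteq> 0 \<Longrightarrow> norm x \<le> R" using h by (auto simp: csupp_def)
  have "norm x \<le> R + norm t" if "h (x + t) \<noteq> 0" for x
    using R(2)[OF that] norm_triangle_ineq4[of "x + t" t] by simp
  then show "csupp (\<lambda>x. h (x + t))" unfolding csupp_def using R(1) by (intro exI[of _ "R + norm t"]) auto
qed

lemma cc_sum: "(\<And>i. i \<in> I \<Longrightarrow> cc (h i)) \<Longrightarrow> cc (\<lambda>x. \<Sum>i\<in>I. h i x)"
proof (induction I rule: infinite_finite_induct)
  case (insert i I)
  then have "cc (h i)" "cc (\<lambda>x. \<Sum>i\<in>I. h i x)" by auto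
  moreover from this obtain R1 R2 where
    R: "R1 \<ge> 0" "\<And>x. h i x \<noteq> 0 \<Longrightarrow> norm x \<le> R1" "\<And>x. (\<Sum>i\<in>I. h i x) \<noteq> 0 \<Longrightarrow> norm x \<le> R2"
    by (auto simp: cc_def csupp_def)
  have "norm x \<le> max R1 R2" if "h i x + (\<Sum>i\<in>I. h i x) \<noteq> 0" for x
    using that R(2)[of x] R(3)[of x] by (cases "h i x = 0") (auto simp: le_max_iff_disj)
  with R(1) have "csupp (\<lambda>x. h i x + (\<Sum>i\<in>I. h i x))"
    unfolding csupp_def by (intro exI[of _ "max R1 R2"]) auto
  ultimately show ?case using insert by (simp add: cc_def continuous_on_add)
qed (auto simp: cc_def csupp_def)

lemma cc_scale: "cc h \<Longrightarrow> cc (\<lambda>x. c * h x)"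
  using cc_mult[of h "\<lambda>_. c"] by (simp add: mult.commute)

lemma cc_cnj: "cc h \<Longrightarrow> cc (\<lambda>x. cnj (h x))"
  unfolding cc_def csupp_def by (auto intro: continuous_on_cnj)

lemma cc_cmod: "cc h \<Longrightarrow> cc (\<lambda>x. of_real (cmod (h x)))"
  unfolding cc_def csupp_def by (auto intro: continuous_intros)

lemma LINT_translate: "cc h \<Longrightarrow> (LINT x|lebesgue. h (x + t)) = (LINT x|lebesgue. h x)"
  by (simp add: lebesgue_integral_borel cc_borel cc_translate integral_translate)

context expanding
begin

lemma act_continuous: "continuous_on UNIV (act M)"
  using act_pow_continuous[of 1] by simp

lemma cc_act:
  assumes "cc h" shows "cc (\<lambda>x. h (act M x))"
proof -
  obtain R where R: "R \<ge> 0" "\<And>x. h x \<noteq> 0 \<Longrightarrow> norm x \<le> R" using assms by (auto simp: cc_def csupp_def)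
  have "norm x \<le> invC * invL * R" if nz: "h (act M x) \<noteq> 0" for x
  proof -
    have "norm x \<le> invC * invL * norm (act M x)" using inv_bounds(4)[of 1 "act M x"] by simp
    also have "\<dots> \<le> invC * invL * R" using R(2)[OF nz] inv_bounds(1,2) by (intro mult_left_mono) auto
    finally show ?thesis .
  qed
  moreover have "continuous_on UNIV (\<lambda>x. h (act M x))"
    by (rule continuous_on_compose2[of UNIV h]) (use assms act_continuous in \<open>auto simp: cc_def\<close>)
  ultimately show ?thesis using R(1) inv_bounds(1,2) unfolding cc_def csupp_def
    by (intro conjI exI[of _ "invC * invL * R"]) auto
qed

text \<open>The library's change of variables needs a well-ordered index type. For an integral matrix the
  factor \<open>1 / \<bar>det M\<bar>\<close> follows instead by averaging over translations: the cosets \<open>\<gamma> + M \<int>\<^sup>n\<close>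
  partition \<open>\<int>\<^sup>n\<close>, and both periodizations are integrals over the unit cube.\<close>

lemma integral_act:
  assumes h: "cc h"
  shows "(LINT x|lborel. h (act M x)) = (LINT x|lborel. h x) / of_nat (dM M)"
proof -
  let ?Q = "unit_cube :: (real ^ 'n) set"
  let ?J = "LINT x|lborel. h (act M x)"
  obtain R where R: "R \<ge> 0" "\<And>x. h x \<noteq> 0 \<Longrightarrow> norm x \<le> R" using h by (auto simp: cc_def csupp_def)
  obtain \<rho>1 where \<rho>1: "\<And>y. y \<in> ?Q \<Longrightarrow> norm y \<le> \<rho>1" using bounded_unit_cube by (auto simp: bounded_iff)
  obtain \<rho>2 where \<rho>2: "\<And>y. y \<in> act M ` ?Q \<Longrightarrow> norm y \<le> \<rho>2"
    using bounded_act_image[OF bounded_unit_cube] unfolding bounded_iff by blast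
  define S where "S = {k :: int ^ 'n. norm (0 - rvec k) \<le> R + \<rho>1 + \<rho>2}"
  have S: "finite S" unfolding S_def by (rule lattice_ball_finite)
  have out: "h (act M x + s + rvec n) = 0" if "x \<in> ?Q" "s \<in> ?Q" "n \<notin> S" for x s n
  proof (rule ccontr)
    assume "h (act M x + s + rvec n) \<noteq> 0"
    then have "norm (act M x + s + rvec n) \<le> R" by (rule R(2))
    moreover have "norm (rvec n) \<le> norm (act M x + s + rvec n) + norm (act M x + s)"
      using norm_triangle_ineq4[of "act M x + s + rvec n" "act M x + s"] by simp
    moreover have "norm (act M x + s) \<le> \<rho>2 + \<rho>1"
      using norm_triangle_ineq[of "act M x" s] \<rho>2[of "act M x"] \<rho>1[of s] that by fastforce
    ultimately show False using that(3) by (simp add: S_def)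
  qed
  \<comment> \<open>The periodization of \<open>h\<close>, truncated to the translates that can be
    nonzero at \<open>act M x + s\<close> with \<open>x\<close> and \<open>s\<close> in the unit
    cube.\<close>
  define F where "F y = (\<Sum>n\<in>S. h (y + rvec n))" for y
  have transl: "(LINT x|lborel. h (act M x + t)) = ?J" for t
  proof -
    have "act M x + t = act M (x + ainv t)" for x by (simp add: act_add)
    then show ?thesis using integral_translate[of "\<lambda>x. h (act M x)" "ainv t"] cc_borel[OF cc_act[OF h]] by simp
  qed
  \<comment> \<open>The free shift \<open>s\<close> prepares Fubini: integrated over
    \<open>x\<close>, the expression is \<open>d\<close> times \<open>?J\<close> for every
    \<open>s\<close> in the cube; integrated over \<open>s\<close>, it is the integral of
    \<open>h\<close> for every \<open>x\<close> in the cube (\<open>inner\<close>).\<close>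
  have average: "of_nat (dM M) * ?J = (LINT x|lborel. indicator ?Q x *\<^sub>R F (act M x + s))" if s: "s \<in> ?Q" for s
  proof -
    have inn: "integrable lborel (\<lambda>x. h (act M x + t))" for t
      using cc_integrable_lborel[OF cc_act[OF cc_translate[OF h]]] .
    have "of_nat (dM M) * ?J = (\<Sum>\<gamma>\<in>Gamma_set M. (LINT x|lborel. h (act M x + (s + rvec \<gamma>))))"
      by (simp add: transl card_Gamma)
    also have "\<dots> = (\<Sum>\<gamma>\<in>Gamma_set M. (LINT x|lborel. indicator ?Q x *\<^sub>R (\<Sum>k\<in>cquo ` S. h (act M (x + rvec k) + (s + rvec \<gamma>)))))"
    proof (intro sum.cong refl integral_periodize inn)
      fix \<gamma> x k assume g: "\<gamma> \<in> Gamma_set M" and x: "x \<in> ?Q" and k: "k \<notin> cquo ` S"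
      have "\<gamma> + M *v k \<notin> S" using k cquo_Gamma[OF g, of k] by (metis imageI)
      from out[OF x s this] show "h (act M (x + rvec k) + (s + rvec \<gamma>)) = 0"
        by (simp add: act_add act_rvec rvec_add add_ac)
    qed (use S in simp)
    also have "\<dots> = (LINT x|lborel. (\<Sum>\<gamma>\<in>Gamma_set M. indicator ?Q x *\<^sub>R (\<Sum>k\<in>cquo ` S. h (act M (x + rvec k) + (s + rvec \<gamma>)))))"
    proof (rule LINT_sum[symmetric])
      fix \<gamma>
      have "cc (\<lambda>x. \<Sum>k\<in>cquo ` S. h (act M (x + rvec k) + (s + rvec \<gamma>)))"
        using cc_translate[OF cc_act[OF cc_translate[OF h]]] by (intro cc_sum) simp
      from cc_integrable_lborel[OF this]
      show "integrable lborel (\<lambda>x. indicator ?Q x *\<^sub>R (\<Sum>k\<in>cquo ` S. h (act M (x + rvec k) + (s + rvec \<gamma>))))"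
        by (rule integrable_mult_indicator[rotated]) (use sets_unit_cube in simp)
    qed
    also have "\<dots> = (LINT x|lborel. indicator ?Q x *\<^sub>R F (act M x + s))"
    proof (rule LINT_cong[OF refl])
      fix x
      show "(\<Sum>\<gamma>\<in>Gamma_set M. indicator ?Q x *\<^sub>R (\<Sum>k\<in>cquo ` S. h (act M (x + rvec k) + (s + rvec \<gamma>)))) =
        indicator ?Q x *\<^sub>R F (act M x + s)"
      proof (cases "x \<in> ?Q")
        case True
        let ?f = "\<lambda>(\<gamma>, k). \<gamma> + M *v k"
        have inj: "inj_on ?f (Gamma_set M \<times> cquo ` S)"
          by (rule inj_on_inverseI[where g = "\<lambda>n. (crep n, cquo n)"]) (auto simp: cquo_Gamma crep_id)
        have "(\<Sum>\<gamma>\<in>Gamma_set M. \<Sum>k\<in>cquo ` S. h (act M (x + rvec k) + (s + rvec \<gamma>))) =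
            (\<Sum>p\<in>Gamma_set M \<times> cquo ` S. h (act M x + s + rvec (?f p)))"
          unfolding sum.cartesian_product
          by (intro sum.cong) (auto simp: act_add act_rvec rvec_add add_ac)
        also have "\<dots> = (\<Sum>n\<in>?f ` (Gamma_set M \<times> cquo ` S). h (act M x + s + rvec n))"
          using inj by (simp add: sum.reindex)
        also have "\<dots> = (\<Sum>n\<in>S. h (act M x + s + rvec n))"
        proof (rule sum.mono_neutral_right)
          show "S \<subseteq> ?f ` (Gamma_set M \<times> cquo ` S)"
          proof
            fix n assume "n \<in> S"
            then show "n \<in> ?f ` (Gamma_set M \<times> cquo ` S)"
              using crep_Gamma[of n] crep_cquo[of n] by (intro image_eqI[of _ _ "(crep n, cquo n)"]) auto
          qed
        qed (use S out[OF True s] in auto)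
        finally show ?thesis unfolding F_def scaleR_sum_right[symmetric] by simp
      qed simp
    qed
    finally show ?thesis .
  qed
  have Fcont: "continuous_on UNIV F" using cc_sum[of S "\<lambda>n y. h (y + rvec n)"] cc_translate[OF h]
    by (simp add: F_def[abs_def] cc_def)
  obtain BF where BF: "\<And>y. cmod (F y) \<le> BF"
    using cc_bounded[OF cc_sum[of S "\<lambda>n y. h (y + rvec n)"]] cc_translate[OF h] by (auto simp: F_def)
  have inner: "(LINT s|lborel. indicator ?Q s *\<^sub>R F (act M x + s)) = (LINT x|lborel. h x)" if x: "x \<in> ?Q" for x
  proof -
    have "(LINT s|lborel. h (s + act M x)) = (LINT s|lborel. indicator ?Q s *\<^sub>R (\<Sum>n\<in>S. h ((s + rvec n) + act M x)))"
      by (rule integral_periodize[OF cc_integrable_lborel[OF cc_translate[OF h]] S]) (use out[OF x] in \<open>simp add: add_ac\<close>)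
    then show ?thesis using integral_translate[OF cc_borel[OF h], of "act M x"] by (simp add: F_def add_ac)
  qed
  let ?G = "\<lambda>x s. indicator ?Q x *\<^sub>R indicator ?Q s *\<^sub>R F (act M x + s)"
  have "integrable (lborel \<Otimes>\<^sub>M lborel) (\<lambda>(x, s). ?G x s)"
    unfolding lborel_prod
  proof (rule bounded_csupp_integrable)
    have "continuous_on UNIV (\<lambda>p :: (real ^ 'n) \<times> (real ^ 'n). F (act M (fst p) + snd p))"
      by (rule continuous_on_compose2[OF Fcont])
        (auto intro!: continuous_intros continuous_on_compose2[OF act_continuous])
    then have m: "(\<lambda>p. F (act M (fst p) + snd p)) \<in> borel_measurable borel" by (rule borel_measurable_continuous_onI)
    have "?Q \<times> ?Q \<in> sets borel" unfolding borel_prod[symmetric] by (intro pair_measureI sets_unit_cube)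
    then have "(\<lambda>p. indicator (?Q \<times> ?Q) p *\<^sub>R F (act M (fst p) + snd p)) \<in> borel_measurable borel"
      using m by simp
    also have "(\<lambda>p. indicator (?Q \<times> ?Q) p *\<^sub>R F (act M (fst p) + snd p)) = (\<lambda>(x, s). ?G x s)"
      by (auto simp: indicator_def fun_eq_iff)
    finally show "(\<lambda>(x, s). ?G x s) \<in> borel_measurable borel" .
    show "norm (case p of (x, s) \<Rightarrow> ?G x s) \<le> max 0 BF" for p
      using BF by (auto simp: indicator_def le_max_iff_disj split: prod.split)
    show "csupp (\<lambda>(x, s). ?G x s)"
      unfolding csupp_def
    proof (intro exI[of _ "\<bar>\<rho>1\<bar> + \<bar>\<rho>1\<bar>"] conjI allI impI)
      fix p :: "(real ^ 'n) \<times> (real ^ 'n)" assume "(case p of (x, s) \<Rightarrow> ?G x s) \<noteq> 0"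
      then have "fst p \<in> ?Q" "snd p \<in> ?Q" by (auto simp: indicator_def split: prod.splits if_splits)
      then show "norm p \<le> \<bar>\<rho>1\<bar> + \<bar>\<rho>1\<bar>"
        using \<rho>1[of "fst p"] \<rho>1[of "snd p"] norm_Pair_le[of "fst p" "snd p"] by simp
    qed simp
  qed
  from lborel_pair.Fubini_integral[OF this]
  have fub: "(LINT s|lborel. (LINT x|lborel. ?G x s)) = (LINT x|lborel. (LINT s|lborel. ?G x s))" .
  have "(LINT s|lborel. (LINT x|lborel. ?G x s)) = (LINT s|lborel. indicator ?Q s *\<^sub>R (of_nat (dM M) * ?J))"
  proof (rule LINT_cong[OF refl])
    fix s
    show "(LINT x|lborel. ?G x s) = indicator ?Q s *\<^sub>R (of_nat (dM M) * ?J)"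
      using average[of s] by (cases "s \<in> ?Q") auto
  qed
  moreover have "(LINT x|lborel. (LINT s|lborel. ?G x s)) = (LINT x|lborel. indicator ?Q x *\<^sub>R (LINT x|lborel. h x))"
  proof (rule LINT_cong[OF refl])
    fix x
    show "(LINT s|lborel. ?G x s) = indicator ?Q x *\<^sub>R (LINT x|lborel. h x)"
      using inner[of x] by (cases "x \<in> ?Q") auto
  qed
  ultimately have "of_nat (dM M) * ?J = (LINT x|lborel. h x)" using fub by (simp add: integral_unit_cube)
  then show ?thesis using dM_pos by (simp add: field_simps)
qed

lemma cc_act_pow: "cc h \<Longrightarrow> cc (\<lambda>x. h ((act M ^^ n) x))"
proof (induction n arbitrary: h)
  case (Suc n)
  from Suc.IH[OF cc_act[OF Suc.prems]] show ?case by simp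
qed simp

lemma cc_affine: "cc h \<Longrightarrow> cc (\<lambda>x. h ((act M ^^ n) x - y))"
  using cc_act_pow[OF cc_translate, of h n "- y"] by simp

lemma LINT_act_pow: "cc h \<Longrightarrow> (LINT x|lebesgue. h ((act M ^^ n) x)) = (LINT x|lebesgue. h x) / of_nat (dM M) ^ n"
proof (induction n arbitrary: h)
  case (Suc n)
  have "(LINT x|lebesgue. h ((act M ^^ Suc n) x)) = (LINT x|lebesgue. h (act M ((act M ^^ n) x)))" by simp
  also have "\<dots> = (LINT x|lebesgue. h (act M x)) / of_nat (dM M) ^ n"
    by (rule Suc.IH[OF cc_act[OF Suc.prems]])
  also have "(LINT x|lebesgue. h (act M x)) = (LINT x|lebesgue. h x) / of_nat (dM M)"
    using Suc.prems by (simp add: lebesgue_integral_borel cc_borel cc_act integral_act)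
  finally show ?case by simp
qed simp

lemma LINT_affine:
  assumes "cc h"
  shows "(LINT x|lebesgue. h ((act M ^^ n) x - y)) = (LINT x|lebesgue. h x) / of_nat (dM M) ^ n"
  using LINT_act_pow[OF cc_translate[OF assms], of n "- y"] LINT_translate[OF assms, of "- y"] by simp

lemma cc_refine:
  assumes "cc h" "b \<in> l0" shows "cc (refine b h)"
proof -
  have "cc (\<lambda>x. of_nat (dM M) * (\<Sum>l | b l \<noteq> 0. b l * h ((act M ^^ 1) x - rvec l)))"
    by (intro cc_scale cc_sum cc_affine assms)
  then show ?thesis by (simp add: refine_def[abs_def])
qed

text \<open>Moves the refinement onto the test function. With \<open>g\<close> an exponential this
  gives the Fourier transform, with \<open>g\<close> a polynomial the moments of the refined
  function.\<close>

lemma LINT_refine: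
  assumes h: "cc h" and b: "b \<in> l0" and g: "continuous_on UNIV g"
  shows "(LINT x|lebesgue. refine b h x * g x) =
    (LINT y|lebesgue. h y * (\<Sum>l | b l \<noteq> 0. b l * g (ainv (y + rvec l))))"
proof -
  have ainv_cont: "continuous_on UNIV ainv"
    using linear_ainv by (simp add: linear_continuous_on linear_linear)
  have gcont: "continuous_on UNIV (\<lambda>y. g (ainv (y + rvec l)))" for l
    by (intro continuous_on_compose2[OF g] continuous_on_compose2[OF ainv_cont] continuous_intros) auto
  have int_l: "(LINT x|lebesgue. h (act M x - rvec l) * g x) = (LINT y|lebesgue. h y * g (ainv (y + rvec l))) / of_nat (dM M)" for l
  proof -
    have "(LINT x|lebesgue. h (act M x - rvec l) * g x) =
        (LINT x|lebesgue. (\<lambda>y. h y * g (ainv (y + rvec l))) ((act M ^^ 1) x - rvec l))" by simp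
    also have "\<dots> = (LINT y|lebesgue. h y * g (ainv (y + rvec l))) / of_nat (dM M) ^ 1"
      by (rule LINT_affine[OF cc_mult[OF h gcont]])
    finally show ?thesis by simp
  qed
  have int: "integrable lebesgue (\<lambda>x. b l * (h (act M x - rvec l) * g x))" for l
    using cc_integrable[OF cc_scale[OF cc_mult[OF cc_affine[OF h, of 1 "rvec l"] g]]] by simp
  have "(LINT x|lebesgue. refine b h x * g x) =
      (LINT x|lebesgue. of_nat (dM M) * (\<Sum>l | b l \<noteq> 0. b l * (h (act M x - rvec l) * g x)))"
    by (simp add: refine_def sum_distrib_left sum_distrib_right mult.assoc)
  also have "\<dots> = of_nat (dM M) * (\<Sum>l | b l \<noteq> 0. b l * (LINT x|lebesgue. h (act M x - rvec l) * g x))"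
    using int by (simp add: integral_sum)
  also have "\<dots> = (\<Sum>l | b l \<noteq> 0. b l * (LINT y|lebesgue. h y * g (ainv (y + rvec l))))"
    unfolding int_l using dM_pos by (simp add: sum_distrib_left)
  also have "\<dots> = (\<Sum>l | b l \<noteq> 0. (LINT y|lebesgue. b l * (h y * g (ainv (y + rvec l)))))" by simp
  also have "\<dots> = (LINT y|lebesgue. (\<Sum>l | b l \<noteq> 0. b l * (h y * g (ainv (y + rvec l)))))"
    by (rule LINT_sum[symmetric]) (intro cc_integrable cc_scale cc_mult h gcont)
  also have "\<dots> = (LINT y|lebesgue. h y * (\<Sum>l | b l \<noteq> 0. b l * g (ainv (y + rvec l))))"
    by (simp add: sum_distrib_left mult_ac)
  finally show ?thesis .
qed

end

section \<open>Fourier transforms\<close>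

lemma exp_inner_continuous: "continuous_on UNIV (\<lambda>x :: real ^ 'n. exp (- (\<i> * of_real (x \<bullet> \<xi>))))"
  by (intro continuous_intros)

context expanding
begin

lemma fourier_refine:
  assumes "cc h" "b \<in> l0"
  shows "fourier (refine b h) \<xi> = fseries b (act_invT M \<xi>) * fourier h (act_invT M \<xi>)"
proof -
  let ?\<eta> = "act_invT M \<xi>"
  have "fourier (refine b h) \<xi> = (LINT y|lebesgue. h y * (\<Sum>l | b l \<noteq> 0. b l * exp (- (\<i> * of_real (ainv (y + rvec l) \<bullet> \<xi>)))))"
    unfolding fourier_def by (rule LINT_refine[OF assms exp_inner_continuous])
  also have "\<dots> = (LINT y|lebesgue. fseries b ?\<eta> * (h y * exp (- (\<i> * of_real (y \<bullet> ?\<eta>)))))"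
  proof (rule LINT_cong[OF refl])
    fix y
    have "exp (- (\<i> * of_real (ainv (y + rvec l) \<bullet> \<xi>))) = chr l ?\<eta> * exp (- (\<i> * of_real (y \<bullet> ?\<eta>)))" for l
      by (simp add: chr_def inner_act_invT[symmetric] inner_add_left algebra_simps flip: exp_add)
    then show "h y * (\<Sum>l | b l \<noteq> 0. b l * exp (- (\<i> * of_real (ainv (y + rvec l) \<bullet> \<xi>)))) =
        fseries b ?\<eta> * (h y * exp (- (\<i> * of_real (y \<bullet> ?\<eta>))))"
      by (simp add: fseries_chr sum_distrib_left sum_distrib_right mult_ac)
  qed
  finally show ?thesis by (simp add: fourier_def)
qed

end

lemma cmod_exp_i_diff: "cmod (exp (- (\<i> * of_real t)) - 1) \<le> \<bar>t\<bar>"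
proof -
  have "cmod (exp (- (\<i> * of_real t)) - (\<Sum>k\<le>0. (- (\<i> * of_real t)) ^ k / fact k))
     \<le> exp \<bar>Re (- (\<i> * of_real t))\<bar> * cmod (- (\<i> * of_real t)) ^ Suc 0 / fact 0"
    by (rule Taylor_exp)
  then show ?thesis by (simp add: norm_mult)
qed

lemma cmod_exp_i_taylor: "cmod (exp (- (\<i> * of_real t)) - 1 + \<i> * t) \<le> t\<^sup>2"
proof -
  have "cmod (exp (- (\<i> * of_real t)) - (\<Sum>k\<le>1. (- (\<i> * of_real t)) ^ k / fact k))
     \<le> exp \<bar>Re (- (\<i> * of_real t))\<bar> * cmod (- (\<i> * of_real t)) ^ Suc 1 / fact 1"
    by (rule Taylor_exp)
  then show ?thesis by (simp add: norm_mult power2_eq_square algebra_simps)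
qed

text \<open>Differentiation under the integral with an explicit remainder: on the support of
  \<open>h\<close> the coordinate is at most \<open>R\<close>, so the second order error of the
  exponential is at most t^2 R^2 times \<open>|h|\<close>.\<close>

lemma partial_deriv_fourier:
  assumes h: "cc h"
  shows "partial_deriv i (fourier h) = fourier (\<lambda>x. h x * (- \<i> * of_real (x $ i)))"
proof
  fix \<xi>
  obtain R where R: "R \<ge> 0" "\<And>x. h x \<noteq> 0 \<Longrightarrow> norm x \<le> R" using h by (auto simp: cc_def csupp_def)
  let ?e = "\<lambda>\<xi> x. exp (- (\<i> * of_real (x \<bullet> \<xi>)))"
  let ?D = "\<lambda>x. h x * (- \<i> * of_real (x $ i))"
  let ?F = "\<lambda>t. fourier h (\<xi> + t *\<^sub>R axis i 1)"
  define K where "K = R\<^sup>2 * (LINT x|lebesgue. cmod (h x))"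
  have ccD: "cc ?D" by (intro cc_mult[OF h] continuous_intros)
  have i1: "integrable lebesgue (\<lambda>x. h x * ?e \<xi> x)" "integrable lebesgue (\<lambda>x. ?D x * ?e \<xi> x)" for \<xi>
    by (intro cc_integrable cc_mult h ccD exp_inner_continuous)+
  have I: "integrable lebesgue (\<lambda>x. cmod (h x))" using cc_integrable[OF h] by simp
  have bound: "cmod (?F t - fourier h \<xi> - t *\<^sub>R fourier ?D \<xi>) \<le> K * t\<^sup>2" for t
  proof -
    have "?F t - fourier h \<xi> - t *\<^sub>R fourier ?D \<xi> =
        (LINT x|lebesgue. h x * ?e (\<xi> + t *\<^sub>R axis i 1) x - h x * ?e \<xi> x - t *\<^sub>R (?D x * ?e \<xi> x))"
      unfolding fourier_def using i1 by simp
    also have "cmod \<dots> \<le> (LINT x|lebesgue. (t\<^sup>2 * R\<^sup>2) * cmod (h x))"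
    proof (rule LINT_norm_le)
      fix x
      have "h x * ?e (\<xi> + t *\<^sub>R axis i 1) x - h x * ?e \<xi> x - t *\<^sub>R (?D x * ?e \<xi> x) =
          h x * ?e \<xi> x * (exp (- (\<i> * of_real (t * x $ i))) - 1 + \<i> * (t * x $ i))"
      proof -
        have "x \<bullet> (\<xi> + t *\<^sub>R axis i 1) = x \<bullet> \<xi> + t * x $ i" by (simp add: inner_add_right inner_axis)
        then have "?e (\<xi> + t *\<^sub>R axis i 1) x = ?e \<xi> x * exp (- (\<i> * of_real (t * x $ i)))"
          by (simp only: of_real_add distrib_left minus_add_distrib exp_add)
        then show ?thesis by (simp only: scaleR_conv_of_real) (simp add: algebra_simps)
      qed
      then have "cmod (h x * ?e (\<xi> + t *\<^sub>R axis i 1) x - h x * ?e \<xi> x - t *\<^sub>R (?D x * ?e \<xi> x)) =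
          cmod (h x) * cmod (exp (- (\<i> * of_real (t * x $ i))) - 1 + \<i> * (t * x $ i))"
        by (simp add: norm_mult)
      also have "\<dots> \<le> cmod (h x) * (t\<^sup>2 * R\<^sup>2)"
      proof (cases "h x = 0")
        case False
        have "\<bar>x $ i\<bar> \<le> R" using component_le_norm_cart[of x i] R(2)[OF False] by linarith
        then have "(x $ i)\<^sup>2 \<le> R\<^sup>2" using R(1) by (metis abs_le_square_iff abs_of_nonneg)
        then have "(t * x $ i)\<^sup>2 \<le> t\<^sup>2 * R\<^sup>2" by (simp add: power_mult_distrib mult_left_mono)
        then show ?thesis using cmod_exp_i_taylor[of "t * x $ i"] by (intro mult_left_mono) auto
      qed simp
      finally show "cmod (h x * ?e (\<xi> + t *\<^sub>R axis i 1) x - h x * ?e \<xi> x - t *\<^sub>R (?D x * ?e \<xi> x)) \<le> (t\<^sup>2 * R\<^sup>2) * cmod (h x)"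
        by (simp add: mult.commute)
    qed (use i1 I in auto)
    also have "\<dots> = K * t\<^sup>2" by (simp add: K_def)
    finally show ?thesis .
  qed
  have K: "K \<ge> 0" unfolding K_def by (auto intro!: mult_nonneg_nonneg LINT_nonneg)
  have "(?F has_vector_derivative fourier ?D \<xi>) (at 0)"
    unfolding has_vector_derivative_def has_derivative_at
  proof (intro conjI bounded_linear_scaleR_left)
    have lim0: "(\<lambda>t :: real. K * \<bar>t\<bar>) \<midarrow>0\<rightarrow> 0"
      by (auto intro!: tendsto_eq_intros)
    show "(\<lambda>t. norm (?F (0 + t) - ?F 0 - t *\<^sub>R fourier ?D \<xi>) / norm t) \<midarrow>0\<rightarrow> 0"
    proof (rule Lim_null_comparison[OF _ lim0], rule always_eventually, rule allI)
      fix t :: real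
      show "norm (norm (?F (0 + t) - ?F 0 - t *\<^sub>R fourier ?D \<xi>) / norm t) \<le> K * \<bar>t\<bar>"
      proof (cases "t = 0")
        case False
        then show ?thesis using bound[of t] by (simp add: divide_le_eq power2_eq_square mult.assoc)
      qed simp
    qed
  qed
  from vector_derivative_at[OF this]
  show "partial_deriv i (fourier h) \<xi> = fourier ?D \<xi>" by (simp add: partial_deriv_def)
qed

lemma multi_deriv_fourier:
  assumes h: "cc h"
  shows "multi_deriv \<mu> (fourier h) \<xi> = fourier (\<lambda>x. h x * (\<Prod>i\<in>UNIV. (- \<i> * of_real (x $ i)) ^ \<mu> i)) \<xi>"
proof -
  have "cc (\<lambda>x. h x * prod_list (map (\<lambda>i. - \<i> * of_real (x $ i)) w)) \<and>
    foldr partial_deriv w (fourier h) = fourier (\<lambda>x. h x * prod_list (map (\<lambda>i. - \<i> * of_real (x $ i)) w))" for w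
  proof (induction w)
    case (Cons i w)
    let ?h = "\<lambda>x. h x * prod_list (map (\<lambda>i. - \<i> * of_real (x $ i)) w)"
    have cch: "cc ?h" using Cons by blast
    have eq: "(\<lambda>x. h x * prod_list (map (\<lambda>i. - \<i> * of_real (x $ i)) (i # w))) = (\<lambda>x. ?h x * (- \<i> * of_real (x $ i)))"
      by (simp add: fun_eq_iff mult_ac)
    have "cc (\<lambda>x. ?h x * (- \<i> * of_real (x $ i)))" by (intro cc_mult[OF cch] continuous_intros)
    then show ?case using Cons partial_deriv_fourier[OF cch, of i] unfolding eq by simp
  qed (use h in simp)
  moreover obtain w where "\<And>i. count_list w i = \<mu> i" "\<And>f. multi_deriv \<mu> f = foldr partial_deriv w f"
    using multi_deriv_word[of \<mu>] by metis
  ultimately show ?thesis by (simp add: prod_list_count)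
qed

context expanding
begin

text \<open>For each \<open>y\<close> the inner sum of \<open>LINT_refine\<close> is the moment of
  \<open>b\<close> against an affine image of \<open>p\<close>, hence zero: vanishing moments of the
  filter pass to the function.\<close>

lemma refine_moment:
  assumes h: "cc h" and b: "b \<in> l0" "annih r b" and p: "polydeg n p" "n < r" "continuous_on UNIV p"
  shows "(LINT x|lebesgue. refine b h x * p x) = 0"
proof -
  have "(\<Sum>l | b l \<noteq> 0. b l * p (ainv (y + rvec l))) = 0" for y
  proof -
    have "(\<Sum>l | b l \<noteq> 0. b l * (\<lambda>x. p (matrix_inv (rmat M) *v x + ainv y)) (rvec l)) = 0"
      by (rule annihD[OF b(2) polydeg_affine[OF p(1)] p(2)])
    then show ?thesis by (simp add: ainv_add add.commute flip: ainv_def)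
  qed
  then show ?thesis unfolding LINT_refine[OF h b(1) p(3)] by simp
qed

lemma refine_vm:
  assumes h: "cc h" and b: "b \<in> l0" "annih r b"
  shows "vm_fun (refine b h) \<ge> enat r"
proof -
  have "vanishes_O (fourier (refine b h)) r"
    unfolding eq_mod_O_def
  proof (intro allI impI)
    fix \<mu> :: "'n \<Rightarrow> nat" assume \<mu>: "(\<Sum>i\<in>UNIV. \<mu> i) < r"
    let ?p = "\<lambda>x. \<Prod>i\<in>UNIV. (- \<i> * of_real (x $ i)) ^ \<mu> i"
    have "polydeg (\<Sum>i\<in>UNIV. \<mu> i) (\<lambda>x. (\<Prod>i\<in>UNIV. (- \<i>) ^ \<mu> i) * (\<Prod>i\<in>UNIV. of_real (x $ i) ^ \<mu> i))"
      by (rule polydeg_scale[OF polydeg_monom])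
    then have p: "polydeg (\<Sum>i\<in>UNIV. \<mu> i) ?p" by (simp only: power_mult_distrib prod.distrib)
    have "(LINT x|lebesgue. refine b h x * ?p x) = 0"
      by (rule refine_moment[OF h b p \<mu>]) (intro continuous_intros)
    then show "multi_deriv \<mu> (fourier (refine b h)) 0 = multi_deriv \<mu> (\<lambda>_. 0) 0"
      unfolding multi_deriv_fourier[OF cc_refine[OF h b(1)]] by (simp add: fourier_def)
  qed
  then show ?thesis unfolding vm_fun_def by (intro Sup_upper) auto
qed

lemma refine_integral_0:
  assumes "cc h" "b \<in> l0" "annih r b" "r \<ge> 1"
  shows "(LINT x|lebesgue. refine b h x) = 0"
  using refine_moment[OF assms(1-3) polydeg.const[of 0 1]] assms(4) by simp

end

context smooth_filter
begin

lemma phi_cc: "cc phi"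
  by (simp add: cc_def phi_continuous phi_csupp)

text \<open>Periodized over the unit cube, the integrand is the partition of unity by lattice
  translates of \<open>phi\<close>.\<close>

lemma phi_integral: "(LINT x|lebesgue. phi x) = 1"
proof -
  obtain R where R: "R \<ge> 0" "\<And>x. phi x \<noteq> 0 \<Longrightarrow> norm x \<le> R" using phi_csupp by (auto simp: csupp_def)
  obtain \<rho> where \<rho>: "\<And>y :: real ^ 'a. y \<in> unit_cube \<Longrightarrow> norm y \<le> \<rho>" using bounded_unit_cube by (auto simp: bounded_iff)
  define S where "S = {k :: int ^ 'a. norm (0 - rvec k) \<le> R + \<rho>}"
  have S: "finite S" unfolding S_def by (rule lattice_ball_finite)
  have out: "phi (x + rvec k) = 0" if "x \<in> unit_cube" "k \<notin> S" for x k
  proof (rule ccontr)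
    assume "phi (x + rvec k) \<noteq> 0"
    then have "norm (x + rvec k) \<le> R" by (rule R(2))
    moreover have "norm (rvec k) \<le> norm (x + rvec k) + norm x" using norm_triangle_ineq4[of "x + rvec k" x] by simp
    ultimately show False using that \<rho>[OF that(1)] by (simp add: S_def)
  qed
  have part: "(\<Sum>k\<in>S. phi (x + rvec k)) = 1" if x: "x \<in> unit_cube" for x
  proof -
    have "(\<Sum>k\<in>uminus ` S. phi (x - rvec k)) = 1"
    proof (rule phi_partition)
      fix k assume "k \<notin> uminus ` S"
      then have "- k \<notin> S" by (metis image_eqI minus_minus)
      from out[OF x this] show "phi (x - rvec k) = 0" by (simp add: rvec_minus)
    qed (use S in simp)
    then show ?thesis by (subst (asm) sum.reindex) (auto simp: rvec_minus)
  qed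
  have "(LINT x|lborel. phi x) = (LINT x|lborel. indicator unit_cube x *\<^sub>R (\<Sum>k\<in>S. phi (x + rvec k)))"
    by (rule integral_periodize[OF cc_integrable_lborel[OF phi_cc] S out])
  also have "\<dots> = (LINT x|lborel. indicator (unit_cube :: (real ^ 'a) set) x *\<^sub>R (1 :: complex))"
  proof (rule LINT_cong[OF refl])
    fix x
    show "indicator unit_cube x *\<^sub>R (\<Sum>k\<in>S. phi (x + rvec k)) = indicator unit_cube x *\<^sub>R (1 :: complex)"
      using part[of x] by (cases "x \<in> unit_cube") auto
  qed
  also have "\<dots> = 1" by (rule integral_unit_cube)
  finally show ?thesis by (simp add: lebesgue_integral_borel cc_borel phi_cc)
qed

lemma fourier_phi_pow:
  "fourier phi \<xi> = (\<Prod>j<n. fseries a ((act_invT M ^^ Suc j) \<xi>)) * fourier phi ((act_invT M ^^ n) \<xi>)"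
proof (induction n)
  case (Suc n)
  have "phi = refine a phi" using phi_refine by blast
  then have "fourier phi ((act_invT M ^^ n) \<xi>) =
      fseries a ((act_invT M ^^ Suc n) \<xi>) * fourier phi ((act_invT M ^^ Suc n) \<xi>)"
    using fourier_refine[OF phi_cc a_l0, of "(act_invT M ^^ n) \<xi>"] by simp
  with Suc show ?case by simp
qed simp

lemma invT_tendsto_0: "(\<lambda>n. (act_invT M ^^ n) \<xi>) \<longlonglongrightarrow> 0"
proof (rule Lim_null_comparison)
  show "\<forall>\<^sub>F n in sequentially. norm ((act_invT M ^^ n) \<xi>) \<le> invC * norm \<xi> * invL ^ n"
    using invT_bound[of _ \<xi>] by (simp add: mult_ac)
  show "(\<lambda>n. invC * norm \<xi> * invL ^ n) \<longlonglongrightarrow> 0"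
    using inv_bounds by (intro tendsto_mult_right_zero LIMSEQ_power_zero) auto
qed

text \<open>\<open>prodinf\<close> has a known value only after convergence is shown, which follows
  from the Lipschitz bound of the series at 0 and the geometric decay of the frequencies. The factor
  left after finitely many steps of the refinement equation tends to the integral of
  \<open>phi\<close>, which is 1.\<close>

lemma refinable_hat_eq: "refinable_hat M a \<xi> = fourier phi \<xi>"
proof -
  let ?f = "\<lambda>j. fseries a ((act_invT M ^^ Suc j) \<xi>)"
  define Ka where "Ka = (\<Sum>k | a k \<noteq> 0. cmod (a k) * norm (rvec k))"
  have lip: "cmod (fseries a \<eta> - 1) \<le> Ka * norm \<eta>" for \<eta>
  proof -
    have "fseries a \<eta> - 1 = (\<Sum>k | a k \<noteq> 0. a k * (chr k \<eta> - 1))"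
      using a_hat_0 unfolding fseries_chr by (simp add: right_diff_distrib sum_subtractf)
    also have "cmod \<dots> \<le> (\<Sum>k | a k \<noteq> 0. cmod (a k) * norm (rvec k) * norm \<eta>)"
    proof (rule sum_norm_le)
      fix k
      have "cmod (chr k \<eta> - 1) \<le> norm (rvec k) * norm \<eta>"
        unfolding chr_def using cmod_exp_i_diff[of "rvec k \<bullet> \<eta>"] Cauchy_Schwarz_ineq2[of "rvec k" \<eta>] by linarith
      then show "cmod (a k * (chr k \<eta> - 1)) \<le> cmod (a k) * norm (rvec k) * norm \<eta>"
        by (simp add: norm_mult mult.assoc mult_left_mono)
    qed
    finally show ?thesis by (simp add: Ka_def sum_distrib_right)
  qed
  have Ka: "Ka \<ge> 0" unfolding Ka_def by (intro sum_nonneg) auto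
  have "summable (\<lambda>j. cmod (?f j - 1))"
  proof (rule summable_comparison_test')
    have "summable (\<lambda>j. (Ka * invC * invL * norm \<xi>) * invL ^ j)"
      using inv_bounds(2,3) by (intro summable_mult summable_geometric) auto
    then show "summable (\<lambda>j. Ka * (invC * invL ^ Suc j * norm \<xi>))" by (simp add: mult_ac)
    fix j
    have "cmod (?f j - 1) \<le> Ka * norm ((act_invT M ^^ Suc j) \<xi>)" by (rule lip)
    also have "\<dots> \<le> Ka * (invC * invL ^ Suc j * norm \<xi>)" by (rule mult_left_mono[OF invT_bound Ka])
    finally show "norm (cmod (?f j - 1)) \<le> Ka * (invC * invL ^ Suc j * norm \<xi>)" by simp
  qed
  then have "abs_convergent_prod ?f" by (rule summable_imp_abs_convergent_prod)
  then have "convergent_prod ?f" by (rule abs_convergent_prod_imp_convergent_prod)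
  then have lim: "(\<lambda>n. \<Prod>j\<le>n. ?f j) \<longlonglongrightarrow> refinable_hat M a \<xi>"
    unfolding refinable_hat_def by (rule convergent_prod_LIMSEQ)
  have "(\<lambda>n. fourier phi ((act_invT M ^^ Suc n) \<xi>)) \<longlonglongrightarrow> fourier phi 0"
    unfolding fourier_def
  proof (rule Bochner_Integration.integral_dominated_convergence[where w = "\<lambda>x. cmod (phi x)"])
    show "AE x in lebesgue. (\<lambda>n. phi x * exp (- (\<i> * of_real (x \<bullet> (act_invT M ^^ Suc n) \<xi>)))) \<longlonglongrightarrow>
        phi x * exp (- (\<i> * of_real (x \<bullet> 0)))"
      by (intro AE_I2 tendsto_intros LIMSEQ_Suc[OF invT_tendsto_0])
  qed (use cc_integrable[OF phi_cc] cc_integrable[OF cc_mult[OF phi_cc exp_inner_continuous]]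
      in \<open>auto simp: norm_mult intro!: borel_measurable_integrable\<close>)
  then have "(\<lambda>n. fourier phi ((act_invT M ^^ Suc n) \<xi>)) \<longlonglongrightarrow> 1" using phi_integral by (simp add: fourier_def)
  from tendsto_mult[OF lim this]
  have "(\<lambda>n. (\<Prod>j\<le>n. ?f j) * fourier phi ((act_invT M ^^ Suc n) \<xi>)) \<longlonglongrightarrow> refinable_hat M a \<xi>" by simp
  moreover have "(\<Prod>j\<le>n. ?f j) * fourier phi ((act_invT M ^^ Suc n) \<xi>) = fourier phi \<xi>" for n
    using fourier_phi_pow[of \<xi> "Suc n"] by (simp only: lessThan_Suc_atMost)
  ultimately show ?thesis by (simp add: LIMSEQ_const_iff)
qed

lemma phi_has_fourier: "has_fourier phi (refinable_hat M a)"
  by (simp add: has_fourier_def cc_integrable phi_cc refinable_hat_eq)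

end

section \<open>Square integrable functions\<close>

definition nsq :: "(real ^ 'n \<Rightarrow> complex) \<Rightarrow> real" where
  "nsq f = (LINT x|lebesgue. (cmod (f x))\<^sup>2)"

lemma L2D: "f \<in> L2 \<Longrightarrow> f \<in> borel_measurable lebesgue" "f \<in> L2 \<Longrightarrow> integrable lebesgue (\<lambda>x. (cmod (f x))\<^sup>2)"
  by (auto simp: L2_def)

lemma nsq_nonneg [simp]: "nsq f \<ge> 0"
  unfolding nsq_def by (rule LINT_nonneg) simp

lemma L2_norm_nsq: "L2_norm f = sqrt (nsq f)" "(L2_norm f)\<^sup>2 = nsq f"
  using nsq_nonneg[of f] by (simp_all add: L2_norm_def nsq_def)

lemma L2_norm_nonneg [simp]: "L2_norm f \<ge> 0"
  by (simp add: L2_norm_nsq)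

lemma cc_L2: "cc h \<Longrightarrow> h \<in> L2"
proof -
  assume h: "cc h"
  have "h \<in> borel_measurable lebesgue" using measurable_completion[of h lborel borel] cc_borel[OF h] by simp
  moreover have "integrable lebesgue (\<lambda>x. cmod (h x * h x))"
    using cc_integrable[OF cc_mult[OF h, of h]] h by (simp add: cc_def)
  ultimately show ?thesis by (simp add: L2_def norm_mult power2_eq_square)
qed

lemma L2_mult_integrable:
  assumes "f \<in> L2" "g \<in> L2"
  shows "integrable lebesgue (\<lambda>x. f x * cnj (g x))" "integrable lebesgue (\<lambda>x. cmod (f x) * cmod (g x))"
proof -
  have m: "f \<in> borel_measurable lebesgue" "g \<in> borel_measurable lebesgue" using assms by (auto simp: L2_def)
  have mc: "(\<lambda>x. cnj (g x)) \<in> borel_measurable lebesgue"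
    using measurable_comp[OF m(2) borel_measurable_continuous_onI[of cnj]] by (simp add: o_def continuous_on_cnj continuous_on_id)
  have i: "integrable lebesgue (\<lambda>x. (cmod (f x))\<^sup>2 + (cmod (g x))\<^sup>2)" using assms by (simp add: L2_def)
  have le: "cmod (f x) * cmod (g x) \<le> (cmod (f x))\<^sup>2 + (cmod (g x))\<^sup>2" for x
  proof -
    have "0 \<le> cmod (f x) * cmod (g x)" by simp
    then show ?thesis using sum_squares_bound[of "cmod (f x)" "cmod (g x)"] unfolding mult.assoc by linarith
  qed
  show "integrable lebesgue (\<lambda>x. f x * cnj (g x))"
    by (rule integrable_dominated[OF i]) (use borel_measurable_times[OF m(1) mc] le in \<open>auto simp: norm_mult\<close>)
  show "integrable lebesgue (\<lambda>x. cmod (f x) * cmod (g x))"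
    by (rule integrable_dominated[OF i]) (use m le in \<open>auto simp: norm_mult\<close>)
qed

lemma L2_zero [simp]: "(\<lambda>_. 0) \<in> L2"
  by (simp add: L2_def)

lemma L2_scale: "f \<in> L2 \<Longrightarrow> (\<lambda>x. c * f x) \<in> L2"
  by (auto simp: L2_def norm_mult power_mult_distrib intro!: borel_measurable_times)

lemma L2_add:
  assumes "f \<in> L2" "g \<in> L2" shows "(\<lambda>x. f x + g x) \<in> L2"
proof -
  have m: "f \<in> borel_measurable lebesgue" "g \<in> borel_measurable lebesgue" using assms by (auto simp: L2_def)
  have i: "integrable lebesgue (\<lambda>x. 2 * (cmod (f x))\<^sup>2 + 2 * (cmod (g x))\<^sup>2)" using assms by (simp add: L2_def)
  have le: "(cmod (f x + g x))\<^sup>2 \<le> 2 * (cmod (f x))\<^sup>2 + 2 * (cmod (g x))\<^sup>2" for x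
  proof -
    have "(cmod (f x + g x))\<^sup>2 \<le> (cmod (f x) + cmod (g x))\<^sup>2" by (intro power_mono norm_triangle_ineq) auto
    also have "\<dots> \<le> 2 * (cmod (f x))\<^sup>2 + 2 * (cmod (g x))\<^sup>2"
      using sum_squares_bound[of "cmod (f x)" "cmod (g x)"] by (simp add: power2_sum)
    finally show ?thesis .
  qed
  have "integrable lebesgue (\<lambda>x. (cmod (f x + g x))\<^sup>2)"
    by (rule integrable_dominated[OF i]) (use m le in auto)
  then show ?thesis using m by (simp add: L2_def)
qed

lemma L2_sum: "(\<And>i. i \<in> I \<Longrightarrow> f i \<in> L2) \<Longrightarrow> (\<lambda>x. \<Sum>i\<in>I. f i x) \<in> L2"
  by (induction I rule: infinite_finite_induct) (auto intro: L2_add)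

lemma L2_diff: "f \<in> L2 \<Longrightarrow> g \<in> L2 \<Longrightarrow> (\<lambda>x. f x - g x) \<in> L2"
  using L2_add[of f "\<lambda>x. (-1) * g x"] L2_scale[of g "-1"] by simp

lemma L2_inner_self: "f \<in> L2 \<Longrightarrow> L2_inner f f = of_real (nsq f)"
  unfolding L2_inner_def nsq_def by (simp add: complex_norm_square[symmetric] del: of_real_power)

lemma L2_inner_cnj: "L2_inner g f = cnj (L2_inner f g)"
proof -
  have "cnj (LINT x|lebesgue. f x * cnj (g x)) = (LINT x|lebesgue. cnj (f x * cnj (g x)))"
    by (rule Bochner_Integration.integral_cnj[symmetric])
  then show ?thesis by (simp add: L2_inner_def mult.commute)
qed

lemma L2_inner_add_left: "f \<in> L2 \<Longrightarrow> g \<in> L2 \<Longrightarrow> h \<in> L2 \<Longrightarrow> L2_inner (\<lambda>x. f x + g x) h = L2_inner f h + L2_inner g h"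
  unfolding L2_inner_def by (simp add: distrib_right L2_mult_integrable)

lemma L2_inner_diff_left: "f \<in> L2 \<Longrightarrow> g \<in> L2 \<Longrightarrow> h \<in> L2 \<Longrightarrow> L2_inner (\<lambda>x. f x - g x) h = L2_inner f h - L2_inner g h"
  unfolding L2_inner_def by (simp add: left_diff_distrib L2_mult_integrable)

lemma L2_inner_scale_left: "L2_inner (\<lambda>x. c * f x) h = c * L2_inner f h"
  unfolding L2_inner_def by (simp add: mult.assoc)

lemma L2_inner_sum_left:
  "(\<And>i. i \<in> I \<Longrightarrow> f i \<in> L2) \<Longrightarrow> h \<in> L2 \<Longrightarrow> L2_inner (\<lambda>x. \<Sum>i\<in>I. c i * f i x) h = (\<Sum>i\<in>I. c i * L2_inner (f i) h)"
proof (induction I rule: infinite_finite_induct)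
  case (insert i I)
  then show ?case by (simp add: L2_inner_add_left L2_inner_scale_left L2_scale L2_sum)
qed (simp_all add: L2_inner_def)

lemma L2_inner_sum_right:
  assumes "\<And>i. i \<in> I \<Longrightarrow> f i \<in> L2" "h \<in> L2"
  shows "L2_inner h (\<lambda>x. \<Sum>i\<in>I. c i * f i x) = (\<Sum>i\<in>I. cnj (c i) * L2_inner h (f i))"
proof -
  have "L2_inner h (\<lambda>x. \<Sum>i\<in>I. c i * f i x) = cnj (\<Sum>i\<in>I. c i * L2_inner (f i) h)"
    using L2_inner_cnj[of h "\<lambda>x. \<Sum>i\<in>I. c i * f i x"] by (simp only: L2_inner_sum_left[OF assms])
  also have "\<dots> = (\<Sum>i\<in>I. cnj (c i) * L2_inner h (f i))"
    unfolding cnj_sum complex_cnj_mult L2_inner_cnj[of h, symmetric] ..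
  finally show ?thesis .
qed

lemma L2_Cauchy_Schwarz:
  assumes "f \<in> L2" "g \<in> L2" shows "cmod (L2_inner f g) \<le> L2_norm f * L2_norm g"
proof -
  define z where "z = (LINT x|lebesgue. cmod (f x) * cmod (g x))"
  have z0: "z \<ge> 0" unfolding z_def by (rule LINT_nonneg) simp
  have quad: "0 \<le> s\<^sup>2 * nsq f - 2 * s * z + nsq g" for s
  proof -
    have "0 \<le> (LINT x|lebesgue. (s * cmod (f x) - cmod (g x))\<^sup>2)"
      by (rule LINT_nonneg) simp
    also have "\<dots> = (LINT x|lebesgue. s\<^sup>2 * (cmod (f x))\<^sup>2 - 2 * s * (cmod (f x) * cmod (g x)) + (cmod (g x))\<^sup>2)"
      by (rule LINT_cong[OF refl]) (simp add: power2_diff power_mult_distrib algebra_simps)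
    also have "\<dots> = s\<^sup>2 * nsq f - 2 * s * z + nsq g"
      unfolding nsq_def z_def using L2D(2)[OF assms(1)] L2D(2)[OF assms(2)] L2_mult_integrable(2)[OF assms] by simp
    finally show ?thesis .
  qed
  have "z\<^sup>2 \<le> nsq f * nsq g"
  proof (cases "nsq f = 0")
    case True
    have "z = 0"
    proof (rule ccontr)
      assume "z \<noteq> 0"
      \<comment> \<open>With this \<open>s\<close> the quadratic expression equals -1.\<close>
      then show False using quad[of "(nsq g + 1) / (2 * z)"] True by simp
    qed
    then show ?thesis using True by simp
  next
    case False
    then have pos: "nsq f > 0" using nsq_nonneg[of f] by linarith
    have "0 \<le> (z / nsq f)\<^sup>2 * nsq f - 2 * (z / nsq f) * z + nsq g" by (rule quad)
    also have "\<dots> = nsq g - z\<^sup>2 / nsq f" using pos by (simp add: power2_eq_square field_simps)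
    finally show ?thesis using pos by (simp add: field_simps)
  qed
  then have "z \<le> L2_norm f * L2_norm g"
    unfolding L2_norm_nsq real_sqrt_mult[symmetric] by (rule real_le_rsqrt)
  moreover have "cmod (L2_inner f g) \<le> z"
    unfolding L2_inner_def z_def by (rule LINT_norm_le) (use L2_mult_integrable[OF assms] in \<open>auto simp: norm_mult\<close>)
  ultimately show ?thesis by linarith
qed

lemma L2_norm_triangle:
  assumes "f \<in> L2" "g \<in> L2" shows "L2_norm (\<lambda>x. f x + g x) \<le> L2_norm f + L2_norm g"
proof -
  define k where "k = (\<lambda>x. f x * cnj (g x))"
  have ik: "integrable lebesgue k" unfolding k_def by (rule L2_mult_integrable[OF assms])
  have "nsq (\<lambda>x. f x + g x) = (LINT x|lebesgue. (cmod (f x))\<^sup>2 + (cmod (g x))\<^sup>2 + 2 * Re (k x))"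
    unfolding nsq_def cmod_power2 k_def by (simp add: power2_eq_square algebra_simps)
  also have "\<dots> = nsq f + nsq g + 2 * Re (L2_inner f g)"
    unfolding nsq_def L2_inner_def k_def[symmetric] using L2D(2)[OF assms(1)] L2D(2)[OF assms(2)] ik by simp
  also have "\<dots> \<le> nsq f + nsq g + 2 * (L2_norm f * L2_norm g)"
    using L2_Cauchy_Schwarz[OF assms] complex_Re_le_cmod[of "L2_inner f g"] by linarith
  also have "\<dots> = (L2_norm f + L2_norm g)\<^sup>2" by (simp add: power2_sum L2_norm_nsq(2))
  finally show ?thesis unfolding L2_norm_nsq(1)[of "\<lambda>x. f x + g x"] by (rule real_le_lsqrt[rotated -1]) auto
qed

lemma L2_norm_scale: "L2_norm (\<lambda>x. c * f x) = cmod c * L2_norm f"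
  unfolding L2_norm_def norm_mult power_mult_distrib by (simp add: real_sqrt_mult)

text \<open>Schur's test on the Gram matrix: weighted arithmetic-geometric means split each product
  of two coefficients, and by symmetry of the matrix both halves reduce to the same weighted row
  sums.\<close>

lemma schur_bound:
  assumes I: "finite I" and e: "\<And>i. i \<in> I \<Longrightarrow> e i \<in> L2" and w: "\<And>i. i \<in> I \<Longrightarrow> w i > 0"
    and row: "\<And>i. i \<in> I \<Longrightarrow> (\<Sum>j\<in>I. cmod (L2_inner (e i) (e j)) * w j) \<le> C * w i"
  shows "nsq (\<lambda>x. \<Sum>i\<in>I. c i * e i x) \<le> C * (\<Sum>i\<in>I. (cmod (c i))\<^sup>2)"
proof -
  let ?S = "\<lambda>x. \<Sum>i\<in>I. c i * e i x"
  let ?G = "\<lambda>i j. cmod (L2_inner (e i) (e j))"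
  have S: "?S \<in> L2" using e by (intro L2_sum L2_scale)
  have sym: "?G i j = ?G j i" for i j using L2_inner_cnj[of "e i" "e j"] by simp
  have eq: "complex_of_real (nsq ?S) = (\<Sum>i\<in>I. \<Sum>j\<in>I. c i * (cnj (c j) * L2_inner (e i) (e j)))"
    unfolding L2_inner_self[OF S, symmetric] using e S
    by (simp add: L2_inner_sum_left L2_inner_sum_right sum_distrib_left)
  have "nsq ?S = cmod (complex_of_real (nsq ?S))" by simp
  also have "\<dots> = cmod (\<Sum>i\<in>I. \<Sum>j\<in>I. c i * (cnj (c j) * L2_inner (e i) (e j)))" unfolding eq ..
  also have "\<dots> \<le> (\<Sum>i\<in>I. \<Sum>j\<in>I. ?G i j * (cmod (c i) * cmod (c j)))"
    by (intro sum_norm_le) (simp add: norm_mult mult_ac)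
  also have "\<dots> \<le> (\<Sum>i\<in>I. \<Sum>j\<in>I. (?G i j * ((cmod (c i))\<^sup>2 * (w j / w i)) + ?G i j * ((cmod (c j))\<^sup>2 * (w i / w j))) / 2)"
  proof (intro sum_mono)
    fix i j assume ij: "i \<in> I" "j \<in> I"
    \<comment> \<open>Scaling the two factors by \<open>q\<close> and its inverse leaves their
      product unchanged and makes the weighted row sum appear.\<close>
    define q where "q = sqrt (w j / w i)"
    have q: "q > 0" "q\<^sup>2 = w j / w i" using w[OF ij(1)] w[OF ij(2)] by (auto simp: q_def)
    have "2 * ((cmod (c i) * q) * (cmod (c j) / q)) \<le> (cmod (c i) * q)\<^sup>2 + (cmod (c j) / q)\<^sup>2"
      using sum_squares_bound[of "cmod (c i) * q" "cmod (c j) / q"] by (simp only: mult.assoc)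
    then have "2 * (cmod (c i) * cmod (c j)) \<le> (cmod (c i))\<^sup>2 * (w j / w i) + (cmod (c j))\<^sup>2 * (w i / w j)"
      using q w[OF ij(1)] w[OF ij(2)] by (simp add: power_mult_distrib power_divide)
    from mult_left_mono[OF this, of "?G i j"]
    show "?G i j * (cmod (c i) * cmod (c j)) \<le> (?G i j * ((cmod (c i))\<^sup>2 * (w j / w i)) + ?G i j * ((cmod (c j))\<^sup>2 * (w i / w j))) / 2"
      by (simp add: distrib_left)
  qed
  also have "\<dots> = ((\<Sum>i\<in>I. \<Sum>j\<in>I. ?G i j * ((cmod (c i))\<^sup>2 * (w j / w i))) + (\<Sum>i\<in>I. \<Sum>j\<in>I. ?G i j * ((cmod (c j))\<^sup>2 * (w i / w j)))) / 2"
    by (simp add: sum.distrib flip: sum_divide_distrib)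
  also have "(\<Sum>i\<in>I. \<Sum>j\<in>I. ?G i j * ((cmod (c j))\<^sup>2 * (w i / w j))) = (\<Sum>i\<in>I. \<Sum>j\<in>I. ?G i j * ((cmod (c i))\<^sup>2 * (w j / w i)))"
    by (subst sum.swap) (simp add: sym)
  also have "((\<Sum>i\<in>I. \<Sum>j\<in>I. ?G i j * ((cmod (c i))\<^sup>2 * (w j / w i))) + (\<Sum>i\<in>I. \<Sum>j\<in>I. ?G i j * ((cmod (c i))\<^sup>2 * (w j / w i)))) / 2 =
      (\<Sum>i\<in>I. ((cmod (c i))\<^sup>2 / w i) * (\<Sum>j\<in>I. ?G i j * w j))"
    by (simp add: sum_distrib_left mult_ac)
  also have "\<dots> \<le> (\<Sum>i\<in>I. ((cmod (c i))\<^sup>2 / w i) * (C * w i))"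
    using row w by (intro sum_mono mult_left_mono) (auto simp: less_imp_le)
  also have "\<dots> = (\<Sum>i\<in>I. C * (cmod (c i))\<^sup>2)"
  proof (rule sum.cong[OF refl])
    fix i assume "i \<in> I"
    from w[OF this] show "((cmod (c i))\<^sup>2 / w i) * (C * w i) = C * (cmod (c i))\<^sup>2" by simp
  qed
  finally show ?thesis by (simp add: sum_distrib_left)
qed

text \<open>Pairing \<open>f\<close> with the combination formed from its own coefficients gives the
  energy \<open>T\<close>; the synthesis bound and Cauchy-Schwarz yield T^2 \<le> nsq f * C T, and
  one factor \<open>T\<close> cancels.\<close>

lemma bessel_dual:
  assumes I: "finite I" and e: "\<And>i. i \<in> I \<Longrightarrow> e i \<in> L2" and f: "f \<in> L2" and C: "C \<ge> 0"
    and bound: "\<And>c. nsq (\<lambda>x. \<Sum>i\<in>I. c i * e i x) \<le> C * (\<Sum>i\<in>I. (cmod (c i))\<^sup>2)"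
  shows "(\<Sum>i\<in>I. (cmod (L2_inner f (e i)))\<^sup>2) \<le> C * nsq f"
proof -
  let ?c = "\<lambda>i. L2_inner f (e i)"
  let ?g = "\<lambda>x. \<Sum>i\<in>I. ?c i * e i x"
  define T where "T = (\<Sum>i\<in>I. (cmod (?c i))\<^sup>2)"
  have T0: "T \<ge> 0" unfolding T_def by (intro sum_nonneg) simp
  have g: "?g \<in> L2" using e by (intro L2_sum L2_scale)
  have "L2_inner f ?g = (\<Sum>i\<in>I. cnj (?c i) * L2_inner f (e i))" by (rule L2_inner_sum_right[OF e f])
  also have "\<dots> = complex_of_real T"
    unfolding T_def of_real_sum complex_norm_square by (simp add: mult.commute)
  finally have "complex_of_real T = L2_inner f ?g" by simp
  then have "T \<le> L2_norm f * L2_norm ?g"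
    using L2_Cauchy_Schwarz[OF f g] norm_of_real[of T, where 'a = complex] T0 by simp
  then have "T\<^sup>2 \<le> (L2_norm f * L2_norm ?g)\<^sup>2" using T0 by (rule power_mono)
  also have "\<dots> = nsq f * nsq ?g" by (simp add: power_mult_distrib L2_norm_nsq(2))
  also have "\<dots> \<le> nsq f * (C * T)" using bound[of ?c] by (intro mult_left_mono) (auto simp: T_def)
  finally have "T * T \<le> (C * nsq f) * T" by (simp add: power2_eq_square mult_ac)
  then show ?thesis unfolding T_def[symmetric] using T0 C
    by (cases "T = 0") (auto simp: mult_le_cancel_right)
qed

section \<open>Almost orthogonality of dilated functions\<close>

context expanding
begin

definition dpow :: "nat \<Rightarrow> real" where
  "dpow j = real (dM M) powr (real j / 2)"

lemma dpow_pos: "dpow j > 0"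
  using dM_pos by (simp add: dpow_def)

lemma dpow_sq: "dpow j * dpow j = real (dM M) ^ j"
  using dM_pos by (simp add: dpow_def powr_realpow flip: powr_add)

lemma dilate_shift_eq: "dilate_shift M g j k x = of_real (dpow j) * g ((act M ^^ j) x - rvec k)"
  by (simp add: dilate_shift_def dpow_def)

abbreviation "dil \<equiv> dilate_shift M"

lemma cc_dilate_shift: "cc g \<Longrightarrow> cc (dil g j k)"
  using cc_scale[OF cc_affine[of g j "rvec k"], of "of_real (dpow j)"] by (simp add: dilate_shift_eq[abs_def])

lemma shift_eq_dilate_shift: "shift g k = dil g 0 k"
  using dM_pos by (simp add: shift_def dilate_shift_def fun_eq_iff)

text \<open>A modulus of continuity of this form is what the cascade algorithm yields; it amounts to
  Hoelder continuity.\<close>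

definition regular :: "(real ^ 'n \<Rightarrow> complex) \<Rightarrow> bool" where
  "regular h \<longleftrightarrow> cc h \<and> (\<exists>C r A. C \<ge> 0 \<and> 0 < r \<and> r < 1 \<and> A \<ge> 1 \<and>
    (\<forall>n x y. cmod (h x - h y) \<le> C * (r ^ n + A ^ n * norm (x - y))))"

lemma regular_refine:
  assumes h: "regular h" and b: "b \<in> l0" shows "regular (refine b h)"
proof -
  obtain C r A where C: "C \<ge> 0" "0 < r" "r < 1" "A \<ge> 1"
    "\<And>n x y. cmod (h x - h y) \<le> C * (r ^ n + A ^ n * norm (x - y))" and cch: "cc h"
    using h by (auto simp: regular_def)
  obtain A0 where A0: "A0 \<ge> 1" "\<And>n x. norm ((act M ^^ n) x) \<le> A0 ^ n * norm x" using act_pow_bound by blast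
  define D where "D = real (dM M) * ((\<Sum>l | b l \<noteq> 0. cmod (b l)) * (C * A0))"
  have D: "D \<ge> 0" unfolding D_def using C(1) A0(1) by (intro mult_nonneg_nonneg sum_nonneg) auto
  have "cmod (refine b h x - refine b h y) \<le> D * (r ^ n + A ^ n * norm (x - y))" for n x y
  proof -
    have 1: "cmod (h (act M x - rvec l) - h (act M y - rvec l)) \<le> C * A0 * (r ^ n + A ^ n * norm (x - y))" for l
    proof -
      have "norm (act M x - act M y) \<le> A0 * norm (x - y)" using A0(2)[of 1 "x - y"] by (simp add: act_diff)
      then have "A ^ n * norm (act M x - act M y) \<le> A ^ n * (A0 * norm (x - y))" using C(4) by (intro mult_left_mono) auto
      moreover have "1 * r ^ n \<le> A0 * r ^ n" using A0(1) C(2) by (intro mult_right_mono) auto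
      ultimately have "r ^ n + A ^ n * norm (act M x - act M y) \<le> A0 * (r ^ n + A ^ n * norm (x - y))"
        by (simp add: algebra_simps)
      then have "C * (r ^ n + A ^ n * norm (act M x - act M y)) \<le> C * (A0 * (r ^ n + A ^ n * norm (x - y)))"
        using C(1) by (intro mult_left_mono)
      then show ?thesis using C(5)[of "act M x - rvec l" "act M y - rvec l" n] by (simp add: mult.assoc)
    qed
    have "refine b h x - refine b h y = of_nat (dM M) * (\<Sum>l | b l \<noteq> 0. b l * (h (act M x - rvec l) - h (act M y - rvec l)))"
      by (simp add: refine_def right_diff_distrib sum_subtractf)
    also have "cmod \<dots> \<le> real (dM M) * (\<Sum>l | b l \<noteq> 0. cmod (b l) * (C * A0 * (r ^ n + A ^ n * norm (x - y))))"
    proof -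
      have "cmod (b l * (h (act M x - rvec l) - h (act M y - rvec l))) \<le> cmod (b l) * (C * A0 * (r ^ n + A ^ n * norm (x - y)))" for l
        unfolding norm_mult by (intro mult_left_mono 1) simp
      then show ?thesis unfolding norm_mult[of "of_nat (dM M)"] by (intro mult_mono sum_norm_le) (auto intro!: sum_nonneg)
    qed
    also have "\<dots> = D * (r ^ n + A ^ n * norm (x - y))"
      unfolding D_def sum_distrib_right[symmetric] by (simp add: mult_ac)
    finally show ?thesis .
  qed
  then show ?thesis using D C(2-4) cc_refine[OF cch b] unfolding regular_def by blast
qed

text \<open>\<open>q\<close> is chosen so that \<open>q\<close> contractions by \<open>invL\<close>
  outweigh one factor \<open>A\<close>. With \<open>n = N div q\<close> both terms of the modulus
  then decay like \<open>s ^ n\<close>, and the rate per level is the q-th root of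
  \<open>s\<close>.\<close>

lemma regular_decay:
  assumes h: "regular h" and D: "D \<ge> 0"
  shows "\<exists>C t. C \<ge> 0 \<and> 0 < t \<and> t < 1 \<and> (\<forall>N x y. norm (x - y) \<le> D * invL ^ N \<longrightarrow> cmod (h x - h y) \<le> C * t ^ N)"
proof -
  obtain C r A where C: "C \<ge> 0" "0 < r" "r < 1" "A \<ge> 1"
    "\<And>n x y. cmod (h x - h y) \<le> C * (r ^ n + A ^ n * norm (x - y))"
    using h by (auto simp: regular_def)
  have "(\<lambda>q. A * invL ^ q) \<longlonglongrightarrow> 0" using inv_bounds(2,3) by (intro tendsto_mult_right_zero LIMSEQ_power_zero) auto
  from eventually_conj[OF order_tendstoD(2)[OF this, of "1/2"] eventually_ge_at_top[of 1]]
  obtain q :: nat where q: "A * invL ^ q < 1 / 2" "q \<ge> 1" by (auto simp: eventually_sequentially)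
  define s where "s = max r (1 / 2)"
  have s: "0 < s" "s < 1" "r \<le> s" "1 / 2 \<le> s" using C(2,3) by (auto simp: s_def)
  define t where "t = root q s"
  have t: "0 < t" "t < 1" "t ^ q = s" using s q(2) by (auto simp: t_def real_root_lt_1_iff)
  have "cmod (h x - h y) \<le> (C * (1 + D) / s) * t ^ N" if xy: "norm (x - y) \<le> D * invL ^ N" for N x y
  proof -
    define n where "n = N div q"
    have "q * n + N mod q = N" "N mod q < q" using q(2) by (simp_all add: n_def)
    then have qn: "q * n \<le> N" "N \<le> q * n + q" by linarith+
    have "A ^ n * norm (x - y) \<le> A ^ n * (D * invL ^ (q * n))"
    proof (intro mult_left_mono order_trans[OF xy])
      show "invL ^ N \<le> invL ^ (q * n)" using inv_bounds(2,3) qn(1) by (intro power_decreasing) auto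
    qed (use C(4) D in auto)
    also have "\<dots> = D * (A * invL ^ q) ^ n" by (simp add: power_mult_distrib power_mult)
    also have "\<dots> \<le> D * s ^ n"
      using q(1) s C(4) inv_bounds(2) D by (intro mult_left_mono power_mono) auto
    finally have "r ^ n + A ^ n * norm (x - y) \<le> s ^ n + D * s ^ n"
      using power_mono[OF s(3), of n] C(2) by linarith
    then have le: "cmod (h x - h y) \<le> C * (s ^ n + D * s ^ n)"
      using C(5)[of x y n] mult_left_mono[of _ _ C] C(1) by (meson order_trans)
    have tq: "t ^ (q * n + q) = s ^ n * s" by (simp only: power_add power_mult t(3))
    have "C * (s ^ n + D * s ^ n) = (C * (1 + D) / s) * (t ^ (q * n + q))" unfolding tq using s(1) by (simp add: field_simps)
    also have "\<dots> \<le> (C * (1 + D) / s) * t ^ N"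
      using qn(2) t C(1) D s(1) by (intro mult_left_mono power_decreasing) auto
    finally show ?thesis using le by linarith
  qed
  then show ?thesis using t C(1) D s(1) by (intro exI[of _ "C * (1 + D) / s"] exI[of _ t]) auto
qed

text \<open>A continuous majorant of the indicator of the ball of radius \<open>R\<close>, so that
  integrands localized to supports remain in \<open>cc\<close>.\<close>

definition bump :: "real \<Rightarrow> real ^ 'n \<Rightarrow> real" where
  "bump R y = max 0 (min 1 (R + 1 - norm y))"

lemma bump_props: "bump R y \<ge> 0" "bump R y \<le> 1" "norm y \<le> R \<Longrightarrow> bump R y = 1" "bump R y \<noteq> 0 \<Longrightarrow> norm y \<le> R + 1"
  by (auto simp: bump_def)

lemma cc_bump: "cc (\<lambda>y. of_real (bump R y))"
proof -
  have "norm y \<le> \<bar>R + 1\<bar>" if "bump R y \<noteq> 0" for y using bump_props(4)[OF that] by linarith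
  then have "csupp (\<lambda>y. complex_of_real (bump R y))" unfolding csupp_def by (intro exI[of _ "\<bar>R + 1\<bar>"]) auto
  then show ?thesis unfolding cc_def bump_def by (auto intro!: continuous_intros)
qed

lemma LINT_affine_real:
  assumes "cc (\<lambda>x. of_real (u x))"
  shows "(LINT x|lebesgue. u ((act M ^^ n) x - y)) = (LINT x|lebesgue. u x) / real (dM M) ^ n"
proof -
  have "complex_of_real (LINT x|lebesgue. u ((act M ^^ n) x - y)) = (LINT x|lebesgue. of_real (u x)) / of_nat (dM M) ^ n"
    using LINT_affine[OF assms, of n y] by simp
  then have "complex_of_real (LINT x|lebesgue. u ((act M ^^ n) x - y)) = of_real ((LINT x|lebesgue. u x) / real (dM M) ^ n)"
    by simp
  then show ?thesis by (simp only: of_real_eq_iff)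
qed

lemma sum_lattice_bounded:
  fixes u :: "real ^ 'n \<Rightarrow> real"
  assumes "\<And>x. u x \<noteq> 0 \<Longrightarrow> norm x \<le> R" "\<And>x. u x \<le> B" "B \<ge> 0" "\<And>x :: real ^ 'n. card {k. norm (x - rvec k) \<le> R} \<le> CC" "finite K"
  shows "(\<Sum>k\<in>K. u (x - rvec k)) \<le> real CC * B"
proof -
  have "(\<Sum>k\<in>K. u (x - rvec k)) = (\<Sum>k\<in>K \<inter> {k. norm (x - rvec k) \<le> R}. u (x - rvec k))"
    by (rule sum.mono_neutral_right) (use assms in auto)
  also have "\<dots> \<le> real (card (K \<inter> {k. norm (x - rvec k) \<le> R})) * B"
    by (rule sum_bounded_above) (rule assms)
  also have "\<dots> \<le> real CC * B"
  proof (rule mult_right_mono)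
    have "card (K \<inter> {k. norm (x - rvec k) \<le> R}) \<le> card {k. norm (x - rvec k) \<le> R}"
      by (rule card_mono[OF lattice_ball_finite]) auto
    then show "real (card (K \<inter> {k. norm (x - rvec k) \<le> R})) \<le> real CC" using assms(4)[of x] by linarith
  qed (rule assms)
  finally show ?thesis .
qed

text \<open>Two ways of gaining a factor \<open>W\<close>: size alone, or cancellation of the finer
  function against a coarser one that varies little. The radius is that of the finer support,
  \<open>N\<close> levels down, seen in coordinates of the coarser level.\<close>

abbreviation osc_le :: "(real ^ 'n \<Rightarrow> complex) \<Rightarrow> (real ^ 'n \<Rightarrow> complex) \<Rightarrow> real \<Rightarrow> nat \<Rightarrow> real \<Rightarrow> bool" where
  "osc_le g h R N W \<equiv> (\<forall>x. cmod (g x) \<le> W) \<or>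
    (LINT x|lebesgue. h x) = 0 \<and> (\<forall>x y. norm (x - y) \<le> invC * R * invL ^ N \<longrightarrow> cmod (g x - g y) \<le> W)"

text \<open>If the finer function has mean zero, a constant may be subtracted from the coarser one
  before taking absolute values, which replaces its size by its oscillation over the finer
  support.\<close>

lemma pair_bound:
  assumes g: "cc g" "\<And>x. g x \<noteq> 0 \<Longrightarrow> norm x \<le> R" and h: "cc h" "\<And>x. h x \<noteq> 0 \<Longrightarrow> norm x \<le> R"
    and R: "R \<ge> 0" and W: "W \<ge> 0"
    and cases: "osc_le g h R N W"
  shows "cmod (L2_inner (dil g j k) (dil h (j + N) k')) \<le>
    dpow j * W * (LINT x|lebesgue. bump (R + invC * R) ((act M ^^ j) x - rvec k) * cmod (dil h (j + N) k' x))"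
proof -
  let ?E = "dil g j k" and ?H = "dil h (j + N) k'"
  let ?b = "\<lambda>x. bump (R + invC * R) ((act M ^^ j) x - rvec k)"
  have cH: "cc ?H" "cc (\<lambda>x. of_real (cmod (?H x)))" using cc_dilate_shift[OF h(1)] cc_cmod by blast+
  have cb: "continuous_on UNIV (\<lambda>x. complex_of_real (?b x))"
    using cc_affine[OF cc_bump, of "R + invC * R" j "rvec k"] by (simp add: cc_def)
  have ib: "integrable lebesgue (\<lambda>x. dpow j * W * (?b x * cmod (?H x)))"
  proof -
    have "integrable lebesgue (\<lambda>x. complex_of_real (dpow j * W) * (of_real (cmod (?H x)) * of_real (?b x)))"
      by (intro cc_integrable cc_scale cc_mult cH cb)
    then have "integrable lebesgue (\<lambda>x. complex_of_real (dpow j * W * (?b x * cmod (?H x))))" by (simp add: mult_ac)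
    then show ?thesis by (simp only: complex_of_real_integrable_eq)
  qed
  have key: "\<exists>c. (c = 0 \<or> (LINT x|lebesgue. h x) = 0) \<and>
    (\<forall>x. cmod ((?E x - c) * cnj (?H x)) \<le> dpow j * W * (?b x * cmod (?H x)))"
    using cases
  proof
    assume W1: "\<forall>x. cmod (g x) \<le> W"
    have "cmod (?E x) \<le> dpow j * W * ?b x" for x
    proof (cases "?E x = 0")
      case False
      then have "norm ((act M ^^ j) x - rvec k) \<le> R" using g(2) by (auto simp: dilate_shift_eq)
      then have "?b x = 1" using R inv_bounds(1) by (intro bump_props(3)) (simp add: add_increasing2)
      then show ?thesis using W1 dpow_pos[of j] by (simp add: dilate_shift_eq norm_mult mult_left_mono)
    qed (use dpow_pos[of j] W bump_props(1) in simp)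
    from mult_right_mono[OF this] show ?thesis
      by (intro exI[of _ 0]) (simp add: norm_mult mult.assoc)
  next
    assume W2: "(LINT x|lebesgue. h x) = 0 \<and> (\<forall>x y. norm (x - y) \<le> invC * R * invL ^ N \<longrightarrow> cmod (g x - g y) \<le> W)"
    let ?p = "(ainv ^^ N) (rvec k') - rvec k"
    \<comment> \<open>The value of the coarser function at the point where the argument of the finer
      one is 0.\<close>
    define c where "c = of_real (dpow j) * g ?p"
    have "cmod ((?E x - c) * cnj (?H x)) \<le> dpow j * W * (?b x * cmod (?H x))" for x
    proof (cases "?H x = 0")
      case False
      let ?y = "(act M ^^ j) x - rvec k" and ?z = "(act M ^^ (j + N)) x - rvec k'"
      have z: "norm ?z \<le> R" using False h(2) by (auto simp: dilate_shift_eq)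
      have "(act M ^^ (j + N)) x = (act M ^^ N) ((act M ^^ j) x)" by (simp add: funpow_add add.commute[of j])
      then have "(ainv ^^ N) ((act M ^^ (j + N)) x) = (act M ^^ j) x" by (simp only: ainv_act_pow)
      then have yz: "?y - ?p = (ainv ^^ N) ?z" by (simp only: ainv_pow_diff diff_diff_eq2 diff_add_cancel)
      have "norm ((ainv ^^ N) ?z) \<le> invC * invL ^ N * norm ?z" by (rule inv_bounds)
      also have "\<dots> \<le> invC * invL ^ N * R" using z inv_bounds(1,2) by (intro mult_left_mono) auto
      finally have near: "norm (?y - ?p) \<le> invC * R * invL ^ N" unfolding yz by (simp add: mult_ac)
      have "invL ^ N \<le> 1" using inv_bounds(2,3) by (intro power_le_one) auto
      then have "invC * R * invL ^ N \<le> invC * R * 1" using inv_bounds(1) R by (intro mult_left_mono) auto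
      then have near': "norm (?y - ?p) \<le> invC * R" using near by simp
      \<comment> \<open>Beyond the radius \<open>R + invC * R\<close> both points lie outside the
        support of \<open>g\<close>, so localizing by the bump loses nothing.\<close>
      have "cmod (g ?y - g ?p) \<le> W * ?b x"
      proof (cases "norm ?y \<le> R + invC * R")
        case True
        then show ?thesis using W2 near bump_props(3)[OF True] by simp
      next
        case far: False
        then have "norm ?y > R" using inv_bounds(1) R by (smt (verit) mult_nonneg_nonneg)
        moreover have "norm ?p > R" using far near' norm_triangle_ineq[of "?y - ?p" ?p] by simp
        ultimately have "g ?y = 0" "g ?p = 0" using g(2) by (meson not_le)+
        then show ?thesis using W bump_props(1) by simp
      qed
      then have "dpow j * cmod (g ?y - g ?p) \<le> dpow j * (W * ?b x)" using dpow_pos[of j] by (intro mult_left_mono) auto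
      moreover have "cmod (?E x - c) = dpow j * cmod (g ?y - g ?p)"
        using dpow_pos[of j] by (simp add: c_def dilate_shift_eq norm_mult flip: right_diff_distrib)
      ultimately have "cmod (?E x - c) \<le> dpow j * W * ?b x" by (simp add: mult.assoc)
      from mult_right_mono[OF this, of "cmod (?H x)"] show ?thesis by (simp add: norm_mult mult.assoc)
    qed simp
    then show ?thesis using W2 by blast
  qed
  then obtain c where c: "c = 0 \<or> (LINT x|lebesgue. h x) = 0"
    "\<And>x. cmod ((?E x - c) * cnj (?H x)) \<le> dpow j * W * (?b x * cmod (?H x))" by blast
  have cE: "cc ?E" using cc_dilate_shift[OF g(1)] .
  have i1: "integrable lebesgue (\<lambda>x. ?E x * cnj (?H x))" "integrable lebesgue (\<lambda>x. c * cnj (?H x))"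
    using cc_integrable[OF cc_mult[OF cE, of "\<lambda>x. cnj (?H x)"]] cc_integrable[OF cc_scale[OF cc_cnj[OF cH(1)], of c]] cc_cnj[OF cH(1)]
    by (auto simp: cc_def)
  have zero: "(LINT x|lebesgue. c * cnj (?H x)) = 0"
  proof -
    have "(LINT x|lebesgue. ?H x) = of_real (dpow (j + N)) * ((LINT x|lebesgue. h x) / of_nat (dM M) ^ (j + N))"
      using LINT_affine[OF h(1), of "j + N" "rvec k'"] by (simp add: dilate_shift_eq[abs_def])
    moreover have "(LINT x|lebesgue. c * cnj (?H x)) = c * cnj (LINT x|lebesgue. ?H x)" by simp
    ultimately show ?thesis using c(1) by auto
  qed
  have "L2_inner ?E ?H = (LINT x|lebesgue. (?E x - c) * cnj (?H x))"
    unfolding L2_inner_def left_diff_distrib using i1 zero by simp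
  also have "cmod \<dots> \<le> (LINT x|lebesgue. dpow j * W * (?b x * cmod (?H x)))"
    by (rule LINT_norm_le[OF _ ib c(2)]) (use i1 in \<open>simp add: left_diff_distrib\<close>)
  finally show ?thesis by simp
qed

text \<open>With the weights \<open>d^(- j / 2)\<close> the bounds for sums over the finer and over the coarser level
  take the same form.\<close>

abbreviation pair_sums_le :: "(real ^ 'n \<Rightarrow> complex) \<Rightarrow> real \<Rightarrow> real \<Rightarrow> bool" where
  "pair_sums_le h R C0 \<equiv> \<forall>g N W. cc g \<longrightarrow> (\<forall>x. g x \<noteq> 0 \<longrightarrow> norm x \<le> R) \<longrightarrow> W \<ge> 0 \<longrightarrow>
    osc_le g h R N W \<longrightarrow>
    (\<forall>j K. finite K \<longrightarrow>
      (\<forall>k. (\<Sum>k'\<in>K. cmod (L2_inner (dil g j k) (dil h (j + N) k'))) / dpow (j + N) \<le> C0 * W / dpow j) \<and>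
      (\<forall>k'. (\<Sum>k\<in>K. cmod (L2_inner (dil g j k) (dil h (j + N) k'))) / dpow j \<le> C0 * W / dpow (j + N)))"

text \<open>Each sum is taken inside the integral of \<open>pair_bound\<close>, where boundedly many
  supports meet at a point: those of the finer functions in one case, the bumps in the other. The
  constant depends on \<open>h\<close> and \<open>R\<close>, but not on \<open>g\<close>, the levels
  or \<open>W\<close>.\<close>

lemma pair_sums:
  assumes h: "cc h" "\<And>x. h x \<noteq> 0 \<Longrightarrow> norm x \<le> R" and R: "R \<ge> 0"
  shows "\<exists>C0\<ge>0. pair_sums_le h R C0"
proof -
  let ?R' = "R + invC * R"
  obtain B where B: "B \<ge> 0" "\<And>x. cmod (h x) \<le> B" using cc_bounded[OF h(1)] by blast
  obtain CC where CC: "\<And>x :: real ^ 'n. card {k. norm (x - rvec k) \<le> R} \<le> CC" using lattice_ball_card by blast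
  obtain CC' where CC': "\<And>x :: real ^ 'n. card {k. norm (x - rvec k) \<le> ?R' + 1} \<le> CC'" using lattice_ball_card by blast
  let ?Ib = "LINT x|lebesgue. bump ?R' x" and ?Ih = "LINT x|lebesgue. cmod (h x)"
  have Ib0: "?Ib \<ge> 0" using bump_props(1) by (intro LINT_nonneg)
  have Ih0: "?Ih \<ge> 0" by (intro LINT_nonneg) simp
  define C0 where "C0 = real CC * B * ?Ib + real CC' * ?Ih"
  have C0: "C0 \<ge> 0" "real CC * B * ?Ib \<le> C0" "real CC' * ?Ih \<le> C0" using B(1) Ib0 Ih0 by (auto simp: C0_def)
  let ?b = "\<lambda>j k x. bump ?R' ((act M ^^ j) x - rvec k)"
  let ?H = "\<lambda>j k. dil h j k"
  have dd: "real (dM M) ^ j = dpow j * dpow j" for j by (simp add: dpow_sq)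
  have ibH: "integrable lebesgue (\<lambda>x. ?b j k x * cmod (?H j' k' x))" for j k j' k'
  proof -
    have "continuous_on UNIV (\<lambda>x. complex_of_real (?b j k x))"
      using cc_affine[OF cc_bump, of ?R' j "rvec k"] by (simp add: cc_def)
    then have "integrable lebesgue (\<lambda>x. of_real (cmod (?H j' k' x)) * complex_of_real (?b j k x))"
      by (intro cc_integrable cc_mult cc_cmod cc_dilate_shift h)
    then have "integrable lebesgue (\<lambda>x. complex_of_real (?b j k x * cmod (?H j' k' x)))" by (simp add: mult_ac)
    then show ?thesis by (simp only: complex_of_real_integrable_eq)
  qed
  have iH: "integrable lebesgue (\<lambda>x. cmod (?H j k x))" for j k
    using cc_integrable[OF cc_dilate_shift[OF h(1)]] by simp
  have ib: "integrable lebesgue (?b j k)" for j k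
    using cc_integrable[OF cc_affine[OF cc_bump, of ?R' j "rvec k"]] by (simp only: complex_of_real_integrable_eq)
  have fine: "(\<Sum>k'\<in>K. (LINT x|lebesgue. ?b j k x * cmod (?H j' k' x))) \<le> dpow j' * C0 / (dpow j * dpow j)"
    if "finite K" for j j' k K
  proof -
    have "(\<Sum>k'\<in>K. (LINT x|lebesgue. ?b j k x * cmod (?H j' k' x))) = (LINT x|lebesgue. (\<Sum>k'\<in>K. ?b j k x * cmod (?H j' k' x)))"
      by (rule LINT_sum[symmetric]) (rule ibH)
    also have "\<dots> \<le> (LINT x|lebesgue. (dpow j' * (real CC * B)) * ?b j k x)"
    proof (rule integral_mono)
      fix x
      have "(\<Sum>k'\<in>K. cmod (?H j' k' x)) = dpow j' * (\<Sum>k'\<in>K. (\<lambda>y. cmod (h y)) ((act M ^^ j') x - rvec k'))"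
        using dpow_pos[of j'] by (simp add: dilate_shift_eq norm_mult sum_distrib_left)
      also have "\<dots> \<le> dpow j' * (real CC * B)"
        using dpow_pos[of j'] h(2) B CC that by (intro mult_left_mono sum_lattice_bounded[where R = R]) auto
      finally have "?b j k x * (\<Sum>k'\<in>K. cmod (?H j' k' x)) \<le> ?b j k x * (dpow j' * (real CC * B))"
        using bump_props(1) by (intro mult_left_mono)
      then show "(\<Sum>k'\<in>K. ?b j k x * cmod (?H j' k' x)) \<le> (dpow j' * (real CC * B)) * ?b j k x"
        unfolding sum_distrib_left[symmetric] by (simp only: mult.commute[of "dpow j' * (real CC * B)"])
    qed (use ibH ib in auto)
    also have "\<dots> = dpow j' * (real CC * B * ?Ib) / (dpow j * dpow j)"
      using LINT_affine_real[OF cc_bump, of ?R' j "rvec k"] by (simp add: dd)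
    also have "\<dots> \<le> dpow j' * C0 / (dpow j * dpow j)"
      using C0(2) dpow_pos[of j] dpow_pos[of j'] by (intro divide_right_mono mult_left_mono) auto
    finally show ?thesis .
  qed
  have coarse: "(\<Sum>k\<in>K. (LINT x|lebesgue. ?b j k x * cmod (?H j' k' x))) \<le> C0 / dpow j'"
    if "finite K" for j j' k' K
  proof -
    have "(\<Sum>k\<in>K. (LINT x|lebesgue. ?b j k x * cmod (?H j' k' x))) = (LINT x|lebesgue. (\<Sum>k\<in>K. ?b j k x * cmod (?H j' k' x)))"
      by (rule LINT_sum[symmetric]) (rule ibH)
    also have "\<dots> \<le> (LINT x|lebesgue. real CC' * cmod (?H j' k' x))"
    proof (rule integral_mono)
      fix x
      have "(\<Sum>k\<in>K. ?b j k x) \<le> real CC' * 1"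
        using bump_props CC' that by (intro sum_lattice_bounded[where R = "?R' + 1"]) auto
      then have "(\<Sum>k\<in>K. ?b j k x) * cmod (?H j' k' x) \<le> real CC' * cmod (?H j' k' x)"
        by (intro mult_right_mono) auto
      then show "(\<Sum>k\<in>K. ?b j k x * cmod (?H j' k' x)) \<le> real CC' * cmod (?H j' k' x)"
        by (simp add: sum_distrib_right)
    qed (use ibH iH in auto)
    also have "\<dots> = real CC' * (dpow j' * (LINT x|lebesgue. cmod (h ((act M ^^ j') x - rvec k'))))"
      using dpow_pos[of j'] by (simp add: dilate_shift_eq norm_mult)
    also have "(LINT x|lebesgue. cmod (h ((act M ^^ j') x - rvec k'))) = ?Ih / (dpow j' * dpow j')"
      using LINT_affine_real[OF cc_cmod[OF h(1)], of j' "rvec k'"] by (simp add: dd)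
    also have "real CC' * (dpow j' * (?Ih / (dpow j' * dpow j'))) = real CC' * ?Ih / dpow j'"
      using dpow_pos[of j'] by simp
    also have "\<dots> \<le> C0 / dpow j'" using C0(3) dpow_pos[of j'] by (intro divide_right_mono) auto
    finally show ?thesis .
  qed
  show ?thesis
  proof (rule exI[of _ C0], intro conjI[OF C0(1)] allI impI)
    fix g :: "real ^ 'n \<Rightarrow> complex" and N W j and K :: "(int ^ 'n) set"
    assume g: "cc g" "\<forall>x. g x \<noteq> 0 \<longrightarrow> norm x \<le> R" and W: "0 \<le> W" and cases: "osc_le g h R N W" and K: "finite K"
    let ?c = "\<lambda>k k'. cmod (L2_inner (dil g j k) (?H (j + N) k'))"
    have pb: "?c k k' \<le> dpow j * W * (LINT x|lebesgue. ?b j k x * cmod (?H (j + N) k' x))" for k k'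
      by (rule pair_bound[OF g(1) _ h R W cases]) (use g in auto)
    have 1: "(\<Sum>k'\<in>K. ?c k k') / dpow (j + N) \<le> C0 * W / dpow j" for k
    proof -
      have "(\<Sum>k'\<in>K. ?c k k') \<le> dpow j * W * (\<Sum>k'\<in>K. (LINT x|lebesgue. ?b j k x * cmod (?H (j + N) k' x)))"
        unfolding sum_distrib_left by (intro sum_mono pb)
      also have "\<dots> \<le> dpow j * W * (dpow (j + N) * C0 / (dpow j * dpow j))"
        using W dpow_pos[of j] by (intro mult_left_mono fine K) auto
      finally show ?thesis using dpow_pos[of j] dpow_pos[of "j + N"] by (simp add: divide_le_eq mult_ac)
    qed
    have 2: "(\<Sum>k\<in>K. ?c k k') / dpow j \<le> C0 * W / dpow (j + N)" for k'
    proof -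
      have "(\<Sum>k\<in>K. ?c k k') \<le> dpow j * W * (\<Sum>k\<in>K. (LINT x|lebesgue. ?b j k x * cmod (?H (j + N) k' x)))"
        unfolding sum_distrib_left by (intro sum_mono pb)
      also have "\<dots> \<le> dpow j * W * (C0 / dpow (j + N))"
        using W dpow_pos[of j] by (intro mult_left_mono coarse K) auto
      finally show ?thesis using dpow_pos[of j] by (simp add: divide_le_eq mult_ac)
    qed
    show "(\<forall>k. (\<Sum>k'\<in>K. ?c k k') / dpow (j + N) \<le> C0 * W / dpow j) \<and> (\<forall>k'. (\<Sum>k\<in>K. ?c k k') / dpow j \<le> C0 * W / dpow (j + N))"
      using 1 2 by blast
  qed
qed

end

lemma geometric_sum_le: "0 \<le> t \<Longrightarrow> t < 1 \<Longrightarrow> (\<Sum>i\<le>n. t ^ i) \<le> 1 / (1 - t :: real)"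
  using sum_gp0[of t n] by (simp add: divide_right_mono)

lemma two_sided_geometric_sum_le:
  fixes t :: real
  assumes t: "0 < t" "t < 1"
  shows "(\<Sum>j'\<le>J. t ^ ((j - j') + (j' - j))) \<le> 2 / (1 - t)"
proof -
  have "(\<Sum>j'\<le>J. t ^ ((j - j') + (j' - j))) \<le> (\<Sum>j'\<in>{..j} \<union> {j..j+J}. t ^ ((j - j') + (j' - j)))"
    using t by (intro sum_mono2) auto
  also have "\<dots> \<le> (\<Sum>j'\<le>j. t ^ ((j - j') + (j' - j))) + (\<Sum>j'=j..j+J. t ^ ((j - j') + (j' - j)))"
    using t by (subst sum.union_inter[symmetric]) (auto intro!: sum_nonneg)
  also have "(\<Sum>j'\<le>j. t ^ ((j - j') + (j' - j))) = (\<Sum>i\<le>j. t ^ i)"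
    by (rule sum.reindex_bij_witness[of _ "\<lambda>i. j - i" "\<lambda>i. j - i"]) auto
  also have "(\<Sum>j'=j..j+J. t ^ ((j - j') + (j' - j))) = (\<Sum>i\<le>J. t ^ i)"
    by (rule sum.reindex_bij_witness[of _ "\<lambda>i. j + i" "\<lambda>i. i - j"]) auto
  also have "(\<Sum>i\<le>j. t ^ i) + (\<Sum>i\<le>J. t ^ i) \<le> 1 / (1 - t) + 1 / (1 - t)"
    using t by (intro add_mono geometric_sum_le) auto
  finally show ?thesis by simp
qed

context expanding
begin

text \<open>The function on the strictly finer level supplies the cancellation. Its level is
  positive, so the alternative \<open>j = 0\<close> is excluded and its integral vanishes; on equal
  levels size suffices. This admits \<phi>, which has integral 1, on level 0.\<close>

lemma level_pair:
  assumes g: "regular g" and h: "regular h"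
  shows "\<exists>C t. C \<ge> 0 \<and> 0 < t \<and> t < 1 \<and> (\<forall>j j' k K. finite K \<longrightarrow>
      j = 0 \<or> (LINT x|lebesgue. g x) = 0 \<longrightarrow> j' = 0 \<or> (LINT x|lebesgue. h x) = 0 \<longrightarrow>
      (\<Sum>k'\<in>K. cmod (L2_inner (dil g j k) (dil h j' k'))) / dpow j' \<le> C * t ^ ((j - j') + (j' - j)) / dpow j)"
proof -
  have cc: "cc g" "cc h" using g h by (auto simp: regular_def)
  obtain R1 R2 where "\<And>x. g x \<noteq> 0 \<Longrightarrow> norm x \<le> R1" "\<And>x. h x \<noteq> 0 \<Longrightarrow> norm x \<le> R2"
    using cc unfolding cc_def csupp_def by meson
  then obtain R where R: "R \<ge> 0" "\<And>x. g x \<noteq> 0 \<Longrightarrow> norm x \<le> R" "\<And>x. h x \<noteq> 0 \<Longrightarrow> norm x \<le> R"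
    by (intro that[of "max 0 (max R1 R2)"]) force+
  have D: "invC * R \<ge> 0" using inv_bounds(1) R(1) by simp
  obtain Bg where Bg: "Bg \<ge> 0" "\<And>x. cmod (g x) \<le> Bg" using cc_bounded[OF cc(1)] by blast
  obtain Bh where Bh: "Bh \<ge> 0" "\<And>x. cmod (h x) \<le> Bh" using cc_bounded[OF cc(2)] by blast
  obtain Cg tg where tg: "Cg \<ge> 0" "0 < tg" "tg < 1" "\<And>N x y. norm (x - y) \<le> invC * R * invL ^ N \<Longrightarrow> cmod (g x - g y) \<le> Cg * tg ^ N"
    using regular_decay[OF g D] by blast
  obtain Ch th where th: "Ch \<ge> 0" "0 < th" "th < 1" "\<And>N x y. norm (x - y) \<le> invC * R * invL ^ N \<Longrightarrow> cmod (h x - h y) \<le> Ch * th ^ N"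
    using regular_decay[OF h D] by blast
  obtain C1 where C1: "C1 \<ge> 0" and P1: "pair_sums_le h R C1"
    using pair_sums[OF cc(2) R(3,1)] by auto
  obtain C2 where C2: "C2 \<ge> 0" and P2: "pair_sums_le g R C2"
    using pair_sums[OF cc(1) R(2,1)] by auto
  define t where "t = max tg th"
  have t: "0 < t" "t < 1" "tg \<le> t" "th \<le> t" using tg th by (auto simp: t_def)
  define C where "C = C1 * (Bg + Cg) + C2 * (Bh + Ch)"
  have C: "C1 * (Bg + Cg) \<le> C" "C2 * (Bh + Ch) \<le> C" "C \<ge> 0" using C1 C2 Bg(1) Bh(1) tg(1) th(1) by (auto simp: C_def)
  show ?thesis
  proof (rule exI[of _ C], rule exI[of _ t], intro conjI allI impI C t)
    fix j j' :: nat and k and K :: "(int ^ 'n) set"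
    assume K: "finite K" and jg: "j = 0 \<or> (LINT x|lebesgue. g x) = 0" and jh: "j' = 0 \<or> (LINT x|lebesgue. h x) = 0"
    show "(\<Sum>k'\<in>K. cmod (L2_inner (dil g j k) (dil h j' k'))) / dpow j' \<le> C * t ^ ((j - j') + (j' - j)) / dpow j"
    proof (cases "j \<le> j'")
      case True
      then obtain N where N: "j' = j + N" using le_Suc_ex by blast
      define W where "W = (Bg + Cg) * t ^ N"
      have W: "W \<ge> 0" using Bg(1) tg(1) t(1) by (simp add: W_def)
      have "osc_le g h R N W"
      proof (cases "N = 0")
        case True
        then show ?thesis using Bg(2) tg(1) by (auto simp: W_def intro: add_increasing2)
      next
        case False
        have "Cg * tg ^ N \<le> W" unfolding W_def using tg t Bg(1) by (intro mult_mono power_mono) auto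
        then show ?thesis using False jh N tg(4) by (fastforce intro: order_trans)
      qed
      with P1 cc(1) R(2) W K have "(\<Sum>k'\<in>K. cmod (L2_inner (dil g j k) (dil h (j + N) k'))) / dpow (j + N) \<le> C1 * W / dpow j" by blast
      also have "\<dots> \<le> C * t ^ N / dpow j"
        using mult_right_mono[OF C(1), of "t ^ N"] t(1) dpow_pos[of j] by (intro divide_right_mono) (auto simp: W_def mult.assoc)
      finally show ?thesis by (simp add: N)
    next
      case False
      then obtain N where N: "j = j' + N" "N \<noteq> 0" using le_Suc_ex[of j' j] by force
      define W where "W = (Bh + Ch) * t ^ N"
      have W: "W \<ge> 0" using Bh(1) th(1) t(1) by (simp add: W_def)
      have "Ch * th ^ N \<le> W" unfolding W_def using th t Bh(1) by (intro mult_mono power_mono) auto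
      then have "(LINT x|lebesgue. g x) = 0 \<and> (\<forall>x y. norm (x - y) \<le> invC * R * invL ^ N \<longrightarrow> cmod (h x - h y) \<le> W)"
        using jg N th(4) by (fastforce intro: order_trans)
      with P2 cc(2) R(3) W K have "(\<Sum>k'\<in>K. cmod (L2_inner (dil h j' k') (dil g (j' + N) k))) / dpow j' \<le> C2 * W / dpow (j' + N)" by blast
      also have "\<dots> \<le> C * t ^ N / dpow (j' + N)"
        using mult_right_mono[OF C(2), of "t ^ N"] t(1) dpow_pos[of "j' + N"] by (intro divide_right_mono) (auto simp: W_def mult.assoc)
      finally have le: "(\<Sum>k'\<in>K. cmod (L2_inner (dil h j' k') (dil g (j' + N) k))) / dpow j' \<le> C * t ^ N / dpow (j' + N)" .
      have "cmod (L2_inner (dil h j' k') (dil g (j' + N) k)) = cmod (L2_inner (dil g (j' + N) k) (dil h j' k'))" for k'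
        using L2_inner_cnj[of "dil h j' k'" "dil g (j' + N) k"] by simp
      with le show ?thesis by (simp add: N)
    qed
  qed
qed

definition elem :: "(nat \<Rightarrow> real ^ 'n \<Rightarrow> complex) \<Rightarrow> nat \<times> nat \<times> (int ^ 'n) \<Rightarrow> real ^ 'n \<Rightarrow> complex" where
  "elem F i = (case i of (l, j, k) \<Rightarrow> dil (F l) j k)"

lemma elem_L2: "regular (F (fst i)) \<Longrightarrow> elem F i \<in> L2"
  by (cases i) (auto simp: elem_def regular_def intro!: cc_L2 cc_dilate_shift)

text \<open>Schur's test with weight 1 / \<open>dpow j\<close>, for which \<open>level_pair\<close>
  bounds a row block by block. Summing over levels costs a two-sided geometric series, summing over
  generators the factor \<open>L\<close>.\<close>

lemma bessel_family:
  assumes F: "\<And>l. l < L \<Longrightarrow> regular (F l)"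
  shows "\<exists>C\<ge>0. \<forall>I c. finite I \<longrightarrow> I \<subseteq> {(l, j, k). l < L \<and> (j = 0 \<or> (LINT x|lebesgue. F l x) = 0)} \<longrightarrow>
    nsq (\<lambda>x. \<Sum>i\<in>I. c i * elem F i x) \<le> C * (\<Sum>i\<in>I. (cmod (c i))\<^sup>2)"
proof -
  let ?G = "\<lambda>l l' j j' k k'. cmod (L2_inner (dil (F l) j k) (dil (F l') j' k'))"
  let ?adm = "\<lambda>l j. j = (0::nat) \<or> (LINT x|lebesgue. F l x) = 0"
  let ?Q = "\<lambda>p C t. C \<ge> 0 \<and> 0 < t \<and> t < 1 \<and> (\<forall>j j' k K. finite K \<longrightarrow> ?adm (fst p) j \<longrightarrow> ?adm (snd p) j' \<longrightarrow>
        (\<Sum>k'\<in>K. ?G (fst p) (snd p) j j' k k') / dpow j' \<le> C * (t :: real) ^ ((j - j') + (j' - j)) / dpow j)"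
  have "\<exists>q. fst p < L \<and> snd p < L \<longrightarrow> ?Q p (fst q) (snd q)" for p
  proof (cases "fst p < L \<and> snd p < L")
    case True
    then have "regular (F (fst p))" "regular (F (snd p))" using F by auto
    from level_pair[OF this] True show ?thesis
      unfolding split_paired_Ex fst_conv snd_conv by (simp only: simp_thms)
  qed blast
  then have "\<forall>p. \<exists>q. fst p < L \<and> snd p < L \<longrightarrow> ?Q p (fst q) (snd q)" ..
  from choice[OF this] obtain q' where q': "\<And>p. fst p < L \<and> snd p < L \<Longrightarrow> ?Q p (fst (q' p)) (snd (q' p))" by blast
  obtain q where q: "\<And>l l'. l < L \<Longrightarrow> l' < L \<Longrightarrow> fst (q (l, l')) \<ge> 0"
    "\<And>l l'. l < L \<Longrightarrow> l' < L \<Longrightarrow> 0 < snd (q (l, l'))"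
    "\<And>l l'. l < L \<Longrightarrow> l' < L \<Longrightarrow> snd (q (l, l')) < 1"
    "\<And>l l' j j' k K. l < L \<Longrightarrow> l' < L \<Longrightarrow> finite K \<Longrightarrow> ?adm l j \<Longrightarrow> ?adm l' j' \<Longrightarrow>
        (\<Sum>k'\<in>K. ?G l l' j j' k k') / dpow j' \<le> fst (q (l, l')) * (snd (q (l, l'))) ^ ((j - j') + (j' - j)) / dpow j"
    by (rule that[of q']) (use q'[of "(_, _)"] in \<open>simp_all only: fst_conv snd_conv\<close>)
  let ?P = "{..<L} \<times> {..<L}"
  \<comment> \<open>A common rate for all pairs of generators; the entry 1/2 keeps the maximum
    defined and positive even if there are none.\<close>
  define t where "t = Max (insert (1/2) ((snd \<circ> q) ` ?P))"
  have tge: "1/2 \<le> t" "\<And>l l'. l < L \<Longrightarrow> l' < L \<Longrightarrow> snd (q (l, l')) \<le> t"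
    unfolding t_def by (intro Max_ge, simp, simp) (intro Max_ge, simp, force)
  have t: "0 < t" "t < 1" using tge(1) q(3) by (auto simp: t_def)
  define C where "C = (\<Sum>p\<in>?P. fst (q p))"
  have C: "fst (q (l, l')) \<le> C" if "l < L" "l' < L" for l l'
    unfolding C_def using that q(1) by (intro member_le_sum) auto
  have C0: "C \<ge> 0" unfolding C_def using q(1) by (intro sum_nonneg) auto
  have level: "(\<Sum>k'\<in>K. ?G l l' j j' k k') / dpow j' \<le> C * t ^ ((j - j') + (j' - j)) / dpow j"
    if "l < L" "l' < L" "finite K" "?adm l j" "?adm l' j'" for l l' j j' k K
  proof -
    have "fst (q (l, l')) * (snd (q (l, l'))) ^ ((j - j') + (j' - j)) \<le> C * t ^ ((j - j') + (j' - j))"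
      using that q C0 tge C by (intro mult_mono power_mono) (auto simp: less_imp_le)
    then have "fst (q (l, l')) * (snd (q (l, l'))) ^ ((j - j') + (j' - j)) / dpow j \<le> C * t ^ ((j - j') + (j' - j)) / dpow j"
      using dpow_pos[of j] by (intro divide_right_mono) auto
    then show ?thesis using q(4)[OF that, of k] by linarith
  qed
  define CF where "CF = real L * (C * (2 / (1 - t)))"
  have "nsq (\<lambda>x. \<Sum>i\<in>I. c i * elem F i x) \<le> CF * (\<Sum>i\<in>I. (cmod (c i))\<^sup>2)"
    if I: "finite I" "I \<subseteq> {(l, j, k). l < L \<and> ?adm l j}" for I c
  proof (rule schur_bound[where w = "\<lambda>(l, j, k). 1 / dpow j"])
    fix i assume iI: "i \<in> I"
    obtain l j k where i: "i = (l, j, k)" by (cases i) auto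
    then have lj: "l < L" "?adm l j" using iI I(2) by auto
    define pr where "pr = (\<lambda>i :: nat \<times> nat \<times> (int ^ 'n). (fst i, fst (snd i)))"
    define J where "J = Max (insert 0 ((fst \<circ> snd) ` I))"
    have sub: "pr ` I \<subseteq> {..<L} \<times> {..J}" using I unfolding pr_def J_def by (auto intro!: Max_ge rev_image_eqI)
    have "(\<Sum>i'\<in>I. cmod (L2_inner (elem F i) (elem F i')) * (case i' of (l, j, k) \<Rightarrow> 1 / dpow j)) =
        (\<Sum>p\<in>pr ` I. \<Sum>i'\<in>{i' \<in> I. pr i' = p}. cmod (L2_inner (elem F i) (elem F i')) * (case i' of (l, j, k) \<Rightarrow> 1 / dpow j))"
      by (rule sum.image_gen[OF I(1)])
    also have "\<dots> \<le> (\<Sum>p\<in>pr ` I. C * t ^ ((j - snd p) + (snd p - j)) / dpow j)"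
    proof (rule sum_mono)
      fix p assume p: "p \<in> pr ` I"
      obtain l' j' where p': "p = (l', j')" by (cases p)
      have lj': "l' < L" "?adm l' j'" using p I(2) by (auto simp: p' pr_def)
      let ?K = "(snd \<circ> snd) ` {i' \<in> I. pr i' = p}"
      have "(\<Sum>i'\<in>{i' \<in> I. pr i' = p}. cmod (L2_inner (elem F i) (elem F i')) * (case i' of (l, j, k) \<Rightarrow> 1 / dpow j)) =
          (\<Sum>k'\<in>?K. ?G l l' j j' k k' / dpow j')"
        by (rule sum.reindex_bij_witness[of _ "\<lambda>k'. (l', j', k')" "snd \<circ> snd"]) (auto simp: p' pr_def elem_def i)
      also have "\<dots> \<le> C * t ^ ((j - j') + (j' - j)) / dpow j"
        unfolding sum_divide_distrib[symmetric] using lj lj' I(1) by (intro level) auto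
      finally show "(\<Sum>i'\<in>{i' \<in> I. pr i' = p}. cmod (L2_inner (elem F i) (elem F i')) * (case i' of (l, j, k) \<Rightarrow> 1 / dpow j)) \<le>
          C * t ^ ((j - snd p) + (snd p - j)) / dpow j" by (simp add: p')
    qed
    also have "\<dots> \<le> (\<Sum>p\<in>{..<L} \<times> {..J}. C * t ^ ((j - snd p) + (snd p - j)) / dpow j)"
      using sub C0 t dpow_pos[of j] by (intro sum_mono2) auto
    also have "\<dots> = real L * (C * (\<Sum>j'\<le>J. t ^ ((j - j') + (j' - j)))) / dpow j"
      by (simp add: sum.cartesian_product' sum_distrib_left sum_divide_distrib)
    also have "\<dots> \<le> CF / dpow j"
      unfolding CF_def using two_sided_geometric_sum_le[OF t, of j J] C0 dpow_pos[of j]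
      by (intro divide_right_mono mult_left_mono) auto
    finally show "(\<Sum>i'\<in>I. cmod (L2_inner (elem F i) (elem F i')) * (case i' of (l, j, k) \<Rightarrow> 1 / dpow j)) \<le> CF * (case i of (l, j, k) \<Rightarrow> 1 / dpow j)"
      by (simp add: i)
  qed (use I F dpow_pos in \<open>auto intro!: elem_L2\<close>)
  moreover have "CF \<ge> 0" using C0 t by (simp add: CF_def)
  ultimately show ?thesis by blast
qed

section \<open>Density of continuous functions with bounded support\<close>

lemma nsq_tendsto_0:
  fixes h :: "nat \<Rightarrow> real ^ 'n \<Rightarrow> complex"
  assumes m: "\<And>n. h n \<in> borel_measurable lebesgue" and w: "integrable lebesgue w"
    and lim: "AE x in lebesgue. (\<lambda>n. h n x) \<longlonglongrightarrow> 0" and le: "\<And>n x. (cmod (h n x))\<^sup>2 \<le> w x"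
  shows "(\<lambda>n. nsq (h n)) \<longlonglongrightarrow> 0"
proof -
  have "(\<lambda>n. LINT x|lebesgue. (cmod (h n x))\<^sup>2) \<longlonglongrightarrow> (LINT (x::real^'n)|lebesgue. (0::real))"
  proof (rule Bochner_Integration.integral_dominated_convergence[where w = w])
    show "AE x in lebesgue. (\<lambda>n. (cmod (h n x))\<^sup>2) \<longlonglongrightarrow> 0"
      using lim by eventually_elim (auto intro!: tendsto_eq_intros)
  qed (use m w le in auto)
  then show ?thesis by (simp add: nsq_def)
qed

lemma L2_approx_bounded:
  fixes f :: "real ^ 'n \<Rightarrow> complex"
  assumes f: "f \<in> L2" and e: "e > 0"
  shows "\<exists>n. nsq (\<lambda>x. f x - (if cmod (f x) \<le> real n \<and> norm x \<le> real n then f x else 0)) < e"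
proof -
  let ?h = "\<lambda>n x. f x - (if cmod (f x) \<le> real n \<and> norm x \<le> real n then f x else 0)"
  have fm: "f \<in> borel_measurable lebesgue" using f by (simp add: L2_def)
  have nm: "(\<lambda>x :: real ^ 'n. norm x) \<in> borel_measurable lebesgue"
    by (simp add: borel_measurable_continuous_onI continuous_on_norm_id measurable_completion)
  have "(\<lambda>n. nsq (?h n)) \<longlonglongrightarrow> 0"
  proof (rule nsq_tendsto_0)
    show "integrable lebesgue (\<lambda>x. (cmod (f x))\<^sup>2)" using f by (simp add: L2_def)
    have "(\<lambda>n. ?h n x) \<longlonglongrightarrow> 0" for x
    proof (rule tendsto_eventually)
      obtain N :: nat where "cmod (f x) + norm x \<le> real N" using real_arch_simple by blast
      then have "?h n x = 0" if "n \<ge> N" for n using that norm_ge_zero[of x] norm_ge_zero[of "f x"] by (smt (verit) of_nat_mono right_minus_eq)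
      then show "\<forall>\<^sub>F n in sequentially. ?h n x = 0" unfolding eventually_sequentially by blast
    qed
    then show "AE x in lebesgue. (\<lambda>n. ?h n x) \<longlonglongrightarrow> 0" by simp
    show "?h n \<in> borel_measurable lebesgue" for n using fm nm by measurable
  qed auto
  then show ?thesis using order_tendstoD(2)[of "\<lambda>n. nsq (?h n)" 0 sequentially e] e by (auto simp: eventually_sequentially)
qed

text \<open>After truncation to a bounded function of bounded support, \<open>measurable_on\<close>
  supplies continuous functions converging off a negligible set. Clamping their values and cutting
  them off by a bump puts them into \<open>cc\<close> and provides an integrable majorant, so the
  convergence is in L2.\<close>

lemma cc_dense:
  fixes f :: "real ^ 'n \<Rightarrow> complex"
  assumes f: "f \<in> L2" and e: "e > 0"
  shows "\<exists>g. cc g \<and> L2_norm (\<lambda>x. f x - g x) < e"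
proof -
  have e2: "(e / 2)\<^sup>2 > 0" using e by simp
  obtain n where n: "nsq (\<lambda>x. f x - (if cmod (f x) \<le> real n \<and> norm x \<le> real n then f x else 0)) < (e / 2)\<^sup>2"
    using L2_approx_bounded[OF f e2] by blast
  \<comment> \<open>One more than \<open>n\<close>, so that the denominator in \<open>cl\<close>
    never vanishes.\<close>
  define B where "B = real n + 1"
  have B: "B > 0" by (simp add: B_def)
  define f' where "f' = (\<lambda>x. if cmod (f x) \<le> real n \<and> norm x \<le> real n then f x else 0)"
  have fm: "f \<in> borel_measurable lebesgue" using f by (simp add: L2_def)
  have nm: "(\<lambda>x :: real ^ 'n. norm x) \<in> borel_measurable lebesgue"
    by (simp add: borel_measurable_continuous_onI continuous_on_norm_id measurable_completion)
  have fm': "f' \<in> borel_measurable lebesgue" unfolding f'_def using fm nm by measurable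
  have f'b: "cmod (f' x) \<le> B" "norm x > B \<Longrightarrow> f' x = 0" for x by (auto simp: f'_def B_def)
  have "f' measurable_on UNIV" using fm' by (simp add: measurable_on_iff_borel_measurable lebesgue_on_UNIV_eq)
  then obtain N g where N: "negligible N" and g: "\<And>k. continuous_on UNIV (g k)"
    and lim: "\<And>x. x \<notin> N \<Longrightarrow> (\<lambda>k. g k x) \<longlonglongrightarrow> f' x" by (auto simp: measurable_on_def)
  \<comment> \<open>The radial retraction onto the disc of radius \<open>B\<close>; it is continuous
    and fixes the values of \<open>f'\<close>.\<close>
  define cl where "cl = (\<lambda>z :: complex. z * of_real (B / max B (cmod z)))"
  have clc: "continuous_on UNIV cl" unfolding cl_def using B by (intro continuous_intros) auto
  have clb: "cmod (cl z) \<le> B" for z using B by (auto simp: cl_def norm_mult norm_divide max_def field_simps)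
  have cl_id: "cmod z \<le> B \<Longrightarrow> cl z = z" for z using B by (simp add: cl_def max_def)
  define h where "h = (\<lambda>k x. cl (g k x) * of_real (bump B x))"
  have cch: "cc (h k)" for k
  proof -
    have "continuous_on UNIV (\<lambda>x. cl (g k x))" using continuous_on_compose2[OF clc g] by simp
    from cc_mult[OF cc_bump this, of B] show ?thesis by (simp add: h_def mult.commute)
  qed
  have "(\<lambda>k. nsq (\<lambda>x. f' x - h k x)) \<longlonglongrightarrow> 0"
  proof (rule nsq_tendsto_0[where w = "\<lambda>x. (2 * B)\<^sup>2 * bump B x"])
    show "(\<lambda>x. f' x - h k x) \<in> borel_measurable lebesgue" for k
      using fm' L2D(1)[OF cc_L2[OF cch]] by (rule borel_measurable_diff)
    show "integrable lebesgue (\<lambda>x :: real ^ 'n. (2 * B)\<^sup>2 * bump B x)"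
      using cc_integrable[OF cc_bump, of B] by (simp only: complex_of_real_integrable_eq integrable_mult_right)
    have "(\<lambda>k. f' x - h k x) \<longlonglongrightarrow> 0" if "x \<notin> N" for x
    proof -
      have "(\<lambda>k. f' x - cl (g k x) * of_real (bump B x)) \<longlonglongrightarrow> f' x - cl (f' x) * of_real (bump B x)"
        by (intro tendsto_intros continuous_on_tendsto_compose[OF clc lim[OF that]]) auto
      moreover have "f' x - cl (f' x) * of_real (bump B x) = 0"
        using f'b[of x] bump_props(3)[of x B] by (cases "norm x \<le> B") (auto simp: cl_id)
      ultimately show ?thesis by (simp add: h_def)
    qed
    then show "AE x in lebesgue. (\<lambda>k. f' x - h k x) \<longlonglongrightarrow> 0"
      using N by (intro AE_I'[of N]) (auto simp: negligible_iff_null_sets)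
    show "(cmod (f' x - h k x))\<^sup>2 \<le> (2 * B)\<^sup>2 * bump B x" for k x
    proof (cases "norm x \<le> B")
      case True
      have "cmod (f' x - h k x) \<le> B + B"
        using f'b(1)[of x] clb[of "g k x"] norm_triangle_ineq4[of "f' x" "h k x"] bump_props(3)[OF True] by (simp add: h_def)
      then show ?thesis using bump_props(3)[OF True] power_mono[of "cmod (f' x - h k x)" "2 * B" 2] by simp
    next
      case False
      have "cmod (h k x) \<le> B * bump B x"
        unfolding h_def using clb bump_props(1) by (simp add: norm_mult mult_right_mono)
      then have "(cmod (h k x))\<^sup>2 \<le> (B * bump B x)\<^sup>2" by (intro power_mono) auto
      also have "\<dots> \<le> B\<^sup>2 * bump B x"
        using mult_left_mono[OF mult_left_le[OF bump_props(2,1), of B x], of "B * B"] B by (simp add: power2_eq_square mult_ac)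
      also have "\<dots> \<le> (2 * B)\<^sup>2 * bump B x" using bump_props(1)[of B x] by (intro mult_right_mono) (auto simp: power_mult_distrib)
      finally show ?thesis using f'b(2)[of x] False by simp
    qed
  qed
  then obtain k where k: "nsq (\<lambda>x. f' x - h k x) < (e / 2)\<^sup>2"
    using order_tendstoD(2)[OF _ e2] by (fastforce simp: eventually_sequentially)
  have f'L: "f' \<in> L2" unfolding L2_def
  proof (simp add: fm', rule integrable_dominated[OF L2D(2)[OF f]])
    show "(\<lambda>x. (cmod (f' x))\<^sup>2) \<in> borel_measurable lebesgue" using fm' by simp
  qed (auto simp: f'_def)
  have lt: "L2_norm u < e / 2" if "nsq u < (e / 2)\<^sup>2" for u :: "real ^ 'n \<Rightarrow> complex"
    unfolding L2_norm_nsq using that e by (intro real_less_lsqrt) auto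
  have "L2_norm (\<lambda>x. (f x - f' x) + (f' x - h k x)) < e"
    using L2_norm_triangle[OF L2_diff[OF f f'L] L2_diff[OF f'L cc_L2[OF cch[of k]]]] lt[OF k] lt[OF n[folded f'_def]]
    by (simp add: f'_def)
  then show ?thesis using cch by (intro exI[of _ "h k"]) simp
qed

end

section \<open>One step of the fast framelet transform\<close>

locale framelet_bank = filter_bank M a m \<gamma> s u \<epsilon> + smooth_filter M a m
  for M :: "int ^ 'n ^ 'n" and a m \<gamma> s u \<epsilon>
begin

text \<open>By \<open>tau_sum\<close> this is the sum over \<open>k\<close> of
  \<open>cnj (b (p - M *v k)) * b (q - M *v k)\<close>, the kernel of analysis followed by synthesis
  with \<open>b\<close>. The form as a convolution gives access to its Fourier series.\<close>

definition tau :: "'n filt \<Rightarrow> int ^ 'n \<Rightarrow> int ^ 'n \<Rightarrow> complex" where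
  "tau b p q = conv (\<lambda>n. if crep n = crep q then b n else 0) (flip b) (q - p)"

lemma coset_part_l0: "b \<in> l0 \<Longrightarrow> (\<lambda>n. if crep n = crep q then b n else 0) \<in> l0"
  by (rule l0I[OF l0_finite[of b]]) auto

lemma coset_average:
  assumes b: "b \<in> l0"
  shows "(\<Sum>\<omega>\<in>Omega M. cnj (ochr q \<omega>) * (cnj (fseries b \<xi>) * fseries b (\<xi> + (2 * pi) *\<^sub>R \<omega>))) =
    of_nat (dM M) * fseries (conv (\<lambda>n. if crep n = crep q then b n else 0) (flip b)) \<xi>"
proof -
  let ?bq = "\<lambda>n. if crep n = crep q then b n else 0"
  have "(\<Sum>\<omega>\<in>Omega M. cnj (ochr q \<omega>) * (cnj (fseries b \<xi>) * fseries b (\<xi> + (2 * pi) *\<^sub>R \<omega>))) =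
      cnj (fseries b \<xi>) * (\<Sum>\<omega>\<in>Omega M. cnj (ochr q \<omega>) * (\<Sum>n | b n \<noteq> 0. b n * chr n \<xi> * ochr n \<omega>))"
    by (simp add: fseries_chr[of b "\<xi> + _"] chr_plus sum_distrib_left mult_ac)
  also have "(\<Sum>\<omega>\<in>Omega M. cnj (ochr q \<omega>) * (\<Sum>n | b n \<noteq> 0. b n * chr n \<xi> * ochr n \<omega>)) =
      of_nat (dM M) * (\<Sum>n | b n \<noteq> 0. if crep n = crep q then b n * chr n \<xi> else 0)"
    by (rule sum_Omega_coset[OF l0_finite[OF b]])
  also have "(\<Sum>n | b n \<noteq> 0. if crep n = crep q then b n * chr n \<xi> else 0) = fseries ?bq \<xi>"
    by (subst fseries_superset[OF l0_finite[OF b]]) (auto intro!: sum.cong)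
  finally show ?thesis using b by (simp add: fseries_conv coset_part_l0 flip_l0 fseries_flip mult_ac)
qed

text \<open>The identity of the filter bank, averaged over \<open>Omega M\<close> against the
  character of \<open>q\<close>: the right side leaves the term \<omega> = 0, so the signed kernels
  add up to \<open>delta (q - p)\<close> divided by \<open>d\<close>.\<close>

lemma tau_identity:
  "of_nat (dM M) * (tau a p q + (\<Sum>l<length bs. of_int (\<epsilon>s ! l) * tau (bs ! l) p q)) = (if p = q then 1 else 0)"
proof -
  let ?c = "\<lambda>b. conv (\<lambda>n. if crep n = crep q then b n else 0) (flip b)"
  let ?T = "\<lambda>b \<xi> \<omega>. cnj (fseries b \<xi>) * fseries b (\<xi> + (2 * pi) *\<^sub>R \<omega>)"
  let ?W = "\<lambda>r. of_nat (dM M) * ?c a r + (\<Sum>l<length bs. of_int (\<epsilon>s ! l) * (of_nat (dM M) * ?c (bs ! l) r))"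
  have c_l0: "?c b \<in> l0" if "b \<in> l0" for b using that by (intro conv_l0 coset_part_l0 flip_l0)
  have bl: "bs ! l \<in> l0" if "l < length bs" for l using bs_props(1) that by simp
  have "fseries ?W \<xi> = 1" for \<xi>
  proof -
    have "fseries ?W \<xi> = of_nat (dM M) * fseries (?c a) \<xi> + (\<Sum>l<length bs. of_int (\<epsilon>s ! l) * (of_nat (dM M) * fseries (?c (bs ! l)) \<xi>))"
    proof -
      have "fseries (\<lambda>r. \<Sum>l<length bs. of_int (\<epsilon>s ! l) * (of_nat (dM M) * ?c (bs ! l) r)) \<xi> =
          (\<Sum>l<length bs. of_int (\<epsilon>s ! l) * (of_nat (dM M) * fseries (?c (bs ! l)) \<xi>))"
        using c_l0 bl by (subst fseries_sum) (auto simp: fseries_scale intro!: l0_scale)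
      then show ?thesis using c_l0 bl a_l0 by (subst fseries_add) (auto simp: fseries_scale intro!: l0_scale l0_sum)
    qed
    also have "\<dots> = (\<Sum>\<omega>\<in>Omega M. cnj (ochr q \<omega>) * ?T a \<xi> \<omega>) +
        (\<Sum>l<length bs. of_int (\<epsilon>s ! l) * (\<Sum>\<omega>\<in>Omega M. cnj (ochr q \<omega>) * ?T (bs ! l) \<xi> \<omega>))"
      using bl a_l0 by (simp add: coset_average)
    also have "\<dots> = (\<Sum>\<omega>\<in>Omega M. cnj (ochr q \<omega>) * (?T a \<xi> \<omega> + (\<Sum>l<length bs. of_int (\<epsilon>s ! l) * ?T (bs ! l) \<xi> \<omega>)))"
      unfolding distrib_left sum.distrib sum_distrib_left
      by (subst sum.swap) (simp add: mult_ac)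
    also have "\<dots> = (\<Sum>\<omega>\<in>Omega M. cnj (ochr q \<omega>) * delta \<omega>)"
      by (rule sum.cong[OF refl]) (simp only: filter_bank_identity)
    also have "\<dots> = (\<Sum>\<omega>\<in>{0}. cnj (ochr q \<omega>) * delta \<omega>)"
      by (rule sum.mono_neutral_right) (auto simp: delta_def zero_Omega)
    finally show ?thesis by (simp add: delta_def)
  qed
  moreover have "?W \<in> l0" using c_l0 bl a_l0 by (intro l0_add l0_scale l0_sum) auto
  ultimately have "?W = delta" by (intro fseries_inject) auto
  then have "?W (q - p) = delta (q - p)" by (rule fun_cong)
  then show ?thesis by (auto simp: tau_def delta_def distrib_left sum_distrib_left mult_ac)
qed

lemma tau_sum:
  assumes b: "b \<in> l0" and K: "finite K" "\<And>k. b (q - M *v k) \<noteq> 0 \<Longrightarrow> k \<in> K"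
  shows "(\<Sum>k\<in>K. cnj (b (p - M *v k)) * b (q - M *v k)) = tau b p q"
proof -
  let ?S = "{x. b (q - x) \<noteq> 0}"
  have "?S \<subseteq> (\<lambda>n. q - n) ` {n. b n \<noteq> 0}" by (auto intro!: image_eqI[of _ _ "q - _"])
  then have S: "finite ?S" using l0_finite[OF b] by (meson finite_imageI finite_subset)
  have cr: "crep (q - n) = crep 0 \<longleftrightarrow> crep n = crep q" for n
    using crep_diff_eq_0[of q n] crep_diff_eq_0[of 0 0] by auto
  have "(\<Sum>k\<in>K. cnj (b (p - M *v k)) * b (q - M *v k)) = (\<Sum>x\<in>?S. if crep x = crep 0 then cnj (b (p - x)) * b (q - x) else 0)"
    using sum_coset_reindex[OF S _ K(1), of "\<lambda>x. cnj (b (p - x)) * b (q - x)" 0] K(2) by simp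
  also have "\<dots> = (\<Sum>n | b n \<noteq> 0. (if crep n = crep q then b n else 0) * flip b (q - p - n))"
    by (rule sum.reindex_bij_witness[of _ "\<lambda>n. q - n" "\<lambda>n. q - n"]) (auto simp: flip_def cr[symmetric] algebra_simps)
  also have "\<dots> = tau b p q" unfolding tau_def by (rule conv_superset[symmetric, OF l0_finite[OF b]]) auto
  finally show ?thesis .
qed

lemma coset_bilinear:
  assumes b: "b \<in> l0" and C: "finite C" "\<And>k. k \<notin> C \<Longrightarrow> c k = 0" and V: "finite V" "\<And>k. k \<notin> V \<Longrightarrow> v k = 0"
    and K: "finite K" "\<And>k. k \<notin> K \<Longrightarrow> (\<Sum>n | b n \<noteq> 0. cnj (b n) * c (M *v k + n)) = 0"
  shows "(\<Sum>k\<in>K. (\<Sum>n | b n \<noteq> 0. cnj (b n) * c (M *v k + n)) * (\<Sum>n | b n \<noteq> 0. b n * v (M *v k + n))) =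
    (\<Sum>p\<in>C. \<Sum>q\<in>V. c p * v q * tau b p q)"
proof -
  let ?A = "\<lambda>k. \<Sum>n | b n \<noteq> 0. cnj (b n) * c (M *v k + n)" and ?B = "\<lambda>k. \<Sum>n | b n \<noteq> 0. b n * v (M *v k + n)"
  define K' where "K' = K \<union> (\<Union>q\<in>V. {k. b (q - M *v k) \<noteq> 0})"
  have "finite {k. b (q - M *v k) \<noteq> 0}" for q
    using finite_vimageI[OF l0_finite[OF b], of "\<lambda>k. q - M *v k"] by (simp add: inj_on_def vimage_def)
  then have K': "finite K'" "K \<subseteq> K'" using K(1) V(1) by (auto simp: K'_def)
  have re: "(\<Sum>n | b n \<noteq> 0. f (b n) * w (y + n)) = (\<Sum>p\<in>P. f (b (p - y)) * w p)"
    if "finite P" "\<And>k. k \<notin> P \<Longrightarrow> w k = 0" "f 0 = 0" for f :: "complex \<Rightarrow> complex" and w y P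
    by (rule sum.reindex_bij_witness_not_neutral[of "{n. b n \<noteq> 0 \<and> w (y + n) = 0}" "{p \<in> P. b (p - y) = 0 \<or> w p = 0}" _ "\<lambda>p. p - y" "\<lambda>n. y + n"])
      (use that l0_finite[OF b] in auto)
  have "(\<Sum>k\<in>K. ?A k * ?B k) = (\<Sum>k\<in>K'. ?A k * ?B k)"
    by (rule sum.mono_neutral_left[OF K']) (use K(2) in auto)
  also have "\<dots> = (\<Sum>k\<in>K'. (\<Sum>p\<in>C. cnj (b (p - M *v k)) * c p) * (\<Sum>q\<in>V. b (q - M *v k) * v q))"
    using re[where w = c and f = cnj, OF C] re[where w = v and f = "\<lambda>z. z", OF V] by simp
  also have "\<dots> = (\<Sum>k\<in>K'. \<Sum>p\<in>C. \<Sum>q\<in>V. c p * v q * (cnj (b (p - M *v k)) * b (q - M *v k)))"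
    unfolding sum_product by (simp add: mult_ac)
  also have "\<dots> = (\<Sum>p\<in>C. \<Sum>q\<in>V. \<Sum>k\<in>K'. c p * v q * (cnj (b (p - M *v k)) * b (q - M *v k)))"
    by (subst sum.swap, intro sum.cong[OF refl], rule sum.swap)
  also have "\<dots> = (\<Sum>p\<in>C. \<Sum>q\<in>V. c p * v q * tau b p q)"
    unfolding sum_distrib_left[symmetric] by (intro sum.cong refl arg_cong2[where f = "(*)"] tau_sum b K') (auto simp: K'_def)
  finally show ?thesis .
qed

text \<open>Perfect reconstruction in bilinear form. In the application \<open>c\<close> holds the
  coefficients of a function on the finer level and \<open>v\<close> the values of the finer
  functions at a point; \<open>X b\<close> is then, up to the factor \<open>d\<close>, the coarser
  contribution of \<open>b\<close>.\<close>

lemma bank_step: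
  assumes C: "finite C" "\<And>k. k \<notin> C \<Longrightarrow> c k = 0" and V: "finite V" "\<And>k. k \<notin> V \<Longrightarrow> v k = 0"
    and K: "finite K" "\<And>b k. b \<in> insert a (set bs) \<Longrightarrow> k \<notin> K \<Longrightarrow> (\<Sum>n | b n \<noteq> 0. cnj (b n) * c (M *v k + n)) = 0"
  defines "X \<equiv> \<lambda>b. \<Sum>k\<in>K. (\<Sum>n | b n \<noteq> 0. cnj (b n) * c (M *v k + n)) * (\<Sum>n | b n \<noteq> 0. b n * v (M *v k + n))"
  shows "of_nat (dM M) * (X a + (\<Sum>l<length bs. of_int (\<epsilon>s ! l) * X (bs ! l))) = (\<Sum>q\<in>C. c q * v q)"
proof -
  have X: "X b = (\<Sum>p\<in>C. \<Sum>q\<in>V. c p * v q * tau b p q)" if "b \<in> insert a (set bs)" for b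
    unfolding X_def using that a_l0 bs_props(1) by (intro coset_bilinear C V K) auto
  have "of_nat (dM M) * (X a + (\<Sum>l<length bs. of_int (\<epsilon>s ! l) * X (bs ! l))) =
      (\<Sum>p\<in>C. \<Sum>q\<in>V. c p * v q * (of_nat (dM M) * (tau a p q + (\<Sum>l<length bs. of_int (\<epsilon>s ! l) * tau (bs ! l) p q))))"
  proof -
    have "(\<Sum>l<length bs. of_int (\<epsilon>s ! l) * X (bs ! l)) = (\<Sum>p\<in>C. \<Sum>q\<in>V. \<Sum>l<length bs. of_int (\<epsilon>s ! l) * (c p * v q * tau (bs ! l) p q))"
    proof -
      have "(\<Sum>l<length bs. of_int (\<epsilon>s ! l) * X (bs ! l)) = (\<Sum>l<length bs. \<Sum>p\<in>C. \<Sum>q\<in>V. of_int (\<epsilon>s ! l) * (c p * v q * tau (bs ! l) p q))"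
        by (simp add: X sum_distrib_left)
      then show ?thesis by (simp only:) (subst sum.swap, intro sum.cong[OF refl], rule sum.swap)
    qed
    then show ?thesis
      by (simp add: X distrib_left sum.distrib sum_distrib_left mult_ac)
  qed
  also have "\<dots> = (\<Sum>p\<in>C. \<Sum>q\<in>V. if p = q then c p * v q else 0)"
    unfolding tau_identity by (intro sum.cong) auto
  also have "\<dots> = (\<Sum>q\<in>C. c q * v q)"
    using V by (auto intro!: sum.cong)
  finally show ?thesis .
qed

lemma dilate_refine:
  "dil (refine b phi) j k x =
    (\<Sum>n | b n \<noteq> 0. of_real (real (dM M) * dpow j / dpow (Suc j)) * b n * dil phi (Suc j) (M *v k + n) x)"
  using dpow_pos[of "Suc j"]
  by (simp add: dilate_shift_eq refine_def act_diff act_rvec rvec_add sum_distrib_left algebra_simps)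

text \<open>The factor in \<open>dilate_refine\<close> is the square root of \<open>d\<close>. It
  occurs once in the coefficient and once in the function, which accounts for the \<open>d\<close>
  of \<open>bank_step\<close>.\<close>

lemma refine_scale_sq: "real (dM M) * dpow j / dpow (Suc j) * (real (dM M) * dpow j / dpow (Suc j)) = real (dM M)"
proof -
  have "real (dM M) * dpow j / dpow (Suc j) * (real (dM M) * dpow j / dpow (Suc j)) = (real (dM M))\<^sup>2 * (dpow j * dpow j) / (dpow (Suc j) * dpow (Suc j))"
    by (simp add: power2_eq_square)
  then show ?thesis using dM_pos by (simp add: dpow_sq power2_eq_square)
qed

lemma phi_L2: "dil phi j k \<in> L2"
  by (intro cc_L2 cc_dilate_shift phi_cc)

lemma inner_dilate_refine:
  assumes g: "g \<in> L2"
  shows "L2_inner g (dil (refine b phi) j k) =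
    of_real (real (dM M) * dpow j / dpow (Suc j)) * (\<Sum>n | b n \<noteq> 0. cnj (b n) * L2_inner g (dil phi (Suc j) (M *v k + n)))"
  unfolding dilate_refine[abs_def] using g phi_L2 by (subst L2_inner_sum_right) (auto simp: sum_distrib_left mult_ac)

lemma coefficients_finite:
  assumes g: "cc g" and h: "cc h"
  shows "finite {k. L2_inner g (dil h j k) \<noteq> 0}"
proof -
  obtain A where A: "A \<ge> 1" "\<And>n x. norm ((act M ^^ n) x) \<le> A ^ n * norm x" using act_pow_bound by blast
  obtain R where R: "R \<ge> 0" "\<And>x. g x \<noteq> 0 \<Longrightarrow> norm x \<le> R" using g by (auto simp: cc_def csupp_def)
  obtain R' where R': "R' \<ge> 0" "\<And>x. h x \<noteq> 0 \<Longrightarrow> norm x \<le> R'" using h by (auto simp: cc_def csupp_def)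
  have "norm (0 - rvec k) \<le> R' + A ^ j * R" if nz: "L2_inner g (dil h j k) \<noteq> 0" for k
  proof -
    have "\<exists>x. g x \<noteq> 0 \<and> dil h j k x \<noteq> 0"
    proof (rule ccontr)
      assume "\<not> ?thesis"
      then have "(\<lambda>x. g x * cnj (dil h j k x)) = (\<lambda>_. 0)" by (auto simp: fun_eq_iff)
      then show False using nz by (simp add: L2_inner_def)
    qed
    then obtain x where x: "norm x \<le> R" "norm ((act M ^^ j) x - rvec k) \<le> R'" using R(2) R'(2) by (auto simp: dilate_shift_eq)
    have "norm ((act M ^^ j) x) \<le> A ^ j * R" using order_trans[OF A(2)[of j x] mult_left_mono[OF x(1), of "A ^ j"]] zero_le_power[of A j] A(1) by linarith
    then show ?thesis using x(2) norm_triangle_ineq4[of "(act M ^^ j) x" "(act M ^^ j) x - rvec k"] by simp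
  qed
  then show ?thesis by (intro finite_subset[OF _ lattice_ball_finite[of 0 "R' + A ^ j * R"]]) auto
qed

lemma values_finite: "finite {k. dil phi j k x \<noteq> 0}"
proof -
  obtain R where R: "R \<ge> 0" "\<And>x. phi x \<noteq> 0 \<Longrightarrow> norm x \<le> R" using phi_csupp by (auto simp: csupp_def)
  show ?thesis
    by (rule finite_subset[OF _ lattice_ball_finite[of "(act M ^^ j) x" R]]) (use R(2) in \<open>auto simp: dilate_shift_eq\<close>)
qed

text \<open>A quasi-projection only: the translates of \<open>phi\<close> are not assumed
  orthogonal. Restricting to nonzero coefficients makes the sum finite for \<open>cc g\<close>
  (\<open>coefficients_finite\<close>).\<close>

definition proj :: "(real ^ 'n \<Rightarrow> complex) \<Rightarrow> nat \<Rightarrow> real ^ 'n \<Rightarrow> complex" where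
  "proj g J x = (\<Sum>k | L2_inner g (dil phi J k) \<noteq> 0. L2_inner g (dil phi J k) * dil phi J k x)"

abbreviation "psi l \<equiv> refine (bs ! l) phi"

lemma proj_Suc:
  assumes g: "cc g"
  shows "proj g (Suc j) x = proj g j x + (\<Sum>l<length bs. of_int (\<epsilon>s ! l) *
    (\<Sum>k | L2_inner g (dil (psi l) j k) \<noteq> 0. L2_inner g (dil (psi l) j k) * dil (psi l) j k x))"
proof -
  let ?N = "\<lambda>h j. {k. L2_inner g (dil h j k) \<noteq> 0}"
  define ka where "ka = real (dM M) * dpow j / dpow (Suc j)"
  have ka: "ka > 0" "ka * ka = real (dM M)" using dM_pos dpow_pos[of j] dpow_pos[of "Suc j"] refine_scale_sq[of j] by (auto simp: ka_def)
  define c where "c = (\<lambda>k. L2_inner g (dil phi (Suc j) k))"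
  define v where "v = (\<lambda>k. dil phi (Suc j) k x)"
  have fin: "finite (?N (refine b phi) j)" if "b \<in> insert a (set bs)" for b
    using that a_l0 bs_props(1) by (intro coefficients_finite g cc_refine phi_cc) auto
  define K where "K = (\<Union>b\<in>insert a (set bs). ?N (refine b phi) j)"
  have K: "finite K" unfolding K_def using fin by (intro finite_UN_I) auto
  define X where "X = (\<lambda>b. \<Sum>k\<in>K. (\<Sum>n | b n \<noteq> 0. cnj (b n) * c (M *v k + n)) * (\<Sum>n | b n \<noteq> 0. b n * v (M *v k + n)))"
  have A: "L2_inner g (dil (refine b phi) j k) = of_real ka * (\<Sum>n | b n \<noteq> 0. cnj (b n) * c (M *v k + n))" for b k
    unfolding c_def ka_def by (rule inner_dilate_refine[OF cc_L2[OF g]])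
  have B: "dil (refine b phi) j k x = of_real ka * (\<Sum>n | b n \<noteq> 0. b n * v (M *v k + n))" for b k
    unfolding v_def ka_def dilate_refine sum_distrib_left by (simp add: mult.assoc)
  have Kz: "(\<Sum>n | b n \<noteq> 0. cnj (b n) * c (M *v k + n)) = 0" if "b \<in> insert a (set bs)" "k \<notin> K" for b k
    using that A[of b k] ka(1) by (auto simp: K_def)
  have sumX: "of_nat (dM M) * X b = (\<Sum>k\<in>?N (refine b phi) j. L2_inner g (dil (refine b phi) j k) * dil (refine b phi) j k x)"
    if "b \<in> insert a (set bs)" for b
  proof -
    have "of_nat (dM M) = (of_real ka * of_real ka :: complex)" using ka(2) by (metis of_real_mult of_real_of_nat_eq)
    then have "of_nat (dM M) * X b = (\<Sum>k\<in>K. L2_inner g (dil (refine b phi) j k) * dil (refine b phi) j k x)"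
      unfolding A B X_def by (simp add: sum_distrib_left mult_ac)
    also have "\<dots> = (\<Sum>k\<in>?N (refine b phi) j. L2_inner g (dil (refine b phi) j k) * dil (refine b phi) j k x)"
      by (rule sum.mono_neutral_right[OF K]) (use that in \<open>auto simp: K_def\<close>)
    finally show ?thesis .
  qed
  have "refine a phi = phi" using phi_refine by (auto simp: fun_eq_iff)
  then have Xa: "of_nat (dM M) * X a = proj g j x" using sumX[of a] by (simp add: proj_def)
  have "proj g (Suc j) x = (\<Sum>q\<in>?N phi (Suc j). c q * v q)" by (simp add: proj_def c_def v_def)
  also have "\<dots> = of_nat (dM M) * (X a + (\<Sum>l<length bs. of_int (\<epsilon>s ! l) * X (bs ! l)))"
    unfolding X_def
    by (rule bank_step[symmetric, OF coefficients_finite[OF g phi_cc] _ values_finite _ K Kz]) (auto simp: c_def v_def)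
  also have "\<dots> = of_nat (dM M) * X a + (\<Sum>l<length bs. of_int (\<epsilon>s ! l) * (of_nat (dM M) * X (bs ! l)))"
    by (simp add: distrib_left sum_distrib_left mult.left_commute)
  finally show ?thesis unfolding Xa by (simp add: sumX)
qed

section \<open>Convergence of the projections\<close>

text \<open>Because \<open>phi\<close> has integral 1, each normalized coefficient is
  \<open>g x\<close> plus an average \<open>t k\<close> of \<open>g y - g x\<close> over nearby
  \<open>y\<close>. The part with \<open>g x\<close> sums to \<open>g x\<close> by the partition of
  unity, and boundedly many errors \<open>t k\<close> remain.\<close>

lemma proj_error:
  assumes g: "cc g" and B: "B \<ge> 0" "\<And>x. cmod (phi x) \<le> B" and R: "R \<ge> 0" "\<And>x. phi x \<noteq> 0 \<Longrightarrow> norm x \<le> R"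
    and CC: "\<And>x :: real ^ 'n. card {k. norm (x - rvec k) \<le> R} \<le> CC" and w: "w \<ge> 0"
    and osc: "\<And>y. norm (y - x) \<le> invC * invL ^ J * (2 * R) \<Longrightarrow> cmod (g y - g x) \<le> w"
  shows "cmod (proj g J x - g x) \<le> real CC * (B * (LINT y|lebesgue. cmod (phi y)) * w)"
proof -
  let ?D = "dil phi J" and ?p = "\<lambda>k y. phi ((act M ^^ J) y - rvec k)"
  let ?d = "of_nat (dM M) ^ J :: complex"
  let ?I = "LINT y|lebesgue. cmod (phi y)"
  define S where "S = {k. norm ((act M ^^ J) x - rvec k) \<le> R}"
  have S: "finite S" unfolding S_def by (rule lattice_ball_finite)
  have Sz: "?p k x = 0" if "k \<notin> S" for k using that R(2) by (auto simp: S_def)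
  have d0: "real (dM M) ^ J > 0" using dM_pos by simp
  have dd: "of_real (dpow J) * of_real (dpow J) = ?d" using dpow_sq[of J] by (metis of_real_mult of_real_of_nat_eq of_real_power)
  define t where "t = (\<lambda>k. ?d * (LINT y|lebesgue. (g y - g x) * cnj (?p k y)))"
  have ccp: "cc (?p k)" for k by (rule cc_affine[OF phi_cc])
  have i1: "integrable lebesgue (\<lambda>y. g y * cnj (?p k y))" for k
    using L2_mult_integrable(1)[OF cc_L2[OF g] cc_L2[OF ccp]] .
  have i2: "integrable lebesgue (\<lambda>y. g x * cnj (?p k y))" for k
    using cc_integrable[OF cc_scale[OF cc_cnj[OF ccp]]] .
  have i3: "integrable lebesgue (\<lambda>y. cmod (?p k y))" for k using cc_integrable[OF ccp] by simp
  have term_eq: "L2_inner g (?D k) * ?D k x = (t k + g x) * ?p k x" for k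
  proof -
    have "(LINT y|lebesgue. cnj (?p k y)) = 1 / ?d"
      using LINT_affine[OF cc_cnj[OF phi_cc], of J "rvec k"] phi_integral by simp
    then have "t k = ?d * (LINT y|lebesgue. g y * cnj (?p k y)) - g x"
      unfolding t_def left_diff_distrib using i1[of k] i2[of k] d0 by (simp add: right_diff_distrib)
    moreover have "L2_inner g (?D k) = (LINT y|lebesgue. of_real (dpow J) * (g y * cnj (?p k y)))"
      unfolding L2_inner_def by (simp add: dilate_shift_eq mult.left_commute)
    moreover have "\<dots> = of_real (dpow J) * (LINT y|lebesgue. g y * cnj (?p k y))" by (rule integral_mult_right_zero)
    ultimately show ?thesis unfolding dd[symmetric] by (simp only: dilate_shift_eq) (simp add: mult_ac)
  qed
  have tb: "cmod (t k) \<le> ?I * w" if k: "k \<in> S" for k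
  proof -
    have "cmod (LINT y|lebesgue. (g y - g x) * cnj (?p k y)) \<le> (LINT y|lebesgue. w * cmod (?p k y))"
    proof (rule LINT_norm_le)
      show "integrable lebesgue (\<lambda>y. (g y - g x) * cnj (?p k y))" using i1[of k] i2[of k] by (simp add: left_diff_distrib)
      show "cmod ((g y - g x) * cnj (?p k y)) \<le> w * cmod (?p k y)" for y
      proof (cases "?p k y = 0")
        case False
        let ?z = "(act M ^^ J) y - (act M ^^ J) x"
        have "norm ?z \<le> 2 * R"
          using R(2)[OF False] k norm_triangle_ineq4[of "(act M ^^ J) y - rvec k" "(act M ^^ J) x - rvec k"] by (simp add: S_def)
        then have "invC * invL ^ J * norm ?z \<le> invC * invL ^ J * (2 * R)" using inv_bounds(1,2) by (intro mult_left_mono) auto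
        moreover have "(ainv ^^ J) ?z = y - x" by (simp add: ainv_pow_diff)
        ultimately have "norm (y - x) \<le> invC * invL ^ J * (2 * R)" using inv_bounds(4)[of J ?z] by simp
        then show ?thesis using osc by (simp add: norm_mult mult_right_mono)
      qed (use w in simp)
    qed (use i3 in auto)
    also have "\<dots> = w * (?I / real (dM M) ^ J)"
      using LINT_affine_real[OF cc_cmod[OF phi_cc], of J "rvec k"] by simp
    finally have "real (dM M) ^ J * cmod (LINT y|lebesgue. (g y - g x) * cnj (?p k y)) \<le> ?I * w"
      using d0 by (simp add: field_simps)
    then show ?thesis by (simp add: t_def norm_mult norm_power)
  qed
  have "proj g J x = (\<Sum>k\<in>{k. L2_inner g (?D k) \<noteq> 0} \<union> S. L2_inner g (?D k) * ?D k x)"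
    unfolding proj_def by (rule sum.mono_neutral_left) (use S coefficients_finite[OF g phi_cc] in auto)
  also have "\<dots> = (\<Sum>k\<in>S. L2_inner g (?D k) * ?D k x)"
    by (rule sum.mono_neutral_right) (use S Sz coefficients_finite[OF g phi_cc] in \<open>auto simp: dilate_shift_eq\<close>)
  also have "\<dots> = (\<Sum>k\<in>S. t k * ?p k x) + g x * (\<Sum>k\<in>S. ?p k x)"
    by (simp add: term_eq distrib_right sum.distrib sum_distrib_left)
  finally have "proj g J x - g x = (\<Sum>k\<in>S. t k * ?p k x)" using phi_partition[OF S Sz] by simp
  also have "cmod \<dots> \<le> (\<Sum>k\<in>S. (?I * w) * B)"
  proof (rule sum_norm_le)
    fix k assume "k \<in> S"
    from tb[OF this] show "cmod (t k * ?p k x) \<le> (?I * w) * B"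
      unfolding norm_mult using B w LINT_nonneg[of lebesgue "\<lambda>y. cmod (phi y)"] by (intro mult_mono) auto
  qed
  also have "\<dots> \<le> real CC * (B * ?I * w)"
  proof -
    have "real (card S) \<le> real CC" using CC[of "(act M ^^ J) x"] by (simp add: S_def)
    moreover have "0 \<le> B * ?I * w" using B w LINT_nonneg[of lebesgue "\<lambda>y. cmod (phi y)"] by simp
    ultimately show ?thesis using mult_right_mono[of "real (card S)" "real CC" "B * ?I * w"] by (simp add: mult_ac)
  qed
  finally show ?thesis .
qed

lemma proj_cc: "cc (proj g J)"
  unfolding proj_def[abs_def] by (intro cc_sum cc_scale cc_dilate_shift phi_cc)

text \<open>Dominated convergence: continuity at a point gives the limit there, and
  \<open>proj_error\<close> with the crude oscillation bound \<open>2 * Bg\<close> gives the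
  majorant.\<close>

lemma proj_tendsto:
  assumes g: "cc g" shows "(\<lambda>J. nsq (\<lambda>x. proj g J x - g x)) \<longlonglongrightarrow> 0"
proof -
  obtain B where B: "B \<ge> 0" "\<And>x. cmod (phi x) \<le> B" using phi_bounded by blast
  obtain R where R: "R \<ge> 0" "\<And>x. phi x \<noteq> 0 \<Longrightarrow> norm x \<le> R" using phi_csupp by (auto simp: csupp_def)
  obtain CC where CC: "\<And>x :: real ^ 'n. card {k. norm (x - rvec k) \<le> R} \<le> CC" using lattice_ball_card by blast
  obtain Bg where Bg: "Bg \<ge> 0" "\<And>x. cmod (g x) \<le> Bg" using cc_bounded[OF g] by blast
  obtain Rg where Rg: "Rg \<ge> 0" "\<And>x. g x \<noteq> 0 \<Longrightarrow> norm x \<le> Rg" using g by (auto simp: cc_def csupp_def)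
  define Q where "Q = real CC * (B * (LINT y|lebesgue. cmod (phi y)))"
  have Q: "Q \<ge> 0" unfolding Q_def using B(1) LINT_nonneg[of lebesgue "\<lambda>y. cmod (phi y)"] by simp
  have err: "cmod (proj g J x - g x) \<le> Q * w"
    if "w \<ge> 0" "\<And>y. norm (y - x) \<le> invC * invL ^ J * (2 * R) \<Longrightarrow> cmod (g y - g x) \<le> w" for J x w
    using proj_error[OF g B R CC that] by (simp add: Q_def mult.assoc)
  \<comment> \<open>Beyond this radius the error is 0 for every \<open>J\<close>, since the
    projection averages \<open>g\<close> over distances of at most
    \<open>invC * (2 * R)\<close>.\<close>
  let ?R = "Rg + invC * (2 * R)"
  show ?thesis
  proof (rule nsq_tendsto_0[where w = "\<lambda>x. (Q * (2 * Bg))\<^sup>2 * bump ?R x"])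
    show "(\<lambda>x. proj g J x - g x) \<in> borel_measurable lebesgue" for J
      by (intro borel_measurable_diff L2D(1)[OF cc_L2] proj_cc g)
    show "integrable lebesgue (\<lambda>x. (Q * (2 * Bg))\<^sup>2 * bump ?R x)"
      using cc_integrable[OF cc_bump, of ?R] by (simp only: complex_of_real_integrable_eq integrable_mult_right)
    have "(\<lambda>J. proj g J x - g x) \<longlonglongrightarrow> 0" for x
    proof (rule LIMSEQ_I)
      fix r :: real assume r: "r > 0"
      \<comment> \<open>\<open>Q + 1\<close> because \<open>Q\<close> may be 0; the halving makes
        the final inequality strict.\<close>
      define w where "w = r / (Q + 1) / 2"
      have w: "w > 0" "Q * w < r" using r Q by (auto simp: w_def field_simps intro!: add_nonneg_pos)
      have "isCont g x" using g by (simp add: cc_def continuous_on_eq_continuous_at)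
      then obtain dl where dl: "dl > 0" "\<And>y. norm (y - x) < dl \<Longrightarrow> cmod (g y - g x) < w"
        unfolding continuous_at_eps_delta dist_norm using w(1) by blast
      have "(\<lambda>J. invC * invL ^ J * (2 * R)) \<longlonglongrightarrow> 0"
        using inv_bounds(2,3) by (auto intro!: tendsto_mult_left_zero tendsto_mult_right_zero LIMSEQ_power_zero)
      from order_tendstoD(2)[OF this dl(1)] obtain N where N: "\<And>J. J \<ge> N \<Longrightarrow> invC * invL ^ J * (2 * R) < dl"
        by (auto simp: eventually_sequentially)
      have "cmod (proj g J x - g x) \<le> Q * w" if "J \<ge> N" for J
        by (rule err) (use w dl(2) N[OF that] in \<open>auto intro!: less_imp_le\<close>)
      then show "\<exists>N. \<forall>J\<ge>N. norm (proj g J x - g x - 0) < r" using w(2) by (intro exI[of _ N]) force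
    qed
    then show "AE x in lebesgue. (\<lambda>J. proj g J x - g x) \<longlonglongrightarrow> 0" by simp
    show "(cmod (proj g J x - g x))\<^sup>2 \<le> (Q * (2 * Bg))\<^sup>2 * bump ?R x" for J x
    proof (cases "norm x \<le> ?R")
      case True
      have "cmod (proj g J x - g x) \<le> Q * (2 * Bg)"
      proof (rule err)
        show "cmod (g y - g x) \<le> 2 * Bg" for y using norm_triangle_ineq4[of "g y" "g x"] Bg(2)[of x] Bg(2)[of y] by linarith
      qed (use Bg in simp)
      then show ?thesis using power_mono[of "cmod (proj g J x - g x)" "Q * (2 * Bg)" 2] bump_props(3)[OF True] by simp
    next
      case False
      have "cmod (proj g J x - g x) \<le> Q * 0"
      proof (rule err)
        fix y assume y: "norm (y - x) \<le> invC * invL ^ J * (2 * R)"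
        have "invL ^ J \<le> 1" using inv_bounds(2,3) by (intro power_le_one) auto
        then have "invC * invL ^ J * (2 * R) \<le> invC * 1 * (2 * R)" using inv_bounds(1,2) R(1) by (intro mult_mono) auto
        then have "norm (y - x) \<le> invC * (2 * R)" using y by linarith
        then have "norm y > Rg" using False norm_triangle_ineq2[of x y] by (simp add: norm_minus_commute)
        moreover have "norm x > Rg" using False inv_bounds(1) R(1) by (smt (verit) mult_nonneg_nonneg)
        ultimately have "g y = 0" "g x = 0" using Rg(2) by (meson not_le)+
        then show "cmod (g y - g x) \<le> 0" by simp
      qed simp
      then show ?thesis using bump_props(1)[of ?R x] by simp
    qed
  qed
qed

end

section \<open>The framelet\<close>

lemma infsum_ennreal_mono_set: "A \<subseteq> B \<Longrightarrow> infsum f A \<le> (infsum f B :: ennreal)"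
  by (simp add: nonneg_infsum_complete) (rule SUP_subset_mono, auto)

text \<open>Tonelli for sums of nonnegative terms. It merges the iterated sums in
  \<open>framelet\<close> into one sum over \<open>framelet_index\<close>, where finite subsets can
  be handled directly.\<close>

lemma infsum_Sigma_ennreal:
  fixes f :: "'a \<times> 'b \<Rightarrow> ennreal"
  shows "infsum f (Sigma A B) = infsum (\<lambda>x. infsum (\<lambda>y. f (x, y)) (B x)) A"
proof (rule antisym)
  have fin: "infsum f (Sigma G B) = (\<Sum>x\<in>G. infsum (\<lambda>y. f (x, y)) (B x))" if "finite G" for G
    using that
  proof (induction G)
    case (insert x G)
    have "Sigma (insert x G) B = Pair x ` B x \<union> Sigma G B" by auto
    moreover have "infsum f (Pair x ` B x \<union> Sigma G B) = infsum f (Pair x ` B x) + infsum f (Sigma G B)"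
      using insert(2) by (intro infsum_Un_disjoint) (auto intro: nonneg_summable_on_complete)
    moreover have "infsum f (Pair x ` B x) = infsum (\<lambda>y. f (x, y)) (B x)" by (simp add: infsum_reindex inj_on_def comp_def)
    ultimately show ?case using insert by simp
  qed simp
  show "infsum f (Sigma A B) \<le> infsum (\<lambda>x. infsum (\<lambda>y. f (x, y)) (B x)) A"
    unfolding nonneg_infsum_complete[of "Sigma A B" f, simplified]
  proof (rule SUP_least)
    fix F assume "F \<in> {F. finite F \<and> F \<subseteq> Sigma A B}"
    then have F: "finite F" "F \<subseteq> Sigma A B" by auto
    have "sum f F = infsum f F" using F(1) by simp
    also have "\<dots> \<le> infsum f (Sigma (fst ` F) B)" using F(2) by (intro infsum_ennreal_mono_set) force
    also have "\<dots> = infsum (\<lambda>x. infsum (\<lambda>y. f (x, y)) (B x)) (fst ` F)" using F(1) by (simp add: fin)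
    also have "\<dots> \<le> infsum (\<lambda>x. infsum (\<lambda>y. f (x, y)) (B x)) A" using F(2) by (intro infsum_ennreal_mono_set) auto
    finally show "sum f F \<le> infsum (\<lambda>x. infsum (\<lambda>y. f (x, y)) (B x)) A" .
  qed
  show "infsum (\<lambda>x. infsum (\<lambda>y. f (x, y)) (B x)) A \<le> infsum f (Sigma A B)"
    unfolding nonneg_infsum_complete[of A "\<lambda>x. infsum (\<lambda>y. f (x, y)) (B x)", simplified]
  proof (rule SUP_least)
    fix G assume "G \<in> {F. finite F \<and> F \<subseteq> A}"
    then have "finite G" "G \<subseteq> A" by auto
    then show "(\<Sum>x\<in>G. infsum (\<lambda>y. f (x, y)) (B x)) \<le> infsum f (Sigma A B)"
      unfolding fin[OF \<open>finite G\<close>, symmetric] by (intro infsum_ennreal_mono_set) auto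
  qed
qed

lemma framelet_infsum:
  fixes w :: "(int ^ 'n) + (nat \<times> nat \<times> (int ^ 'n)) \<Rightarrow> ennreal"
  shows "(\<Sum>\<^sub>\<infinity>k. w (Inl k)) + (\<Sum>l<L. \<Sum>\<^sub>\<infinity>j. \<Sum>\<^sub>\<infinity>k. w (Inr (l, j, k))) = (\<Sum>\<^sub>\<infinity>i\<in>framelet_index L. w i)"
proof -
  have "(\<Sum>\<^sub>\<infinity>i\<in>framelet_index L. w i) = (\<Sum>\<^sub>\<infinity>i\<in>range Inl. w i) + (\<Sum>\<^sub>\<infinity>i\<in>Inr ` ({..<L} \<times> UNIV). w i)"
    unfolding framelet_index_def Plus_def
    by (rule infsum_Un_disjoint) (auto intro: nonneg_summable_on_complete)
  also have "(\<Sum>\<^sub>\<infinity>i\<in>Inr ` ({..<L} \<times> UNIV). w i) = (\<Sum>\<^sub>\<infinity>p\<in>{..<L} \<times> (UNIV \<times> UNIV). w (Inr p))"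
    by (simp add: infsum_reindex comp_def)
  also have "\<dots> = (\<Sum>l<L. \<Sum>\<^sub>\<infinity>j. \<Sum>\<^sub>\<infinity>k. w (Inr (l, j, k)))"
    unfolding infsum_Sigma_ennreal by simp
  also have "(\<Sum>\<^sub>\<infinity>i\<in>range Inl. w i) = (\<Sum>\<^sub>\<infinity>k. w (Inl k))" by (simp add: infsum_reindex comp_def)
  finally show ?thesis by simp
qed

context framelet_bank
begin

definition "psis = map (\<lambda>b. refine b phi) bs"

abbreviation "idx \<equiv> framelet_index (length bs) :: ((int ^ 'n) + (nat \<times> nat \<times> (int ^ 'n))) set"

abbreviation "fe \<equiv> framelet_elem M phi psis"

definition sg :: "(int ^ 'n) + (nat \<times> nat \<times> (int ^ 'n)) \<Rightarrow> int" where
  "sg i = (case i of Inl k \<Rightarrow> 1 | Inr (l, j, k) \<Rightarrow> \<epsilon>s ! l)"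

lemma sg_cases: "i \<in> idx \<Longrightarrow> sg i = 1 \<or> sg i = -1"
  using subsetD[OF signs nth_mem] length_all_filters[of M s \<epsilon> a \<gamma> u]
  by (auto simp: sg_def framelet_index_def split: sum.splits)

lemma sg_cmod: "i \<in> idx \<Longrightarrow> cmod (of_int (sg i)) = 1"
  using sg_cases[of i] by auto

lemma psi_regular: "l < length bs \<Longrightarrow> regular (psi l)" and phi_regular: "regular phi"
proof -
  show "regular phi" using phi_modulus phi_cc by (simp add: regular_def)
  then show "l < length bs \<Longrightarrow> regular (psi l)" using bs_props(1) by (intro regular_refine) auto
qed

lemma psis_nth: "l < length bs \<Longrightarrow> psis ! l = psi l"
  by (simp add: psis_def)

lemma fe_L2: "i \<in> idx \<Longrightarrow> fe i \<in> L2"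
  using psi_regular phi_regular
  by (cases i) (auto simp: framelet_index_def psis_nth shift_eq_dilate_shift regular_def intro!: cc_L2 cc_dilate_shift)

text \<open>The injection \<iota> makes \<phi> generator 0 on level 0 and shifts the indices of the
  others by one, so that \<open>bessel_family\<close> applies; the generators used on all levels
  have mean zero because \<open>m \<ge> 1\<close>.\<close>

lemma framelet_bessel:
  "\<exists>C\<ge>0. \<forall>I c. finite I \<longrightarrow> I \<subseteq> idx \<longrightarrow> nsq (\<lambda>x. \<Sum>i\<in>I. c i * fe i x) \<le> C * (\<Sum>i\<in>I. (cmod (c i))\<^sup>2)"
proof -
  define F where "F = (\<lambda>l. if l = 0 then phi else psi (l - 1))"
  define \<iota> :: "(int ^ 'n) + (nat \<times> nat \<times> (int ^ 'n)) \<Rightarrow> nat \<times> nat \<times> (int ^ 'n)"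
    where "\<iota> = (\<lambda>i. case i of Inl k \<Rightarrow> (0, 0, k) | Inr (l, j, k) \<Rightarrow> (Suc l, j, k))"
  have inj: "inj \<iota>" by (rule injI) (auto simp: \<iota>_def split: sum.splits)
  have F: "regular (F l)" if "l < Suc (length bs)" for l using that psi_regular[of "l - 1"] phi_regular by (auto simp: F_def)
  have fe: "fe i = elem F (\<iota> i)" if "i \<in> idx" for i
    using that by (auto simp: framelet_index_def \<iota>_def elem_def F_def psis_nth shift_eq_dilate_shift)
  have adm: "\<iota> i \<in> {(l, j, k). l < Suc (length bs) \<and> (j = 0 \<or> (LINT x|lebesgue. F l x) = 0)}" if "i \<in> idx" for i
    using that refine_integral_0[OF phi_cc bs_props(1,2)[OF nth_mem] m_pos]
    by (auto simp: framelet_index_def \<iota>_def F_def)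
  obtain C where C: "C \<ge> 0" "\<And>I c. finite I \<Longrightarrow> I \<subseteq> {(l, j, k). l < Suc (length bs) \<and> (j = 0 \<or> (LINT x|lebesgue. F l x) = 0)} \<Longrightarrow>
      nsq (\<lambda>x. \<Sum>i\<in>I. c i * elem F i x) \<le> C * (\<Sum>i\<in>I. (cmod (c i))\<^sup>2)"
    using bessel_family[of "Suc (length bs)" F] F by blast
  have "nsq (\<lambda>x. \<Sum>i\<in>I. c i * fe i x) \<le> C * (\<Sum>i\<in>I. (cmod (c i))\<^sup>2)" if I: "finite I" "I \<subseteq> idx" for I c
  proof -
    have inj': "inj_on \<iota> I" using inj by (rule inj_on_subset) simp
    have "nsq (\<lambda>x. \<Sum>p\<in>\<iota> ` I. c (inv \<iota> p) * elem F p x) \<le> C * (\<Sum>p\<in>\<iota> ` I. (cmod (c (inv \<iota> p)))\<^sup>2)"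
    proof (rule C(2))
      show "finite (\<iota> ` I)" using I(1) by (rule finite_imageI)
      show "\<iota> ` I \<subseteq> {(l, j, k). l < Suc (length bs) \<and> (j = 0 \<or> (LINT x|lebesgue. F l x) = 0)}"
        by (rule image_subsetI, rule adm) (rule subsetD[OF I(2)])
    qed
    moreover have "(\<Sum>p\<in>\<iota> ` I. c (inv \<iota> p) * elem F p x) = (\<Sum>i\<in>I. c i * fe i x)" for x
      unfolding sum.reindex[OF inj'] using I(2) by (intro sum.cong) (auto simp: inv_f_f[OF inj] fe)
    moreover have "(\<Sum>p\<in>\<iota> ` I. (cmod (c (inv \<iota> p)))\<^sup>2) = (\<Sum>i\<in>I. (cmod (c i))\<^sup>2)"
      unfolding sum.reindex[OF inj'] by (simp add: inv_f_f[OF inj])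
    ultimately show ?thesis by simp
  qed
  then show ?thesis using C(1) by blast
qed

definition besselC :: real where
  "besselC = (SOME C. C \<ge> 0 \<and> (\<forall>I c. finite I \<longrightarrow> I \<subseteq> idx \<longrightarrow> nsq (\<lambda>x. \<Sum>i\<in>I. c i * fe i x) \<le> C * (\<Sum>i\<in>I. (cmod (c i))\<^sup>2)))"

lemma besselC: "besselC \<ge> 0"
    "finite I \<Longrightarrow> I \<subseteq> idx \<Longrightarrow> nsq (\<lambda>x. \<Sum>i\<in>I. c i * fe i x) \<le> besselC * (\<Sum>i\<in>I. (cmod (c i))\<^sup>2)"
  using someI_ex[OF framelet_bessel, folded besselC_def] by auto

definition recon :: "((int ^ 'n) + (nat \<times> nat \<times> (int ^ 'n))) set \<Rightarrow> (real ^ 'n \<Rightarrow> complex) \<Rightarrow> real ^ 'n \<Rightarrow> complex" where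
  "recon I f x = (\<Sum>i\<in>I. L2_inner f (fe i) * of_int (sg i) * fe i x)"

lemma recon_L2: "I \<subseteq> idx \<Longrightarrow> recon I f \<in> L2"
  unfolding recon_def[abs_def] using fe_L2 by (intro L2_sum L2_scale) auto

lemma nsq_recon:
  assumes "finite I" "I \<subseteq> idx"
  shows "nsq (recon I f) \<le> besselC * (\<Sum>i\<in>I. (cmod (L2_inner f (fe i)))\<^sup>2)"
proof -
  have "(\<Sum>i\<in>I. (cmod (L2_inner f (fe i) * of_int (sg i)))\<^sup>2) = (\<Sum>i\<in>I. (cmod (L2_inner f (fe i)))\<^sup>2)"
    using assms(2) sg_cmod by (intro sum.cong refl) (simp add: norm_mult subset_iff del: norm_of_int)
  then show ?thesis using besselC(2)[OF assms, of "\<lambda>i. L2_inner f (fe i) * of_int (sg i)"] by (simp add: recon_def[abs_def])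
qed

lemma coefficients_square_sum:
  assumes "finite I" "I \<subseteq> idx" "f \<in> L2"
  shows "(\<Sum>i\<in>I. (cmod (L2_inner f (fe i)))\<^sup>2) \<le> besselC * nsq f"
  by (rule bessel_dual) (use assms fe_L2 besselC in auto)

lemma L2_norm_recon_le:
  assumes "finite I" "I \<subseteq> idx" "f \<in> L2"
  shows "L2_norm (recon I f) \<le> besselC * L2_norm f"
proof -
  have "nsq (recon I f) \<le> besselC * (besselC * nsq f)"
    using nsq_recon[OF assms(1,2), of f] mult_left_mono[OF coefficients_square_sum[OF assms] besselC(1)] by linarith
  then have "nsq (recon I f) \<le> (besselC * L2_norm f)\<^sup>2" by (simp only: power_mult_distrib L2_norm_nsq(2) power2_eq_square[of besselC] mult.assoc)
  then show ?thesis unfolding L2_norm_nsq(1)[of "recon I f"] using besselC(1) by (intro real_le_lsqrt) auto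
qed

lemma recon_diff:
  assumes "I \<subseteq> idx" "f \<in> L2" "g \<in> L2"
  shows "recon I (\<lambda>x. f x - g x) x = recon I f x - recon I g x"
proof -
  have "L2_inner (\<lambda>x. f x - g x) (fe i) = L2_inner f (fe i) - L2_inner g (fe i)" if "i \<in> I" for i
    using that assms fe_L2 by (intro L2_inner_diff_left) auto
  then show ?thesis unfolding recon_def sum_subtractf[symmetric] by (intro sum.cong) (auto simp: left_diff_distrib)
qed

text \<open>The indices below level \<open>J\<close> with nonzero coefficients. The set is finite
  for \<open>g\<close> in \<open>cc\<close>, and its partial sum telescopes to
  \<open>proj g J\<close>.\<close>

definition level_set :: "(real ^ 'n \<Rightarrow> complex) \<Rightarrow> nat \<Rightarrow> ((int ^ 'n) + (nat \<times> nat \<times> (int ^ 'n))) set" where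
  "level_set g J = Inl ` {k. L2_inner g (dil phi 0 k) \<noteq> 0} \<union>
    Inr ` (SIGMA l:{..<length bs}. SIGMA j:{..<J}. {k. L2_inner g (dil (psi l) j k) \<noteq> 0})"

lemma level_set_props:
  assumes g: "cc g"
  shows "finite (level_set g J)" "level_set g J \<subseteq> idx"
    "recon (level_set g J) g x = proj g J x"
proof -
  let ?N = "\<lambda>h j. {k. L2_inner g (dil h j k) \<noteq> 0}"
  have fin: "finite (?N phi j)" "l < length bs \<Longrightarrow> finite (?N (psi l) j)" for l j
    using coefficients_finite[OF g] phi_cc psi_regular by (auto simp: regular_def)
  show "finite (level_set g J)" unfolding level_set_def using fin by (intro finite_UnI finite_imageI finite_SigmaI) auto
  show "level_set g J \<subseteq> idx" by (auto simp: level_set_def framelet_index_def)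
  let ?T = "\<lambda>J. \<Sum>l<length bs. \<Sum>j<J. \<Sum>k\<in>?N (psi l) j. L2_inner g (dil (psi l) j k) * of_int (\<epsilon>s ! l) * dil (psi l) j k x"
  have "recon (level_set g J) g x = proj g 0 x + ?T J"
  proof -
    let ?\<Sigma> = "SIGMA l:{..<length bs}. SIGMA j:{..<J}. ?N (psi l) j"
    have f\<Sigma>: "finite ?\<Sigma>" using fin by (intro finite_SigmaI) auto
    have "recon (level_set g J) g x = (\<Sum>i\<in>Inl ` ?N phi 0. L2_inner g (fe i) * of_int (sg i) * fe i x) + (\<Sum>i\<in>Inr ` ?\<Sigma>. L2_inner g (fe i) * of_int (sg i) * fe i x)"
      unfolding recon_def level_set_def using fin f\<Sigma> by (intro sum.union_disjoint) auto
    also have "(\<Sum>i\<in>Inl ` ?N phi 0. L2_inner g (fe i) * of_int (sg i) * fe i x) = proj g 0 x"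
      by (simp add: sum.reindex sg_def shift_eq_dilate_shift proj_def)
    also have "(\<Sum>i\<in>Inr ` ?\<Sigma>. L2_inner g (fe i) * of_int (sg i) * fe i x) =
        (\<Sum>(l, j, k)\<in>?\<Sigma>. L2_inner g (dil (psi l) j k) * of_int (\<epsilon>s ! l) * dil (psi l) j k x)"
      unfolding sum.reindex[OF inj_Inr] by (intro sum.cong) (auto simp: sg_def psis_nth)
    also have "\<dots> = (\<Sum>l<length bs. \<Sum>(j, k)\<in>Sigma {..<J} (\<lambda>j. ?N (psi l) j). L2_inner g (dil (psi l) j k) * of_int (\<epsilon>s ! l) * dil (psi l) j k x)"
      by (rule sum.Sigma[symmetric]) (use fin in \<open>auto intro: finite_SigmaI\<close>)
    also have "\<dots> = ?T J"
      by (intro sum.cong refl sum.Sigma[symmetric]) (use fin in auto)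
    finally show ?thesis .
  qed
  also have "\<dots> = proj g J x"
  proof (induction J)
    case (Suc J)
    have "?T (Suc J) = ?T J + (\<Sum>l<length bs. of_int (\<epsilon>s ! l) *
        (\<Sum>k\<in>?N (psi l) J. L2_inner g (dil (psi l) J k) * dil (psi l) J k x))"
      by (simp add: sum.distrib sum_distrib_left mult_ac)
    then show ?case using Suc proj_Suc[OF g, of J x] by simp
  qed simp
  finally show "recon (level_set g J) g x = proj g J x" .
qed

text \<open>The energies of finite index sets are bounded, so some \<open>I0\<close> leaves little
  energy outside, and by the Bessel bound all larger partial sums stay close to that of
  \<open>I0\<close>. One of them is a projection close to \<open>g\<close>, which identifies the
  limit without fixing an order of summation.\<close>

lemma recon_cc_approx:
  assumes g: "cc g" and e: "e > 0"
  shows "\<exists>I0. finite I0 \<and> I0 \<subseteq> idx \<and> (\<forall>I. finite I \<longrightarrow> I0 \<subseteq> I \<longrightarrow> I \<subseteq> idx \<longrightarrow> L2_norm (\<lambda>x. g x - recon I g x) < e)"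
proof -
  have gL: "g \<in> L2" by (rule cc_L2[OF g])
  let ?c = "\<lambda>i. (cmod (L2_inner g (fe i)))\<^sup>2"
  define A where "A = {sum ?c I | I. finite I \<and> I \<subseteq> idx}"
  have A: "A \<noteq> {}" "bdd_above A"
    unfolding A_def bdd_above_def using coefficients_square_sum[OF _ _ gL] by blast+
  \<comment> \<open>Chosen so that \<open>besselC\<close> times the missing energy stays below
    \<open>(e / 3)^2\<close>; adding 1 covers \<open>besselC = 0\<close> and makes the bound
    strict.\<close>
  define \<eta> where "\<eta> = (e / 3)\<^sup>2 / (besselC + 1)"
  have \<eta>: "\<eta> > 0" using e besselC(1) by (simp add: \<eta>_def)
  obtain I0 where I0: "finite I0" "I0 \<subseteq> idx" "Sup A - \<eta> < sum ?c I0"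
    using less_cSupD[OF A(1), of "Sup A - \<eta>"] \<eta> by (auto simp: A_def)
  have tail: "L2_norm (\<lambda>x. recon I g x - recon I0 g x) < e / 3" if I: "finite I" "I0 \<subseteq> I" "I \<subseteq> idx" for I
  proof -
    have "sum ?c I \<le> Sup A" using I A(2) by (intro cSup_upper) (auto simp: A_def)
    then have small: "sum ?c (I - I0) < \<eta>" using I0(3) sum_diff[OF I(1,2), of ?c] by simp
    have eq: "recon I g x - recon I0 g x = recon (I - I0) g x" for x unfolding recon_def by (rule sum_diff[OF I(1,2), symmetric])
    have "nsq (recon (I - I0) g) \<le> besselC * sum ?c (I - I0)" using I by (intro nsq_recon) auto
    also have "\<dots> \<le> besselC * \<eta>" using small besselC(1) by (intro mult_left_mono) auto
    also have "\<dots> < (besselC + 1) * \<eta>" using \<eta> by (simp add: distrib_right)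
    also have "\<dots> = (e / 3)\<^sup>2" using besselC(1) by (simp add: \<eta>_def)
    finally show ?thesis unfolding eq L2_norm_nsq using e by (intro real_less_lsqrt) auto
  qed
  have "(e / 3)\<^sup>2 > 0" using e by simp
  from order_tendstoD(2)[OF proj_tendsto[OF g] this]
  obtain J0 where J0: "\<And>J. J \<ge> J0 \<Longrightarrow> nsq (\<lambda>x. proj g J x - g x) < (e / 3)\<^sup>2" by (auto simp: eventually_sequentially)
  define J where "J = Suc (Max (insert J0 ((\<lambda>i. case i of Inl k \<Rightarrow> 0 | Inr (l, j, k) \<Rightarrow> j) ` I0)))"
  have J: "J0 \<le> J" "\<And>l j k. Inr (l, j, k) \<in> I0 \<Longrightarrow> j < J"
  proof -
    show "J0 \<le> J" unfolding J_def using I0(1) by (intro le_SucI Max_ge) auto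
    show "j < J" if "Inr (l, j, k) \<in> I0" for l j k
      unfolding J_def less_Suc_eq_le using I0(1) that by (intro Max_ge) (auto intro!: rev_image_eqI[OF that])
  qed
  \<comment> \<open>\<open>J\<close> exceeds every level occurring in \<open>I0\<close>, so the
    indices that \<open>I0\<close> adds to \<open>level_set g J\<close> have coefficient 0.\<close>
  let ?IJ = "level_set g J \<union> I0"
  have IJ: "finite ?IJ" "I0 \<subseteq> ?IJ" "?IJ \<subseteq> idx" using level_set_props(1,2)[OF g] I0 by auto
  have "recon ?IJ g x = recon (level_set g J) g x" for x
    unfolding recon_def
  proof (rule sum.mono_neutral_right[OF IJ(1)])
    show "\<forall>i\<in>?IJ - level_set g J. L2_inner g (fe i) * of_int (sg i) * fe i x = 0"
    proof
      fix i assume i: "i \<in> ?IJ - level_set g J"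
      then have "i \<in> I0" "i \<in> idx" using I0(2) by auto
      then have "L2_inner g (fe i) = 0" using i J(2)
        by (cases i) (auto simp: level_set_def framelet_index_def psis_nth shift_eq_dilate_shift)
      then show "L2_inner g (fe i) * of_int (sg i) * fe i x = 0" by simp
    qed
  qed auto
  then have "recon ?IJ g x = proj g J x" for x using level_set_props(3)[OF g] by simp
  then have t1: "L2_norm (\<lambda>x. proj g J x - recon I0 g x) < e / 3" using tail[OF IJ] by simp
  have gp: "L2_norm (\<lambda>x. g x - proj g J x) < e / 3"
  proof -
    have "nsq (\<lambda>x. g x - proj g J x) = nsq (\<lambda>x. proj g J x - g x)" by (simp add: nsq_def norm_minus_commute)
    then show ?thesis using J0[OF J(1)] e unfolding L2_norm_nsq by (intro real_less_lsqrt) auto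
  qed
  have "L2_norm (\<lambda>x. g x - recon I g x) < e" if I: "finite I" "I0 \<subseteq> I" "I \<subseteq> idx" for I
  proof -
    have L: "recon I g \<in> L2" "recon I0 g \<in> L2" "proj g J \<in> L2" using recon_L2 I I0 cc_L2[OF proj_cc] by auto
    have t2: "L2_norm (\<lambda>x. recon I0 g x - recon I g x) < e / 3"
      using tail[OF I] by (simp add: L2_norm_def norm_minus_commute)
    have "L2_norm (\<lambda>x. (g x - proj g J x) + ((proj g J x - recon I0 g x) + (recon I0 g x - recon I g x))) \<le>
        L2_norm (\<lambda>x. g x - proj g J x) + L2_norm (\<lambda>x. (proj g J x - recon I0 g x) + (recon I0 g x - recon I g x))"
      by (intro L2_norm_triangle L2_diff L2_add gL L)
    moreover have "L2_norm (\<lambda>x. (proj g J x - recon I0 g x) + (recon I0 g x - recon I g x)) \<le>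
        L2_norm (\<lambda>x. proj g J x - recon I0 g x) + L2_norm (\<lambda>x. recon I0 g x - recon I g x)"
      by (intro L2_norm_triangle L2_diff L)
    ultimately show ?thesis using t1 t2 gp by simp
  qed
  then show ?thesis using I0 by blast
qed

text \<open>The finite reconstructions are bounded on L2 by \<open>besselC\<close>, independently of
  the index set. An approximation of \<open>f\<close> by \<open>g\<close> therefore costs at most
  \<open>1 + besselC\<close> times its error, which explains the tolerance.\<close>

lemma recon_approx:
  assumes f: "f \<in> L2" and e: "e > 0"
  shows "\<exists>I0. finite I0 \<and> I0 \<subseteq> idx \<and> (\<forall>I. finite I \<longrightarrow> I0 \<subseteq> I \<longrightarrow> I \<subseteq> idx \<longrightarrow> L2_norm (\<lambda>x. f x - recon I f x) < e)"
proof -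
  have "e / 2 / (1 + besselC) > 0" using e besselC(1) by simp
  from cc_dense[OF f this] obtain g where g: "cc g" "L2_norm (\<lambda>x. f x - g x) < e / 2 / (1 + besselC)" by blast
  have "e / 2 > 0" using e by simp
  from recon_cc_approx[OF g(1) this] obtain I0 where I0: "finite I0" "I0 \<subseteq> idx"
    "\<And>I. finite I \<Longrightarrow> I0 \<subseteq> I \<Longrightarrow> I \<subseteq> idx \<Longrightarrow> L2_norm (\<lambda>x. g x - recon I g x) < e / 2" by blast
  have "L2_norm (\<lambda>x. f x - recon I f x) < e" if I: "finite I" "I0 \<subseteq> I" "I \<subseteq> idx" for I
  proof -
    let ?h = "\<lambda>x. f x - g x"
    have L: "recon I g \<in> L2" "recon I f \<in> L2" "g \<in> L2" "?h \<in> L2" using recon_L2 I cc_L2[OF g(1)] L2_diff[OF f] by auto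
    have eq: "f x - recon I f x = ?h x + ((g x - recon I g x) + (-1) * recon I ?h x)" for x
      using recon_diff[OF I(3) f L(3)] by simp
    have "L2_norm (\<lambda>x. f x - recon I f x) \<le> L2_norm ?h + L2_norm (\<lambda>x. (g x - recon I g x) + (-1) * recon I ?h x)"
      unfolding eq by (intro L2_norm_triangle L2_add L2_scale L2_diff L f recon_L2 I)
    also have "L2_norm (\<lambda>x. (g x - recon I g x) + (-1) * recon I ?h x) \<le> L2_norm (\<lambda>x. g x - recon I g x) + L2_norm (\<lambda>x. (-1) * recon I ?h x)"
      by (intro L2_norm_triangle L2_add L2_scale L2_diff L recon_L2 I)
    also have "L2_norm (\<lambda>x. (-1) * recon I ?h x) \<le> besselC * L2_norm ?h"
      unfolding L2_norm_scale using L2_norm_recon_le[OF I(1,3) L(4)] by simp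
    finally have "L2_norm (\<lambda>x. f x - recon I f x) < (1 + besselC) * L2_norm ?h + e / 2"
      using I0(3)[OF I] by (simp add: algebra_simps)
    moreover have "(1 + besselC) * L2_norm ?h < e / 2" using g(2) besselC(1) by (simp add: field_simps)
    ultimately show ?thesis by simp
  qed
  then show ?thesis using I0(1,2) by blast
qed

text \<open>All signs in \<open>\<langle>S f, f\<rangle> = \<Sum>\<plusminus>\<bar>\<langle>f, e\<^sub>i\<rangle>\<bar>\<^sup>2\<close> may be replaced by \<open>+\<close> for a lower bound of the energy.\<close>

lemma energy_lower:
  assumes f: "f \<in> L2" and e: "e > 0"
  shows "\<exists>I. finite I \<and> I \<subseteq> idx \<and> nsq f \<le> (\<Sum>i\<in>I. (cmod (L2_inner f (fe i)))\<^sup>2) + e"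
proof -
  have "e / (L2_norm f + 1) > 0" using e L2_norm_nonneg[of f] by (intro divide_pos_pos) linarith+
  from recon_approx[OF f this] obtain I where I: "finite I" "I \<subseteq> idx" "L2_norm (\<lambda>x. f x - recon I f x) < e / (L2_norm f + 1)" by blast
  have "cmod (L2_inner (\<lambda>x. f x - recon I f x) f) \<le> e / (L2_norm f + 1) * L2_norm f"
    using order_trans[OF L2_Cauchy_Schwarz[OF L2_diff[OF f recon_L2[OF I(2), of f]] f] mult_right_mono[OF less_imp_le[OF I(3)] L2_norm_nonneg[of f]]] .
  also have "\<dots> \<le> e" using e L2_norm_nonneg[of f] by (simp add: divide_le_eq add_nonneg_pos)
  finally have 1: "Re (L2_inner f f) - Re (L2_inner (recon I f) f) \<le> e"
    using complex_Re_le_cmod[of "L2_inner (\<lambda>x. f x - recon I f x) f"] L2_inner_diff_left[OF f recon_L2[OF I(2), of f] f] by simp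
  have "L2_inner (recon I f) f = (\<Sum>i\<in>I. L2_inner f (fe i) * of_int (sg i) * L2_inner (fe i) f)"
    unfolding recon_def[abs_def] using I(2) fe_L2 f by (intro L2_inner_sum_left) auto
  also have "\<dots> = (\<Sum>i\<in>I. of_real (of_int (sg i) * (cmod (L2_inner f (fe i)))\<^sup>2))"
  proof (rule sum.cong[OF refl])
    fix i
    show "L2_inner f (fe i) * of_int (sg i) * L2_inner (fe i) f = of_real (of_int (sg i) * (cmod (L2_inner f (fe i)))\<^sup>2)"
      unfolding L2_inner_cnj[of "fe i" f] of_real_mult complex_norm_square by simp
  qed
  finally have "Re (L2_inner (recon I f) f) = (\<Sum>i\<in>I. of_int (sg i) * (cmod (L2_inner f (fe i)))\<^sup>2)" by (simp flip: of_real_sum)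
  also have "\<dots> \<le> (\<Sum>i\<in>I. (cmod (L2_inner f (fe i)))\<^sup>2)"
  proof (rule sum_mono)
    fix i assume "i \<in> I"
    then have "sg i = 1 \<or> sg i = -1" using sg_cases I(2) by blast
    then show "of_int (sg i) * (cmod (L2_inner f (fe i)))\<^sup>2 \<le> (cmod (L2_inner f (fe i)))\<^sup>2" by auto
  qed
  finally show ?thesis using 1 L2_inner_self[OF f] I(1,2) by (intro exI[of _ I]) simp
qed

text \<open>The sum is a supremum over finite index sets, to which the finite estimates apply. The
  upper constant is \<open>besselC + 1\<close> because \<open>framelet\<close> asks for a strictly
  positive one.\<close>

lemma energy_bounds:
  assumes f: "f \<in> L2"
  defines "S \<equiv> \<Sum>\<^sub>\<infinity>i\<in>idx. ennreal ((cmod (L2_inner f (fe i)))\<^sup>2)"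
  shows "ennreal (nsq f) \<le> S" "S \<le> ennreal ((besselC + 1) * nsq f)"
proof -
  have S: "S = (SUP I\<in>{I. finite I \<and> I \<subseteq> idx}. ennreal (\<Sum>i\<in>I. (cmod (L2_inner f (fe i)))\<^sup>2))"
    unfolding S_def by (subst nonneg_infsum_complete) (auto intro!: SUP_cong sum_ennreal)
  show "S \<le> ennreal ((besselC + 1) * nsq f)"
    unfolding S
  proof (rule SUP_least)
    fix I assume "I \<in> {I. finite I \<and> I \<subseteq> idx}"
    then have "(\<Sum>i\<in>I. (cmod (L2_inner f (fe i)))\<^sup>2) \<le> besselC * nsq f" using f by (intro coefficients_square_sum) auto
    then show "ennreal (\<Sum>i\<in>I. (cmod (L2_inner f (fe i)))\<^sup>2) \<le> ennreal ((besselC + 1) * nsq f)"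
      using nsq_nonneg[of f] by (intro ennreal_leI) (simp add: distrib_right add_increasing2)
  qed
  show "ennreal (nsq f) \<le> S"
  proof (rule ennreal_le_epsilon)
    fix e :: real assume "e > 0"
    from energy_lower[OF f this] obtain I where I: "finite I" "I \<subseteq> idx" "nsq f \<le> (\<Sum>i\<in>I. (cmod (L2_inner f (fe i)))\<^sup>2) + e" by blast
    have "ennreal (nsq f) \<le> ennreal (\<Sum>i\<in>I. (cmod (L2_inner f (fe i)))\<^sup>2) + ennreal e"
      using I(3) \<open>e > 0\<close> by (subst ennreal_plus[symmetric]) (auto intro!: sum_nonneg ennreal_leI)
    also have "\<dots> \<le> S + ennreal e" unfolding S using I(1,2) by (intro add_right_mono SUP_upper) auto
    finally show "ennreal (nsq f) \<le> S + ennreal e" .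
  qed
qed

text \<open>The dual generators differ from \<open>psis\<close> by signs only, which leave the
  moduli of the coefficients unchanged; one energy estimate thus serves both systems.\<close>

lemma framelet_if_same_energy:
  assumes "length qs = length bs" "set qs \<subseteq> L2"
    and "\<And>f i. i \<in> idx \<Longrightarrow> cmod (L2_inner f (framelet_elem M phi qs i)) = cmod (L2_inner f (fe i))"
  shows "framelet M phi qs"
proof -
  have en: "(\<Sum>\<^sub>\<infinity>k. ennreal ((cmod (L2_inner f (shift phi k)))\<^sup>2)) +
      (\<Sum>l<length qs. \<Sum>\<^sub>\<infinity>j. \<Sum>\<^sub>\<infinity>k. ennreal ((cmod (L2_inner f (dil (qs ! l) j k)))\<^sup>2)) =
      (\<Sum>\<^sub>\<infinity>i\<in>idx. ennreal ((cmod (L2_inner f (fe i)))\<^sup>2))" for f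
    using framelet_infsum[of "\<lambda>i. ennreal ((cmod (L2_inner f (framelet_elem M phi qs i)))\<^sup>2)" "length bs"] assms(1)
    by (simp add: assms(3) cong: infsum_cong)
  have "phi \<in> L2" by (rule cc_L2[OF phi_cc])
  then show ?thesis
    unfolding framelet_def Let_def en
    using assms(2) energy_bounds besselC(1) by (intro conjI exI[of _ 1] exI[of _ "besselC + 1"]) (auto simp: L2_norm_nsq(2))
qed

lemma psis_quasi_tight: "quasi_tight_framelet M phi psis \<epsilon>s"
proof -
  define qs where "qs = map (\<lambda>l x. of_int (\<epsilon>s ! l) * psi l x) [0..<length bs]"
  have len: "length \<epsilon>s = length bs" "length qs = length bs" "length psis = length bs"
    by (simp_all add: length_all_filters qs_def psis_def)
  have qe: "framelet_elem M phi qs i = (\<lambda>x. of_int (sg i) * fe i x)" if "i \<in> idx" for i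
    using that by (auto simp: framelet_index_def sg_def qs_def psis_nth dilate_shift_def fun_eq_iff)
  have "set psis \<subseteq> L2" using bs_props(1) by (auto simp: psis_def intro!: cc_L2 cc_refine phi_cc)
  then have 1: "framelet M phi psis" using len by (intro framelet_if_same_energy) auto
  have qL: "set qs \<subseteq> L2" using bs_props(1) by (auto simp: qs_def intro!: L2_scale[OF cc_L2] cc_refine phi_cc)
  have 2: "framelet M phi qs"
  proof (rule framelet_if_same_energy[OF len(2) qL])
    fix f i assume i: "i \<in> idx"
    have "L2_inner f (framelet_elem M phi qs i) = cnj (of_int (sg i) * L2_inner (fe i) f)"
      unfolding qe[OF i] L2_inner_cnj[of f "\<lambda>x. of_int (sg i) * fe i x"] L2_inner_scale_left ..
    then show "cmod (L2_inner f (framelet_elem M phi qs i)) = cmod (L2_inner f (fe i))"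
      using sg_cmod[OF i] L2_inner_cnj[of f "fe i"] by (simp add: norm_mult)
  qed
  have "((\<lambda>I. L2_norm (\<lambda>x. f x - (\<Sum>i\<in>I. L2_inner f (fe i) * framelet_elem M phi qs i x))) \<longlongrightarrow> 0) (finite_subsets_at_top idx)"
    if f: "f \<in> L2" for f
  proof (rule tendstoI)
    fix e :: real assume "e > 0"
    from recon_approx[OF f this] obtain I0 where I0: "finite I0" "I0 \<subseteq> idx"
      "\<And>I. finite I \<Longrightarrow> I0 \<subseteq> I \<Longrightarrow> I \<subseteq> idx \<Longrightarrow> L2_norm (\<lambda>x. f x - recon I f x) < e" by blast
    have "L2_norm (\<lambda>x. f x - (\<Sum>i\<in>I. L2_inner f (fe i) * framelet_elem M phi qs i x)) < e"
      if I: "finite I" "I0 \<subseteq> I" "I \<subseteq> idx" for I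
    proof -
      have "(\<Sum>i\<in>I. L2_inner f (fe i) * framelet_elem M phi qs i x) = recon I f x" for x
        unfolding recon_def using I(3) by (intro sum.cong) (auto simp: qe mult.assoc)
      then show ?thesis using I0(3)[OF I] by simp
    qed
    then show "\<forall>\<^sub>F I in finite_subsets_at_top idx. dist (L2_norm (\<lambda>x. f x - (\<Sum>i\<in>I. L2_inner f (fe i) * framelet_elem M phi qs i x))) 0 < e"
      unfolding eventually_finite_subsets_at_top using I0(1,2) by (intro exI[of _ I0]) auto
  qed
  then have "dual_framelet M phi psis phi qs" unfolding dual_framelet_def using 1 2 len by simp
  moreover have "psis ! l = (\<lambda>x. of_int (\<epsilon>s ! l) * (qs ! l) x)" if "l < length psis" for l
  proof -
    have "\<epsilon>s ! l = 1 \<or> \<epsilon>s ! l = -1" using subsetD[OF signs nth_mem[of l]] that len by auto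
    then show ?thesis using that len by (auto simp: qs_def psis_nth fun_eq_iff)
  qed
  ultimately show ?thesis unfolding quasi_tight_framelet_def using len signs by auto
qed

lemma psis_framelet:
  "\<exists>\<psi>s. length \<psi>s = length bs \<and>
    (\<forall>l<length bs. continuous_on UNIV (\<psi>s ! l) \<and>
      has_fourier (\<psi>s ! l) (\<lambda>\<xi>. fseries (bs ! l) (act_invT M \<xi>) * fourier phi (act_invT M \<xi>))) \<and>
    quasi_tight_framelet M phi \<psi>s \<epsilon>s \<and>
    (\<forall>l<length bs. (\<forall>k. k \<noteq> 0 \<longrightarrow> (\<psi>s ! l) (rvec k) = 0) \<and> vm_fun (\<psi>s ! l) \<ge> enat m)"
proof (rule exI[of _ psis], intro conjI allI impI psis_quasi_tight)
  fix l assume l: "l < length bs"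
  have b: "bs ! l \<in> l0" "annih m (bs ! l)" using bs_props(1,2) l by auto
  have c: "cc (psis ! l)" using cc_refine[OF phi_cc b(1)] l by (simp add: psis_nth)
  then show "continuous_on UNIV (psis ! l)" by (simp add: cc_def)
  show "has_fourier (psis ! l) (\<lambda>\<xi>. fseries (bs ! l) (act_invT M \<xi>) * fourier phi (act_invT M \<xi>))"
    using cc_integrable[OF c] fourier_refine[OF phi_cc b(1)] l by (simp add: has_fourier_def psis_nth)
  show "vm_fun (psis ! l) \<ge> enat m" using refine_vm[OF phi_cc b] l by (simp add: psis_nth)
  fix k :: "int ^ 'n" assume k: "k \<noteq> 0"
  \<comment> \<open>As \<open>phi\<close> is fundamental, the value at \<open>k\<close> is
    \<open>d\<close> times the coefficient of the filter at \<open>M *v k\<close>.\<close>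
  have "psi l (rvec k) = of_nat (dM M) * (\<Sum>n | (bs ! l) n \<noteq> 0. (bs ! l) n * delta (M *v k - n))"
    by (simp add: refine_def act_rvec phi_rvec flip: rvec_diff)
  also have "\<dots> = 0" using bs_props(3)[OF nth_mem[OF l] k] by (auto simp: delta_def intro!: sum.neutral)
  finally show "(psis ! l) (rvec k) = 0" using l by (simp add: psis_nth)
qed (simp add: psis_def)

end

theorem corollary2p5:
  fixes M :: "int ^ 'n ^ 'n"
    and \<gamma> :: "nat \<Rightarrow> int ^ 'n"
    and a :: "int ^ 'n \<Rightarrow> complex"
    and m :: nat
  assumes "dilation_matrix M"
    and "bij_betw \<gamma> {1..dM M} (Gamma_set M)" and "\<gamma> 1 = 0"
    and "a \<in> l0" and "interpolatory M a" and "fseries a 0 = 1"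
    and "m \<ge> 1" and "sr a M = enat (2 * m)"
  shows
    "(\<exists>bs \<epsilon>s. bs \<noteq> [] \<and> quasi_tight_filter_bank M a bs \<epsilon>s \<and>
        (\<forall>l<length bs. vm_filter (bs ! l) \<ge> enat m \<and> (\<forall>k. k \<noteq> 0 \<longrightarrow> (bs ! l) (M *v k) = 0)))
     \<and>
     (\<forall>j\<in>{2..dM M}. \<exists>sj uj \<epsilon>j. signed_squares (h_filter M a (\<gamma> j)) m sj uj \<epsilon>j)
     \<and>
     (\<forall>s u \<epsilon>. (\<forall>j\<in>{2..dM M}. signed_squares (h_filter M a (\<gamma> j)) m (s j) (u j) (\<epsilon> j)) \<longrightarrow>
        (let bs = all_filters M a \<gamma> s u; \<epsilon>s = all_signs M s \<epsilon> in
           quasi_tight_filter_bank M a bs \<epsilon>s \<and>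
           (\<forall>l<length bs. vm_filter (bs ! l) \<ge> enat m \<and> (\<forall>k. k \<noteq> 0 \<longrightarrow> (bs ! l) (M *v k) = 0))))
     \<and>
     (sm_inf a M > 0 \<longrightarrow>
        (\<exists>\<phi>. has_fourier \<phi> (refinable_hat M a) \<and> fundamental \<phi> \<and>
           (\<forall>s u \<epsilon>. (\<forall>j\<in>{2..dM M}. signed_squares (h_filter M a (\<gamma> j)) m (s j) (u j) (\<epsilon> j)) \<longrightarrow>
              (let bs = all_filters M a \<gamma> s u; \<epsilon>s = all_signs M s \<epsilon> in
                 \<exists>\<psi>s. length \<psi>s = length bs \<and>
                   (\<forall>l<length bs. continuous_on UNIV (\<psi>s ! l) \<and>
                      has_fourier (\<psi>s ! l)
                        (\<lambda>\<xi>. fseries (bs ! l) (act_invT M \<xi>) * fourier \<phi> (act_invT M \<xi>))) \<and>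
                   quasi_tight_framelet M \<phi> \<psi>s \<epsilon>s \<and>
                   (\<forall>l<length bs. (\<forall>k. k \<noteq> 0 \<longrightarrow> (\<psi>s ! l) (rvec k) = 0) \<and>
                      vm_fun (\<psi>s ! l) \<ge> enat m)))))"
proof -
  have card: "card (Gamma_set M) = dM M" using bij_betw_same_card[OF assms(2)] by simp
  interpret interp_filter M a m by unfold_locales (use assms card in auto)
  have S1: "\<forall>j\<in>{2..dM M}. \<exists>sj uj \<epsilon>j. signed_squares (h_filter M a (\<gamma> j)) m sj uj \<epsilon>j"
    using ex_signed_squares by blast
  have S2: "quasi_tight_filter_bank M a (all_filters M a \<gamma> s u) (all_signs M s \<epsilon>) \<and>
      (\<forall>l<length (all_filters M a \<gamma> s u). vm_filter (all_filters M a \<gamma> s u ! l) \<ge> enat m \<and>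
        (\<forall>k. k \<noteq> 0 \<longrightarrow> (all_filters M a \<gamma> s u ! l) (M *v k) = 0))"
    if "\<forall>j\<in>{2..dM M}. signed_squares (h_filter M a (\<gamma> j)) m (s j) (u j) (\<epsilon> j)" for s u \<epsilon>
  proof -
    interpret filter_bank M a m \<gamma> s u \<epsilon> by unfold_locales (use assms that in auto)
    show ?thesis using quasi_tight_bank bs_vm bs_props(3) by simp
  qed
  obtain s u \<epsilon> where "\<forall>j\<in>{2..dM M}. signed_squares (h_filter M a (\<gamma> j)) m (s j) (u j) (\<epsilon> j)"
    using S1 by metis
  from S2[OF this] have conj1: "\<exists>bs \<epsilon>s. bs \<noteq> [] \<and> quasi_tight_filter_bank M a bs \<epsilon>s \<and>
      (\<forall>l<length bs. vm_filter (bs ! l) \<ge> enat m \<and> (\<forall>k. k \<noteq> 0 \<longrightarrow> (bs ! l) (M *v k) = 0))"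
    by (intro exI[of _ "all_filters M a \<gamma> s u"] exI[of _ "all_signs M s \<epsilon>"]) (simp add: all_filters_def)
  have fb: "framelet_bank M a m \<gamma> s u \<epsilon>"
    if "sm_inf a M > 0" "\<forall>j\<in>{2..dM M}. signed_squares (h_filter M a (\<gamma> j)) m (s j) (u j) (\<epsilon> j)" for s u \<epsilon>
    by unfold_locales (use assms card that in auto)
  \<comment> \<open>The function depends on \<open>M\<close>, \<open>a\<close> and \<open>m\<close>
    alone, so one witness precedes every choice of the squares.\<close>
  have phi: "has_fourier (smooth_filter.phi M a m) (refinable_hat M a)" "fundamental (smooth_filter.phi M a m)" if "sm_inf a M > 0"
  proof -
    interpret smooth_filter M a m by unfold_locales (rule that)
    show "has_fourier phi (refinable_hat M a)" "fundamental phi" by (rule phi_has_fourier phi_fundamental)+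
  qed
  show ?thesis
    unfolding Let_def
    by (intro conjI impI exI[of _ "smooth_filter.phi M a m"] phi allI framelet_bank.psis_framelet[OF fb] conj1 S1 S2[THEN conjunct1] S2[THEN conjunct2])
qed

end
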